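(* Let $\mathcal V$ be a symmetric monoidal closed category which is locally $\lambda$-presentable as a closed category, and let $\mathbb L$ be a $\lambda$-ary language over $\mathcal V$ for which in $\mathbf{Str}(\mathbb L)$ every strong epimorphism is regular. Then the enriched Birkhoff subcategories of $\mathbf{Str}(\mathbb L)$ are precisely the classes (full subcategories) of the form $\mathbf{Mod}(\mathbb E)$ for $\mathbb E$ an extended $\infty$-ary equational $\mathbb L$-theory.
   Context: Setting. $\mathcal V=(\mathcal V_0,\otimes,I)$ is a symmetric monoidal closed category with internal hom $A^X:=[X,A]$, and $\lambda$ is a regular cardinal such that $\mathcal V$ is locally $\lambda$-presentable as a closed category: $\mathcal V_0$ is locally $\lambda$-presentable and the full subcategory $\mathcal V_\lambda$ of $\lambda$-presentable objects contains $I$ and is closed under $\otimes$. Languages and structures. A $\lambda$-ary language $\mathbb L$ over $\mathcal V$ is a set of function symbols $f:(X,Y)$ with input arity $X$ and output arity $Y$ in $\mathcal V_\lambda$. An $\mathbb L$-structure is an object $A\in\mathcal V$ with a morphism $f_A\colon A^X\to A^Y$ in $\mathcal V$ for each $f:(X,Y)$ in $\mathbb L$. A morphism of $\mathbb L$-structures is $h\colon A\to B$ in $\mathcal V$ with $h^Y f_A=f_B h^X$ for all $f$. $\mathbb L$-structures form a $\mathcal V$-category $\mathbf{Str}(\mathbb L)$ in which $\mathbf{Str}(\mathbb L)(A,B)$ is the joint equalizer, over all $f:(X,Y)$ in $\mathbb L$, of the two maps $[A,B]\rightrightarrows[A^X,B^Y]$ given by $h\mapsto f_B h^X$ and $h\mapsto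 h^Yf_A$. The forgetful $\mathcal V$-functor $U\colon\mathbf{Str}(\mathbb L)\to\mathcal V$ has a left adjoint $F$. Extended equational theories. An extended $\infty$-ary term of arity $(X,Y)$, with $X,Y\in\mathcal V$ arbitrary, is a morphism $t\colon FY\to FX$ in $\mathbf{Str}(\mathbb L)$; its interpretation in $A$ is $t_A\colon A^X\cong\mathbf{Str}(\mathbb L)(FX,A)\xrightarrow{\mathbf{Str}(\mathbb L)(t,A)}\mathbf{Str}(\mathbb L)(FY,A)\cong A^Y$. An extended $\infty$-ary equational $\mathbb L$-theory $\mathbb E$ is a collection (possibly a large class) of equations $(s=t)$ between extended terms of the same arity. $\mathbf{Mod}(\mathbb E)$ is the full subcategory of $\mathbf{Str}(\mathbb L)$ on those $A$ with $s_A=t_A$ in $\mathcal V$ for every $(s=t)$ in $\mathbb E$. Birkhoff subcategories. An enriched Birkhoff subcategory of $\mathbf{Str}(\mathbb L)$ is a full replete subcategory $\mathcal L$ closed under: products and powers (by objects of $\mathcal V$); substructures (if $A\rightarrowtail B$ is a monomorphism in $\mathbf{Str}(\mathbb L)$ and $B\in\mathcal L$, then $A\in\mathcal L$); and $\mathcal V$-split quotients (if $e\colon A\to B$ is an epimorphism in $\mathbf{Str}(\mathbb L)$ such that $Ue$ is a split epimorphism in $\mathcal V$, and $A\in\mathcal L$, then $B\in\mathcal L$). *)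

theory Defs
  imports "HOL-Library.FuncSet"
begin

unbundle cardinal_syntax

section \<open>Size\<close>

text \<open>
  HOL has no notion of a (small) set as opposed to a class.  Smallness is therefore taken relative
  to an arbitrary uncountable strongly inaccessible cardinal \<open>\<kappa>\<close> (equivalently, a Grothendieck
  universe): a collection is small if it has fewer than \<open>\<kappa>\<close> elements, and collections without a
  size restriction play the role of (possibly large) classes.  As \<open>\<kappa>\<close> is a relation on the type
  \<open>'u\<close>, every small set is equipotent to a subset of \<open>'u\<close>, so quantifying over index sets and
  index categories with elements in \<open>'u\<close> covers all small ones up to isomorphism.
\<close>

definition regular_cardinal :: "'l rel \<Rightarrow> bool" where
  "regular_cardinal l \<longleftrightarrow> Card_order l \<and> infinite (Field l) \<and> regularCard l"

definition inaccessible :: "'u rel \<Rightarrow> bool" where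
  "inaccessible \<kappa> \<longleftrightarrow> regular_cardinal \<kappa> \<and> natLeq <o \<kappa> \<and>
     (\<forall>A :: 'u set. |A| <o \<kappa> \<longrightarrow> |Pow A| <o \<kappa>)"

definition small :: "'u rel \<Rightarrow> 'a set \<Rightarrow> bool" where
  "small \<kappa> A \<longleftrightarrow> |A| <o \<kappa>"


section \<open>Ordinary categories\<close>

text \<open>
  Hom-sets of different pairs of objects may overlap.  In particular the category of structures
  below literally uses arrows of the base category as arrows.
\<close>

record ('o, 'm) cat =
  Ob :: "'o set"
  Hom :: "'o \<Rightarrow> 'o \<Rightarrow> 'm set"
  Idt :: "'o \<Rightarrow> 'm"
  Cmp :: "'m \<Rightarrow> 'm \<Rightarrow> 'm"  (infixl "\<cdot>\<index>" 70)

locale category =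
  fixes C :: "('o, 'm, 'x) cat_scheme" (structure)
  assumes hom_ob: "f \<in> Hom C A B \<Longrightarrow> A \<in> Ob C \<and> B \<in> Ob C"
    and idt_hom: "A \<in> Ob C \<Longrightarrow> Idt C A \<in> Hom C A A"
    and cmp_hom: "\<lbrakk>f \<in> Hom C A B; g \<in> Hom C B D\<rbrakk> \<Longrightarrow> g \<cdot> f \<in> Hom C A D"
    and idt_left: "f \<in> Hom C A B \<Longrightarrow> Idt C B \<cdot> f = f"
    and idt_right: "f \<in> Hom C A B \<Longrightarrow> f \<cdot> Idt C A = f"
    and cmp_assoc: "\<lbrakk>f \<in> Hom C A B; g \<in> Hom C B D; h \<in> Hom C D E\<rbrakk> \<Longrightarrow> (h \<cdot> g) \<cdot> f = h \<cdot> (g \<cdot> f)"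

definition is_inverse :: "('o, 'm, 'x) cat_scheme \<Rightarrow> 'o \<Rightarrow> 'o \<Rightarrow> 'm \<Rightarrow> 'm \<Rightarrow> bool" where
  "is_inverse C A B f g \<longleftrightarrow> f \<in> Hom C A B \<and> g \<in> Hom C B A \<and>
     g \<cdot>\<^bsub>C\<^esub> f = Idt C A \<and> f \<cdot>\<^bsub>C\<^esub> g = Idt C B"

definition iso :: "('o, 'm, 'x) cat_scheme \<Rightarrow> 'o \<Rightarrow> 'o \<Rightarrow> 'm \<Rightarrow> bool" where
  "iso C A B f \<longleftrightarrow> (\<exists>g. is_inverse C A B f g)"

definition the_inverse :: "('o, 'm, 'x) cat_scheme \<Rightarrow> 'o \<Rightarrow> 'o \<Rightarrow> 'm \<Rightarrow> 'm" where
  "the_inverse C A B f = (THE g. is_inverse C A B f g)"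

definition monomorphism :: "('o, 'm, 'x) cat_scheme \<Rightarrow> 'o \<Rightarrow> 'o \<Rightarrow> 'm \<Rightarrow> bool" where
  "monomorphism C A B m \<longleftrightarrow> m \<in> Hom C A B \<and>
     (\<forall>X. \<forall>f \<in> Hom C X A. \<forall>g \<in> Hom C X A. m \<cdot>\<^bsub>C\<^esub> f = m \<cdot>\<^bsub>C\<^esub> g \<longrightarrow> f = g)"

definition epimorphism :: "('o, 'm, 'x) cat_scheme \<Rightarrow> 'o \<Rightarrow> 'o \<Rightarrow> 'm \<Rightarrow> bool" where
  "epimorphism C A B e \<longleftrightarrow> e \<in> Hom C A B \<and>
     (\<forall>X. \<forall>f \<in> Hom C B X. \<forall>g \<in> Hom C B X. f \<cdot>\<^bsub>C\<^esub> e = g \<cdot>\<^bsub>C\<^esub> e \<longrightarrow> f = g)"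

definition split_epi :: "('o, 'm, 'x) cat_scheme \<Rightarrow> 'o \<Rightarrow> 'o \<Rightarrow> 'm \<Rightarrow> bool" where
  "split_epi C A B e \<longleftrightarrow> e \<in> Hom C A B \<and> (\<exists>s \<in> Hom C B A. e \<cdot>\<^bsub>C\<^esub> s = Idt C B)"

definition strong_epi :: "('o, 'm, 'x) cat_scheme \<Rightarrow> 'o \<Rightarrow> 'o \<Rightarrow> 'm \<Rightarrow> bool" where
  "strong_epi C A B e \<longleftrightarrow> epimorphism C A B e \<and>
     (\<forall>X Y m u v. monomorphism C X Y m \<and> u \<in> Hom C A X \<and> v \<in> Hom C B Y \<and> v \<cdot>\<^bsub>C\<^esub> e = m \<cdot>\<^bsub>C\<^esub> u
        \<longrightarrow> (\<exists>d \<in> Hom C B X. d \<cdot>\<^bsub>C\<^esub> e = u \<and> m \<cdot>\<^bsub>C\<^esub> d = v))"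

definition coequalizer :: "('o, 'm, 'x) cat_scheme \<Rightarrow> 'o \<Rightarrow> 'o \<Rightarrow> 'o \<Rightarrow> 'm \<Rightarrow> 'm \<Rightarrow> 'm \<Rightarrow> bool" where
  "coequalizer C Z A B u v e \<longleftrightarrow> u \<in> Hom C Z A \<and> v \<in> Hom C Z A \<and> e \<in> Hom C A B \<and>
     e \<cdot>\<^bsub>C\<^esub> u = e \<cdot>\<^bsub>C\<^esub> v \<and>
     (\<forall>X. \<forall>f \<in> Hom C A X. f \<cdot>\<^bsub>C\<^esub> u = f \<cdot>\<^bsub>C\<^esub> v \<longrightarrow> (\<exists>!h. h \<in> Hom C B X \<and> h \<cdot>\<^bsub>C\<^esub> e = f))"

definition regular_epi :: "('o, 'm, 'x) cat_scheme \<Rightarrow> 'o \<Rightarrow> 'o \<Rightarrow> 'm \<Rightarrow> bool" where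
  "regular_epi C A B e \<longleftrightarrow> (\<exists>Z u v. coequalizer C Z A B u v e)"

definition is_product :: "('o, 'm, 'x) cat_scheme \<Rightarrow> 'i set \<Rightarrow> ('i \<Rightarrow> 'o) \<Rightarrow> 'o \<Rightarrow> ('i \<Rightarrow> 'm) \<Rightarrow> bool" where
  "is_product C I D P p \<longleftrightarrow> P \<in> Ob C \<and> (\<forall>i \<in> I. p i \<in> Hom C P (D i)) \<and>
     (\<forall>Q \<in> Ob C. \<forall>q. (\<forall>i \<in> I. q i \<in> Hom C Q (D i)) \<longrightarrow>
        (\<exists>!u. u \<in> Hom C Q P \<and> (\<forall>i \<in> I. p i \<cdot>\<^bsub>C\<^esub> u = q i)))"


section \<open>Colimits and local presentability\<close>

definition small_category :: "'u rel \<Rightarrow> ('u, 'u) cat \<Rightarrow> bool" where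
  "small_category \<kappa> J \<longleftrightarrow> category J \<and> small \<kappa> (Ob J) \<and> (\<forall>i j. small \<kappa> (Hom J i j))"

text \<open>
  Since hom-sets may overlap, the arrow part \<open>d\<close> of a functor takes source and target as
  additional arguments.
\<close>

definition diagram ::
  "('j, 'a, 'y) cat_scheme \<Rightarrow> ('o, 'm, 'x) cat_scheme \<Rightarrow> ('j \<Rightarrow> 'o) \<Rightarrow> ('j \<Rightarrow> 'j \<Rightarrow> 'a \<Rightarrow> 'm) \<Rightarrow> bool" where
  "diagram J C D d \<longleftrightarrow>
     (\<forall>i \<in> Ob J. D i \<in> Ob C) \<and>
     (\<forall>i j. \<forall>a \<in> Hom J i j. d i j a \<in> Hom C (D i) (D j)) \<and>
     (\<forall>i \<in> Ob J. d i i (Idt J i) = Idt C (D i)) \<and>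
     (\<forall>i j k. \<forall>a \<in> Hom J i j. \<forall>b \<in> Hom J j k. d i k (b \<cdot>\<^bsub>J\<^esub> a) = d j k b \<cdot>\<^bsub>C\<^esub> d i j a)"

definition cocone ::
  "('j, 'a, 'y) cat_scheme \<Rightarrow> ('o, 'm, 'x) cat_scheme \<Rightarrow> ('j \<Rightarrow> 'o) \<Rightarrow> ('j \<Rightarrow> 'j \<Rightarrow> 'a \<Rightarrow> 'm) \<Rightarrow>
   'o \<Rightarrow> ('j \<Rightarrow> 'm) \<Rightarrow> bool" where
  "cocone J C D d X c \<longleftrightarrow> X \<in> Ob C \<and> (\<forall>i \<in> Ob J. c i \<in> Hom C (D i) X) \<and>
     (\<forall>i j. \<forall>a \<in> Hom J i j. c j \<cdot>\<^bsub>C\<^esub> d i j a = c i)"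

definition colimit ::
  "('j, 'a, 'y) cat_scheme \<Rightarrow> ('o, 'm, 'x) cat_scheme \<Rightarrow> ('j \<Rightarrow> 'o) \<Rightarrow> ('j \<Rightarrow> 'j \<Rightarrow> 'a \<Rightarrow> 'm) \<Rightarrow>
   'o \<Rightarrow> ('j \<Rightarrow> 'm) \<Rightarrow> bool" where
  "colimit J C D d X c \<longleftrightarrow> cocone J C D d X c \<and>
     (\<forall>Y c'. cocone J C D d Y c' \<longrightarrow>
        (\<exists>!u. u \<in> Hom C X Y \<and> (\<forall>i \<in> Ob J. u \<cdot>\<^bsub>C\<^esub> c i = c' i)))"

definition cocomplete :: "'u rel \<Rightarrow> ('o, 'm, 'x) cat_scheme \<Rightarrow> bool" where
  "cocomplete \<kappa> C \<longleftrightarrow> (\<forall>(J :: ('u, 'u) cat) D d. small_category \<kappa> J \<and> diagram J C D d \<longrightarrow>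
     (\<exists>X c. colimit J C D d X c))"

text \<open>Posets are regarded as thin antisymmetric categories.\<close>

definition directed_poset :: "'u rel \<Rightarrow> 'l rel \<Rightarrow> ('u, 'u) cat \<Rightarrow> bool" where
  "directed_poset \<kappa> l J \<longleftrightarrow> small_category \<kappa> J \<and>
     (\<forall>i j. \<forall>a \<in> Hom J i j. \<forall>b \<in> Hom J i j. a = b) \<and>
     (\<forall>i j. Hom J i j \<noteq> {} \<and> Hom J j i \<noteq> {} \<longrightarrow> i = j) \<and>
     (\<forall>S \<subseteq> Ob J. |S| <o l \<longrightarrow> (\<exists>j \<in> Ob J. \<forall>i \<in> S. Hom J i j \<noteq> {}))"

text \<open>
  An object \<open>X\<close> is \<open>l\<close>-presentable if \<open>Hom(X,-)\<close> preserves \<open>l\<close>-directed colimits.  By the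
  description of directed colimits of sets this says that each arrow from \<open>X\<close> into such a colimit
  factors through a stage of the diagram, and that two factorizations through the same stage are
  identified at a later stage.
\<close>

definition presentable :: "'u rel \<Rightarrow> 'l rel \<Rightarrow> ('o, 'm, 'x) cat_scheme \<Rightarrow> 'o \<Rightarrow> bool" where
  "presentable \<kappa> l C X \<longleftrightarrow> X \<in> Ob C \<and>
     (\<forall>(J :: ('u, 'u) cat) D d Y c.
        directed_poset \<kappa> l J \<and> diagram J C D d \<and> colimit J C D d Y c \<longrightarrow>
          (\<forall>f \<in> Hom C X Y. \<exists>i \<in> Ob J. \<exists>g \<in> Hom C X (D i). f = c i \<cdot>\<^bsub>C\<^esub> g) \<and>
          (\<forall>i \<in> Ob J. \<forall>g \<in> Hom C X (D i). \<forall>h \<in> Hom C X (D i). c i \<cdot>\<^bsub>C\<^esub> g = c i \<cdot>\<^bsub>C\<^esub> h \<longrightarrow>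
             (\<exists>j \<in> Ob J. \<exists>a \<in> Hom J i j. d i j a \<cdot>\<^bsub>C\<^esub> g = d i j a \<cdot>\<^bsub>C\<^esub> h)))"

definition locally_presentable :: "'u rel \<Rightarrow> 'l rel \<Rightarrow> ('o, 'm, 'x) cat_scheme \<Rightarrow> bool" where
  "locally_presentable \<kappa> l C \<longleftrightarrow> category C \<and> (\<forall>A B. small \<kappa> (Hom C A B)) \<and> cocomplete \<kappa> C \<and>
     (\<exists>G. small \<kappa> G \<and> (\<forall>X \<in> G. presentable \<kappa> l C X) \<and>
        (\<forall>A \<in> Ob C. \<exists>(J :: ('u, 'u) cat) D d c.
           directed_poset \<kappa> l J \<and> diagram J C D d \<and> D ` Ob J \<subseteq> G \<and> colimit J C D d A c))"


section \<open>Symmetric monoidal closed categories\<close>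

text \<open>
  \<open>Ten\<close> and \<open>TenM\<close> are the object and arrow parts of the tensor product; \<open>ihom V X A\<close> is the
  internal hom \<open>[X,A] = A\<^sup>X\<close>, with evaluation \<open>ev V X A : [X,A] \<otimes> X \<rightarrow> A\<close>.
\<close>

record ('o, 'm) smc = "('o, 'm) cat" +
  Ten :: "'o \<Rightarrow> 'o \<Rightarrow> 'o"  (infixl "\<otimes>\<index>" 75)
  TenM :: "'m \<Rightarrow> 'm \<Rightarrow> 'm"  (infixl "\<odot>\<index>" 75)
  unit :: "'o"
  asc :: "'o \<Rightarrow> 'o \<Rightarrow> 'o \<Rightarrow> 'm"
  lun :: "'o \<Rightarrow> 'm"
  run :: "'o \<Rightarrow> 'm"
  sym :: "'o \<Rightarrow> 'o \<Rightarrow> 'm"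
  ihom :: "'o \<Rightarrow> 'o \<Rightarrow> 'o"
  ev :: "'o \<Rightarrow> 'o \<Rightarrow> 'm"

locale symmetric_monoidal_closed = category V
  for V :: "('o, 'm, 'x) smc_scheme" (structure) +
  assumes ten_ob: "\<lbrakk>A \<in> Ob V; B \<in> Ob V\<rbrakk> \<Longrightarrow> A \<otimes> B \<in> Ob V"
    and ten_hom: "\<lbrakk>f \<in> Hom V A A'; g \<in> Hom V B B'\<rbrakk> \<Longrightarrow> f \<odot> g \<in> Hom V (A \<otimes> B) (A' \<otimes> B')"
    and ten_idt: "\<lbrakk>A \<in> Ob V; B \<in> Ob V\<rbrakk> \<Longrightarrow> Idt V A \<odot> Idt V B = Idt V (A \<otimes> B)"
    and ten_cmp: "\<lbrakk>f \<in> Hom V A A'; f' \<in> Hom V A' A''; g \<in> Hom V B B'; g' \<in> Hom V B' B''\<rbrakk> \<Longrightarrow>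
       (f' \<cdot> f) \<odot> (g' \<cdot> g) = (f' \<odot> g') \<cdot> (f \<odot> g)"
    and unit_ob: "unit V \<in> Ob V"
    and asc_iso: "\<lbrakk>A \<in> Ob V; B \<in> Ob V; C \<in> Ob V\<rbrakk> \<Longrightarrow>
       iso V ((A \<otimes> B) \<otimes> C) (A \<otimes> (B \<otimes> C)) (asc V A B C)"
    and asc_nat: "\<lbrakk>f \<in> Hom V A A'; g \<in> Hom V B B'; h \<in> Hom V C C'\<rbrakk> \<Longrightarrow>
       asc V A' B' C' \<cdot> ((f \<odot> g) \<odot> h) = (f \<odot> (g \<odot> h)) \<cdot> asc V A B C"
    and lun_iso: "A \<in> Ob V \<Longrightarrow> iso V (unit V \<otimes> A) A (lun V A)"
    and lun_nat: "f \<in> Hom V A B \<Longrightarrow> lun V B \<cdot> (Idt V (unit V) \<odot> f) = f \<cdot> lun V A"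
    and run_iso: "A \<in> Ob V \<Longrightarrow> iso V (A \<otimes> unit V) A (run V A)"
    and run_nat: "f \<in> Hom V A B \<Longrightarrow> run V B \<cdot> (f \<odot> Idt V (unit V)) = f \<cdot> run V A"
    and sym_hom: "\<lbrakk>A \<in> Ob V; B \<in> Ob V\<rbrakk> \<Longrightarrow> sym V A B \<in> Hom V (A \<otimes> B) (B \<otimes> A)"
    and sym_nat: "\<lbrakk>f \<in> Hom V A A'; g \<in> Hom V B B'\<rbrakk> \<Longrightarrow>
       sym V A' B' \<cdot> (f \<odot> g) = (g \<odot> f) \<cdot> sym V A B"
    and sym_inv: "\<lbrakk>A \<in> Ob V; B \<in> Ob V\<rbrakk> \<Longrightarrow> sym V B A \<cdot> sym V A B = Idt V (A \<otimes> B)"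
    and pentagon: "\<lbrakk>A \<in> Ob V; B \<in> Ob V; C \<in> Ob V; D \<in> Ob V\<rbrakk> \<Longrightarrow>
       asc V A B (C \<otimes> D) \<cdot> asc V (A \<otimes> B) C D =
       (Idt V A \<odot> asc V B C D) \<cdot> asc V A (B \<otimes> C) D \<cdot> (asc V A B C \<odot> Idt V D)"
    and triangle: "\<lbrakk>A \<in> Ob V; B \<in> Ob V\<rbrakk> \<Longrightarrow>
       (Idt V A \<odot> lun V B) \<cdot> asc V A (unit V) B = run V A \<odot> Idt V B"
    and sym_unit: "A \<in> Ob V \<Longrightarrow> lun V A \<cdot> sym V A (unit V) = run V A"
    and hexagon: "\<lbrakk>A \<in> Ob V; B \<in> Ob V; C \<in> Ob V\<rbrakk> \<Longrightarrow>
       asc V B C A \<cdot> sym V A (B \<otimes> C) \<cdot> asc V A B C =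
       (Idt V B \<odot> sym V A C) \<cdot> asc V B A C \<cdot> (sym V A B \<odot> Idt V C)"
    and ihom_ob: "\<lbrakk>X \<in> Ob V; A \<in> Ob V\<rbrakk> \<Longrightarrow> ihom V X A \<in> Ob V"
    and ev_hom: "\<lbrakk>X \<in> Ob V; A \<in> Ob V\<rbrakk> \<Longrightarrow> ev V X A \<in> Hom V (ihom V X A \<otimes> X) A"
    and ev_universal: "\<lbrakk>Z \<in> Ob V; X \<in> Ob V; f \<in> Hom V (Z \<otimes> X) A\<rbrakk> \<Longrightarrow>
       \<exists>!g. g \<in> Hom V Z (ihom V X A) \<and> ev V X A \<cdot> (g \<odot> Idt V X) = f"

definition locally_presentable_closed :: "'u rel \<Rightarrow> 'l rel \<Rightarrow> ('o, 'm, 'x) smc_scheme \<Rightarrow> bool" where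
  "locally_presentable_closed \<kappa> l V \<longleftrightarrow> locally_presentable \<kappa> l V \<and>
     presentable \<kappa> l V (unit V) \<and>
     (\<forall>X Y. presentable \<kappa> l V X \<and> presentable \<kappa> l V Y \<longrightarrow> presentable \<kappa> l V (X \<otimes>\<^bsub>V\<^esub> Y))"

text \<open>\<open>curry V Z X A f : Z \<rightarrow> [X,A]\<close> is the transpose of \<open>f : Z \<otimes> X \<rightarrow> A\<close>.\<close>

definition curry :: "('o, 'm, 'x) smc_scheme \<Rightarrow> 'o \<Rightarrow> 'o \<Rightarrow> 'o \<Rightarrow> 'm \<Rightarrow> 'm" where
  "curry V Z X A f = (THE g. g \<in> Hom V Z (ihom V X A) \<and> ev V X A \<cdot>\<^bsub>V\<^esub> (g \<odot>\<^bsub>V\<^esub> Idt V X) = f)"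

text \<open>\<open>post V X A B h = h\<^sup>X : [X,A] \<rightarrow> [X,B]\<close> for \<open>h : A \<rightarrow> B\<close>.\<close>

definition post :: "('o, 'm, 'x) smc_scheme \<Rightarrow> 'o \<Rightarrow> 'o \<Rightarrow> 'o \<Rightarrow> 'm \<Rightarrow> 'm" where
  "post V X A B h = curry V (ihom V X A) X B (h \<cdot>\<^bsub>V\<^esub> ev V X A)"

text \<open>\<open>pre V X Y A f = [f,A] : [Y,A] \<rightarrow> [X,A]\<close> for \<open>f : X \<rightarrow> Y\<close>.\<close>

definition pre :: "('o, 'm, 'x) smc_scheme \<Rightarrow> 'o \<Rightarrow> 'o \<Rightarrow> 'o \<Rightarrow> 'm \<Rightarrow> 'm" where
  "pre V X Y A f = curry V (ihom V Y A) X A (ev V Y A \<cdot>\<^bsub>V\<^esub> (Idt V (ihom V Y A) \<odot>\<^bsub>V\<^esub> f))"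

text \<open>Internal composition \<open>[A,B] \<otimes> [X,A] \<rightarrow> [X,B]\<close>, and its transpose
  \<open>[A,B] \<rightarrow> [[X,A],[X,B]]\<close>, which is the action of the \<open>\<V>\<close>-functor \<open>[X,-]\<close> on hom-objects.\<close>

definition icomp :: "('o, 'm, 'x) smc_scheme \<Rightarrow> 'o \<Rightarrow> 'o \<Rightarrow> 'o \<Rightarrow> 'm" where
  "icomp V X A B = curry V (ihom V A B \<otimes>\<^bsub>V\<^esub> ihom V X A) X B
     (ev V A B \<cdot>\<^bsub>V\<^esub> (Idt V (ihom V A B) \<odot>\<^bsub>V\<^esub> ev V X A) \<cdot>\<^bsub>V\<^esub> asc V (ihom V A B) (ihom V X A) X)"

definition ipost :: "('o, 'm, 'x) smc_scheme \<Rightarrow> 'o \<Rightarrow> 'o \<Rightarrow> 'o \<Rightarrow> 'm" where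
  "ipost V X A B = curry V (ihom V A B) (ihom V X A) (ihom V X B) (icomp V X A B)"


section \<open>Languages and structures\<close>

record ('f, 'o) language =
  Sym :: "'f set"
  In :: "'f \<Rightarrow> 'o"
  Out :: "'f \<Rightarrow> 'o"

definition ary_language :: "'u rel \<Rightarrow> 'l rel \<Rightarrow> ('o, 'm, 'x) smc_scheme \<Rightarrow> ('f, 'o) language \<Rightarrow> bool" where
  "ary_language \<kappa> l V L \<longleftrightarrow> small \<kappa> (Sym L) \<and>
     (\<forall>f \<in> Sym L. presentable \<kappa> l V (In L f) \<and> presentable \<kappa> l V (Out L f))"

type_synonym ('o, 'm, 'f) struct = "'o \<times> ('f \<Rightarrow> 'm)"

definition Str :: "('o, 'm, 'x) smc_scheme \<Rightarrow> ('f, 'o) language \<Rightarrow> (('o, 'm, 'f) struct, 'm) cat" where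
  "Str V L =
     (let S = {(A, a). A \<in> Ob V \<and>
                 a \<in> (\<Pi>\<^sub>E f \<in> Sym L. Hom V (ihom V (In L f) A) (ihom V (Out L f) A))}
      in \<lparr>Ob = S,
          Hom = (\<lambda>(A, a) (B, b). {h. (A, a) \<in> S \<and> (B, b) \<in> S \<and> h \<in> Hom V A B \<and>
                   (\<forall>f \<in> Sym L. post V (Out L f) A B h \<cdot>\<^bsub>V\<^esub> a f = b f \<cdot>\<^bsub>V\<^esub> post V (In L f) A B h)}),
          Idt = (\<lambda>(A, a). Idt V A),
          Cmp = Cmp V\<rparr>)"

text \<open>
  The hom-object \<open>Str(P,Q)\<close> with its inclusion into \<open>[A,B]\<close>: the joint equalizer of the maps
  \<open>[A,B] \<rightrightarrows> [A\<^sup>X,B\<^sup>Y]\<close>, \<open>h \<mapsto> f\<^sub>B h\<^sup>X\<close> and \<open>h \<mapsto> h\<^sup>Y f\<^sub>A\<close>, over all symbols \<open>f : (X,Y)\<close>.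
  It is determined up to isomorphism, and one such equalizer is chosen.
\<close>

definition str_eq1 :: "('o, 'm, 'x) smc_scheme \<Rightarrow> ('f, 'o) language \<Rightarrow> 'f \<Rightarrow>
    ('o, 'm, 'f) struct \<Rightarrow> ('o, 'm, 'f) struct \<Rightarrow> 'm" where
  "str_eq1 V L f P Q = (let A = fst P; B = fst Q; X = In L f; Y = Out L f in
     post V (ihom V X A) (ihom V X B) (ihom V Y B) (snd Q f) \<cdot>\<^bsub>V\<^esub> ipost V X A B)"

definition str_eq2 :: "('o, 'm, 'x) smc_scheme \<Rightarrow> ('f, 'o) language \<Rightarrow> 'f \<Rightarrow>
    ('o, 'm, 'f) struct \<Rightarrow> ('o, 'm, 'f) struct \<Rightarrow> 'm" where
  "str_eq2 V L f P Q = (let A = fst P; B = fst Q; X = In L f; Y = Out L f in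
     pre V (ihom V X A) (ihom V Y A) (ihom V Y B) (snd P f) \<cdot>\<^bsub>V\<^esub> ipost V Y A B)"

definition is_str_hom :: "('o, 'm, 'x) smc_scheme \<Rightarrow> ('f, 'o) language \<Rightarrow>
    ('o, 'm, 'f) struct \<Rightarrow> ('o, 'm, 'f) struct \<Rightarrow> 'o \<times> 'm \<Rightarrow> bool" where
  "is_str_hom V L P Q = (\<lambda>(E, e).
     e \<in> Hom V E (ihom V (fst P) (fst Q)) \<and>
     (\<forall>f \<in> Sym L. str_eq1 V L f P Q \<cdot>\<^bsub>V\<^esub> e = str_eq2 V L f P Q \<cdot>\<^bsub>V\<^esub> e) \<and>
     (\<forall>Z. \<forall>k \<in> Hom V Z (ihom V (fst P) (fst Q)).
        (\<forall>f \<in> Sym L. str_eq1 V L f P Q \<cdot>\<^bsub>V\<^esub> k = str_eq2 V L f P Q \<cdot>\<^bsub>V\<^esub> k) \<longrightarrow>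
        (\<exists>!u. u \<in> Hom V Z E \<and> e \<cdot>\<^bsub>V\<^esub> u = k)))"

definition str_hom :: "('o, 'm, 'x) smc_scheme \<Rightarrow> ('f, 'o) language \<Rightarrow>
    ('o, 'm, 'f) struct \<Rightarrow> ('o, 'm, 'f) struct \<Rightarrow> 'o" where
  "str_hom V L P Q = fst (SOME Ee. is_str_hom V L P Q Ee)"

definition str_inc :: "('o, 'm, 'x) smc_scheme \<Rightarrow> ('f, 'o) language \<Rightarrow>
    ('o, 'm, 'f) struct \<Rightarrow> ('o, 'm, 'f) struct \<Rightarrow> 'm" where
  "str_inc V L P Q = snd (SOME Ee. is_str_hom V L P Q Ee)"

text \<open>
  The composition \<open>Str(Q,R) \<otimes> Str(P,Q) \<rightarrow> Str(P,R)\<close> of the \<open>\<V>\<close>-category of structures, and the map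
  \<open>Str(t,R) : Str(Q,R) \<rightarrow> Str(P,R)\<close> induced by a morphism \<open>t : P \<rightarrow> Q\<close>, are the restrictions of the
  corresponding maps of \<open>\<V>\<close> to the subobjects \<open>Str(-,-)\<close> of \<open>[-,-]\<close>.
\<close>

definition str_comp :: "('o, 'm, 'x) smc_scheme \<Rightarrow> ('f, 'o) language \<Rightarrow>
    ('o, 'm, 'f) struct \<Rightarrow> ('o, 'm, 'f) struct \<Rightarrow> ('o, 'm, 'f) struct \<Rightarrow> 'm" where
  "str_comp V L P Q R = (THE u.
     u \<in> Hom V (str_hom V L Q R \<otimes>\<^bsub>V\<^esub> str_hom V L P Q) (str_hom V L P R) \<and>
     str_inc V L P R \<cdot>\<^bsub>V\<^esub> u =
       icomp V (fst P) (fst Q) (fst R) \<cdot>\<^bsub>V\<^esub> (str_inc V L Q R \<odot>\<^bsub>V\<^esub> str_inc V L P Q))"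

definition str_pre :: "('o, 'm, 'x) smc_scheme \<Rightarrow> ('f, 'o) language \<Rightarrow>
    ('o, 'm, 'f) struct \<Rightarrow> ('o, 'm, 'f) struct \<Rightarrow> ('o, 'm, 'f) struct \<Rightarrow> 'm \<Rightarrow> 'm" where
  "str_pre V L P Q R t = (THE u. u \<in> Hom V (str_hom V L Q R) (str_hom V L P R) \<and>
     str_inc V L P R \<cdot>\<^bsub>V\<^esub> u = pre V (fst P) (fst Q) (fst R) t \<cdot>\<^bsub>V\<^esub> str_inc V L Q R)"


section \<open>The left adjoint and extended equational theories\<close>

text \<open>
  \<open>transpose V L X P \<eta> Q : Str(P,Q) \<rightarrow> [X,UQ]\<close> is the \<open>\<V>\<close>-natural transformation corresponding to
  \<open>\<eta> : X \<rightarrow> UP\<close>, namely \<open>Str(P,Q) \<rightarrow> [UP,UQ] \<rightarrow> [X,UQ]\<close>.  A left adjoint \<open>F\<close> of the \<open>\<V>\<close>-functor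
  \<open>U\<close> amounts to a choice, for each \<open>X\<close>, of a structure \<open>FX\<close> and a unit \<open>\<eta>\<close> for which all these
  maps are invertible.
\<close>

definition transpose :: "('o, 'm, 'x) smc_scheme \<Rightarrow> ('f, 'o) language \<Rightarrow>
    'o \<Rightarrow> ('o, 'm, 'f) struct \<Rightarrow> 'm \<Rightarrow> ('o, 'm, 'f) struct \<Rightarrow> 'm" where
  "transpose V L X P \<eta> Q = pre V X (fst P) (fst Q) \<eta> \<cdot>\<^bsub>V\<^esub> str_inc V L P Q"

definition is_free :: "('o, 'm, 'x) smc_scheme \<Rightarrow> ('f, 'o) language \<Rightarrow>
    'o \<Rightarrow> ('o, 'm, 'f) struct \<times> 'm \<Rightarrow> bool" where
  "is_free V L X = (\<lambda>(P, \<eta>). P \<in> Ob (Str V L) \<and> \<eta> \<in> Hom V X (fst P) \<and>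
     (\<forall>Q \<in> Ob (Str V L). iso V (str_hom V L P Q) (ihom V X (fst Q)) (transpose V L X P \<eta> Q)))"

definition Free :: "('o, 'm, 'x) smc_scheme \<Rightarrow> ('f, 'o) language \<Rightarrow> 'o \<Rightarrow> ('o, 'm, 'f) struct" where
  "Free V L X = fst (SOME P\<eta>. is_free V L X P\<eta>)"

definition free_unit :: "('o, 'm, 'x) smc_scheme \<Rightarrow> ('f, 'o) language \<Rightarrow> 'o \<Rightarrow> 'm" where
  "free_unit V L X = snd (SOME P\<eta>. is_free V L X P\<eta>)"

definition adj :: "('o, 'm, 'x) smc_scheme \<Rightarrow> ('f, 'o) language \<Rightarrow>
    'o \<Rightarrow> ('o, 'm, 'f) struct \<Rightarrow> 'm" where
  "adj V L X Q = transpose V L X (Free V L X) (free_unit V L X) Q"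

text \<open>The interpretation \<open>A\<^sup>X \<cong> Str(FX,Q) \<rightarrow> Str(FY,Q) \<cong> A\<^sup>Y\<close>, \<open>A = UQ\<close>, of a term
  \<open>t : FY \<rightarrow> FX\<close>.\<close>

definition interp :: "('o, 'm, 'x) smc_scheme \<Rightarrow> ('f, 'o) language \<Rightarrow>
    'o \<Rightarrow> 'o \<Rightarrow> 'm \<Rightarrow> ('o, 'm, 'f) struct \<Rightarrow> 'm" where
  "interp V L X Y t Q =
     adj V L Y Q \<cdot>\<^bsub>V\<^esub> str_pre V L (Free V L Y) (Free V L X) Q t \<cdot>\<^bsub>V\<^esub>
     the_inverse V (str_hom V L (Free V L X) Q) (ihom V X (fst Q)) (adj V L X Q)"

text \<open>An equation \<open>(X, Y, s, t)\<close> consists of two extended terms \<open>s\<close>, \<open>t\<close> of arity \<open>(X,Y)\<close>.\<close>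

definition ext_theory :: "('o, 'm, 'x) smc_scheme \<Rightarrow> ('f, 'o) language \<Rightarrow>
    ('o \<times> 'o \<times> 'm \<times> 'm) set \<Rightarrow> bool" where
  "ext_theory V L E \<longleftrightarrow> (\<forall>(X, Y, s, t) \<in> E. X \<in> Ob V \<and> Y \<in> Ob V \<and>
     s \<in> Hom (Str V L) (Free V L Y) (Free V L X) \<and>
     t \<in> Hom (Str V L) (Free V L Y) (Free V L X))"

definition Mod :: "('o, 'm, 'x) smc_scheme \<Rightarrow> ('f, 'o) language \<Rightarrow>
    ('o \<times> 'o \<times> 'm \<times> 'm) set \<Rightarrow> ('o, 'm, 'f) struct set" where
  "Mod V L E = {Q \<in> Ob (Str V L). \<forall>(X, Y, s, t) \<in> E. interp V L X Y s Q = interp V L X Y t Q}"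


section \<open>Enriched Birkhoff subcategories\<close>

text \<open>
  \<open>P\<close> is the power of \<open>Q\<close> by \<open>Z\<close> in the \<open>\<V>\<close>-category of structures, with counit
  \<open>\<pi> : Z \<rightarrow> Str(P,Q)\<close>: the induced \<open>\<V>\<close>-natural maps \<open>Str(R,P) \<rightarrow> [Z,Str(R,Q)]\<close> are invertible.
\<close>

definition is_power :: "('o, 'm, 'x) smc_scheme \<Rightarrow> ('f, 'o) language \<Rightarrow>
    'o \<Rightarrow> ('o, 'm, 'f) struct \<Rightarrow> ('o, 'm, 'f) struct \<Rightarrow> 'm \<Rightarrow> bool" where
  "is_power V L Z Q P \<pi> \<longleftrightarrow> P \<in> Ob (Str V L) \<and> \<pi> \<in> Hom V Z (str_hom V L P Q) \<and>
     (\<forall>R \<in> Ob (Str V L).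
        iso V (str_hom V L R P) (ihom V Z (str_hom V L R Q))
          (curry V (str_hom V L R P) Z (str_hom V L R Q)
             (str_comp V L R P Q \<cdot>\<^bsub>V\<^esub> (\<pi> \<odot>\<^bsub>V\<^esub> Idt V (str_hom V L R P)) \<cdot>\<^bsub>V\<^esub>
              sym V (str_hom V L R P) Z)))"

text \<open>
  A full subcategory is given by its class of objects.  Products are those of the underlying
  ordinary category; as structures have all powers, these are also products in the enriched sense.
\<close>

definition birkhoff :: "'u rel \<Rightarrow> ('o, 'm, 'x) smc_scheme \<Rightarrow> ('f, 'o) language \<Rightarrow>
    ('o, 'm, 'f) struct set \<Rightarrow> bool" where
  "birkhoff \<kappa> V L S \<longleftrightarrow> S \<subseteq> Ob (Str V L) \<and>
     (\<forall>A B h. A \<in> S \<and> iso (Str V L) A B h \<longrightarrow> B \<in> S) \<and>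
     (\<forall>(I :: 'u set) D P p. small \<kappa> I \<and> (\<forall>i \<in> I. D i \<in> S) \<and> is_product (Str V L) I D P p
        \<longrightarrow> P \<in> S) \<and>
     (\<forall>Z Q P \<pi>. Z \<in> Ob V \<and> Q \<in> S \<and> is_power V L Z Q P \<pi> \<longrightarrow> P \<in> S) \<and>
     (\<forall>A B m. monomorphism (Str V L) A B m \<and> B \<in> S \<longrightarrow> A \<in> S) \<and>
     (\<forall>A B e. epimorphism (Str V L) A B e \<and> split_epi V (fst A) (fst B) e \<and> A \<in> S \<longrightarrow> B \<in> S)"

end

theory Submission
  imports Defs
begin

text \<open>
  That \<open>Mod(\<E>)\<close> is an enriched Birkhoff subcategory is checked on generalized elements
  \<open>W \<rightarrow> Str(FX,Q)\<close>, that is, on homomorphisms \<open>FX \<rightarrow> Q\<close> parametrized by \<open>W\<close>: \<open>Q\<close> satisfies \<open>s = t\<close> iff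
  all of them identify \<open>s\<close> and \<open>t\<close>.  Along a \<open>\<V>\<close>-split quotient they lift because \<open>FX\<close> is free.

  Conversely, let \<open>\<E>\<close> consist of all equations valid in a Birkhoff subcategory \<open>\<L>\<close>, and let \<open>A\<close> satisfy \<open>\<E>\<close>.
  The reflection \<open>r : F(UA) \<rightarrow> R\<close> into \<open>\<L>\<close> is a strong, hence a regular epimorphism, so it is the
  coequalizer of two arrows, which may be taken to start in a free structure: they form an equation.  Powers turn the
  ordinary universal property of \<open>r\<close> into the enriched one, so this equation is valid in \<open>\<L>\<close>, hence in
  \<open>A\<close>.  Therefore the counit \<open>F(UA) \<rightarrow> A\<close>, which is split by the unit in \<open>\<V>\<close>, factors
  through \<open>r\<close>, and \<open>A\<close> is a \<open>\<V>\<close>-split quotient of \<open>R\<close>.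
\<close>

section \<open>Smallness\<close>

text \<open>Neither limits nor free structures are given: local presentability is stated as
  cocompleteness together with a small set of presentable objects of which every object is an
  \<open>l\<close>-directed colimit. Equalizers, products, preimages and intersections therefore
  come from one representability criterion, for conditions on families of arrows that can be checked
  locally on colimits. Free structures arise from a chain of length \<open>l\<close>, which is long
  enough because \<open>[X,-]\<close> preserves \<open>l\<close>-directed colimits for every arity
  \<open>X\<close>; closure of presentable objects under the tensor product enters there.

  An equation is a single parallel pair of arrows, whereas a strong epimorphism is known only by its
  lifting property; being a coequalizer is what makes the reflection expressible by an equation.
  Theories may be large but products must be small, so the reflection cannot use all homomorphisms
  into \<open>S\<close> at once and takes one for each kernel.

  Hom-objects and \<open>THE\<close> are awkward to compute with; all enriched claims are uncurried
  to equations between arrows \<open>Z \<otimes> A -> B\<close>.\<close>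

lemma small_subset: "A \<subseteq> B \<Longrightarrow> small \<kappa> B \<Longrightarrow> small \<kappa> A"
  unfolding small_def using card_of_mono1 ordLeq_ordLess_trans by blast

lemma small_image: "small \<kappa> A \<Longrightarrow> small \<kappa> (f ` A)"
  unfolding small_def using card_of_image ordLeq_ordLess_trans by blast

lemma small_inj_on: "inj_on f A \<Longrightarrow> small \<kappa> (f ` A) \<Longrightarrow> small \<kappa> A"
  by (metis inv_into_image_cancel order_refl small_image)

locale universe =
  fixes \<kappa> :: "'u rel"
  assumes inaccessible: "inaccessible \<kappa>"
begin

lemma Card_order_univ: "Card_order \<kappa>" and infinite_univ: "infinite (Field \<kappa>)"
  and stable_univ: "stable \<kappa>"
  using inaccessible regularCard_stable unfolding inaccessible_def regular_cardinal_def by auto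

text \<open>Diagrams and products are indexed by elements of \<open>'u\<close>, so index sets of
  other types, such as sets of graph edges or of kernels, have to be copied into
  \<open>'u\<close>.\<close>

lemma small_embed:
  assumes "small \<kappa> (A :: 'a set)"
  obtains \<iota> :: "'a \<Rightarrow> 'u" where "inj_on \<iota> A"
proof -
  have "|A| \<le>o |Field \<kappa>|"
    using assms Card_order_univ card_of_Field_ordIso ordIso_iff_ordLeq ordLeq_transitive
      ordLess_imp_ordLeq unfolding small_def by blast
  then show ?thesis using that card_of_ordLeq[of A "Field \<kappa>"] by blast
qed

lemma small_finite: "finite A \<Longrightarrow> small \<kappa> A"
  unfolding small_def
  by (rule finite_ordLess_infinite[OF card_of_Well_order _ _ infinite_univ])
    (use Card_order_univ in \<open>auto simp: Field_card_of card_order_on_well_order_on\<close>)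

lemma small_Sigma: "small \<kappa> A \<Longrightarrow> (\<And>a. a \<in> A \<Longrightarrow> small \<kappa> (B a)) \<Longrightarrow> small \<kappa> (Sigma A B)"
  unfolding small_def using stable_elim[OF stable_univ] by blast

lemma small_UNION:
  fixes A :: "'a set" and B :: "'a \<Rightarrow> 'b set"
  assumes "small \<kappa> A" "\<And>a. a \<in> A \<Longrightarrow> small \<kappa> (B a)"
  shows "small \<kappa> (\<Union>a\<in>A. B a)"
proof -
  have "small \<kappa> (snd ` Sigma A B)" using assms by (intro small_image small_Sigma)
  moreover have "snd ` Sigma A B = (\<Union>a\<in>A. B a)" by (rule snd_image_Sigma)
  ultimately show ?thesis by metis
qed

lemma small_Un: "small \<kappa> A \<Longrightarrow> small \<kappa> B \<Longrightarrow> small \<kappa> (A \<union> B)"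
  unfolding small_def by (rule card_of_Un_ordLess_infinite_Field[OF infinite_univ Card_order_univ])

lemma small_Plus: "small \<kappa> A \<Longrightarrow> small \<kappa> B \<Longrightarrow> small \<kappa> (A <+> B)"
  unfolding Plus_def by (intro small_Un small_image)

lemma small_Pow:
  assumes "small \<kappa> A" shows "small \<kappa> (Pow A)"
proof -
  obtain \<iota> :: "'a \<Rightarrow> 'u" where \<iota>: "inj_on \<iota> A" using small_embed[OF assms] .
  have "small \<kappa> (Pow (\<iota> ` A))"
    using inaccessible small_image[OF assms] unfolding inaccessible_def small_def by blast
  then have "small \<kappa> ((`) \<iota> ` Pow A)" by (rule small_subset[rotated]) auto
  then show ?thesis by (rule small_inj_on[OF inj_on_image_Pow[OF \<iota>]])
qed

text \<open>An extensional function is determined by its graph, a subset of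
  \<open>Sigma I B\<close>; the bound is then the closure of small sets under power sets, the strong
  limit property of the inaccessible cardinal.\<close>

lemma small_PiE:
  assumes "small \<kappa> I" "\<And>i. i \<in> I \<Longrightarrow> small \<kappa> (B i)"
  shows "small \<kappa> (Pi\<^sub>E I B)"
proof (rule small_inj_on)
  show "inj_on (\<lambda>f. (\<lambda>i. (i, f i)) ` I) (Pi\<^sub>E I B)"
  proof (rule inj_onI)
    fix f g assume f: "f \<in> Pi\<^sub>E I B" and g: "g \<in> Pi\<^sub>E I B"
      and e: "(\<lambda>i. (i, f i)) ` I = (\<lambda>i. (i, g i)) ` I"
    have "f i = g i" if "i \<in> I" for i
    proof -
      have "(i, f i) \<in> (\<lambda>i. (i, g i)) ` I" using e that by blast
      then show ?thesis by blast
    qed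
    then show "f = g" using f g by (rule PiE_ext[rotated 2])
  qed
  show "small \<kappa> ((\<lambda>f. (\<lambda>i. (i, f i)) ` I) ` Pi\<^sub>E I B)"
    by (rule small_subset[OF _ small_Pow[OF small_Sigma[of I B]]]) (use assms in auto)
qed

text \<open>Supplies the labels for the identities and the two legs of the spans in the index
  category of \<open>graph_colimit_exists\<close>.\<close>

lemma three_distinct: obtains a b c :: 'u where "a \<noteq> b" "a \<noteq> c" "b \<noteq> c"
proof -
  obtain S where "S \<subseteq> Field \<kappa>" "card S = 3"
    using infinite_arbitrarily_large[OF infinite_univ, of 3] by blast
  then show ?thesis using that card_3_iff by metis
qed

end


section \<open>Colimits of graphs\<close>

text \<open>Edges are a bare set of triples without composition. The diagrams built below (elements
  over generators, parallel pairs, stages of the free structure) can thus be written down without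
  proving functoriality.\<close>

definition graph_diagram ::
  "('o, 'm, 'x) cat_scheme \<Rightarrow> 'i set \<Rightarrow> ('i \<Rightarrow> 'o) \<Rightarrow> ('i \<times> 'i \<times> 'm) set \<Rightarrow> bool" where
  "graph_diagram C I D R \<longleftrightarrow> (\<forall>i\<in>I. D i \<in> Ob C) \<and>
     (\<forall>(i, j, a) \<in> R. i \<in> I \<and> j \<in> I \<and> a \<in> Hom C (D i) (D j))"

definition graph_cocone ::
  "('o, 'm, 'x) cat_scheme \<Rightarrow> 'i set \<Rightarrow> ('i \<Rightarrow> 'o) \<Rightarrow> ('i \<times> 'i \<times> 'm) set \<Rightarrow> 'o \<Rightarrow> ('i \<Rightarrow> 'm) \<Rightarrow> bool" where
  "graph_cocone C I D R X c \<longleftrightarrow> X \<in> Ob C \<and> (\<forall>i\<in>I. c i \<in> Hom C (D i) X) \<and>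
     (\<forall>(i, j, a) \<in> R. c j \<cdot>\<^bsub>C\<^esub> a = c i)"

definition graph_colimit ::
  "('o, 'm, 'x) cat_scheme \<Rightarrow> 'i set \<Rightarrow> ('i \<Rightarrow> 'o) \<Rightarrow> ('i \<times> 'i \<times> 'm) set \<Rightarrow> 'o \<Rightarrow> ('i \<Rightarrow> 'm) \<Rightarrow> bool" where
  "graph_colimit C I D R X c \<longleftrightarrow> graph_cocone C I D R X c \<and>
     (\<forall>Y y. graph_cocone C I D R Y y \<longrightarrow> (\<exists>!u. u \<in> Hom C X Y \<and> (\<forall>i\<in>I. u \<cdot>\<^bsub>C\<^esub> c i = y i)))"

text \<open>
  A graph is turned into a category in which every edge \<open>r : i \<rightarrow> j\<close> becomes a span
  \<open>i \<leftarrow> r \<rightarrow> j\<close>; as there are no composable pairs of nonidentity arrows, no free category is needed.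
\<close>

lemma (in universe) graph_colimit_exists:
  fixes C :: "('o, 'm, 'x) cat_scheme" and I :: "'i set"
  assumes cat: "category C" and cocomp: "cocomplete \<kappa> C"
    and gd: "graph_diagram C I D R" and sI: "small \<kappa> I" and sR: "small \<kappa> R"
  obtains X c where "graph_colimit C I D R X c"
proof -
  interpret category C by fact
  obtain u0 u1 u2 :: 'u where u: "u0 \<noteq> u1" "u0 \<noteq> u2" "u1 \<noteq> u2" by (rule three_distinct)
  obtain \<iota> :: "'i + ('i \<times> 'i \<times> 'm) \<Rightarrow> 'u" where \<iota>: "inj_on \<iota> (I <+> R)"
    using small_embed[OF small_Plus[OF sI sR]] .
  define dec where "dec = the_inv_into (I <+> R) \<iota>"
  have dec: "dec (\<iota> z) = z" if "z \<in> I <+> R" for z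
    using that \<iota> unfolding dec_def by (simp add: the_inv_into_f_f)
  have Rd: "i \<in> I" "j \<in> I" "a \<in> Hom C (D i) (D j)" if "(i, j, a) \<in> R" for i j a
    using gd that unfolding graph_diagram_def by blast+
  have Dob: "D i \<in> Ob C" if "i \<in> I" for i
    using gd that unfolding graph_diagram_def by blast
  \<comment> \<open>The label \<open>u0\<close> marks every identity, \<open>u1\<close> the leg of a
    span to the source of the edge and \<open>u2\<close> the leg to its target. Labels are shared
    between pairs of objects, which is harmless since hom-sets may overlap.\<close>
  define J :: "('u, 'u) cat" where "J = \<lparr>Ob = \<iota> ` (I <+> R),
     Hom = (\<lambda>x y. {w. (w = u0 \<and> x = y \<and> x \<in> \<iota> ` (I <+> R)) \<or>
        (\<exists>i j a. (i, j, a) \<in> R \<and> x = \<iota> (Inr (i, j, a)) \<and>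
           ((w = u1 \<and> y = \<iota> (Inl i)) \<or> (w = u2 \<and> y = \<iota> (Inl j))))}),
     Idt = (\<lambda>_. u0), Cmp = (\<lambda>g f. if g = u0 then f else g)\<rparr>"
  have J_sel: "Ob J = \<iota> ` (I <+> R)" "Idt J x = u0" "Cmp J g f = (if g = u0 then f else g)" for x g f
    unfolding J_def by auto
  have HomJ: "w \<in> Hom J x y \<longleftrightarrow> (w = u0 \<and> x = y \<and> x \<in> \<iota> ` (I <+> R)) \<or>
        (\<exists>i j a. (i, j, a) \<in> R \<and> x = \<iota> (Inr (i, j, a)) \<and>
           ((w = u1 \<and> y = \<iota> (Inl i)) \<or> (w = u2 \<and> y = \<iota> (Inl j))))" for w x y
    unfolding J_def by simp
  have leg: "\<iota> (Inl i) \<noteq> \<iota> (Inr r)" if "i \<in> I" "r \<in> R" for i r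
    using that \<iota> unfolding inj_on_def by blast
  have HomJ_cases: "(w = u0 \<and> x = y) \<or> ((\<exists>i\<in>I. y = \<iota> (Inl i)) \<and> (\<exists>r\<in>R. x = \<iota> (Inr r)))"
    if "w \<in> Hom J x y" for w x y
    using that Rd(1,2) unfolding HomJ by metis
  have HomJ_ob: "x \<in> Ob J" "y \<in> Ob J" if "w \<in> Hom J x y" for w x y
    using that Rd(1,2) unfolding HomJ J_sel by (metis InlI InrI imageI)+
  have compJ: "(f = u0 \<and> x = y) \<or> (g = u0 \<and> y = z)" if "f \<in> Hom J x y" "g \<in> Hom J y z" for f g x y z
    using HomJ_cases[OF that(1)] HomJ_cases[OF that(2)] leg by metis
  have catJ: "category J"
  proof
    fix f A B assume "f \<in> Hom J A B" then show "A \<in> Ob J \<and> B \<in> Ob J" using HomJ_ob by blast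
  next
    fix A assume "A \<in> Ob J" then show "Idt J A \<in> Hom J A A" unfolding HomJ J_sel by blast
  next
    fix f A B g E assume fg: "f \<in> Hom J A B" "g \<in> Hom J B E"
    show "g \<cdot>\<^bsub>J\<^esub> f \<in> Hom J A E"
      using compJ[OF fg]
    proof
      assume "f = u0 \<and> A = B"
      then have "g \<cdot>\<^bsub>J\<^esub> f = g" by (simp add: J_sel)
      then show ?thesis using fg \<open>f = u0 \<and> A = B\<close> by simp
    next
      assume "g = u0 \<and> B = E"
      then show ?thesis using fg by (simp add: J_sel)
    qed
  next
    fix f A B assume "f \<in> Hom J A B"
    then show "Idt J B \<cdot>\<^bsub>J\<^esub> f = f" "f \<cdot>\<^bsub>J\<^esub> Idt J A = f" by (auto simp: J_sel)
  next
    fix f A B g E h G show "h \<cdot>\<^bsub>J\<^esub> g \<cdot>\<^bsub>J\<^esub> f = h \<cdot>\<^bsub>J\<^esub> (g \<cdot>\<^bsub>J\<^esub> f)" by (auto simp: J_sel)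
  qed
  have "small \<kappa> (Hom J x y)" for x y
    by (rule small_subset[OF _ small_finite[of "{u0, u1, u2}"]]) (auto simp: HomJ)
  then have smJ: "small_category \<kappa> J"
    using catJ small_image[OF small_Plus[OF sI sR]] unfolding small_category_def J_sel by blast
  \<comment> \<open>An edge \<open>a : i -> j\<close>, viewed as an object, goes to
    \<open>D i\<close>: then \<open>u1\<close> becomes an identity and only \<open>u2\<close>
    carries \<open>a\<close>. The \<open>undefined\<close> branch is never reached, as no arrow
    labelled \<open>u2\<close> leaves a vertex.\<close>
  define D' where "D' x = (case dec x of Inl i \<Rightarrow> D i | Inr (i, j, a) \<Rightarrow> D i)" for x
  define d where "d x (y :: 'u) w = (if w = u2 then (case dec x of Inl i \<Rightarrow> undefined | Inr (i, j, a) \<Rightarrow> a)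
      else Idt C (D' x))" for x y w
  have D'l: "D' (\<iota> (Inl i)) = D i" if "i \<in> I" for i using dec[OF InlI[OF that]] by (simp add: D'_def)
  have D'r: "D' (\<iota> (Inr (i, j, a))) = D i" if "(i, j, a) \<in> R" for i j a
    using dec[OF InrI[OF that]] by (simp add: D'_def)
  have d2: "d (\<iota> (Inr (i, j, a))) y u2 = a" if "(i, j, a) \<in> R" for i j a y
    using dec[OF InrI[OF that]] by (simp add: d_def)
  have d01: "d x y u0 = Idt C (D' x)" "d x y u1 = Idt C (D' x)" for x y
    using u by (auto simp: d_def)
  have decl: "dec (\<iota> (Inl i)) = Inl i" if "i \<in> I" for i using dec[OF InlI[OF that]] .
  have decr: "dec (\<iota> (Inr r)) = Inr r" if "r \<in> R" for r using dec[OF InrI[OF that]] .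
  have D'ob: "D' x \<in> Ob C" if "x \<in> Ob J" for x
    using that Rd Dob unfolding J_sel by (auto simp: D'l D'r)
  have d_hom: "d x y w \<in> Hom C (D' x) (D' y)" if "w \<in> Hom J x y" for w x y
    using that unfolding HomJ
  proof (elim disjE conjE exE)
    assume "w = u0" "x = y" then show ?thesis using HomJ_ob[OF that] D'ob[of x] idt_hom by (simp add: d01)
  next
    fix i j a assume "(i, j, a) \<in> R" "x = \<iota> (Inr (i, j, a))" "w = u1" "y = \<iota> (Inl i)"
    then show ?thesis using Rd Dob idt_hom by (simp add: d01 D'l D'r)
  next
    fix i j a assume "(i, j, a) \<in> R" "x = \<iota> (Inr (i, j, a))" "w = u2" "y = \<iota> (Inl j)"
    then show ?thesis using Rd by (simp add: d2 D'l D'r)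
  qed
  have diag: "diagram J C D' d"
    unfolding diagram_def
  proof (intro conjI ballI allI)
    fix i j k a b assume ab: "a \<in> Hom J i j" "b \<in> Hom J j k"
    show "d i k (b \<cdot>\<^bsub>J\<^esub> a) = d j k b \<cdot>\<^bsub>C\<^esub> d i j a"
      using compJ[OF ab]
    proof
      assume *: "a = u0 \<and> i = j"
      then have "b \<cdot>\<^bsub>J\<^esub> a = b" by (simp add: J_sel)
      then show ?thesis using * idt_right[OF d_hom[OF ab(2)]] by (simp add: d01)
    next
      assume *: "b = u0 \<and> j = k"
      then show ?thesis using idt_left[OF d_hom[OF ab(1)]] by (simp add: J_sel d01)
    qed
  qed (use D'ob d_hom in \<open>simp_all add: J_sel d01\<close>)
  obtain X c where col: "colimit J C D' d X c"
    using cocomp smJ diag unfolding cocomplete_def by blast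
  \<comment> \<open>The value at the object of an edge \<open>i -> j\<close> is forced to be
    \<open>y i\<close>, because \<open>u1\<close> is sent to an identity; the leg \<open>u2\<close>
    then expresses compatibility with the edge.\<close>
  have extend: "cocone J C D' d Y (\<lambda>x. case dec x of Inl i \<Rightarrow> y i | Inr (i, j, a) \<Rightarrow> y i)"
    if gc: "graph_cocone C I D R Y y" for Y y
    unfolding cocone_def
  proof (intro conjI ballI allI)
    show "Y \<in> Ob C" using gc unfolding graph_cocone_def by blast
    show ex_hom: "(case dec x of Inl i \<Rightarrow> y i | Inr (i, j, a) \<Rightarrow> y i) \<in> Hom C (D' x) Y" if x: "x \<in> Ob J" for x
    proof -
      obtain z where z: "z \<in> I <+> R" "x = \<iota> z" using x unfolding J_sel by blast
      show ?thesis using z gc Rd(1) unfolding graph_cocone_def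
        by (cases z) (auto simp: D'l D'r decl decr)
    qed
    fix x z w assume "w \<in> Hom J x z"
    then show "(case dec z of Inl i \<Rightarrow> y i | Inr (i, j, a) \<Rightarrow> y i) \<cdot>\<^bsub>C\<^esub> d x z w =
        (case dec x of Inl i \<Rightarrow> y i | Inr (i, j, a) \<Rightarrow> y i)"
      unfolding HomJ
    proof (elim disjE conjE exE)
      assume w: "w = u0" "x = z" and x: "x \<in> \<iota> ` (I <+> R)"
      have "(case dec x of Inl i \<Rightarrow> y i | Inr (i, j, a) \<Rightarrow> y i) \<in> Hom C (D' x) Y"
        using ex_hom x unfolding J_sel by blast
      then show ?thesis using w idt_right by (simp add: d01)
    next
      fix i j a assume r: "(i, j, a) \<in> R" and "x = \<iota> (Inr (i, j, a))" "w = u1" "z = \<iota> (Inl i)"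
      moreover have "y i \<in> Hom C (D i) Y" using gc Rd(1)[OF r] unfolding graph_cocone_def by blast
      ultimately show ?thesis using idt_right Rd(1) by (simp add: D'r d01 decl decr)
    next
      fix i j a assume r: "(i, j, a) \<in> R" and "x = \<iota> (Inr (i, j, a))" "w = u2" "z = \<iota> (Inl j)"
      moreover have "y j \<cdot>\<^bsub>C\<^esub> a = y i" using gc r unfolding graph_cocone_def by blast
      ultimately show ?thesis using Rd(2) by (simp add: d2 decl decr)
    qed
  qed
  let ?c = "\<lambda>i. c (\<iota> (Inl i))"
  have co: "cocone J C D' d X c" using col unfolding colimit_def by blast
  have cr: "c (\<iota> (Inr (i, j, a))) = ?c i" "?c j \<cdot>\<^bsub>C\<^esub> a = c (\<iota> (Inr (i, j, a)))"
    if r: "(i, j, a) \<in> R" for i j a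
  proof -
    have "u1 \<in> Hom J (\<iota> (Inr (i, j, a))) (\<iota> (Inl i))" using r by (auto simp: HomJ)
    then have "?c i \<cdot>\<^bsub>C\<^esub> d (\<iota> (Inr (i, j, a))) (\<iota> (Inl i)) u1 = c (\<iota> (Inr (i, j, a)))"
      using co unfolding cocone_def by blast
    moreover have "\<iota> (Inl i) \<in> Ob J" using Rd[OF r] by (auto simp: J_sel)
    then have "?c i \<in> Hom C (D i) X" using co D'l[OF Rd(1)[OF r]] unfolding cocone_def by metis
    ultimately show "c (\<iota> (Inr (i, j, a))) = ?c i" using idt_right by (simp add: d01 D'r[OF r])
    have "u2 \<in> Hom J (\<iota> (Inr (i, j, a))) (\<iota> (Inl j))" using r by (auto simp: HomJ)
    then have "?c j \<cdot>\<^bsub>C\<^esub> d (\<iota> (Inr (i, j, a))) (\<iota> (Inl j)) u2 = c (\<iota> (Inr (i, j, a)))"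
      using co unfolding cocone_def by blast
    then show "?c j \<cdot>\<^bsub>C\<^esub> a = c (\<iota> (Inr (i, j, a)))" by (simp add: d2[OF r])
  qed
  have "graph_colimit C I D R X ?c"
    unfolding graph_colimit_def
  proof (intro conjI allI impI)
    show "graph_cocone C I D R X ?c"
      unfolding graph_cocone_def
    proof (intro conjI ballI)
      show "X \<in> Ob C" using co unfolding cocone_def by blast
      fix i assume i: "i \<in> I"
      then have "\<iota> (Inl i) \<in> Ob J" by (auto simp: J_sel)
      then show "?c i \<in> Hom C (D i) X" using co D'l[OF i] unfolding cocone_def by metis
    next
      fix r assume "r \<in> R"
      then show "case r of (i, j, a) \<Rightarrow> ?c j \<cdot>\<^bsub>C\<^esub> a = ?c i" using cr by (auto split: prod.split)
    qed
    fix Y y assume gc: "graph_cocone C I D R Y y"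
    have "(\<forall>x\<in>Ob J. u \<cdot>\<^bsub>C\<^esub> c x = (case dec x of Inl i \<Rightarrow> y i | Inr (i, j, a) \<Rightarrow> y i)) \<longleftrightarrow>
        (\<forall>i\<in>I. u \<cdot>\<^bsub>C\<^esub> ?c i = y i)" for u
    proof
      assume *: "\<forall>x\<in>Ob J. u \<cdot>\<^bsub>C\<^esub> c x = (case dec x of Inl i \<Rightarrow> y i | Inr (i, j, a) \<Rightarrow> y i)"
      show "\<forall>i\<in>I. u \<cdot>\<^bsub>C\<^esub> ?c i = y i"
      proof
        fix i assume "i \<in> I" then show "u \<cdot>\<^bsub>C\<^esub> ?c i = y i" using bspec[OF *, of "\<iota> (Inl i)"]
          by (simp add: J_sel InlI decl)
      qed
    next
      assume *: "\<forall>i\<in>I. u \<cdot>\<^bsub>C\<^esub> ?c i = y i"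
      show "\<forall>x\<in>Ob J. u \<cdot>\<^bsub>C\<^esub> c x = (case dec x of Inl i \<Rightarrow> y i | Inr (i, j, a) \<Rightarrow> y i)"
      proof
        fix x assume "x \<in> Ob J"
        then obtain z where z: "z \<in> I <+> R" "x = \<iota> z" unfolding J_sel by blast
        then show "u \<cdot>\<^bsub>C\<^esub> c x = (case dec x of Inl i \<Rightarrow> y i | Inr (i, j, a) \<Rightarrow> y i)"
          using * cr(1) Rd(1) by (cases z) (auto simp: decl decr)
      qed
    qed
    moreover have "\<exists>!u. u \<in> Hom C X Y \<and>
        (\<forall>x\<in>Ob J. u \<cdot>\<^bsub>C\<^esub> c x = (case dec x of Inl i \<Rightarrow> y i | Inr (i, j, a) \<Rightarrow> y i))"
      using col extend[OF gc] unfolding colimit_def by blast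
    ultimately show "\<exists>!u. u \<in> Hom C X Y \<and> (\<forall>i\<in>I. u \<cdot>\<^bsub>C\<^esub> ?c i = y i)" by simp
  qed
  then show ?thesis using that by blast
qed


section \<open>Representability\<close>

definition effective_sink ::
  "('o, 'm, 'x) cat_scheme \<Rightarrow> ('o \<times> 'm) set \<Rightarrow> 'o \<Rightarrow> bool" where
  "effective_sink C K X \<longleftrightarrow> X \<in> Ob C \<and> (\<forall>(A, f) \<in> K. f \<in> Hom C A X) \<and>
     (\<forall>Y g. Y \<in> Ob C \<and> (\<forall>(A, f) \<in> K. g A f \<in> Hom C A Y) \<and>
        (\<forall>(A, f) \<in> K. \<forall>(A', f') \<in> K. \<forall>B a a'. a \<in> Hom C B A \<and> a' \<in> Hom C B A' \<and>
            f \<cdot>\<^bsub>C\<^esub> a = f' \<cdot>\<^bsub>C\<^esub> a' \<longrightarrow> g A f \<cdot>\<^bsub>C\<^esub> a = g A' f' \<cdot>\<^bsub>C\<^esub> a')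
        \<longrightarrow> (\<exists>!u. u \<in> Hom C X Y \<and> (\<forall>(A, f) \<in> K. u \<cdot>\<^bsub>C\<^esub> f = g A f)))"

section \<open>Effective sinks, colimits and cancellation in an ordinary category\<close>

context category
begin

lemma effective_sinkI:
  assumes "X \<in> Ob C" "\<And>A f. (A, f) \<in> K \<Longrightarrow> f \<in> Hom C A X"
    and "\<And>Y g. \<lbrakk>Y \<in> Ob C; \<And>A f. (A, f) \<in> K \<Longrightarrow> g A f \<in> Hom C A Y;
      \<And>A f A' f' B a a'. \<lbrakk>(A, f) \<in> K; (A', f') \<in> K; a \<in> Hom C B A; a' \<in> Hom C B A'; f \<cdot> a = f' \<cdot> a'\<rbrakk>
        \<Longrightarrow> g A f \<cdot> a = g A' f' \<cdot> a'\<rbrakk>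
      \<Longrightarrow> \<exists>!u. u \<in> Hom C X Y \<and> (\<forall>(A, f) \<in> K. u \<cdot> f = g A f)"
  shows "effective_sink C K X"
  unfolding effective_sink_def
proof (intro conjI allI impI)
  show "\<forall>(A, f)\<in>K. f \<in> Hom C A X" using assms(2) by blast
  fix Y g assume *: "Y \<in> Ob C \<and> (\<forall>(A, f) \<in> K. g A f \<in> Hom C A Y) \<and>
        (\<forall>(A, f) \<in> K. \<forall>(A', f') \<in> K. \<forall>B a a'. a \<in> Hom C B A \<and> a' \<in> Hom C B A' \<and>
            f \<cdot> a = f' \<cdot> a' \<longrightarrow> g A f \<cdot> a = g A' f' \<cdot> a')"
  show "\<exists>!u. u \<in> Hom C X Y \<and> (\<forall>(A, f) \<in> K. u \<cdot> f = g A f)"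
    by (rule assms(3)) (use * in \<open>blast+\<close>)
qed (rule assms(1))

lemma effective_sink_unique:
  assumes "effective_sink C K X" "Y \<in> Ob C" "\<And>A f. (A, f) \<in> K \<Longrightarrow> g A f \<in> Hom C A Y"
    "\<And>A f A' f' B a a'. \<lbrakk>(A, f) \<in> K; (A', f') \<in> K; a \<in> Hom C B A; a' \<in> Hom C B A'; f \<cdot> a = f' \<cdot> a'\<rbrakk>
      \<Longrightarrow> g A f \<cdot> a = g A' f' \<cdot> a'"
  shows "\<exists>!u. u \<in> Hom C X Y \<and> (\<forall>(A, f) \<in> K. u \<cdot> f = g A f)"
proof -
  have "\<forall>(A, f) \<in> K. \<forall>(A', f') \<in> K. \<forall>B a a'. a \<in> Hom C B A \<and> a' \<in> Hom C B A' \<and>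
            f \<cdot> a = f' \<cdot> a' \<longrightarrow> g A f \<cdot> a = g A' f' \<cdot> a'" using assms(4) by blast
  moreover have "\<forall>(A, f) \<in> K. g A f \<in> Hom C A Y" using assms(3) by blast
  ultimately show ?thesis using assms(1,2) unfolding effective_sink_def by simp
qed

lemma effective_sink_hom: "effective_sink C K X \<Longrightarrow> (A, f) \<in> K \<Longrightarrow> f \<in> Hom C A X"
  unfolding effective_sink_def by blast

lemma effective_sink_epi:
  assumes K: "effective_sink C K X" and u: "u \<in> Hom C X Y" and v: "v \<in> Hom C X Y"
    and e: "\<And>A f. (A, f) \<in> K \<Longrightarrow> u \<cdot> f = v \<cdot> f"
  shows "u = v"
proof -
  note h = effective_sink_hom[OF K]
  have "\<exists>!w. w \<in> Hom C X Y \<and> (\<forall>(A, f) \<in> K. w \<cdot> f = u \<cdot> f)"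
  proof (rule effective_sink_unique[OF K])
    show "Y \<in> Ob C" using u hom_ob by blast
    show "u \<cdot> f \<in> Hom C A Y" if "(A, f) \<in> K" for A f using cmp_hom[OF h[OF that] u] .
    fix A f A' f' B a a'
    assume *: "(A, f) \<in> K" "(A', f') \<in> K" "a \<in> Hom C B A" "a' \<in> Hom C B A'" "f \<cdot> a = f' \<cdot> a'"
    then show "u \<cdot> f \<cdot> a = u \<cdot> f' \<cdot> a'" using cmp_assoc[OF *(3) h[OF *(1)] u] cmp_assoc[OF *(4) h[OF *(2)] u] by simp
  qed
  moreover have "\<forall>(A, f) \<in> K. u \<cdot> f = u \<cdot> f" "\<forall>(A, f) \<in> K. v \<cdot> f = u \<cdot> f" using e by auto
  ultimately show ?thesis using u v by blast
qed

lemma effective_sink_glue: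
  assumes "effective_sink C K X" "Y \<in> Ob C" "\<And>A f. (A, f) \<in> K \<Longrightarrow> g A f \<in> Hom C A Y"
    "\<And>A f A' f' B a a'. \<lbrakk>(A, f) \<in> K; (A', f') \<in> K; a \<in> Hom C B A; a' \<in> Hom C B A'; f \<cdot> a = f' \<cdot> a'\<rbrakk>
      \<Longrightarrow> g A f \<cdot> a = g A' f' \<cdot> a'"
  obtains u where "u \<in> Hom C X Y" "\<And>A f. (A, f) \<in> K \<Longrightarrow> u \<cdot> f = g A f"
  using effective_sink_unique[where g = g, OF assms(1,2)] assms(3,4) that by blast

lemma graph_colimitD:
  assumes "graph_colimit C I D R X c"
  shows "X \<in> Ob C" "i \<in> I \<Longrightarrow> c i \<in> Hom C (D i) X" "(i, j, a) \<in> R \<Longrightarrow> c j \<cdot> a = c i"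
  using assms unfolding graph_colimit_def graph_cocone_def by blast+

lemma graph_colimit_glue:
  assumes "graph_colimit C I D R X c" "Y \<in> Ob C" "\<And>i. i \<in> I \<Longrightarrow> y i \<in> Hom C (D i) Y"
    "\<And>i j a. (i, j, a) \<in> R \<Longrightarrow> y j \<cdot> a = y i"
  obtains u where "u \<in> Hom C X Y" "\<And>i. i \<in> I \<Longrightarrow> u \<cdot> c i = y i"
proof -
  have "graph_cocone C I D R Y y" using assms(2-4) unfolding graph_cocone_def by blast
  then show ?thesis using assms(1) that unfolding graph_colimit_def by blast
qed

text \<open>An edge \<open>a\<close> from \<open>i\<close> to \<open>j\<close> yields the span
  consisting of \<open>a\<close> and the identity of \<open>D i\<close>; compatibility on these
  spans already makes a family a cocone.\<close>

lemma effective_sink_graph_colimit: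
  assumes gc: "graph_colimit C I D R X c" and gd: "graph_diagram C I D R"
  shows "effective_sink C ((\<lambda>i. (D i, c i)) ` I) X"
proof (rule effective_sinkI)
  note c = graph_colimitD[OF gc]
  show "X \<in> Ob C" by (rule c)
  show "f \<in> Hom C A X" if "(A, f) \<in> (\<lambda>i. (D i, c i)) ` I" for A f using that c by blast
  fix Y g
  assume Y: "Y \<in> Ob C" and g: "\<And>A f. (A, f) \<in> (\<lambda>i. (D i, c i)) ` I \<Longrightarrow> g A f \<in> Hom C A Y"
    and gg: "\<And>A f A' f' B a a'. \<lbrakk>(A, f) \<in> (\<lambda>i. (D i, c i)) ` I; (A', f') \<in> (\<lambda>i. (D i, c i)) ` I;
      a \<in> Hom C B A; a' \<in> Hom C B A'; f \<cdot> a = f' \<cdot> a'\<rbrakk> \<Longrightarrow> g A f \<cdot> a = g A' f' \<cdot> a'"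
  have g': "g (D i) (c i) \<in> Hom C (D i) Y" if "i \<in> I" for i using g that by blast
  have "g (D j) (c j) \<cdot> a = g (D i) (c i)" if r: "(i, j, a) \<in> R" for i j a
  proof -
    have t: "i \<in> I" "j \<in> I" "a \<in> Hom C (D i) (D j)" "D i \<in> Ob C"
      using gd r unfolding graph_diagram_def by auto
    have "c j \<cdot> a = c i \<cdot> Idt C (D i)" using c(3)[OF r] idt_right[OF c(2)[OF t(1)]] by simp
    then have "g (D j) (c j) \<cdot> a = g (D i) (c i) \<cdot> Idt C (D i)"
      using gg[OF imageI[OF t(2)] imageI[OF t(1)] t(3) idt_hom[OF t(4)]] by simp
    then show ?thesis using idt_right[OF g'[OF t(1)]] by simp
  qed
  then have "graph_cocone C I D R Y (\<lambda>i. g (D i) (c i))"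
    using Y g' unfolding graph_cocone_def by blast
  then have "\<exists>!u. u \<in> Hom C X Y \<and> (\<forall>i\<in>I. u \<cdot> c i = g (D i) (c i))"
    using gc unfolding graph_colimit_def by blast
  then show "\<exists>!u. u \<in> Hom C X Y \<and> (\<forall>(A, f)\<in>(\<lambda>i. (D i, c i)) ` I. u \<cdot> f = g A f)"
    by simp
qed

lemma graph_colimit_epi:
  assumes "graph_colimit C I D R X c" "graph_diagram C I D R" "u \<in> Hom C X Y" "v \<in> Hom C X Y"
    "\<And>i. i \<in> I \<Longrightarrow> u \<cdot> c i = v \<cdot> c i"
  shows "u = v"
  by (rule effective_sink_epi[OF effective_sink_graph_colimit[OF assms(1,2)] assms(3,4)])
    (use assms(5) in auto)

lemma colimitD:
  assumes "colimit J C D d X c"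
  shows "X \<in> Ob C" "i \<in> Ob J \<Longrightarrow> c i \<in> Hom C (D i) X" "a \<in> Hom J i j \<Longrightarrow> c j \<cdot> d i j a = c i"
  using assms unfolding colimit_def cocone_def by blast+

lemma colimit_glue:
  assumes "colimit J C D d X c" "Y \<in> Ob C" "\<And>i. i \<in> Ob J \<Longrightarrow> y i \<in> Hom C (D i) Y"
    "\<And>i j a. a \<in> Hom J i j \<Longrightarrow> y j \<cdot> d i j a = y i"
  obtains u where "u \<in> Hom C X Y" "\<And>i. i \<in> Ob J \<Longrightarrow> u \<cdot> c i = y i"
proof -
  have "cocone J C D d Y y" using assms(2-4) unfolding cocone_def by blast
  then show ?thesis using assms(1) that unfolding colimit_def by blast
qed

lemma colimit_epi:
  assumes col: "colimit J C D d X c" and "category J" "diagram J C D d"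
    and u: "u \<in> Hom C X Y" "v \<in> Hom C X Y" and e: "\<And>i. i \<in> Ob J \<Longrightarrow> u \<cdot> c i = v \<cdot> c i"
  shows "u = v"
proof -
  interpret J: category J by fact
  note c = colimitD[OF col]
  have "cocone J C D d Y (\<lambda>i. v \<cdot> c i)"
    unfolding cocone_def
  proof (intro conjI ballI allI)
    fix i j a assume a: "a \<in> Hom J i j"
    have "d i j a \<in> Hom C (D i) (D j)" "c j \<in> Hom C (D j) X"
      using a assms(3) J.hom_ob[OF a] c unfolding diagram_def by auto
    then show "v \<cdot> c j \<cdot> d i j a = v \<cdot> c i" using u(2) c(3)[OF a] cmp_assoc[of "d i j a" "D i" "D j" "c j" X v Y] by simp
  qed (use u c hom_ob cmp_hom in blast)+
  then have "\<exists>!w. w \<in> Hom C X Y \<and> (\<forall>i\<in>Ob J. w \<cdot> c i = v \<cdot> c i)" using col unfolding colimit_def by blast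
  then show ?thesis using u e by blast
qed

lemma isoE:
  assumes "iso C A B f"
  obtains i where "f \<in> Hom C A B" "i \<in> Hom C B A" "i \<cdot> f = Idt C A" "f \<cdot> i = Idt C B"
  using assms unfolding iso_def is_inverse_def by (elim exE conjE) (rule that)

lemma iso_epi:
  assumes *: "iso C A B f" "g \<in> Hom C B E" "h \<in> Hom C B E" "g \<cdot> f = h \<cdot> f"
  shows "g = h"
proof -
  obtain i where i: "f \<in> Hom C A B" "i \<in> Hom C B A" "i \<cdot> f = Idt C A" "f \<cdot> i = Idt C B" by (rule isoE[OF *(1)])
  have "g = g \<cdot> f \<cdot> i" by (simp only: cmp_assoc[OF i(2,1) *(2)] i(4) idt_right[OF *(2)])
  also have "\<dots> = h" by (simp only: *(4) cmp_assoc[OF i(2,1) *(3)] i(4) idt_right[OF *(3)])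
  finally show ?thesis .
qed

lemma iso_mono:
  assumes *: "iso C A B f" "g \<in> Hom C E A" "h \<in> Hom C E A" "f \<cdot> g = f \<cdot> h"
  shows "g = h"
proof -
  obtain i where i: "f \<in> Hom C A B" "i \<in> Hom C B A" "i \<cdot> f = Idt C A" "f \<cdot> i = Idt C B" by (rule isoE[OF *(1)])
  have "g = i \<cdot> (f \<cdot> g)" by (simp only: cmp_assoc[OF *(2) i(1,2), symmetric] i(3) idt_left[OF *(2)])
  also have "\<dots> = h" by (simp only: *(4) cmp_assoc[OF *(3) i(1,2), symmetric] i(3) idt_left[OF *(3)])
  finally show ?thesis .
qed

lemma iso_cmp_epi:
  assumes *: "iso C A B f" "iso C B E g" "h \<in> Hom C E D" "k \<in> Hom C E D" "h \<cdot> (g \<cdot> f) = k \<cdot> (g \<cdot> f)"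
  shows "h = k"
proof -
  have t: "f \<in> Hom C A B" "g \<in> Hom C B E" using *(1,2) by (auto elim: isoE)
  have "h \<cdot> g \<cdot> f = k \<cdot> g \<cdot> f" by (simp only: cmp_assoc[OF t *(3)] cmp_assoc[OF t *(4)] *(5))
  then have "h \<cdot> g = k \<cdot> g" by (rule iso_epi[OF *(1) cmp_hom[OF t(2) *(3)] cmp_hom[OF t(2) *(4)]])
  then show ?thesis by (rule iso_epi[OF *(2-4)])
qed

text \<open>The Yoneda argument by hand: lifting the identity of \<open>B\<close> gives a section,
  and injectivity on elements makes it a two-sided inverse.\<close>

lemma isoI_elements:
  assumes p: "p \<in> Hom C A B" and ex: "\<And>W v. v \<in> Hom C W B \<Longrightarrow> \<exists>u. u \<in> Hom C W A \<and> p \<cdot> u = v"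
    and inj: "\<And>W u v. \<lbrakk>u \<in> Hom C W A; v \<in> Hom C W A; p \<cdot> u = p \<cdot> v\<rbrakk> \<Longrightarrow> u = v"
  shows "iso C A B p"
proof -
  have ob: "A \<in> Ob C" "B \<in> Ob C" using p hom_ob by blast+
  obtain g where g: "g \<in> Hom C B A" "p \<cdot> g = Idt C B" using ex[OF idt_hom[OF ob(2)]] by blast
  have "p \<cdot> (g \<cdot> p) = p \<cdot> Idt C A"
    by (simp only: cmp_assoc[OF p g(1) p, symmetric] g(2) idt_left[OF p] idt_right[OF p])
  then have "g \<cdot> p = Idt C A" by (rule inj[OF cmp_hom[OF p g(1)] idt_hom[OF ob(1)]])
  then show ?thesis unfolding iso_def is_inverse_def using p g by blast
qed

lemma the_inverse: "iso C A B f \<Longrightarrow> is_inverse C A B f (the_inverse C A B f)"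
  unfolding the_inverse_def
proof (rule theI')
  assume "iso C A B f"
  then obtain g where g: "is_inverse C A B f g" unfolding iso_def by blast
  have "h = g" if h: "is_inverse C A B f h" for h
  proof -
    have gt: "f \<in> Hom C A B" "g \<in> Hom C B A" "f \<cdot> g = Idt C B" and ht: "h \<in> Hom C B A" "h \<cdot> f = Idt C A"
      using g h unfolding is_inverse_def by blast+
    have "h = h \<cdot> f \<cdot> g" by (simp only: cmp_assoc[OF gt(2,1) ht(1)] gt(3) idt_right[OF ht(1)])
    then show ?thesis by (simp only: ht(2) idt_left[OF gt(2)])
  qed
  then show "\<exists>!g. is_inverse C A B f g" using g by blast
qed

lemma monoD: "\<lbrakk>monomorphism C A B m; m \<cdot> f = m \<cdot> g; f \<in> Hom C X A; g \<in> Hom C X A\<rbrakk> \<Longrightarrow> f = g"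
  unfolding monomorphism_def by blast

lemma mono_cmp: "\<lbrakk>monomorphism C A B m; monomorphism C B E n\<rbrakk> \<Longrightarrow> monomorphism C A E (n \<cdot> m)"
proof -
  assume m: "monomorphism C A B m" and n: "monomorphism C B E n"
  have h: "m \<in> Hom C A B" "n \<in> Hom C B E" using m n unfolding monomorphism_def by blast+
  have "f = g" if f: "f \<in> Hom C X A" "g \<in> Hom C X A" and e: "n \<cdot> m \<cdot> f = n \<cdot> m \<cdot> g" for X f g
  proof -
    have "n \<cdot> (m \<cdot> f) = n \<cdot> (m \<cdot> g)" using e by (simp only: cmp_assoc[OF f(1) h] cmp_assoc[OF f(2) h])
    then have "m \<cdot> f = m \<cdot> g" by (rule monoD[OF n _ cmp_hom[OF f(1) h(1)] cmp_hom[OF f(2) h(1)]])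
    then show ?thesis by (rule monoD[OF m _ f])
  qed
  then show ?thesis unfolding monomorphism_def using cmp_hom[OF h] by blast
qed

text \<open>Lifts through a monomorphism are unique, so lifts chosen separately on the members of
  the sink are automatically compatible and glue. This makes factoring through a subobject a local
  condition.\<close>

lemma effective_sink_lift:
  assumes K: "effective_sink C K Z" and m: "monomorphism C M B m" and p: "p \<in> Hom C Z B"
    and l: "\<And>A f. (A, f) \<in> K \<Longrightarrow> \<exists>g. g \<in> Hom C A M \<and> p \<cdot> f = m \<cdot> g"
  shows "\<exists>g. g \<in> Hom C Z M \<and> p = m \<cdot> g"
proof -
  have mh: "m \<in> Hom C M B" using m unfolding monomorphism_def by blast
  define g where "g A f = (SOME g. g \<in> Hom C A M \<and> p \<cdot> f = m \<cdot> g)" for A f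
  have g: "g A f \<in> Hom C A M" "p \<cdot> f = m \<cdot> g A f" if "(A, f) \<in> K" for A f
    using someI_ex[OF l[OF that]] unfolding g_def by blast+
  note f = effective_sink_hom[OF K]
  obtain u where u: "u \<in> Hom C Z M" "\<And>A f. (A, f) \<in> K \<Longrightarrow> u \<cdot> f = g A f"
  proof (rule effective_sink_glue[OF K, of M g])
    show "M \<in> Ob C" using mh hom_ob by blast
    show "g A f \<in> Hom C A M" if "(A, f) \<in> K" for A f using g(1)[OF that] .
    fix A f A' f' N a a' assume *: "(A, f) \<in> K" "(A', f') \<in> K" "a \<in> Hom C N A" "a' \<in> Hom C N A'" "f \<cdot> a = f' \<cdot> a'"
    have "m \<cdot> (g A f \<cdot> a) = p \<cdot> (f \<cdot> a)"
      by (simp only: cmp_assoc[OF *(3) g(1)[OF *(1)] mh, symmetric] g(2)[OF *(1), symmetric] cmp_assoc[OF *(3) f[OF *(1)] p])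
    also have "\<dots> = m \<cdot> (g A' f' \<cdot> a')"
      by (simp only: *(5) cmp_assoc[OF *(4) g(1)[OF *(2)] mh, symmetric] g(2)[OF *(2), symmetric] cmp_assoc[OF *(4) f[OF *(2)] p])
    finally show "g A f \<cdot> a = g A' f' \<cdot> a'"
      by (rule monoD[OF m _ cmp_hom[OF *(3) g(1)[OF *(1)]] cmp_hom[OF *(4) g(1)[OF *(2)]]])
  qed (rule that; assumption)
  have "p = m \<cdot> u"
  proof (rule effective_sink_epi[OF K p cmp_hom[OF u(1) mh]])
    fix A f' assume Af: "(A, f') \<in> K"
    show "p \<cdot> f' = m \<cdot> u \<cdot> f'" by (simp only: cmp_assoc[OF f[OF Af] u(1) mh] u(2)[OF Af] g(2)[OF Af])
  qed
  then show ?thesis using u(1) by blast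
qed

end

section \<open>Representability in a locally presentable category\<close>

locale presentable_category = category V + universe \<kappa>
  for V :: "('o, 'm, 'x) cat_scheme" (structure) and \<kappa> :: "'u rel" +
  fixes l :: "'l rel"
  assumes locally_presentable: "locally_presentable \<kappa> l V"
begin

definition Gen :: "'o set" where
  "Gen = (SOME G. small \<kappa> G \<and> (\<forall>X \<in> G. presentable \<kappa> l V X) \<and>
        (\<forall>A \<in> Ob V. \<exists>(J :: ('u, 'u) cat) D d c.
           directed_poset \<kappa> l J \<and> diagram J V D d \<and> D ` Ob J \<subseteq> G \<and> colimit J V D d A c))"

lemma Gen: "small \<kappa> Gen" "X \<in> Gen \<Longrightarrow> presentable \<kappa> l V X"
  "A \<in> Ob V \<Longrightarrow> \<exists>(J :: ('u, 'u) cat) D d c.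
     directed_poset \<kappa> l J \<and> diagram J V D d \<and> D ` Ob J \<subseteq> Gen \<and> colimit J V D d A c"
  using locally_presentable someI_ex[of "\<lambda>G. small \<kappa> G \<and> (\<forall>X \<in> G. presentable \<kappa> l V X) \<and>
        (\<forall>A \<in> Ob V. \<exists>(J :: ('u, 'u) cat) D d c.
           directed_poset \<kappa> l J \<and> diagram J V D d \<and> D ` Ob J \<subseteq> G \<and> colimit J V D d A c)"]
  unfolding locally_presentable_def Gen_def[symmetric] by blast+

lemma small_hom: "small \<kappa> (Hom V A B)"
  using locally_presentable unfolding locally_presentable_def by blast

lemma graph_colimit:
  assumes "graph_diagram V I D R" "small \<kappa> I" "small \<kappa> R"
  obtains X c where "graph_colimit V I D R X c"
  using graph_colimit_exists[OF category_axioms _ assms] locally_presentable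
  unfolding locally_presentable_def by blast

lemma cocomplete:
  assumes "small_category \<kappa> (J :: ('u, 'u) cat)" "diagram J V D d"
  shows "\<exists>C c. colimit J V D d C c"
proof -
  have "cocomplete \<kappa> V" using locally_presentable unfolding locally_presentable_def by blast
  then show ?thesis using assms unfolding cocomplete_def by blast
qed

lemma Gen_ob: "G \<in> Gen \<Longrightarrow> G \<in> Ob V"
  using Gen(2) unfolding presentable_def by blast

lemma directed_posetD: "directed_poset \<kappa> l J \<Longrightarrow> category J"
  unfolding directed_poset_def small_category_def by blast

text \<open>Some cocone presenting \<open>X\<close> as a colimit of generators is among the arrows
  \<open>a\<close>.\<close>

lemma Gen_epi:
  assumes u: "u \<in> Hom V X Y" "v \<in> Hom V X Y" and e: "\<And>G a. \<lbrakk>G \<in> Gen; a \<in> Hom V G X\<rbrakk> \<Longrightarrow> u \<cdot> a = v \<cdot> a"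
  shows "u = v"
proof -
  have "X \<in> Ob V" using u hom_ob by blast
  then obtain J :: "('u, 'u) cat" and D d c where *: "directed_poset \<kappa> l J" "diagram J V D d" "D ` Ob J \<subseteq> Gen"
    "colimit J V D d X c" using Gen(3) by blast
  show ?thesis
  proof (rule colimit_epi[OF *(4) directed_posetD[OF *(1)] *(2) u])
    fix i assume i: "i \<in> Ob J"
    have "D i \<in> Gen" "c i \<in> Hom V (D i) X" using i *(3) colimitD(2)[OF *(4) i] by auto
    then show "u \<cdot> c i = v \<cdot> c i" by (rule e)
  qed
qed

text \<open>
  The representing object of a presheaf that turns colimits into limits is a terminal object of its
  category of elements.  The colimit of the elements over generators is weakly terminal there, and
  coequalizing all its endomorphisms makes it terminal.
\<close>

lemma representable:
  fixes I :: "'i set" and B :: "'i \<Rightarrow> 'o" and cond :: "'o \<Rightarrow> ('i \<Rightarrow> 'm) \<Rightarrow> bool"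
  assumes sI: "small \<kappa> I" and Bob: "\<And>i. i \<in> I \<Longrightarrow> B i \<in> Ob V"
    and stable: "\<And>Z Z' p p' f. \<lbrakk>f \<in> Hom V Z' Z; \<forall>i\<in>I. p i \<in> Hom V Z (B i); cond Z p;
      \<forall>i\<in>I. p' i = p i \<cdot> f\<rbrakk> \<Longrightarrow> cond Z' p'"
    and local: "\<And>Z p K. \<lbrakk>effective_sink V K Z; \<forall>i\<in>I. p i \<in> Hom V Z (B i);
      \<forall>(A, f)\<in>K. cond A (\<lambda>i. p i \<cdot> f)\<rbrakk> \<Longrightarrow> cond Z p"
  obtains T q where "T \<in> Ob V" "\<And>i. i \<in> I \<Longrightarrow> q i \<in> Hom V T (B i)" "cond T q"
    "\<And>Z p. \<lbrakk>Z \<in> Ob V; \<forall>i\<in>I. p i \<in> Hom V Z (B i); cond Z p\<rbrakk>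
      \<Longrightarrow> \<exists>!u. u \<in> Hom V Z T \<and> (\<forall>i\<in>I. q i \<cdot> u = p i)"
proof -
  \<comment> \<open>Stability along an identity shows that \<open>cond\<close> ignores the values of
    a family outside \<open>I\<close>.\<close>
  have ext: "cond Z p'" if "Z \<in> Ob V" "\<forall>i\<in>I. p i \<in> Hom V Z (B i)" "cond Z p" "\<forall>i\<in>I. p' i = p i" for Z p p'
    by (rule stable[OF idt_hom[OF that(1)] that(2,3)]) (use that idt_right in metis)
  \<comment> \<open>The elements over generators, with \<open>R\<close> as the arrows between them.
    Taking the families extensional keeps \<open>E\<close> small.\<close>
  define E where "E = {(G, q). G \<in> Gen \<and> q \<in> (\<Pi>\<^sub>E i\<in>I. Hom V G (B i)) \<and> cond G q}"
  define R where "R = {(e, e', a). e \<in> E \<and> e' \<in> E \<and> a \<in> Hom V (fst e) (fst e') \<and>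
      (\<forall>i\<in>I. snd e' i \<cdot> a = snd e i)}"
  have E: "G \<in> Gen" "i \<in> I \<Longrightarrow> q i \<in> Hom V G (B i)" "cond G q" if "(G, q) \<in> E" for G q i
    using that unfolding E_def by auto
  have Eob: "fst e \<in> Ob V" if "e \<in> E" for e using that E(1) Gen_ob by (cases e) auto
  have smE: "small \<kappa> E"
    by (rule small_subset[OF _ small_Sigma[of Gen "\<lambda>G. \<Pi>\<^sub>E i\<in>I. Hom V G (B i)"]])
      (auto simp: E_def intro: small_PiE[OF sI small_hom] Gen)
  have "small \<kappa> (E \<times> E \<times> (\<Union>e\<in>E. \<Union>e'\<in>E. Hom V (fst e) (fst e')))"
    by (intro small_Sigma small_UNION smE small_hom)
  then have smR: "small \<kappa> R" by (rule small_subset[rotated]) (auto simp: R_def)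
  have gd: "graph_diagram V E fst R" using Eob unfolding graph_diagram_def R_def by auto
  obtain C c where C: "graph_colimit V E fst R C c" using graph_colimit[OF gd smE smR] .
  note Cc = graph_colimitD[OF C]
  have "\<exists>g. g \<in> Hom V C (B i) \<and> (\<forall>e\<in>E. g \<cdot> c e = snd e i)" if i: "i \<in> I" for i
  proof -
    obtain g where "g \<in> Hom V C (B i)" "\<And>e. e \<in> E \<Longrightarrow> g \<cdot> c e = snd e i"
      by (rule graph_colimit_glue[OF C Bob[OF i], of "\<lambda>e. snd e i"]) (use i E(2) in \<open>auto simp: R_def\<close>)
    then show ?thesis by blast
  qed
  then obtain \<gamma> where \<gamma>: "\<And>i. i \<in> I \<Longrightarrow> \<gamma> i \<in> Hom V C (B i)"
    "\<And>i e. \<lbrakk>i \<in> I; e \<in> E\<rbrakk> \<Longrightarrow> \<gamma> i \<cdot> c e = snd e i" by metis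
  have cond\<gamma>: "cond C \<gamma>"
  proof (rule local[OF effective_sink_graph_colimit[OF C gd]])
    show "\<forall>(A, f)\<in>(\<lambda>e. (fst e, c e)) ` E. cond A (\<lambda>i. \<gamma> i \<cdot> f)"
    proof clarsimp
      fix G q assume e: "(G, q) \<in> E"
      show "cond G (\<lambda>i. \<gamma> i \<cdot> c (G, q))"
        by (rule ext[of _ q]) (use e E[OF e] Gen_ob \<gamma>(2) in auto)
    qed
  qed (use \<gamma> in auto)
  \<comment> \<open>Present \<open>Z\<close> as a colimit of generators: the restrictions of
    \<open>p\<close> to its stages are elements \<open>e j\<close>, and the legs
    \<open>c (e j)\<close> form a cocone on the presentation.\<close>
  have weak: "\<exists>u. u \<in> Hom V Z C \<and> (\<forall>i\<in>I. \<gamma> i \<cdot> u = p i)"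
    if Z: "Z \<in> Ob V" and p: "\<And>i. i \<in> I \<Longrightarrow> p i \<in> Hom V Z (B i)" and pc: "cond Z p" for Z p
  proof -
    obtain J :: "('u, 'u) cat" and D d k where J: "directed_poset \<kappa> l J" "diagram J V D d" "D ` Ob J \<subseteq> Gen"
      and k: "colimit J V D d Z k" using Gen(3)[OF Z] by blast
    interpret J: category J using directed_posetD[OF J(1)] .
    note kk = colimitD[OF k]
    define e where "e j = (D j, restrict (\<lambda>i. p i \<cdot> k j) I)" for j
    have eE: "e j \<in> E" if j: "j \<in> Ob J" for j
    proof -
      have "cond (D j) (restrict (\<lambda>i. p i \<cdot> k j) I)"
        by (rule stable[OF kk(2)[OF j] _ pc]) (use p in auto)
      then show ?thesis using j J(3) p kk(2)[OF j] cmp_hom unfolding E_def e_def by fastforce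
    qed
    obtain u where u: "u \<in> Hom V Z C" "\<And>j. j \<in> Ob J \<Longrightarrow> u \<cdot> k j = c (e j)"
    proof (rule colimit_glue[OF k Cc(1), of "\<lambda>j. c (e j)"])
      show "c (e j) \<in> Hom V (D j) C" if "j \<in> Ob J" for j
        using Cc(2)[OF eE[OF that]] by (simp add: e_def)
      fix i j a assume a: "a \<in> Hom J i j"
      then have ij: "i \<in> Ob J" "j \<in> Ob J" using J.hom_ob by blast+
      have da: "d i j a \<in> Hom V (D i) (D j)" using J(2) a unfolding diagram_def by blast
      have "p n \<cdot> k j \<cdot> d i j a = p n \<cdot> k i" if "n \<in> I" for n
        using cmp_assoc[OF da kk(2)[OF ij(2)] p[OF that]] kk(3)[OF a] by simp
      then have "(e i, e j, d i j a) \<in> R" using eE ij da unfolding R_def e_def by auto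
      then show "c (e j) \<cdot> d i j a = c (e i)" by (rule Cc(3))
    qed (rule that; assumption)
    have "\<gamma> i \<cdot> u = p i" if i: "i \<in> I" for i
    proof (rule colimit_epi[OF k J.category_axioms J(2)])
      show "\<gamma> i \<cdot> u \<in> Hom V Z (B i)" using u \<gamma>(1)[OF i] cmp_hom by blast
      show "p i \<in> Hom V Z (B i)" using p i by blast
      fix j assume j: "j \<in> Ob J"
      have "\<gamma> i \<cdot> u \<cdot> k j = \<gamma> i \<cdot> c (e j)"
        using cmp_assoc[OF kk(2)[OF j] u(1) \<gamma>(1)[OF i]] u(2)[OF j] by simp
      then show "\<gamma> i \<cdot> u \<cdot> k j = p i \<cdot> k j" using \<gamma>(2)[OF i eE[OF j]] i by (simp add: e_def)
    qed
    then show ?thesis using u by blast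
  qed
  \<comment> \<open>The joint coequalizer is taken as the colimit of a graph with one vertex and one
    loop for each endomorphism.\<close>
  define End where "End = {h \<in> Hom V C C. \<forall>i\<in>I. \<gamma> i \<cdot> h = \<gamma> i}"
  define RE where "RE = (\<lambda>h. ((), (), h)) ` End"
  have gdE: "graph_diagram V {()} (\<lambda>_. C) RE"
    using Cc(1) unfolding graph_diagram_def RE_def End_def by auto
  have "small \<kappa> RE" unfolding RE_def
    by (rule small_image[OF small_subset[OF _ small_hom[of C C]]]) (auto simp: End_def)
  then obtain T t' where T': "graph_colimit V {()} (\<lambda>_. C) RE T t'"
    using graph_colimit[OF gdE small_finite[OF finite.insertI[OF finite.emptyI]]] by blast
  define t where "t = t' ()"
  note Tt = graph_colimitD[OF T']
  have t: "t \<in> Hom V C T" "h \<in> End \<Longrightarrow> t \<cdot> h = t" for h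
    using Tt(2)[of "()"] Tt(3)[of "()" "()" h] by (auto simp: t_def RE_def)
  have t_epi: "u = v" if "u \<in> Hom V T Y" "v \<in> Hom V T Y" "u \<cdot> t = v \<cdot> t" for u v Y
    using graph_colimit_epi[OF T' gdE that(1,2)] that(3) t_def by simp
  have "\<exists>g. g \<in> Hom V T (B i) \<and> g \<cdot> t = \<gamma> i" if i: "i \<in> I" for i
  proof -
    obtain g where "g \<in> Hom V T (B i)" "\<And>e. e \<in> {()} \<Longrightarrow> g \<cdot> t' e = \<gamma> i"
      by (rule graph_colimit_glue[OF T' Bob[OF i], of "\<lambda>_. \<gamma> i"])
        (use i \<gamma> in \<open>auto simp: RE_def End_def\<close>)
    then show ?thesis unfolding t_def by blast
  qed
  then obtain \<tau> where \<tau>: "\<And>i. i \<in> I \<Longrightarrow> \<tau> i \<in> Hom V T (B i)" "\<And>i. i \<in> I \<Longrightarrow> \<tau> i \<cdot> t = \<gamma> i" by metis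
  have cond_quot: "cond Q s"
    if Q: "graph_colimit V N D' R' Q c'" and gdQ: "graph_diagram V N D' R'"
      and s: "\<And>i. i \<in> I \<Longrightarrow> s i \<in> Hom V Q (B i)"
      and cs: "\<And>n. n \<in> N \<Longrightarrow> cond (D' n) (\<lambda>i. s i \<cdot> c' n)"
    for Q s and N :: "'n set" and D' R' c'
    by (rule local[OF effective_sink_graph_colimit[OF Q gdQ]]) (use s cs in auto)
  have cond\<tau>: "cond T \<tau>"
  proof (rule cond_quot[OF T' gdE])
    show "cond C (\<lambda>i. \<tau> i \<cdot> t' n)" for n :: unit
      by (rule ext[OF _ _ cond\<gamma>]) (use Cc \<gamma> \<tau> t_def in auto)
  qed (use \<tau> in auto)
  \<comment> \<open>Let \<open>q\<close> coequalize \<open>a\<close> and \<open>b\<close>, with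
    vertex \<open>True\<close> for \<open>Z\<close> and \<open>False\<close> for \<open>T\<close>.
    The family descends to \<open>Q\<close>, so weak terminality gives \<open>s : Q -> C\<close>,
    and \<open>s \<cdot> (q \<cdot> t)\<close> is an endomorphism absorbed by \<open>t\<close>.
    Cancelling the epimorphism \<open>t\<close> makes \<open>t \<cdot> s\<close> a retraction of
    \<open>q\<close>, hence \<open>a = b\<close>.\<close>
  have uniq: "a = b"
    if a: "a \<in> Hom V Z T" and b: "b \<in> Hom V Z T" and e: "\<And>i. i \<in> I \<Longrightarrow> \<tau> i \<cdot> a = \<tau> i \<cdot> b" for Z a b
  proof -
    define D' where "D' n = (if n then Z else T)" for n
    define R' where "R' = {(True, False, a), (True, False, b)}"
    have gd': "graph_diagram V UNIV D' R'" using a b hom_ob unfolding graph_diagram_def D'_def R'_def by auto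
    obtain Q c' where Q: "graph_colimit V UNIV D' R' Q c'"
      using graph_colimit[OF gd'] small_finite unfolding R'_def by (metis finite.emptyI finite.insertI finite)
    define q where "q = c' False"
    note Qc = graph_colimitD[OF Q]
    have q: "q \<in> Hom V T Q" "q \<cdot> a = q \<cdot> b"
      using Qc(2)[of False] Qc(3)[of True False a] Qc(3)[of True False b] by (auto simp: q_def D'_def R'_def)
    have "\<exists>g. g \<in> Hom V Q (B i) \<and> g \<cdot> q = \<tau> i \<and> g \<cdot> c' True = \<tau> i \<cdot> a" if i: "i \<in> I" for i
    proof -
      obtain g where "g \<in> Hom V Q (B i)" "\<And>n. n \<in> UNIV \<Longrightarrow> g \<cdot> c' n = (if n then \<tau> i \<cdot> a else \<tau> i)"
        by (rule graph_colimit_glue[OF Q Bob[OF i], of "\<lambda>n. if n then \<tau> i \<cdot> a else \<tau> i"])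
          (use \<tau>(1)[OF i] e[OF i] cmp_hom[OF a \<tau>(1)[OF i]] in \<open>auto simp: R'_def D'_def\<close>)
      from this(1) this(2)[of False] this(2)[of True] show ?thesis unfolding q_def by auto
    qed
    then obtain \<sigma> where \<sigma>: "\<And>i. i \<in> I \<Longrightarrow> \<sigma> i \<in> Hom V Q (B i)" "\<And>i. i \<in> I \<Longrightarrow> \<sigma> i \<cdot> q = \<tau> i"
      "\<And>i. i \<in> I \<Longrightarrow> \<sigma> i \<cdot> c' True = \<tau> i \<cdot> a" by metis
    have "cond Q \<sigma>"
    proof (rule cond_quot[OF Q gd' \<sigma>(1)])
      fix n :: bool
      show "cond (D' n) (\<lambda>i. \<sigma> i \<cdot> c' n)"
      proof (cases n)
        case True
        have "cond Z (\<lambda>i. \<sigma> i \<cdot> c' True)" by (rule stable[OF a _ cond\<tau>]) (use \<sigma> \<tau> in auto)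
        then show ?thesis using True by (simp add: D'_def)
      next
        case False
        have "cond T (\<lambda>i. \<sigma> i \<cdot> c' False)" by (rule ext[OF Tt(1) _ cond\<tau>]) (use \<sigma> \<tau> q_def in auto)
        then show ?thesis using False by (simp add: D'_def)
      qed
    qed
    then obtain s where s: "s \<in> Hom V Q C" "\<And>i. i \<in> I \<Longrightarrow> \<gamma> i \<cdot> s = \<sigma> i"
      using weak[OF Qc(1), of \<sigma>] \<sigma>(1) by blast
    have qt: "q \<cdot> t \<in> Hom V C Q" using q t cmp_hom by blast
    have "s \<cdot> (q \<cdot> t) \<in> End"
    proof -
      have "\<gamma> i \<cdot> (s \<cdot> (q \<cdot> t)) = \<gamma> i" if i: "i \<in> I" for i
        using cmp_assoc[OF qt s(1) \<gamma>(1)[OF i]] cmp_assoc[OF t(1) q(1) \<sigma>(1)[OF i]] s(2)[OF i] \<sigma>(2)[OF i] \<tau>(2)[OF i]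
        by simp
      then show ?thesis using qt s(1) cmp_hom unfolding End_def by blast
    qed
    then have "t \<cdot> (s \<cdot> (q \<cdot> t)) = t" by (rule t(2))
    moreover have ts: "t \<cdot> s \<in> Hom V Q T" using t s cmp_hom by blast
    ultimately have "t \<cdot> s \<cdot> q \<cdot> t = Idt V T \<cdot> t"
      using cmp_assoc[OF t(1) q(1) ts] cmp_assoc[OF qt s(1) t(1)] idt_left[OF t(1)] by simp
    then have "t \<cdot> s \<cdot> q = Idt V T"
      using t_epi cmp_hom[OF q(1) ts] idt_hom[OF Tt(1)] by blast
    then show "a = b" using cmp_assoc[OF a q(1) ts] cmp_assoc[OF b q(1) ts] q(2) idt_left a b by metis
  qed
  show ?thesis
  proof (rule that[OF Tt(1) \<tau>(1) cond\<tau>])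
    fix Z p assume "Z \<in> Ob V" "\<forall>i\<in>I. p i \<in> Hom V Z (B i)" "cond Z p"
    then obtain u where u: "u \<in> Hom V Z C" "\<And>i. i \<in> I \<Longrightarrow> \<gamma> i \<cdot> u = p i" using weak by metis
    have "t \<cdot> u \<in> Hom V Z T" using u t cmp_hom by blast
    moreover have "\<tau> i \<cdot> (t \<cdot> u) = p i" if i: "i \<in> I" for i
      using cmp_assoc[OF u(1) t(1) \<tau>(1)[OF i]] \<tau>(2)[OF i] u(2)[OF i] by simp
    ultimately show "\<exists>!u. u \<in> Hom V Z T \<and> (\<forall>i\<in>I. \<tau> i \<cdot> u = p i)"
      using uniq by (intro ex1I[of _ "t \<cdot> u"]) auto
  qed
qed

text \<open>A singleton index set: \<open>q\<close> is then the largest subobject of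
  \<open>B\<close> whose inclusion satisfies the local condition \<open>cond\<close>.\<close>

lemma representable_arrow:
  assumes Bob: "B \<in> Ob V"
    and stable: "\<And>Z Z' p f. \<lbrakk>f \<in> Hom V Z' Z; p \<in> Hom V Z B; cond Z p\<rbrakk> \<Longrightarrow> cond Z' (p \<cdot> f)"
    and local: "\<And>Z p K. \<lbrakk>effective_sink V K Z; p \<in> Hom V Z B; \<And>A f. (A, f) \<in> K \<Longrightarrow> cond A (p \<cdot> f)\<rbrakk> \<Longrightarrow> cond Z p"
  obtains T q where "q \<in> Hom V T B" "cond T q"
    "\<And>Z p. \<lbrakk>p \<in> Hom V Z B; cond Z p\<rbrakk> \<Longrightarrow> \<exists>!u. u \<in> Hom V Z T \<and> q \<cdot> u = p"
proof -
  obtain T q where *: "T \<in> Ob V" "\<And>i. i \<in> {()} \<Longrightarrow> q i \<in> Hom V T B" "cond T (q ())"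
    "\<And>Z p. \<lbrakk>Z \<in> Ob V; \<forall>i\<in>{()}. p i \<in> Hom V Z B; cond Z (p ())\<rbrakk>
      \<Longrightarrow> \<exists>!u. u \<in> Hom V Z T \<and> (\<forall>i\<in>{()}. q i \<cdot> u = p i)"
  proof (rule representable[of "{()}" "\<lambda>_. B" "\<lambda>Z p. cond Z (p ())"])
    show "small \<kappa> {()}" by (rule small_finite) simp
    fix Z p K assume "effective_sink V K Z" "\<forall>i\<in>{()}. p i \<in> Hom V Z B" "\<forall>(A, f)\<in>K. cond A (p () \<cdot> f)"
    then show "cond Z (p ())" using local[of K Z "p ()"] by blast
  qed (use Bob stable in auto)
  show ?thesis
  proof (rule that[of "q ()" T])
    fix Z p assume "p \<in> Hom V Z B" "cond Z p"
    then show "\<exists>!u. u \<in> Hom V Z T \<and> q () \<cdot> u = p" using *(4)[of Z "\<lambda>_. p"] hom_ob by auto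
  qed (use * in auto)
qed

end


section \<open>Calculus of transposes\<close>

context symmetric_monoidal_closed
begin

text \<open>The intermediate objects in the typing premises can only be found by matching known
  typings, and a composite on the right has none of its own. Hence one associativity rule for each
  length of the right factor, whose premises concern its components only.\<close>

lemma assoc1: "\<lbrakk>f \<in> Hom V A B; g \<in> Hom V B C; h \<in> Hom V C D\<rbrakk> \<Longrightarrow> h \<cdot> g \<cdot> f = h \<cdot> (g \<cdot> f)"
  by (rule cmp_assoc)

lemma assoc2: "\<lbrakk>f2 \<in> Hom V A A1; f1 \<in> Hom V A1 B; g \<in> Hom V B C; h \<in> Hom V C D\<rbrakk>
  \<Longrightarrow> h \<cdot> g \<cdot> (f1 \<cdot> f2) = h \<cdot> (g \<cdot> (f1 \<cdot> f2))"
  by (rule cmp_assoc[OF cmp_hom])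

lemma assoc3: "\<lbrakk>f3 \<in> Hom V A A2; f2 \<in> Hom V A2 A1; f1 \<in> Hom V A1 B; g \<in> Hom V B C; h \<in> Hom V C D\<rbrakk>
  \<Longrightarrow> h \<cdot> g \<cdot> (f1 \<cdot> (f2 \<cdot> f3)) = h \<cdot> (g \<cdot> (f1 \<cdot> (f2 \<cdot> f3)))"
  by (rule cmp_assoc[OF cmp_hom[OF cmp_hom]])

lemma assoc4: "\<lbrakk>f4 \<in> Hom V A A3; f3 \<in> Hom V A3 A2; f2 \<in> Hom V A2 A1; f1 \<in> Hom V A1 B; g \<in> Hom V B C; h \<in> Hom V C D\<rbrakk>
  \<Longrightarrow> h \<cdot> g \<cdot> (f1 \<cdot> (f2 \<cdot> (f3 \<cdot> f4))) = h \<cdot> (g \<cdot> (f1 \<cdot> (f2 \<cdot> (f3 \<cdot> f4))))"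
  by (rule cmp_assoc[OF cmp_hom[OF cmp_hom[OF cmp_hom]]])

lemmas assocs = assoc1 assoc2 assoc3 assoc4

lemma ten_cmp_left: "\<lbrakk>f \<in> Hom V A A'; f' \<in> Hom V A' A''; X \<in> Ob V\<rbrakk>
  \<Longrightarrow> (f' \<cdot> f) \<odot> Idt V X = (f' \<odot> Idt V X) \<cdot> (f \<odot> Idt V X)"
  using ten_cmp[of f A A' f' A'' "Idt V X" X X "Idt V X" X] idt_hom idt_left by metis

lemma ten_cmp_right: "\<lbrakk>f \<in> Hom V A A'; f' \<in> Hom V A' A''; X \<in> Ob V\<rbrakk>
  \<Longrightarrow> Idt V X \<odot> (f' \<cdot> f) = (Idt V X \<odot> f') \<cdot> (Idt V X \<odot> f)"
  using ten_cmp[of "Idt V X" X X "Idt V X" X f A A' f' A''] idt_hom idt_left by metis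

lemma ten_left_right: "\<lbrakk>f \<in> Hom V A A'; g \<in> Hom V B B'\<rbrakk> \<Longrightarrow> (f \<odot> Idt V B') \<cdot> (Idt V A \<odot> g) = f \<odot> g"
  using ten_cmp[of "Idt V A" A A f A' g B B' "Idt V B'" B'] idt_hom idt_left idt_right hom_ob by metis

lemma ten_right_left: "\<lbrakk>f \<in> Hom V A A'; g \<in> Hom V B B'\<rbrakk> \<Longrightarrow> (Idt V A' \<odot> g) \<cdot> (f \<odot> Idt V B) = f \<odot> g"
  using ten_cmp[of f A A' "Idt V A'" A' "Idt V B" B B g B'] idt_hom idt_left idt_right hom_ob by metis

lemma ten_swap: "\<lbrakk>f \<in> Hom V A A'; g \<in> Hom V B B'\<rbrakk> \<Longrightarrow>
    (Idt V A' \<odot> g) \<cdot> (f \<odot> Idt V B) = (f \<odot> Idt V B') \<cdot> (Idt V A \<odot> g)"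
  by (simp add: ten_left_right ten_right_left)

lemma asc_hom: "\<lbrakk>A \<in> Ob V; B \<in> Ob V; C \<in> Ob V\<rbrakk> \<Longrightarrow> asc V A B C \<in> Hom V ((A \<otimes> B) \<otimes> C) (A \<otimes> (B \<otimes> C))"
  using asc_iso unfolding iso_def is_inverse_def by blast

lemma lun_hom: "A \<in> Ob V \<Longrightarrow> lun V A \<in> Hom V (unit V \<otimes> A) A"
  using lun_iso unfolding iso_def is_inverse_def by blast

text \<open>The inverse of \<open>curry\<close>. Equations between arrows into an internal hom are
  proved by comparing their \<open>unc\<close> images, so the \<open>THE\<close> in
  \<open>curry\<close> is met only once.\<close>

definition unc :: "'o \<Rightarrow> 'o \<Rightarrow> 'm \<Rightarrow> 'm" where
  "unc X A g = ev V X A \<cdot> (g \<odot> Idt V X)"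

lemma curry_unique: "\<lbrakk>Z \<in> Ob V; X \<in> Ob V; f \<in> Hom V (Z \<otimes> X) A\<rbrakk> \<Longrightarrow>
    curry V Z X A f \<in> Hom V Z (ihom V X A) \<and> unc X A (curry V Z X A f) = f"
  unfolding curry_def unc_def by (rule theI') (rule ev_universal)

lemma curry_hom: "\<lbrakk>f \<in> Hom V (Z \<otimes> X) A; Z \<in> Ob V; X \<in> Ob V\<rbrakk> \<Longrightarrow> curry V Z X A f \<in> Hom V Z (ihom V X A)"
  and unc_curry: "\<lbrakk>f \<in> Hom V (Z \<otimes> X) A; Z \<in> Ob V; X \<in> Ob V\<rbrakk> \<Longrightarrow> unc X A (curry V Z X A f) = f"
  using curry_unique by blast+

lemma unc_hom: "\<lbrakk>g \<in> Hom V Z (ihom V X A); X \<in> Ob V; A \<in> Ob V\<rbrakk> \<Longrightarrow> unc X A g \<in> Hom V (Z \<otimes> X) A"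
  unfolding unc_def by (assumption | rule cmp_hom ten_hom ev_hom idt_hom)+

lemma unc_inject: "\<lbrakk>unc X A g = unc X A g'; g \<in> Hom V Z (ihom V X A); g' \<in> Hom V Z (ihom V X A); X \<in> Ob V; A \<in> Ob V\<rbrakk>
  \<Longrightarrow> g = g'"
proof -
  assume *: "unc X A g = unc X A g'" "g \<in> Hom V Z (ihom V X A)" "g' \<in> Hom V Z (ihom V X A)" "X \<in> Ob V" "A \<in> Ob V"
  have "\<exists>!h. h \<in> Hom V Z (ihom V X A) \<and> ev V X A \<cdot> (h \<odot> Idt V X) = unc X A g"
    using ev_universal[OF _ *(4) unc_hom[OF *(2,4,5)]] *(2) hom_ob by blast
  then show ?thesis using *(1-3) unfolding unc_def by metis
qed

lemma unc_cmp:
  assumes *: "g \<in> Hom V Z (ihom V X A)" "a \<in> Hom V W Z" "X \<in> Ob V" "A \<in> Ob V"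
  shows "unc X A (g \<cdot> a) = unc X A g \<cdot> (a \<odot> Idt V X)"
proof -
  show ?thesis
    unfolding unc_def
    by (simp only: ten_cmp_left[OF *(2,1,3)]
      cmp_assoc[OF ten_hom[OF *(2) idt_hom[OF *(3)]] ten_hom[OF *(1) idt_hom[OF *(3)]] ev_hom[OF *(3,4)]])
qed

lemma post_hom: "\<lbrakk>h \<in> Hom V A B; X \<in> Ob V\<rbrakk> \<Longrightarrow> post V X A B h \<in> Hom V (ihom V X A) (ihom V X B)"
  unfolding post_def by (rule curry_hom[OF cmp_hom[OF ev_hom]]) (use ihom_ob hom_ob in blast)+

lemma unc_post: "\<lbrakk>h \<in> Hom V A B; g \<in> Hom V Z (ihom V X A); X \<in> Ob V\<rbrakk>
  \<Longrightarrow> unc X B (post V X A B h \<cdot> g) = h \<cdot> unc X A g"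
proof -
  assume *: "h \<in> Hom V A B" "g \<in> Hom V Z (ihom V X A)" "X \<in> Ob V"
  then have ob: "A \<in> Ob V" "B \<in> Ob V" using hom_ob by blast+
  have e: "ev V X A \<in> Hom V (ihom V X A \<otimes> X) A" by (rule ev_hom) (use * ob in blast)+
  have "unc X B (post V X A B h) = h \<cdot> ev V X A"
    unfolding post_def using unc_curry[OF cmp_hom[OF e *(1)]] ihom_ob * ob by blast
  then have "unc X B (post V X A B h \<cdot> g) = h \<cdot> ev V X A \<cdot> (g \<odot> Idt V X)"
    using unc_cmp[OF post_hom[OF *(1,3)] *(2,3) ob(2)] by simp
  then show ?thesis
    unfolding unc_def using cmp_assoc[OF ten_hom[OF *(2) idt_hom[OF *(3)]] e *(1)] by simp
qed

lemma pre_hom: "\<lbrakk>t \<in> Hom V X Y; A \<in> Ob V\<rbrakk> \<Longrightarrow> pre V X Y A t \<in> Hom V (ihom V Y A) (ihom V X A)"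
  unfolding pre_def by (rule curry_hom[OF cmp_hom[OF ten_hom[OF idt_hom] ev_hom]]) (use ihom_ob hom_ob in blast)+

lemma unc_pre: "\<lbrakk>t \<in> Hom V X Y; g \<in> Hom V Z (ihom V Y A); A \<in> Ob V\<rbrakk>
  \<Longrightarrow> unc X A (pre V X Y A t \<cdot> g) = unc Y A g \<cdot> (Idt V Z \<odot> t)"
proof -
  assume *: "t \<in> Hom V X Y" "g \<in> Hom V Z (ihom V Y A)" "A \<in> Ob V"
  then have ob: "X \<in> Ob V" "Y \<in> Ob V" "Z \<in> Ob V" "ihom V Y A \<in> Ob V" using hom_ob by blast+
  have e: "ev V Y A \<in> Hom V (ihom V Y A \<otimes> Y) A" by (rule ev_hom) (use * ob in blast)+
  have t: "Idt V (ihom V Y A) \<odot> t \<in> Hom V (ihom V Y A \<otimes> X) (ihom V Y A \<otimes> Y)" "Idt V Z \<odot> t \<in> Hom V (Z \<otimes> X) (Z \<otimes> Y)"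
    using * ob by - (assumption | rule ten_hom idt_hom)+
  have g: "g \<odot> Idt V X \<in> Hom V (Z \<otimes> X) (ihom V Y A \<otimes> X)" "g \<odot> Idt V Y \<in> Hom V (Z \<otimes> Y) (ihom V Y A \<otimes> Y)"
    using * ob by - (assumption | rule ten_hom idt_hom)+
  have "unc X A (pre V X Y A t) = ev V Y A \<cdot> (Idt V (ihom V Y A) \<odot> t)"
    unfolding pre_def using unc_curry[OF cmp_hom[OF t(1) e]] ob by blast
  then have "unc X A (pre V X Y A t \<cdot> g) = ev V Y A \<cdot> (Idt V (ihom V Y A) \<odot> t) \<cdot> (g \<odot> Idt V X)"
    using unc_cmp[OF pre_hom[OF *(1,3)] *(2) ob(1) *(3)] by simp
  also have "\<dots> = ev V Y A \<cdot> ((g \<odot> Idt V Y) \<cdot> (Idt V Z \<odot> t))"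
    using cmp_assoc[OF g(1) t(1) e] ten_swap[OF *(2,1)] by simp
  finally show ?thesis unfolding unc_def using cmp_assoc[OF t(2) g(2) e] by simp
qed

text \<open>
  \<open>ext Z X A B k\<close> is the action of \<open>[X,-]\<close> on a \<open>Z\<close>-indexed family \<open>k : Z \<otimes> A \<rightarrow> B\<close> of arrows.
\<close>

definition ext :: "'o \<Rightarrow> 'o \<Rightarrow> 'o \<Rightarrow> 'o \<Rightarrow> 'm \<Rightarrow> 'm" where
  "ext Z X A B k = curry V (Z \<otimes> ihom V X A) X B (k \<cdot> ((Idt V Z \<odot> ev V X A) \<cdot> asc V Z (ihom V X A) X))"

lemma ext_aux: "\<lbrakk>Z \<in> Ob V; X \<in> Ob V; A \<in> Ob V\<rbrakk> \<Longrightarrow>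
    (Idt V Z \<odot> ev V X A) \<cdot> asc V Z (ihom V X A) X \<in> Hom V ((Z \<otimes> ihom V X A) \<otimes> X) (Z \<otimes> A)"
  by (assumption | rule cmp_hom[OF asc_hom ten_hom[OF idt_hom ev_hom]] ihom_ob)+

lemma ext_hom: "\<lbrakk>k \<in> Hom V (Z \<otimes> A) B; Z \<in> Ob V; X \<in> Ob V; A \<in> Ob V\<rbrakk>
  \<Longrightarrow> ext Z X A B k \<in> Hom V (Z \<otimes> ihom V X A) (ihom V X B)"
  unfolding ext_def by (assumption | rule curry_hom[OF cmp_hom[OF ext_aux]] ten_ob ihom_ob)+

lemma unc_ext: "\<lbrakk>k \<in> Hom V (Z \<otimes> A) B; Z \<in> Ob V; X \<in> Ob V; A \<in> Ob V\<rbrakk>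
  \<Longrightarrow> unc X B (ext Z X A B k) = k \<cdot> ((Idt V Z \<odot> ev V X A) \<cdot> asc V Z (ihom V X A) X)"
  unfolding ext_def by (assumption | rule unc_curry[OF cmp_hom[OF ext_aux]] ten_ob ihom_ob)+

lemma ext_post: "\<lbrakk>k \<in> Hom V (Z \<otimes> A) B; h \<in> Hom V B B'; Z \<in> Ob V; X \<in> Ob V; A \<in> Ob V\<rbrakk>
  \<Longrightarrow> ext Z X A B' (h \<cdot> k) = post V X B B' h \<cdot> ext Z X A B k"
proof -
  assume *: "k \<in> Hom V (Z \<otimes> A) B" "h \<in> Hom V B B'" "Z \<in> Ob V" "X \<in> Ob V" "A \<in> Ob V"
  show ?thesis
  proof (rule unc_inject)
    show "unc X B' (ext Z X A B' (h \<cdot> k)) = unc X B' (post V X B B' h \<cdot> ext Z X A B k)"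
      by (simp only: unc_ext[OF cmp_hom[OF *(1,2)] *(3-5)] unc_post[OF *(2) ext_hom[OF *(1,3-5)] *(4)]
        unc_ext[OF *(1,3-5)] cmp_assoc[OF ext_aux[OF *(3-5)] *(1,2)])
    show "ext Z X A B' (h \<cdot> k) \<in> Hom V (Z \<otimes> ihom V X A) (ihom V X B')"
      by (rule ext_hom[OF cmp_hom[OF *(1,2)] *(3-5)])
    show "post V X B B' h \<cdot> ext Z X A B k \<in> Hom V (Z \<otimes> ihom V X A) (ihom V X B')"
      by (rule cmp_hom[OF ext_hom[OF *(1,3-5)] post_hom[OF *(2,4)]])
  qed (use * hom_ob in auto)
qed

text \<open>Naturality of the associator and interchange move \<open>u\<close> past the evaluation.
  It is what allows parametrized homomorphisms to be reindexed.\<close>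

lemma ext_param:
  assumes *: "k \<in> Hom V (Z \<otimes> A) B" "u \<in> Hom V Z' Z" "X \<in> Ob V" "A \<in> Ob V"
  shows "ext Z' X A B (k \<cdot> (u \<odot> Idt V A)) = ext Z X A B k \<cdot> (u \<odot> Idt V (ihom V X A))"
proof -
  have ob: "Z \<in> Ob V" "Z' \<in> Ob V" "B \<in> Ob V" "ihom V X A \<in> Ob V" "ihom V X A \<otimes> X \<in> Ob V"
    using * hom_ob ihom_ob ten_ob by blast+
  have t: "u \<odot> Idt V A \<in> Hom V (Z' \<otimes> A) (Z \<otimes> A)"
    "u \<odot> Idt V (ihom V X A) \<in> Hom V (Z' \<otimes> ihom V X A) (Z \<otimes> ihom V X A)"
    "(u \<odot> Idt V (ihom V X A)) \<odot> Idt V X \<in> Hom V ((Z' \<otimes> ihom V X A) \<otimes> X) ((Z \<otimes> ihom V X A) \<otimes> X)"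
    "u \<odot> Idt V (ihom V X A \<otimes> X) \<in> Hom V (Z' \<otimes> (ihom V X A \<otimes> X)) (Z \<otimes> (ihom V X A \<otimes> X))"
    "Idt V Z \<odot> ev V X A \<in> Hom V (Z \<otimes> (ihom V X A \<otimes> X)) (Z \<otimes> A)"
    "Idt V Z' \<odot> ev V X A \<in> Hom V (Z' \<otimes> (ihom V X A \<otimes> X)) (Z' \<otimes> A)"
    "asc V Z (ihom V X A) X \<in> Hom V ((Z \<otimes> ihom V X A) \<otimes> X) (Z \<otimes> (ihom V X A \<otimes> X))"
    "asc V Z' (ihom V X A) X \<in> Hom V ((Z' \<otimes> ihom V X A) \<otimes> X) (Z' \<otimes> (ihom V X A \<otimes> X))"
    using * ob by - (assumption | rule ten_hom idt_hom ev_hom asc_hom)+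
  have n: "asc V Z (ihom V X A) X \<cdot> ((u \<odot> Idt V (ihom V X A)) \<odot> Idt V X) =
      (u \<odot> Idt V (ihom V X A \<otimes> X)) \<cdot> asc V Z' (ihom V X A) X"
    using asc_nat[OF *(2) idt_hom[OF ob(4)] idt_hom[OF *(3)]] ten_idt[OF ob(4) *(3)] by simp
  have sw: "(Idt V Z \<odot> ev V X A) \<cdot> (u \<odot> Idt V (ihom V X A \<otimes> X)) = (u \<odot> Idt V A) \<cdot> (Idt V Z' \<odot> ev V X A)"
    by (rule ten_swap[OF *(2) ev_hom[OF *(3,4)]])
  show ?thesis
  proof (rule unc_inject)
    have "unc X B (ext Z X A B k \<cdot> (u \<odot> Idt V (ihom V X A))) =
        k \<cdot> ((Idt V Z \<odot> ev V X A) \<cdot> asc V Z (ihom V X A) X) \<cdot> ((u \<odot> Idt V (ihom V X A)) \<odot> Idt V X)"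
      using unc_cmp[OF ext_hom[OF *(1) ob(1) *(3,4)] t(2) *(3) ob(3)] unc_ext[OF *(1) ob(1) *(3,4)] by simp
    also have "\<dots> = k \<cdot> ((Idt V Z \<odot> ev V X A) \<cdot> (asc V Z (ihom V X A) X \<cdot> ((u \<odot> Idt V (ihom V X A)) \<odot> Idt V X)))"
      using *(1) t cmp_hom[OF t(7,5)] by (simp only: assocs)
    also have "\<dots> = k \<cdot> (((Idt V Z \<odot> ev V X A) \<cdot> (u \<odot> Idt V (ihom V X A \<otimes> X))) \<cdot> asc V Z' (ihom V X A) X)"
      unfolding n using *(1) t by (simp only: assocs)
    also have "\<dots> = k \<cdot> (u \<odot> Idt V A) \<cdot> ((Idt V Z' \<odot> ev V X A) \<cdot> asc V Z' (ihom V X A) X)"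
      unfolding sw using *(1) t by (simp only: assocs)
    also have "\<dots> = unc X B (ext Z' X A B (k \<cdot> (u \<odot> Idt V A)))"
      using unc_ext[OF cmp_hom[OF t(1) *(1)] ob(2) *(3,4)] by simp
    finally show "unc X B (ext Z' X A B (k \<cdot> (u \<odot> Idt V A))) = unc X B (ext Z X A B k \<cdot> (u \<odot> Idt V (ihom V X A)))" ..
    show "ext Z' X A B (k \<cdot> (u \<odot> Idt V A)) \<in> Hom V (Z' \<otimes> ihom V X A) (ihom V X B)"
      by (rule ext_hom[OF cmp_hom[OF t(1) *(1)] ob(2) *(3,4)])
    show "ext Z X A B k \<cdot> (u \<odot> Idt V (ihom V X A)) \<in> Hom V (Z' \<otimes> ihom V X A) (ihom V X B)"
      by (rule cmp_hom[OF t(2) ext_hom[OF *(1) ob(1) *(3,4)]])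
  qed (use * ob in auto)
qed

lemma ext_arg:
  assumes *: "k \<in> Hom V (Z \<otimes> A) B" "g \<in> Hom V A' A" "Z \<in> Ob V" "X \<in> Ob V"
  shows "ext Z X A' B (k \<cdot> (Idt V Z \<odot> g)) = ext Z X A B k \<cdot> (Idt V Z \<odot> post V X A' A g)"
proof -
  have ob: "A \<in> Ob V" "A' \<in> Ob V" "B \<in> Ob V" "ihom V X A \<in> Ob V" "ihom V X A' \<in> Ob V"
    using * hom_ob ihom_ob by blast+
  let ?gX = "post V X A' A g"
  have gX: "?gX \<in> Hom V (ihom V X A') (ihom V X A)" by (rule post_hom[OF *(2,4)])
  have t: "Idt V Z \<odot> g \<in> Hom V (Z \<otimes> A') (Z \<otimes> A)"
    "Idt V Z \<odot> ?gX \<in> Hom V (Z \<otimes> ihom V X A') (Z \<otimes> ihom V X A)"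
    "(Idt V Z \<odot> ?gX) \<odot> Idt V X \<in> Hom V ((Z \<otimes> ihom V X A') \<otimes> X) ((Z \<otimes> ihom V X A) \<otimes> X)"
    "Idt V Z \<odot> (?gX \<odot> Idt V X) \<in> Hom V (Z \<otimes> (ihom V X A' \<otimes> X)) (Z \<otimes> (ihom V X A \<otimes> X))"
    "Idt V Z \<odot> ev V X A \<in> Hom V (Z \<otimes> (ihom V X A \<otimes> X)) (Z \<otimes> A)"
    "Idt V Z \<odot> ev V X A' \<in> Hom V (Z \<otimes> (ihom V X A' \<otimes> X)) (Z \<otimes> A')"
    "asc V Z (ihom V X A) X \<in> Hom V ((Z \<otimes> ihom V X A) \<otimes> X) (Z \<otimes> (ihom V X A \<otimes> X))"
    "asc V Z (ihom V X A') X \<in> Hom V ((Z \<otimes> ihom V X A') \<otimes> X) (Z \<otimes> (ihom V X A' \<otimes> X))"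
    "?gX \<odot> Idt V X \<in> Hom V (ihom V X A' \<otimes> X) (ihom V X A \<otimes> X)"
    using * ob gX by - (assumption | rule ten_hom idt_hom ev_hom asc_hom)+
  have n: "asc V Z (ihom V X A) X \<cdot> ((Idt V Z \<odot> ?gX) \<odot> Idt V X) = (Idt V Z \<odot> (?gX \<odot> Idt V X)) \<cdot> asc V Z (ihom V X A') X"
    by (rule asc_nat[OF idt_hom[OF *(3)] gX idt_hom[OF *(4)]])
  have e: "ev V X A \<cdot> (?gX \<odot> Idt V X) = g \<cdot> ev V X A'"
    using unc_post[OF *(2) idt_hom[OF ob(5)] *(4)] idt_right[OF gX] ten_idt[OF ob(5) *(4)]
      idt_right[OF ev_hom[OF *(4) ob(2)]] unfolding unc_def by metis
  have sw: "(Idt V Z \<odot> ev V X A) \<cdot> (Idt V Z \<odot> (?gX \<odot> Idt V X)) = (Idt V Z \<odot> g) \<cdot> (Idt V Z \<odot> ev V X A')"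
    using ten_cmp_right[OF t(9) ev_hom[OF *(4) ob(1)] *(3)] ten_cmp_right[OF ev_hom[OF *(4) ob(2)] *(2,3)] e
    by metis
  show ?thesis
  proof (rule unc_inject)
    have "unc X B (ext Z X A B k \<cdot> (Idt V Z \<odot> ?gX)) =
        k \<cdot> ((Idt V Z \<odot> ev V X A) \<cdot> asc V Z (ihom V X A) X) \<cdot> ((Idt V Z \<odot> ?gX) \<odot> Idt V X)"
      by (simp only: unc_cmp[OF ext_hom[OF *(1) *(3,4) ob(1)] t(2) *(4) ob(3)] unc_ext[OF *(1,3,4) ob(1)])
    also have "\<dots> = k \<cdot> ((Idt V Z \<odot> ev V X A) \<cdot> (asc V Z (ihom V X A) X \<cdot> ((Idt V Z \<odot> ?gX) \<odot> Idt V X)))"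
      using *(1) t cmp_hom[OF t(7,5)] by (simp only: assocs)
    also have "\<dots> = k \<cdot> (((Idt V Z \<odot> ev V X A) \<cdot> (Idt V Z \<odot> (?gX \<odot> Idt V X))) \<cdot> asc V Z (ihom V X A') X)"
      unfolding n using *(1) t by (simp only: assocs)
    also have "\<dots> = k \<cdot> (Idt V Z \<odot> g) \<cdot> ((Idt V Z \<odot> ev V X A') \<cdot> asc V Z (ihom V X A') X)"
      unfolding sw using *(1) t by (simp only: assocs)
    also have "\<dots> = unc X B (ext Z X A' B (k \<cdot> (Idt V Z \<odot> g)))"
      by (simp only: unc_ext[OF cmp_hom[OF t(1) *(1)] *(3,4) ob(2)])
    finally show "unc X B (ext Z X A' B (k \<cdot> (Idt V Z \<odot> g))) = unc X B (ext Z X A B k \<cdot> (Idt V Z \<odot> ?gX))" ..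
    show "ext Z X A' B (k \<cdot> (Idt V Z \<odot> g)) \<in> Hom V (Z \<otimes> ihom V X A') (ihom V X B)"
      by (rule ext_hom[OF cmp_hom[OF t(1) *(1)] *(3,4) ob(2)])
    show "ext Z X A B k \<cdot> (Idt V Z \<odot> ?gX) \<in> Hom V (Z \<otimes> ihom V X A') (ihom V X B)"
      by (rule cmp_hom[OF t(2) ext_hom[OF *(1,3,4) ob(1)]])
  qed (use * ob in auto)
qed

text \<open>Functoriality of \<open>[X,-]\<close> on families over \<open>Z\<close> and
  \<open>W\<close>: the pentagon separates the evaluation of the inner family from the reassociation
  of the parameters.\<close>

lemma ext_comp:
  assumes *: "k \<in> Hom V (Z \<otimes> B) C" "h \<in> Hom V (W \<otimes> A) B" "Z \<in> Ob V" "W \<in> Ob V" "A \<in> Ob V" "X \<in> Ob V"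
  shows "ext (Z \<otimes> W) X A C (k \<cdot> ((Idt V Z \<odot> h) \<cdot> asc V Z W A)) =
      ext Z X B C k \<cdot> ((Idt V Z \<odot> ext W X A B h) \<cdot> asc V Z W (ihom V X A))"
proof -
  let ?H = "ihom V X A" and ?eh = "ext W X A B h"
  have ob: "B \<in> Ob V" "C \<in> Ob V" "?H \<in> Ob V" "ihom V X B \<in> Ob V" "Z \<otimes> W \<in> Ob V" "W \<otimes> ?H \<in> Ob V" "?H \<otimes> X \<in> Ob V"
    using * hom_ob ihom_ob ten_ob by blast+
  have eh: "?eh \<in> Hom V (W \<otimes> ?H) (ihom V X B)" by (rule ext_hom[OF *(2,4,6,5)])
  have t: "Idt V Z \<odot> h \<in> Hom V (Z \<otimes> (W \<otimes> A)) (Z \<otimes> B)"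
    "asc V Z W A \<in> Hom V ((Z \<otimes> W) \<otimes> A) (Z \<otimes> (W \<otimes> A))"
    "Idt V (Z \<otimes> W) \<odot> ev V X A \<in> Hom V ((Z \<otimes> W) \<otimes> (?H \<otimes> X)) ((Z \<otimes> W) \<otimes> A)"
    "asc V (Z \<otimes> W) ?H X \<in> Hom V (((Z \<otimes> W) \<otimes> ?H) \<otimes> X) ((Z \<otimes> W) \<otimes> (?H \<otimes> X))"
    "asc V Z W (?H \<otimes> X) \<in> Hom V ((Z \<otimes> W) \<otimes> (?H \<otimes> X)) (Z \<otimes> (W \<otimes> (?H \<otimes> X)))"
    "Idt V Z \<odot> (Idt V W \<odot> ev V X A) \<in> Hom V (Z \<otimes> (W \<otimes> (?H \<otimes> X))) (Z \<otimes> (W \<otimes> A))"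
    "Idt V Z \<odot> asc V W ?H X \<in> Hom V (Z \<otimes> ((W \<otimes> ?H) \<otimes> X)) (Z \<otimes> (W \<otimes> (?H \<otimes> X)))"
    "asc V Z (W \<otimes> ?H) X \<in> Hom V ((Z \<otimes> (W \<otimes> ?H)) \<otimes> X) (Z \<otimes> ((W \<otimes> ?H) \<otimes> X))"
    "asc V Z W ?H \<odot> Idt V X \<in> Hom V (((Z \<otimes> W) \<otimes> ?H) \<otimes> X) ((Z \<otimes> (W \<otimes> ?H)) \<otimes> X)"
    "Idt V Z \<odot> (?eh \<odot> Idt V X) \<in> Hom V (Z \<otimes> ((W \<otimes> ?H) \<otimes> X)) (Z \<otimes> (ihom V X B \<otimes> X))"
    "Idt V Z \<odot> ev V X B \<in> Hom V (Z \<otimes> (ihom V X B \<otimes> X)) (Z \<otimes> B)"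
    "asc V Z (ihom V X B) X \<in> Hom V ((Z \<otimes> ihom V X B) \<otimes> X) (Z \<otimes> (ihom V X B \<otimes> X))"
    "(Idt V Z \<odot> ?eh) \<odot> Idt V X \<in> Hom V ((Z \<otimes> (W \<otimes> ?H)) \<otimes> X) ((Z \<otimes> ihom V X B) \<otimes> X)"
    "Idt V Z \<odot> ?eh \<in> Hom V (Z \<otimes> (W \<otimes> ?H)) (Z \<otimes> ihom V X B)"
    "asc V Z W ?H \<in> Hom V ((Z \<otimes> W) \<otimes> ?H) (Z \<otimes> (W \<otimes> ?H))"
    "asc V W ?H X \<in> Hom V ((W \<otimes> ?H) \<otimes> X) (W \<otimes> (?H \<otimes> X))"
    "Idt V W \<odot> ev V X A \<in> Hom V (W \<otimes> (?H \<otimes> X)) (W \<otimes> A)"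
    "?eh \<odot> Idt V X \<in> Hom V ((W \<otimes> ?H) \<otimes> X) (ihom V X B \<otimes> X)"
    "ev V X B \<in> Hom V (ihom V X B \<otimes> X) B"
    using * ob eh by - (assumption | rule ten_hom idt_hom ev_hom asc_hom)+
  have K: "k \<cdot> ((Idt V Z \<odot> h) \<cdot> asc V Z W A) \<in> Hom V ((Z \<otimes> W) \<otimes> A) C"
    by (rule cmp_hom[OF cmp_hom[OF t(2,1)] *(1)])
  have n1: "asc V Z W A \<cdot> (Idt V (Z \<otimes> W) \<odot> ev V X A) = (Idt V Z \<odot> (Idt V W \<odot> ev V X A)) \<cdot> asc V Z W (?H \<otimes> X)"
    using asc_nat[OF idt_hom[OF *(3)] idt_hom[OF *(4)] ev_hom[OF *(6,5)]] ten_idt[OF *(3,4)] by simp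
  have p: "asc V Z W (?H \<otimes> X) \<cdot> asc V (Z \<otimes> W) ?H X =
      (Idt V Z \<odot> asc V W ?H X) \<cdot> (asc V Z (W \<otimes> ?H) X \<cdot> (asc V Z W ?H \<odot> Idt V X))"
    using pentagon[OF *(3,4) ob(3) *(6)] cmp_assoc[OF t(9,8,7)] by simp
  have u: "h \<cdot> ((Idt V W \<odot> ev V X A) \<cdot> asc V W ?H X) = ev V X B \<cdot> (?eh \<odot> Idt V X)"
    using unc_ext[OF *(2,4,6,5)] unfolding unc_def by simp
  have u': "(Idt V Z \<odot> h) \<cdot> ((Idt V Z \<odot> (Idt V W \<odot> ev V X A)) \<cdot> (Idt V Z \<odot> asc V W ?H X)) =
      (Idt V Z \<odot> ev V X B) \<cdot> (Idt V Z \<odot> (?eh \<odot> Idt V X))"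
    by (simp only: ten_cmp_right[OF t(16,17) *(3), symmetric] ten_cmp_right[OF cmp_hom[OF t(16,17)] *(2,3), symmetric] u
      ten_cmp_right[OF t(18,19) *(3)])
  have n2: "(Idt V Z \<odot> (?eh \<odot> Idt V X)) \<cdot> asc V Z (W \<otimes> ?H) X = asc V Z (ihom V X B) X \<cdot> ((Idt V Z \<odot> ?eh) \<odot> Idt V X)"
    by (rule asc_nat[OF idt_hom[OF *(3)] eh idt_hom[OF *(6)], symmetric])
  show ?thesis
  proof (rule unc_inject)
    have "unc X C (ext (Z \<otimes> W) X A C (k \<cdot> ((Idt V Z \<odot> h) \<cdot> asc V Z W A))) =
      k \<cdot> ((Idt V Z \<odot> h) \<cdot> asc V Z W A) \<cdot> ((Idt V (Z \<otimes> W) \<odot> ev V X A) \<cdot> asc V (Z \<otimes> W) ?H X)"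
      by (rule unc_ext[OF K ob(5) *(6,5)])
    also have "\<dots> = k \<cdot> ((Idt V Z \<odot> h) \<cdot> ((asc V Z W A \<cdot> (Idt V (Z \<otimes> W) \<odot> ev V X A)) \<cdot> asc V (Z \<otimes> W) ?H X))"
      using *(1) t cmp_hom[OF t(2,1)] by (simp only: assocs)
    also have "\<dots> = k \<cdot> ((Idt V Z \<odot> h) \<cdot> ((Idt V Z \<odot> (Idt V W \<odot> ev V X A)) \<cdot> (asc V Z W (?H \<otimes> X) \<cdot> asc V (Z \<otimes> W) ?H X)))"
      unfolding n1 using *(1) t by (simp only: assocs)
    also have "\<dots> = k \<cdot> (((Idt V Z \<odot> h) \<cdot> ((Idt V Z \<odot> (Idt V W \<odot> ev V X A)) \<cdot> (Idt V Z \<odot> asc V W ?H X))) \<cdot>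
        (asc V Z (W \<otimes> ?H) X \<cdot> (asc V Z W ?H \<odot> Idt V X)))"
      unfolding p using *(1) t cmp_hom[OF t(7,6)] by (simp only: assocs)
    also have "\<dots> = k \<cdot> ((Idt V Z \<odot> ev V X B) \<cdot> (((Idt V Z \<odot> (?eh \<odot> Idt V X)) \<cdot> asc V Z (W \<otimes> ?H) X) \<cdot> (asc V Z W ?H \<odot> Idt V X)))"
      unfolding u' using *(1) t by (simp only: assocs)
    also have "\<dots> = k \<cdot> ((Idt V Z \<odot> ev V X B) \<cdot> asc V Z (ihom V X B) X) \<cdot> (((Idt V Z \<odot> ?eh) \<odot> Idt V X) \<cdot> (asc V Z W ?H \<odot> Idt V X))"
      unfolding n2 using *(1) t cmp_hom[OF t(12,11)] by (simp only: assocs)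
    also have "\<dots> = unc X C (ext Z X B C k \<cdot> ((Idt V Z \<odot> ?eh) \<cdot> asc V Z W ?H))"
      by (simp only: unc_cmp[OF ext_hom[OF *(1,3,6) ob(1)] cmp_hom[OF t(15,14)] *(6) ob(2)] unc_ext[OF *(1,3,6) ob(1)]
        ten_cmp_left[OF t(15,14) *(6)])
    finally show "unc X C (ext (Z \<otimes> W) X A C (k \<cdot> ((Idt V Z \<odot> h) \<cdot> asc V Z W A))) =
      unc X C (ext Z X B C k \<cdot> ((Idt V Z \<odot> ?eh) \<cdot> asc V Z W ?H))" .
    show "ext (Z \<otimes> W) X A C (k \<cdot> ((Idt V Z \<odot> h) \<cdot> asc V Z W A)) \<in> Hom V ((Z \<otimes> W) \<otimes> ?H) (ihom V X C)"
      by (rule ext_hom[OF K ob(5) *(6,5)])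
    show "ext Z X B C k \<cdot> ((Idt V Z \<odot> ?eh) \<cdot> asc V Z W ?H) \<in> Hom V ((Z \<otimes> W) \<otimes> ?H) (ihom V X C)"
      by (rule cmp_hom[OF cmp_hom[OF t(15,14)] ext_hom[OF *(1,3,6) ob(1)]])
  qed (use * ob in auto)
qed

lemma iso_ten_left:
  assumes *: "iso V A B f" "X \<in> Ob V"
  shows "iso V (A \<otimes> X) (B \<otimes> X) (f \<odot> Idt V X)"
proof -
  obtain i where i: "f \<in> Hom V A B" "i \<in> Hom V B A" "i \<cdot> f = Idt V A" "f \<cdot> i = Idt V B" by (rule isoE[OF *(1)])
  have ob: "A \<in> Ob V" "B \<in> Ob V" using i hom_ob by blast+
  have "is_inverse V (A \<otimes> X) (B \<otimes> X) (f \<odot> Idt V X) (i \<odot> Idt V X)"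
    unfolding is_inverse_def
    using ten_cmp_left[OF i(1,2) *(2)] ten_cmp_left[OF i(2,1) *(2)] i(3,4) ten_idt[OF ob(1) *(2)] ten_idt[OF ob(2) *(2)]
      ten_hom[OF i(1) idt_hom[OF *(2)]] ten_hom[OF i(2) idt_hom[OF *(2)]] by simp
  then show ?thesis unfolding iso_def by blast
qed

text \<open>Kelly's derivation of the coherence of the left unit from the pentagon and the triangle.\<close>

lemma lun_asc:
  assumes *: "A \<in> Ob V" "B \<in> Ob V"
  shows "lun V (A \<otimes> B) \<cdot> asc V (unit V) A B = lun V A \<odot> Idt V B"
proof -
  let ?I = "unit V" and ?i = "Idt V (unit V)"
  note I = unit_ob
  have ob: "?I \<otimes> A \<in> Ob V" "?I \<otimes> ?I \<in> Ob V" "A \<otimes> B \<in> Ob V" "?I \<otimes> (A \<otimes> B) \<in> Ob V" "(?I \<otimes> A) \<otimes> B \<in> Ob V"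
    using * I ten_ob by blast+
  let ?l = "lun V (A \<otimes> B)" and ?a = "asc V ?I A B"
  have t: "?l \<in> Hom V (?I \<otimes> (A \<otimes> B)) (A \<otimes> B)" "?a \<in> Hom V ((?I \<otimes> A) \<otimes> B) (?I \<otimes> (A \<otimes> B))"
    "lun V A \<in> Hom V (?I \<otimes> A) A" "lun V A \<odot> Idt V B \<in> Hom V ((?I \<otimes> A) \<otimes> B) (A \<otimes> B)"
    "?i \<odot> ?l \<in> Hom V (?I \<otimes> (?I \<otimes> (A \<otimes> B))) (?I \<otimes> (A \<otimes> B))"
    "?i \<odot> ?a \<in> Hom V (?I \<otimes> ((?I \<otimes> A) \<otimes> B)) (?I \<otimes> (?I \<otimes> (A \<otimes> B)))"
    "asc V ?I (?I \<otimes> A) B \<in> Hom V ((?I \<otimes> (?I \<otimes> A)) \<otimes> B) (?I \<otimes> ((?I \<otimes> A) \<otimes> B))"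
    "asc V ?I ?I A \<odot> Idt V B \<in> Hom V (((?I \<otimes> ?I) \<otimes> A) \<otimes> B) ((?I \<otimes> (?I \<otimes> A)) \<otimes> B)"
    "asc V ?I ?I A \<in> Hom V ((?I \<otimes> ?I) \<otimes> A) (?I \<otimes> (?I \<otimes> A))"
    "asc V ?I ?I (A \<otimes> B) \<in> Hom V ((?I \<otimes> ?I) \<otimes> (A \<otimes> B)) (?I \<otimes> (?I \<otimes> (A \<otimes> B)))"
    "asc V (?I \<otimes> ?I) A B \<in> Hom V (((?I \<otimes> ?I) \<otimes> A) \<otimes> B) ((?I \<otimes> ?I) \<otimes> (A \<otimes> B))"
    "?i \<odot> lun V A \<in> Hom V (?I \<otimes> (?I \<otimes> A)) (?I \<otimes> A)"
    "(?i \<odot> lun V A) \<odot> Idt V B \<in> Hom V ((?I \<otimes> (?I \<otimes> A)) \<otimes> B) ((?I \<otimes> A) \<otimes> B)"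
    "?i \<odot> (lun V A \<odot> Idt V B) \<in> Hom V (?I \<otimes> ((?I \<otimes> A) \<otimes> B)) (?I \<otimes> (A \<otimes> B))"
    using * ob I by - (assumption | rule ten_hom idt_hom asc_hom lun_hom)+
  have r: "run V ?I \<in> Hom V (?I \<otimes> ?I) ?I" using run_iso[OF I] unfolding iso_def is_inverse_def by blast
  \<comment> \<open>A further unit on the left makes room for the pentagon and for the triangle,
    which need the unit in the middle.\<close>
  have "(?i \<odot> (?l \<cdot> ?a)) \<cdot> (asc V ?I (?I \<otimes> A) B \<cdot> (asc V ?I ?I A \<odot> Idt V B)) =
      (?i \<odot> ?l) \<cdot> ((?i \<odot> ?a) \<cdot> asc V ?I (?I \<otimes> A) B \<cdot> (asc V ?I ?I A \<odot> Idt V B))"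
    unfolding ten_cmp_right[OF t(2,1) I] using t cmp_hom[OF t(7,6)] by (simp only: assocs)
  also have "\<dots> = (?i \<odot> ?l) \<cdot> asc V ?I ?I (A \<otimes> B) \<cdot> asc V (?I \<otimes> ?I) A B"
    unfolding pentagon[OF I I *, symmetric] using t by (simp only: assocs)
  also have "\<dots> = (run V ?I \<odot> Idt V (A \<otimes> B)) \<cdot> asc V (?I \<otimes> ?I) A B"
    unfolding triangle[OF I ob(3)] ..
  also have "\<dots> = ?a \<cdot> ((run V ?I \<odot> Idt V A) \<odot> Idt V B)"
    using asc_nat[OF r idt_hom[OF *(1)] idt_hom[OF *(2)]] ten_idt[OF *] by simp
  also have "\<dots> = ?a \<cdot> ((?i \<odot> lun V A) \<odot> Idt V B) \<cdot> (asc V ?I ?I A \<odot> Idt V B)"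
    unfolding triangle[OF I *(1), symmetric] ten_cmp_left[OF t(9,12) *(2)] using t by (simp only: assocs)
  also have "\<dots> = (?i \<odot> (lun V A \<odot> Idt V B)) \<cdot> (asc V ?I (?I \<otimes> A) B \<cdot> (asc V ?I ?I A \<odot> Idt V B))"
    unfolding asc_nat[OF idt_hom[OF I] t(3) idt_hom[OF *(2)]] using t by (simp only: assocs)
  finally have "?i \<odot> (?l \<cdot> ?a) = ?i \<odot> (lun V A \<odot> Idt V B)"
    by (rule iso_cmp_epi[OF iso_ten_left[OF asc_iso[OF I I *(1)] *(2)] asc_iso[OF I ob(1) *(2)], rotated 2])
      (rule ten_hom[OF idt_hom[OF I] cmp_hom[OF t(2,1)]], rule t(14))
  \<comment> \<open>Naturality of \<open>lun\<close> removes the extra unit: tensoring with the unit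
    object is faithful.\<close>
  then have "?l \<cdot> ?a \<cdot> lun V ((?I \<otimes> A) \<otimes> B) = lun V A \<odot> Idt V B \<cdot> lun V ((?I \<otimes> A) \<otimes> B)"
    by (simp only: lun_nat[OF cmp_hom[OF t(2,1)], symmetric] lun_nat[OF t(4), symmetric])
  then show ?thesis by (rule iso_epi[OF lun_iso[OF ob(5)] cmp_hom[OF t(2,1)] t(4)])
qed

text \<open>A family over the unit is a single arrow, and \<open>ext\<close> must then agree with
  \<open>post\<close>. The associator in \<open>ext\<close> is absorbed by
  \<open>lun_asc\<close>.\<close>

lemma ext_unit:
  assumes *: "h \<in> Hom V A B" "X \<in> Ob V"
  shows "ext (unit V) X A B (h \<cdot> lun V A) = post V X A B h \<cdot> lun V (ihom V X A)"
proof -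
  have ob: "A \<in> Ob V" "B \<in> Ob V" "ihom V X A \<in> Ob V" "ihom V X A \<otimes> X \<in> Ob V" using * hom_ob ihom_ob ten_ob by blast+
  note I = unit_ob
  have l: "h \<cdot> lun V A \<in> Hom V (unit V \<otimes> A) B" by (rule cmp_hom[OF lun_hom[OF ob(1)] *(1)])
  have t: "lun V A \<in> Hom V (unit V \<otimes> A) A" "lun V (ihom V X A) \<in> Hom V (unit V \<otimes> ihom V X A) (ihom V X A)"
    "Idt V (unit V) \<odot> ev V X A \<in> Hom V (unit V \<otimes> (ihom V X A \<otimes> X)) (unit V \<otimes> A)"
    "asc V (unit V) (ihom V X A) X \<in> Hom V ((unit V \<otimes> ihom V X A) \<otimes> X) (unit V \<otimes> (ihom V X A \<otimes> X))"
    "lun V (ihom V X A \<otimes> X) \<in> Hom V (unit V \<otimes> (ihom V X A \<otimes> X)) (ihom V X A \<otimes> X)"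
    "ev V X A \<in> Hom V (ihom V X A \<otimes> X) A"
    using * ob I by - (assumption | rule ten_hom idt_hom asc_hom lun_hom ev_hom)+
  show ?thesis
  proof (rule unc_inject)
    have "unc X B (ext (unit V) X A B (h \<cdot> lun V A)) = h \<cdot> lun V A \<cdot> ((Idt V (unit V) \<odot> ev V X A) \<cdot> asc V (unit V) (ihom V X A) X)"
      by (rule unc_ext[OF l I *(2) ob(1)])
    also have "\<dots> = h \<cdot> (lun V A \<cdot> (Idt V (unit V) \<odot> ev V X A) \<cdot> asc V (unit V) (ihom V X A) X)"
      using t *(1) by (simp only: assocs)
    also have "\<dots> = h \<cdot> (ev V X A \<cdot> (lun V (ihom V X A \<otimes> X) \<cdot> asc V (unit V) (ihom V X A) X))"
      unfolding lun_nat[OF t(6)] using t *(1) by (simp only: assocs)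
    also have "\<dots> = h \<cdot> unc X A (lun V (ihom V X A))"
      unfolding lun_asc[OF ob(3) *(2)] unc_def ..
    also have "\<dots> = unc X B (post V X A B h \<cdot> lun V (ihom V X A))"
      by (rule unc_post[OF *(1) t(2) *(2), symmetric])
    finally show "unc X B (ext (unit V) X A B (h \<cdot> lun V A)) = unc X B (post V X A B h \<cdot> lun V (ihom V X A))" .
  qed (rule ext_hom[OF l I *(2) ob(1)], rule cmp_hom[OF t(2) post_hom[OF *]], (use * ob in auto))
qed

section \<open>Internal composition and the action of \<open>[X,-]\<close> on hom-objects\<close>

lemma icomp_hom: "\<lbrakk>X \<in> Ob V; A \<in> Ob V; B \<in> Ob V\<rbrakk> \<Longrightarrow> icomp V X A B \<in> Hom V (ihom V A B \<otimes> ihom V X A) (ihom V X B)"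
  and unc_icomp: "\<lbrakk>X \<in> Ob V; A \<in> Ob V; B \<in> Ob V\<rbrakk> \<Longrightarrow> unc X B (icomp V X A B) =
     ev V A B \<cdot> (Idt V (ihom V A B) \<odot> ev V X A) \<cdot> asc V (ihom V A B) (ihom V X A) X"
  unfolding icomp_def
  by (assumption | rule curry_hom unc_curry cmp_hom ten_hom ev_hom asc_hom idt_hom ihom_ob ten_ob)+

lemma ipost_hom: "\<lbrakk>X \<in> Ob V; A \<in> Ob V; B \<in> Ob V\<rbrakk> \<Longrightarrow>
    ipost V X A B \<in> Hom V (ihom V A B) (ihom V (ihom V X A) (ihom V X B))"
  and unc_ipost: "\<lbrakk>X \<in> Ob V; A \<in> Ob V; B \<in> Ob V\<rbrakk> \<Longrightarrow> unc (ihom V X A) (ihom V X B) (ipost V X A B) = icomp V X A B"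
  unfolding ipost_def
  by (assumption | rule curry_hom unc_curry icomp_hom ihom_ob)+

text \<open>The bridge from \<open>ipost\<close>, through which hom-objects of structures are
  defined, to \<open>ext\<close>: after it the equalizer condition can be read on families.\<close>

lemma unc_ipost_cmp: "\<lbrakk>k \<in> Hom V Z (ihom V A B); X \<in> Ob V; A \<in> Ob V; B \<in> Ob V\<rbrakk> \<Longrightarrow>
    unc (ihom V X A) (ihom V X B) (ipost V X A B \<cdot> k) = ext Z X A B (unc A B k)"
proof -
  assume *: "k \<in> Hom V Z (ihom V A B)" "X \<in> Ob V" "A \<in> Ob V" "B \<in> Ob V"
  let ?H = "ihom V X A" and ?E = "ihom V A B"
  have ob: "Z \<in> Ob V" "?H \<in> Ob V" "ihom V X B \<in> Ob V" "?E \<in> Ob V" "?H \<otimes> X \<in> Ob V" using * hom_ob ihom_ob ten_ob by blast+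
  have t: "k \<odot> Idt V ?H \<in> Hom V (Z \<otimes> ?H) (?E \<otimes> ?H)"
    "(k \<odot> Idt V ?H) \<odot> Idt V X \<in> Hom V ((Z \<otimes> ?H) \<otimes> X) ((?E \<otimes> ?H) \<otimes> X)"
    "k \<odot> Idt V (?H \<otimes> X) \<in> Hom V (Z \<otimes> (?H \<otimes> X)) (?E \<otimes> (?H \<otimes> X))"
    "k \<odot> Idt V A \<in> Hom V (Z \<otimes> A) (?E \<otimes> A)"
    "Idt V ?E \<odot> ev V X A \<in> Hom V (?E \<otimes> (?H \<otimes> X)) (?E \<otimes> A)"
    "Idt V Z \<odot> ev V X A \<in> Hom V (Z \<otimes> (?H \<otimes> X)) (Z \<otimes> A)"
    "asc V ?E ?H X \<in> Hom V ((?E \<otimes> ?H) \<otimes> X) (?E \<otimes> (?H \<otimes> X))"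
    "asc V Z ?H X \<in> Hom V ((Z \<otimes> ?H) \<otimes> X) (Z \<otimes> (?H \<otimes> X))"
    "ev V A B \<in> Hom V (?E \<otimes> A) B"
    using * ob by - (assumption | rule ten_hom idt_hom asc_hom ev_hom)+
  have n: "asc V ?E ?H X \<cdot> ((k \<odot> Idt V ?H) \<odot> Idt V X) = (k \<odot> Idt V (?H \<otimes> X)) \<cdot> asc V Z ?H X"
    using asc_nat[OF *(1) idt_hom[OF ob(2)] idt_hom[OF *(2)]] ten_idt[OF ob(2) *(2)] by simp
  have ik: "icomp V X A B \<cdot> (k \<odot> Idt V ?H) \<in> Hom V (Z \<otimes> ?H) (ihom V X B)"
    by (rule cmp_hom[OF t(1) icomp_hom[OF *(2-4)]])
  have "unc X B (icomp V X A B \<cdot> (k \<odot> Idt V ?H)) =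
      ev V A B \<cdot> (Idt V ?E \<odot> ev V X A) \<cdot> asc V ?E ?H X \<cdot> ((k \<odot> Idt V ?H) \<odot> Idt V X)"
    by (simp only: unc_cmp[OF icomp_hom[OF *(2-4)] t(1) *(2,4)] unc_icomp[OF *(2-4)])
  also have "\<dots> = ev V A B \<cdot> ((Idt V ?E \<odot> ev V X A) \<cdot> (asc V ?E ?H X \<cdot> ((k \<odot> Idt V ?H) \<odot> Idt V X)))"
    using t cmp_hom[OF t(5,9)] cmp_hom[OF t(7,5)] by (simp only: assocs)
  also have "\<dots> = ev V A B \<cdot> ((Idt V ?E \<odot> ev V X A) \<cdot> (k \<odot> Idt V (?H \<otimes> X)) \<cdot> asc V Z ?H X)"
    unfolding n using t by (simp only: assocs)
  also have "\<dots> = ev V A B \<cdot> (k \<odot> Idt V A) \<cdot> ((Idt V Z \<odot> ev V X A) \<cdot> asc V Z ?H X)"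
    unfolding ten_swap[OF *(1) ev_hom[OF *(2,3)]] using t by (simp only: assocs)
  also have "\<dots> = unc X B (ext Z X A B (unc A B k))"
    unfolding unc_ext[OF unc_hom[OF *(1,3,4)] ob(1) *(2,3)] unfolding unc_def ..
  finally have "icomp V X A B \<cdot> (k \<odot> Idt V ?H) = ext Z X A B (unc A B k)"
    by (rule unc_inject[OF _ ik ext_hom[OF unc_hom[OF *(1,3,4)] ob(1) *(2,3)] *(2,4)])
  then show ?thesis
    by (simp only: unc_cmp[OF ipost_hom[OF *(2-4)] *(1) ob(2,3)] unc_ipost[OF *(2-4)])
qed

lemma post_idt:
  assumes *: "A \<in> Ob V" "X \<in> Ob V"
  shows "post V X A A (Idt V A) = Idt V (ihom V X A)"
proof -
  have i: "Idt V (ihom V X A) \<in> Hom V (ihom V X A) (ihom V X A)" using idt_hom ihom_ob * by blast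
  have p: "post V X A A (Idt V A) \<in> Hom V (ihom V X A) (ihom V X A)" by (rule post_hom[OF idt_hom[OF *(1)] *(2)])
  have "unc X A (post V X A A (Idt V A)) = unc X A (Idt V (ihom V X A))"
    using unc_post[OF idt_hom[OF *(1)] i *(2)] idt_right[OF p] idt_left[OF unc_hom[OF i *(2,1)]] by metis
  then show ?thesis by (rule unc_inject[OF _ p i *(2,1)])
qed

lemma post_cmp:
  assumes *: "f \<in> Hom V A B" "g \<in> Hom V B C" "X \<in> Ob V"
  shows "post V X A C (g \<cdot> f) = post V X B C g \<cdot> post V X A B f"
proof -
  have ob: "A \<in> Ob V" "B \<in> Ob V" "C \<in> Ob V" using * hom_ob by blast+
  have i: "Idt V (ihom V X A) \<in> Hom V (ihom V X A) (ihom V X A)" using idt_hom ihom_ob * ob by blast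
  note p = post_hom[OF *(1,3)] post_hom[OF *(2,3)] post_hom[OF cmp_hom[OF *(1,2)] *(3)]
  have "unc X C (post V X A C (g \<cdot> f)) = g \<cdot> f \<cdot> unc X A (Idt V (ihom V X A))"
    using unc_post[OF cmp_hom[OF *(1,2)] i *(3)] by (simp only: idt_right[OF p(3)])
  also have "\<dots> = g \<cdot> (f \<cdot> unc X A (Idt V (ihom V X A)))"
    by (rule cmp_assoc[OF unc_hom[OF i *(3) ob(1)] *(1,2)])
  also have "\<dots> = unc X C (post V X B C g \<cdot> post V X A B f)"
    using unc_post[OF *(1) i *(3)] by (simp only: idt_right[OF p(1)] unc_post[OF *(2) p(1) *(3)])
  finally show ?thesis by (rule unc_inject[OF _ p(3) cmp_hom[OF p(1,2)] *(3) ob(3)])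
qed

text \<open>Evaluation with the parameter on the left, the order used for parametrized
  homomorphisms; it will be the universal family of a power.\<close>

definition evs :: "'o \<Rightarrow> 'o \<Rightarrow> 'm" where
  "evs Z B = ev V Z B \<cdot> sym V Z (ihom V Z B)"

lemma evs_hom: "\<lbrakk>Z \<in> Ob V; B \<in> Ob V\<rbrakk> \<Longrightarrow> evs Z B \<in> Hom V (Z \<otimes> ihom V Z B) B"
  unfolding evs_def by (assumption | rule cmp_hom sym_hom ev_hom ihom_ob)+

lemma sym_iso: "\<lbrakk>A \<in> Ob V; B \<in> Ob V\<rbrakk> \<Longrightarrow> iso V (A \<otimes> B) (B \<otimes> A) (sym V A B)"
  unfolding iso_def is_inverse_def using sym_hom sym_inv by blast

lemma evs_cmp: "\<lbrakk>n \<in> Hom V N (ihom V Z B); Z \<in> Ob V; B \<in> Ob V\<rbrakk> \<Longrightarrow> evs Z B \<cdot> (Idt V Z \<odot> n) = unc Z B n \<cdot> sym V Z N"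
proof -
  assume *: "n \<in> Hom V N (ihom V Z B)" "Z \<in> Ob V" "B \<in> Ob V"
  have o: "N \<in> Ob V" "ihom V Z B \<in> Ob V" using *(1) hom_ob by blast+
  have t: "Idt V Z \<odot> n \<in> Hom V (Z \<otimes> N) (Z \<otimes> ihom V Z B)" "n \<odot> Idt V Z \<in> Hom V (N \<otimes> Z) (ihom V Z B \<otimes> Z)"
    using * o by - (assumption | rule ten_hom idt_hom)+
  note s = sym_hom[OF *(2) o(2)] sym_hom[OF *(2) o(1)] and e = ev_hom[OF *(2,3)]
  show ?thesis
    unfolding evs_def unc_def
    by (simp only: cmp_assoc[OF t(1) s(1) e] sym_nat[OF idt_hom[OF *(2)] *(1)] cmp_assoc[OF s(2) t(2) e])
qed

lemma evs_inject:
  assumes *: "evs Z B \<cdot> (Idt V Z \<odot> n) = evs Z B \<cdot> (Idt V Z \<odot> n')" "n \<in> Hom V N (ihom V Z B)" "n' \<in> Hom V N (ihom V Z B)"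
    "Z \<in> Ob V" "B \<in> Ob V"
  shows "n = n'"
proof -
  have N: "N \<in> Ob V" using *(2) hom_ob by blast
  have "unc Z B n \<cdot> sym V Z N = unc Z B n' \<cdot> sym V Z N" using *(1) evs_cmp[OF *(2,4,5)] evs_cmp[OF *(3,4,5)] by simp
  then have "unc Z B n = unc Z B n'" by (rule iso_epi[OF sym_iso[OF *(4) N] unc_hom[OF *(2,4,5)] unc_hom[OF *(3,4,5)]])
  then show ?thesis by (rule unc_inject[OF _ *(2-5)])
qed

lemma evs_universal:
  assumes g: "g \<in> Hom V (Z \<otimes> N) B" and Z: "Z \<in> Ob V" and N: "N \<in> Ob V"
  obtains n where "n \<in> Hom V N (ihom V Z B)" "evs Z B \<cdot> (Idt V Z \<odot> n) = g"
proof -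
  have B: "B \<in> Ob V" using g hom_ob by blast
  note s = sym_hom[OF N Z] sym_hom[OF Z N]
  note c = curry_hom[OF cmp_hom[OF s(1) g] N Z] unc_curry[OF cmp_hom[OF s(1) g] N Z]
  have "evs Z B \<cdot> (Idt V Z \<odot> curry V N Z B (g \<cdot> sym V N Z)) = g"
    by (simp only: evs_cmp[OF c(1) Z B] c(2) cmp_assoc[OF s(2,1) g] sym_inv[OF Z N] idt_right[OF g])
  then show ?thesis using that c(1) by blast
qed

lemma unc_ext_arg:
  assumes *: "k \<in> Hom V (Z \<otimes> A) B" "n \<in> Hom V W (ihom V Y A)" "Z \<in> Ob V" "Y \<in> Ob V" "A \<in> Ob V"
  shows "unc Y B (ext Z Y A B k \<cdot> (Idt V Z \<odot> n)) = k \<cdot> ((Idt V Z \<odot> unc Y A n) \<cdot> asc V Z W Y)"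
proof -
  have o: "W \<in> Ob V" "B \<in> Ob V" "ihom V Y A \<in> Ob V" using * hom_ob by blast+
  have t: "Idt V Z \<odot> n \<in> Hom V (Z \<otimes> W) (Z \<otimes> ihom V Y A)"
    "(Idt V Z \<odot> n) \<odot> Idt V Y \<in> Hom V ((Z \<otimes> W) \<otimes> Y) ((Z \<otimes> ihom V Y A) \<otimes> Y)"
    "asc V Z (ihom V Y A) Y \<in> Hom V ((Z \<otimes> ihom V Y A) \<otimes> Y) (Z \<otimes> (ihom V Y A \<otimes> Y))"
    "asc V Z W Y \<in> Hom V ((Z \<otimes> W) \<otimes> Y) (Z \<otimes> (W \<otimes> Y))"
    "Idt V Z \<odot> (n \<odot> Idt V Y) \<in> Hom V (Z \<otimes> (W \<otimes> Y)) (Z \<otimes> (ihom V Y A \<otimes> Y))"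
    "Idt V Z \<odot> ev V Y A \<in> Hom V (Z \<otimes> (ihom V Y A \<otimes> Y)) (Z \<otimes> A)"
    "n \<odot> Idt V Y \<in> Hom V (W \<otimes> Y) (ihom V Y A \<otimes> Y)"
    using * o by - (assumption | rule ten_hom idt_hom asc_hom ev_hom)+
  have "unc Y B (ext Z Y A B k \<cdot> (Idt V Z \<odot> n)) =
      k \<cdot> ((Idt V Z \<odot> ev V Y A) \<cdot> asc V Z (ihom V Y A) Y) \<cdot> ((Idt V Z \<odot> n) \<odot> Idt V Y)"
    by (simp only: unc_cmp[OF ext_hom[OF *(1,3-5)] t(1) *(4) o(2)] unc_ext[OF *(1,3-5)])
  also have "\<dots> = k \<cdot> ((Idt V Z \<odot> ev V Y A) \<cdot> (asc V Z (ihom V Y A) Y \<cdot> ((Idt V Z \<odot> n) \<odot> Idt V Y)))"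
    using *(1) t cmp_hom[OF t(3,6)] by (simp only: assocs)
  also have "\<dots> = k \<cdot> (((Idt V Z \<odot> ev V Y A) \<cdot> (Idt V Z \<odot> (n \<odot> Idt V Y))) \<cdot> asc V Z W Y)"
    unfolding asc_nat[OF idt_hom[OF *(3)] *(2) idt_hom[OF *(4)]] using *(1) t by (simp only: assocs)
  also have "\<dots> = k \<cdot> ((Idt V Z \<odot> unc Y A n) \<cdot> asc V Z W Y)"
    unfolding unc_def by (simp only: ten_cmp_right[OF t(7) ev_hom[OF *(4,5)] *(3)])
  finally show ?thesis .
qed

text \<open>With \<open>ext_evs_universal\<close> this says that arrows
  \<open>W -> [Y,[Z,B]]\<close> correspond to arrows \<open>Z \<otimes> W -> [Y,B]\<close>: the
  isomorphism of \<open>[Y,[Z,B]]\<close> with \<open>[Z,[Y,B]]\<close>, in the form in which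
  operations on a power are defined and compared.\<close>

lemma ext_evs_inject:
  assumes e: "ext Z Y (ihom V Z B) B (evs Z B) \<cdot> (Idt V Z \<odot> n) = ext Z Y (ihom V Z B) B (evs Z B) \<cdot> (Idt V Z \<odot> n')"
    and n: "n \<in> Hom V W (ihom V Y (ihom V Z B))" "n' \<in> Hom V W (ihom V Y (ihom V Z B))"
    and o: "Z \<in> Ob V" "Y \<in> Ob V" "B \<in> Ob V"
  shows "n = n'"
proof -
  have W: "W \<in> Ob V" using n hom_ob by blast
  note ZB = ihom_ob[OF o(1,3)]
  note u = unc_hom[OF n(1) o(2) ZB] unc_hom[OF n(2) o(2) ZB]
  note i = idt_hom[OF o(1)] and a = asc_hom[OF o(1) W o(2)] and E = evs_hom[OF o(1,3)]
  have "evs Z B \<cdot> (Idt V Z \<odot> unc Y (ihom V Z B) n) \<cdot> asc V Z W Y = evs Z B \<cdot> (Idt V Z \<odot> unc Y (ihom V Z B) n') \<cdot> asc V Z W Y"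
    using unc_ext_arg[OF E n(1) o(1,2) ZB] unc_ext_arg[OF E n(2) o(1,2) ZB] e
    by (simp only: cmp_assoc[OF a ten_hom[OF i u(1)] E] cmp_assoc[OF a ten_hom[OF i u(2)] E])
  then have "evs Z B \<cdot> (Idt V Z \<odot> unc Y (ihom V Z B) n) = evs Z B \<cdot> (Idt V Z \<odot> unc Y (ihom V Z B) n')"
    by (rule iso_epi[OF asc_iso[OF o(1) W o(2)] cmp_hom[OF ten_hom[OF i u(1)] E] cmp_hom[OF ten_hom[OF i u(2)] E]])
  then have "unc Y (ihom V Z B) n = unc Y (ihom V Z B) n'" by (rule evs_inject[OF _ u o(1,3)])
  then show ?thesis by (rule unc_inject[OF _ n o(2) ZB])
qed

lemma ext_evs_universal:
  assumes g: "g \<in> Hom V (Z \<otimes> W) (ihom V Y B)" and o: "Z \<in> Ob V" "Y \<in> Ob V" "B \<in> Ob V" "W \<in> Ob V"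
  obtains n where "n \<in> Hom V W (ihom V Y (ihom V Z B))" "ext Z Y (ihom V Z B) B (evs Z B) \<cdot> (Idt V Z \<odot> n) = g"
proof -
  note ZB = ihom_ob[OF o(1,3)] and E = evs_hom[OF o(1,3)] and ug = unc_hom[OF g o(2,3)]
  obtain i where i: "asc V Z W Y \<in> Hom V ((Z \<otimes> W) \<otimes> Y) (Z \<otimes> (W \<otimes> Y))" "i \<in> Hom V (Z \<otimes> (W \<otimes> Y)) ((Z \<otimes> W) \<otimes> Y)"
    "i \<cdot> asc V Z W Y = Idt V ((Z \<otimes> W) \<otimes> Y)" "asc V Z W Y \<cdot> i = Idt V (Z \<otimes> (W \<otimes> Y))"
    by (rule isoE[OF asc_iso[OF o(1,4,2)]])
  obtain m where m: "m \<in> Hom V (W \<otimes> Y) (ihom V Z B)" "evs Z B \<cdot> (Idt V Z \<odot> m) = unc Y B g \<cdot> i"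
    by (rule evs_universal[OF cmp_hom[OF i(2) ug] o(1) ten_ob[OF o(4,2)]])
  note c = curry_hom[OF m(1) o(4,2)] unc_curry[OF m(1) o(4,2)]
  have im: "Idt V Z \<odot> m \<in> Hom V (Z \<otimes> (W \<otimes> Y)) (Z \<otimes> ihom V Z B)" by (rule ten_hom[OF idt_hom[OF o(1)] m(1)])
  have h: "ext Z Y (ihom V Z B) B (evs Z B) \<cdot> (Idt V Z \<odot> curry V W Y (ihom V Z B) m) \<in> Hom V (Z \<otimes> W) (ihom V Y B)"
    by (rule cmp_hom[OF ten_hom[OF idt_hom[OF o(1)] c(1)] ext_hom[OF E o(1,2) ZB]])
  have "unc Y B (ext Z Y (ihom V Z B) B (evs Z B) \<cdot> (Idt V Z \<odot> curry V W Y (ihom V Z B) m)) = unc Y B g"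
    by (simp only: unc_ext_arg[OF E c(1) o(1,2) ZB] c(2) cmp_assoc[OF i(1) im E, symmetric] m(2) cmp_assoc[OF i(1,2) ug] i(3) idt_right[OF ug])
  then have "ext Z Y (ihom V Z B) B (evs Z B) \<cdot> (Idt V Z \<odot> curry V W Y (ihom V Z B) m) = g"
    by (rule unc_inject[OF _ h g o(2,3)])
  then show ?thesis using that c(1) by blast
qed

end


section \<open>Structures and parametrized homomorphisms\<close>

locale structures = symmetric_monoidal_closed V + presentable_category V \<kappa> l
  for V :: "('o, 'm, 'x) smc_scheme" (structure) and \<kappa> :: "'u rel" and l :: "'l rel" +
  fixes L :: "('f, 'o) language"
  assumes regular_l: "regular_cardinal l" and l_less: "l <o \<kappa>"
    and presentable_unit_ten: "locally_presentable_closed \<kappa> l V"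
    and language: "ary_language \<kappa> l V L"
begin

abbreviation StrL :: "(('o, 'm, 'f) struct, 'm) cat" where "StrL \<equiv> Str V L"
abbreviation SHom where "SHom \<equiv> str_hom V L"

lemma arity_presentable: "f \<in> Sym L \<Longrightarrow> presentable \<kappa> l V (In L f)" "f \<in> Sym L \<Longrightarrow> presentable \<kappa> l V (Out L f)"
  using language unfolding ary_language_def by auto

lemma arity_ob: "f \<in> Sym L \<Longrightarrow> In L f \<in> Ob V" "f \<in> Sym L \<Longrightarrow> Out L f \<in> Ob V"
  using arity_presentable unfolding presentable_def by auto

lemma Str_cmp [simp]: "g \<cdot>\<^bsub>StrL\<^esub> f = g \<cdot> f"
  and Str_idt [simp]: "Idt StrL P = Idt V (fst P)"
  unfolding Str_def Let_def by (auto split: prod.split)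

lemma Str_ob: "P \<in> Ob StrL \<Longrightarrow> fst P \<in> Ob V"
  and Str_op: "\<lbrakk>P \<in> Ob StrL; f \<in> Sym L\<rbrakk> \<Longrightarrow> snd P f \<in> Hom V (ihom V (In L f) (fst P)) (ihom V (Out L f) (fst P))"
  unfolding Str_def Let_def by auto

lemma Str_obI: "\<lbrakk>A \<in> Ob V; \<And>f. f \<in> Sym L \<Longrightarrow> a f \<in> Hom V (ihom V (In L f) A) (ihom V (Out L f) A)\<rbrakk>
  \<Longrightarrow> (A, restrict a (Sym L)) \<in> Ob StrL"
  unfolding Str_def Let_def by auto

lemma Str_hom_iff: "h \<in> Hom StrL P Q \<longleftrightarrow> P \<in> Ob StrL \<and> Q \<in> Ob StrL \<and> h \<in> Hom V (fst P) (fst Q) \<and>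
    (\<forall>f \<in> Sym L. post V (Out L f) (fst P) (fst Q) h \<cdot> snd P f = snd Q f \<cdot> post V (In L f) (fst P) (fst Q) h)"
  unfolding Str_def Let_def by (cases P; cases Q) auto

lemma Str_homD:
  assumes "h \<in> Hom StrL P Q"
  shows "P \<in> Ob StrL" "Q \<in> Ob StrL" "h \<in> Hom V (fst P) (fst Q)"
    "f \<in> Sym L \<Longrightarrow> post V (Out L f) (fst P) (fst Q) h \<cdot> snd P f = snd Q f \<cdot> post V (In L f) (fst P) (fst Q) h"
  using assms unfolding Str_hom_iff by auto

lemma category_Str: "category StrL"
proof
  fix P assume P: "P \<in> Ob StrL"
  note o = Str_ob[OF P]
  show "Idt StrL P \<in> Hom StrL P P"
    unfolding Str_hom_iff Str_idt
  proof (intro conjI ballI P idt_hom o)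
    fix f assume f: "f \<in> Sym L"
    show "post V (Out L f) (fst P) (fst P) (Idt V (fst P)) \<cdot> snd P f =
        snd P f \<cdot> post V (In L f) (fst P) (fst P) (Idt V (fst P))"
      by (simp only: post_idt[OF o arity_ob(1)[OF f]] post_idt[OF o arity_ob(2)[OF f]]
        idt_left[OF Str_op[OF P f]] idt_right[OF Str_op[OF P f]])
  qed
next
  fix h P Q g R assume h: "h \<in> Hom StrL P Q" and g: "g \<in> Hom StrL Q R"
  note h = Str_homD[OF h] and g = Str_homD[OF g]
  show "g \<cdot>\<^bsub>StrL\<^esub> h \<in> Hom StrL P R"
    unfolding Str_hom_iff Str_cmp
  proof (intro conjI ballI h g cmp_hom[OF h(3) g(3)])
    fix f assume f: "f \<in> Sym L"
    note X = arity_ob(1)[OF f] and Y = arity_ob(2)[OF f]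
    note t = Str_op[OF h(1) f] Str_op[OF h(2) f] Str_op[OF g(2) f] post_hom[OF h(3) X] post_hom[OF g(3) X]
      post_hom[OF h(3) Y] post_hom[OF g(3) Y]
    show "post V (Out L f) (fst P) (fst R) (g \<cdot> h) \<cdot> snd P f = snd R f \<cdot> post V (In L f) (fst P) (fst R) (g \<cdot> h)"
      by (simp only: post_cmp[OF h(3) g(3) X] post_cmp[OF h(3) g(3) Y] cmp_assoc[OF t(1,6,7)] h(4)[OF f]
        cmp_assoc[OF t(4,2,7), symmetric] g(4)[OF f] cmp_assoc[OF t(4,5,3)])
  qed
next
  fix h P Q assume "h \<in> Hom StrL P Q" then show "P \<in> Ob StrL \<and> Q \<in> Ob StrL" using Str_homD by blast
next
  fix h P Q assume h: "h \<in> Hom StrL P Q"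
  show "Idt StrL Q \<cdot>\<^bsub>StrL\<^esub> h = h" "h \<cdot>\<^bsub>StrL\<^esub> Idt StrL P = h"
    unfolding Str_cmp Str_idt by (rule idt_left[OF Str_homD(3)[OF h]] idt_right[OF Str_homD(3)[OF h]])+
next
  fix f P Q g R h T assume "f \<in> Hom StrL P Q" "g \<in> Hom StrL Q R" "h \<in> Hom StrL R T"
  then show "h \<cdot>\<^bsub>StrL\<^esub> g \<cdot>\<^bsub>StrL\<^esub> f = h \<cdot>\<^bsub>StrL\<^esub> (g \<cdot>\<^bsub>StrL\<^esub> f)"
    unfolding Str_cmp by (intro cmp_assoc[OF Str_homD(3) Str_homD(3) Str_homD(3)])
qed

lemma Str_comp: "\<lbrakk>h \<in> Hom StrL P Q; g \<in> Hom StrL Q R\<rbrakk> \<Longrightarrow> g \<cdot> h \<in> Hom StrL P R"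
  using category.cmp_hom[OF category_Str] by simp

text \<open>A homomorphism \<open>P \<rightarrow> Q\<close> parametrized by \<open>Z\<close> is a generalized element \<open>Z \<rightarrow> Str(P,Q)\<close>.\<close>

definition phom :: "'o \<Rightarrow> ('o, 'm, 'f) struct \<Rightarrow> ('o, 'm, 'f) struct \<Rightarrow> 'm \<Rightarrow> bool" where
  "phom Z P Q k \<longleftrightarrow> Z \<in> Ob V \<and> P \<in> Ob StrL \<and> Q \<in> Ob StrL \<and> k \<in> Hom V (Z \<otimes> fst P) (fst Q) \<and>
     (\<forall>f \<in> Sym L. snd Q f \<cdot> ext Z (In L f) (fst P) (fst Q) k =
        ext Z (Out L f) (fst P) (fst Q) k \<cdot> (Idt V Z \<odot> snd P f))"

lemma phomD:
  assumes "phom Z P Q k"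
  shows "Z \<in> Ob V" "P \<in> Ob StrL" "Q \<in> Ob StrL" "k \<in> Hom V (Z \<otimes> fst P) (fst Q)" "fst P \<in> Ob V" "fst Q \<in> Ob V"
    "f \<in> Sym L \<Longrightarrow> snd Q f \<cdot> ext Z (In L f) (fst P) (fst Q) k =
        ext Z (Out L f) (fst P) (fst Q) k \<cdot> (Idt V Z \<odot> snd P f)"
  using assms Str_ob unfolding phom_def by auto

section \<open>Change of target, source and parameter; composition\<close>

lemma phom_post:
  assumes k: "phom Z P Q k" and h: "h \<in> Hom StrL Q R" shows "phom Z P R (h \<cdot> k)"
  unfolding phom_def
proof (intro conjI ballI)
  note k = phomD[OF k] and h = Str_homD[OF h]
  show "Z \<in> Ob V" "P \<in> Ob StrL" "R \<in> Ob StrL" "h \<cdot> k \<in> Hom V (Z \<otimes> fst P) (fst R)"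
    using k(1,2) h(2) cmp_hom[OF k(4) h(3)] by auto
  fix f assume f: "f \<in> Sym L"
  note X = arity_ob(1)[OF f] and Y = arity_ob(2)[OF f]
  note t = Str_op[OF k(3) f] Str_op[OF h(2) f] ext_hom[OF k(4,1) X k(5)] ext_hom[OF k(4,1) Y k(5)]
    post_hom[OF h(3) X] post_hom[OF h(3) Y] ten_hom[OF idt_hom[OF k(1)] Str_op[OF k(2) f]]
  show "snd R f \<cdot> ext Z (In L f) (fst P) (fst R) (h \<cdot> k) =
        ext Z (Out L f) (fst P) (fst R) (h \<cdot> k) \<cdot> (Idt V Z \<odot> snd P f)"
    by (simp only: ext_post[OF k(4) h(3) k(1) X k(5)] ext_post[OF k(4) h(3) k(1) Y k(5)]
      cmp_assoc[OF t(3,5,2), symmetric] h(4)[OF f, symmetric] cmp_assoc[OF t(3,1,6)] k(7)[OF f] cmp_assoc[OF t(7,4,6)])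
qed

lemma phom_pre:
  assumes k: "phom Z P Q k" and h: "h \<in> Hom StrL R P" shows "phom Z R Q (k \<cdot> (Idt V Z \<odot> h))"
  unfolding phom_def
proof (intro conjI ballI)
  note k = phomD[OF k] and h = Str_homD[OF h]
  show "Z \<in> Ob V" "R \<in> Ob StrL" "Q \<in> Ob StrL" "k \<cdot> (Idt V Z \<odot> h) \<in> Hom V (Z \<otimes> fst R) (fst Q)"
    using k(1,3) h(1) cmp_hom[OF ten_hom[OF idt_hom[OF k(1)] h(3)] k(4)] by auto
  fix f assume f: "f \<in> Sym L"
  note X = arity_ob(1)[OF f] and Y = arity_ob(2)[OF f]
  note t = Str_op[OF k(3) f] Str_op[OF k(2) f] Str_op[OF h(1) f] ext_hom[OF k(4,1) X k(5)] ext_hom[OF k(4,1) Y k(5)]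
    post_hom[OF h(3) X] post_hom[OF h(3) Y]
  note i = idt_hom[OF k(1)]
  show "snd Q f \<cdot> ext Z (In L f) (fst R) (fst Q) (k \<cdot> (Idt V Z \<odot> h)) =
        ext Z (Out L f) (fst R) (fst Q) (k \<cdot> (Idt V Z \<odot> h)) \<cdot> (Idt V Z \<odot> snd R f)"
    by (simp only: ext_arg[OF k(4) h(3) k(1) X] ext_arg[OF k(4) h(3) k(1) Y]
      cmp_assoc[OF ten_hom[OF i t(6)] t(4,1), symmetric] k(7)[OF f] cmp_assoc[OF ten_hom[OF i t(6)] ten_hom[OF i t(2)] t(5)]
      cmp_assoc[OF ten_hom[OF i t(3)] ten_hom[OF i t(7)] t(5)] ten_cmp_right[OF t(6,2) k(1), symmetric]
      ten_cmp_right[OF t(3,7) k(1), symmetric] h(4)[OF f])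
qed

lemma phom_param:
  assumes k: "phom Z P Q k" and u: "u \<in> Hom V W Z" shows "phom W P Q (k \<cdot> (u \<odot> Idt V (fst P)))"
  unfolding phom_def
proof (intro conjI ballI)
  note k = phomD[OF k]
  show W: "W \<in> Ob V" using u hom_ob by blast
  show "P \<in> Ob StrL" "Q \<in> Ob StrL" "k \<cdot> (u \<odot> Idt V (fst P)) \<in> Hom V (W \<otimes> fst P) (fst Q)"
    using k(2,3) cmp_hom[OF ten_hom[OF u idt_hom[OF k(5)]] k(4)] by auto
  fix f assume f: "f \<in> Sym L"
  note X = arity_ob(1)[OF f] and Y = arity_ob(2)[OF f]
  note t = Str_op[OF k(3) f] Str_op[OF k(2) f] ext_hom[OF k(4,1) X k(5)] ext_hom[OF k(4,1) Y k(5)]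
  have i: "u \<odot> Idt V (ihom V (In L f) (fst P)) \<in> Hom V (W \<otimes> ihom V (In L f) (fst P)) (Z \<otimes> ihom V (In L f) (fst P))"
    "u \<odot> Idt V (ihom V (Out L f) (fst P)) \<in> Hom V (W \<otimes> ihom V (Out L f) (fst P)) (Z \<otimes> ihom V (Out L f) (fst P))"
    "Idt V Z \<odot> snd P f \<in> Hom V (Z \<otimes> ihom V (In L f) (fst P)) (Z \<otimes> ihom V (Out L f) (fst P))"
    "Idt V W \<odot> snd P f \<in> Hom V (W \<otimes> ihom V (In L f) (fst P)) (W \<otimes> ihom V (Out L f) (fst P))"
    using u t W k X Y by - (assumption | rule ten_hom idt_hom ihom_ob)+
  show "snd Q f \<cdot> ext W (In L f) (fst P) (fst Q) (k \<cdot> (u \<odot> Idt V (fst P))) =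
        ext W (Out L f) (fst P) (fst Q) (k \<cdot> (u \<odot> Idt V (fst P))) \<cdot> (Idt V W \<odot> snd P f)"
    by (simp only: ext_param[OF k(4) u X k(5)] ext_param[OF k(4) u Y k(5)] cmp_assoc[OF i(1) t(3,1), symmetric]
      k(7)[OF f] cmp_assoc[OF i(1,3) t(4)] cmp_assoc[OF i(4,2) t(4)] ten_swap[OF u t(2)])
qed

text \<open>Composition of generalized elements, with parameters tensored. Applied to the universal
  families it shows that internal composition restricts to the hom-objects of structures.\<close>

lemma phom_comp:
  assumes k: "phom Z Q R k" and h: "phom W P Q h"
  shows "phom (Z \<otimes> W) P R (k \<cdot> ((Idt V Z \<odot> h) \<cdot> asc V Z W (fst P)))"
  unfolding phom_def
proof (intro conjI ballI)
  note k = phomD[OF k] and h = phomD[OF h]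
  have a: "asc V Z W (fst P) \<in> Hom V ((Z \<otimes> W) \<otimes> fst P) (Z \<otimes> (W \<otimes> fst P))" by (rule asc_hom[OF k(1) h(1,5)])
  show "Z \<otimes> W \<in> Ob V" "P \<in> Ob StrL" "R \<in> Ob StrL" by (rule ten_ob[OF k(1) h(1)] h(2) k(3))+
  show "k \<cdot> ((Idt V Z \<odot> h) \<cdot> asc V Z W (fst P)) \<in> Hom V ((Z \<otimes> W) \<otimes> fst P) (fst R)"
    by (rule cmp_hom[OF cmp_hom[OF a ten_hom[OF idt_hom[OF k(1)] h(4)]] k(4)])
  fix f assume f: "f \<in> Sym L"
  note X = arity_ob(1)[OF f] and Y = arity_ob(2)[OF f]
  note o = Str_op[OF k(3) f] Str_op[OF k(2) f] Str_op[OF h(2) f]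
  note e = ext_hom[OF k(4,1) X k(5)] ext_hom[OF k(4,1) Y k(5)] ext_hom[OF h(4,1) X h(5)] ext_hom[OF h(4,1) Y h(5)]
  note XP = ihom_ob[OF X h(5)] and YP = ihom_ob[OF Y h(5)]
  note i = idt_hom[OF k(1)]
  note t = ten_hom[OF i e(3)] ten_hom[OF i e(4)] asc_hom[OF k(1) h(1) XP] asc_hom[OF k(1) h(1) YP]
    ten_hom[OF i o(2)] ten_hom[OF idt_hom[OF h(1)] o(3)] ten_hom[OF idt_hom[OF ten_ob[OF k(1) h(1)]] o(3)]
    ten_hom[OF i ten_hom[OF idt_hom[OF h(1)] o(3)]]
  have n: "asc V Z W (ihom V (Out L f) (fst P)) \<cdot> (Idt V (Z \<otimes> W) \<odot> snd P f) =
      (Idt V Z \<odot> (Idt V W \<odot> snd P f)) \<cdot> asc V Z W (ihom V (In L f) (fst P))"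
    using asc_nat[OF i idt_hom[OF h(1)] o(3)] ten_idt[OF k(1) h(1)] by simp
  let ?ek = "\<lambda>X. ext Z X (fst Q) (fst R) k" and ?eh = "\<lambda>X. ext W X (fst P) (fst Q) h"
  have "snd R f \<cdot> (?ek (In L f) \<cdot> ((Idt V Z \<odot> ?eh (In L f)) \<cdot> asc V Z W (ihom V (In L f) (fst P)))) =
      snd R f \<cdot> ?ek (In L f) \<cdot> ((Idt V Z \<odot> ?eh (In L f)) \<cdot> asc V Z W (ihom V (In L f) (fst P)))"
    by (rule cmp_assoc[OF cmp_hom[OF t(3,1)] e(1) o(1), symmetric])
  also have "\<dots> = ?ek (Out L f) \<cdot> (((Idt V Z \<odot> snd Q f) \<cdot> (Idt V Z \<odot> ?eh (In L f))) \<cdot> asc V Z W (ihom V (In L f) (fst P)))"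
    unfolding k(7)[OF f] using t e by (simp only: assocs)
  also have "(Idt V Z \<odot> snd Q f) \<cdot> (Idt V Z \<odot> ?eh (In L f)) = (Idt V Z \<odot> ?eh (Out L f)) \<cdot> (Idt V Z \<odot> (Idt V W \<odot> snd P f))"
    by (simp only: ten_cmp_right[OF e(3) o(2) k(1), symmetric] h(7)[OF f] ten_cmp_right[OF t(6) e(4) k(1)])
  also have "?ek (Out L f) \<cdot> ((Idt V Z \<odot> ?eh (Out L f)) \<cdot> (Idt V Z \<odot> (Idt V W \<odot> snd P f)) \<cdot> asc V Z W (ihom V (In L f) (fst P))) =
      ?ek (Out L f) \<cdot> ((Idt V Z \<odot> ?eh (Out L f)) \<cdot> (asc V Z W (ihom V (Out L f) (fst P)) \<cdot> (Idt V (Z \<otimes> W) \<odot> snd P f)))"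
    unfolding n using t e by (simp only: assocs)
  also have "\<dots> = ?ek (Out L f) \<cdot> ((Idt V Z \<odot> ?eh (Out L f)) \<cdot> asc V Z W (ihom V (Out L f) (fst P))) \<cdot> (Idt V (Z \<otimes> W) \<odot> snd P f)"
    using t e cmp_hom[OF t(4,2)] by (simp only: assocs)
  finally show "snd R f \<cdot> ext (Z \<otimes> W) (In L f) (fst P) (fst R) (k \<cdot> ((Idt V Z \<odot> h) \<cdot> asc V Z W (fst P))) =
    ext (Z \<otimes> W) (Out L f) (fst P) (fst R) (k \<cdot> ((Idt V Z \<odot> h) \<cdot> asc V Z W (fst P))) \<cdot> (Idt V (Z \<otimes> W) \<odot> snd P f)"
    by (simp only: ext_comp[OF k(4) h(4) k(1) h(1,5) X] ext_comp[OF k(4) h(4) k(1) h(1,5) Y])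
qed

lemma phom_unit:
  assumes h: "h \<in> Hom StrL P Q" shows "phom (unit V) P Q (h \<cdot> lun V (fst P))"
  unfolding phom_def
proof (intro conjI ballI)
  note h = Str_homD[OF h]
  note o = Str_ob[OF h(1)]
  show "unit V \<in> Ob V" "P \<in> Ob StrL" "Q \<in> Ob StrL" by (rule unit_ob h)+
  show "h \<cdot> lun V (fst P) \<in> Hom V (unit V \<otimes> fst P) (fst Q)" by (rule cmp_hom[OF lun_hom[OF o] h(3)])
  fix f assume f: "f \<in> Sym L"
  note X = arity_ob(1)[OF f] and Y = arity_ob(2)[OF f]
  note p = Str_op[OF h(1) f] Str_op[OF h(2) f] post_hom[OF h(3) X] post_hom[OF h(3) Y]
    lun_hom[OF ihom_ob[OF X o]] lun_hom[OF ihom_ob[OF Y o]] ten_hom[OF idt_hom[OF unit_ob] Str_op[OF h(1) f]]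
  show "snd Q f \<cdot> ext (unit V) (In L f) (fst P) (fst Q) (h \<cdot> lun V (fst P)) =
        ext (unit V) (Out L f) (fst P) (fst Q) (h \<cdot> lun V (fst P)) \<cdot> (Idt V (unit V) \<odot> snd P f)"
    by (simp only: ext_unit[OF h(3) X] ext_unit[OF h(3) Y] cmp_assoc[OF p(5,3,2), symmetric] h(4)[OF f, symmetric]
      cmp_assoc[OF p(5,1,4)] cmp_assoc[OF p(7,6,4)] lun_nat[OF p(1)])
qed


subsection \<open>Hom-objects\<close>

text \<open>Transposing the two maps of the equalizer turns them into the two sides of the equation
  in \<open>phom\<close>.\<close>

lemma str_eq_iff:
  assumes P: "P \<in> Ob StrL" and Q: "Q \<in> Ob StrL" and k: "k \<in> Hom V Z (ihom V (fst P) (fst Q))" and f: "f \<in> Sym L"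
  shows "str_eq1 V L f P Q \<cdot> k = str_eq2 V L f P Q \<cdot> k \<longleftrightarrow>
    snd Q f \<cdot> ext Z (In L f) (fst P) (fst Q) (unc (fst P) (fst Q) k) =
        ext Z (Out L f) (fst P) (fst Q) (unc (fst P) (fst Q) k) \<cdot> (Idt V Z \<odot> snd P f)"
proof -
  let ?A = "fst P" and ?B = "fst Q" and ?X = "In L f" and ?Y = "Out L f"
  note A = Str_ob[OF P] and B = Str_ob[OF Q] and X = arity_ob(1)[OF f] and Y = arity_ob(2)[OF f]
  note o = Str_op[OF P f] Str_op[OF Q f]
  note XA = ihom_ob[OF X A] and YA = ihom_ob[OF Y A] and XB = ihom_ob[OF X B] and YB = ihom_ob[OF Y B]
  have t: "post V (ihom V ?X ?A) (ihom V ?X ?B) (ihom V ?Y ?B) (snd Q f) \<in> Hom V (ihom V (ihom V ?X ?A) (ihom V ?X ?B)) (ihom V (ihom V ?X ?A) (ihom V ?Y ?B))"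
    "pre V (ihom V ?X ?A) (ihom V ?Y ?A) (ihom V ?Y ?B) (snd P f) \<in> Hom V (ihom V (ihom V ?Y ?A) (ihom V ?Y ?B)) (ihom V (ihom V ?X ?A) (ihom V ?Y ?B))"
    by (rule post_hom[OF o(2) XA] pre_hom[OF o(1) YB])+
  note i = ipost_hom[OF X A B] ipost_hom[OF Y A B]
  have 1: "unc (ihom V ?X ?A) (ihom V ?Y ?B) (str_eq1 V L f P Q \<cdot> k) = snd Q f \<cdot> ext Z ?X ?A ?B (unc ?A ?B k)"
    by (simp only: str_eq1_def Let_def cmp_assoc[OF k i(1) t(1)] unc_post[OF o(2) cmp_hom[OF k i(1)] XA]
      unc_ipost_cmp[OF k X A B])
  have 2: "unc (ihom V ?X ?A) (ihom V ?Y ?B) (str_eq2 V L f P Q \<cdot> k) = ext Z ?Y ?A ?B (unc ?A ?B k) \<cdot> (Idt V Z \<odot> snd P f)"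
    by (simp only: str_eq2_def Let_def cmp_assoc[OF k i(2) t(2)] unc_pre[OF o(1) cmp_hom[OF k i(2)] YB]
      unc_ipost_cmp[OF k Y A B])
  have "str_eq1 V L f P Q \<cdot> k \<in> Hom V Z (ihom V (ihom V ?X ?A) (ihom V ?Y ?B))"
    "str_eq2 V L f P Q \<cdot> k \<in> Hom V Z (ihom V (ihom V ?X ?A) (ihom V ?Y ?B))"
    unfolding str_eq1_def str_eq2_def Let_def
    by (rule cmp_hom[OF k cmp_hom[OF i(1) t(1)]] cmp_hom[OF k cmp_hom[OF i(2) t(2)]])+
  then show ?thesis using unc_inject[OF _ _ _ XA YB] 1 2 by metis
qed

lemma phom_unc_iff:
  assumes P: "P \<in> Ob StrL" and Q: "Q \<in> Ob StrL" and k: "k \<in> Hom V Z (ihom V (fst P) (fst Q))"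
  shows "(\<forall>f\<in>Sym L. str_eq1 V L f P Q \<cdot> k = str_eq2 V L f P Q \<cdot> k) \<longleftrightarrow> phom Z P Q (unc (fst P) (fst Q) k)"
  using str_eq_iff[OF P Q k] P Q hom_ob[OF k] unc_hom[OF k Str_ob[OF P] Str_ob[OF Q]]
  unfolding phom_def by simp

lemma str_eq_hom:
  assumes P: "P \<in> Ob StrL" and Q: "Q \<in> Ob StrL" and f: "f \<in> Sym L"
  shows "str_eq1 V L f P Q \<in> Hom V (ihom V (fst P) (fst Q)) (ihom V (ihom V (In L f) (fst P)) (ihom V (Out L f) (fst Q)))"
    "str_eq2 V L f P Q \<in> Hom V (ihom V (fst P) (fst Q)) (ihom V (ihom V (In L f) (fst P)) (ihom V (Out L f) (fst Q)))"
proof -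
  note A = Str_ob[OF P] and B = Str_ob[OF Q] and X = arity_ob(1)[OF f] and Y = arity_ob(2)[OF f]
  show "str_eq1 V L f P Q \<in> Hom V (ihom V (fst P) (fst Q)) (ihom V (ihom V (In L f) (fst P)) (ihom V (Out L f) (fst Q)))"
    unfolding str_eq1_def Let_def by (rule cmp_hom[OF ipost_hom[OF X A B] post_hom[OF Str_op[OF Q f] ihom_ob[OF X A]]])
  show "str_eq2 V L f P Q \<in> Hom V (ihom V (fst P) (fst Q)) (ihom V (ihom V (In L f) (fst P)) (ihom V (Out L f) (fst Q)))"
    unfolding str_eq2_def Let_def by (rule cmp_hom[OF ipost_hom[OF Y A B] pre_hom[OF Str_op[OF P f] ihom_ob[OF Y B]]])
qed

text \<open>The joint equalizer is the subobject of \<open>[A,B]\<close> cut out by its defining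
  equations; these are local because effective sinks are jointly epic.\<close>

lemma str_hom_exists:
  assumes P: "P \<in> Ob StrL" and Q: "Q \<in> Ob StrL"
  shows "is_str_hom V L P Q (SHom P Q, str_inc V L P Q)"
proof -
  let ?B = "ihom V (fst P) (fst Q)"
  let ?c = "\<lambda>Z k. \<forall>f\<in>Sym L. str_eq1 V L f P Q \<cdot> k = str_eq2 V L f P Q \<cdot> k"
  have B: "?B \<in> Ob V" using P Q Str_ob ihom_ob by blast
  obtain E e where e: "e \<in> Hom V E ?B" "?c E e"
    "\<And>Z p. \<lbrakk>p \<in> Hom V Z ?B; ?c Z p\<rbrakk> \<Longrightarrow> \<exists>!u. u \<in> Hom V Z E \<and> e \<cdot> u = p"
  proof (rule representable_arrow[OF B, of ?c])
    fix Z Z' p f assume *: "f \<in> Hom V Z' Z" "p \<in> Hom V Z ?B" "?c Z p"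
    show "?c Z' (p \<cdot> f)"
    proof
      fix g assume g: "g \<in> Sym L"
      show "str_eq1 V L g P Q \<cdot> (p \<cdot> f) = str_eq2 V L g P Q \<cdot> (p \<cdot> f)"
        using *(3) g by (simp only: cmp_assoc[OF *(1,2) str_eq_hom(1)[OF P Q g], symmetric]
          cmp_assoc[OF *(1,2) str_eq_hom(2)[OF P Q g], symmetric])
    qed
  next
    fix Z p K assume *: "effective_sink V K Z" "p \<in> Hom V Z ?B" "\<And>A f. (A, f) \<in> K \<Longrightarrow> ?c A (p \<cdot> f)"
    show "?c Z p"
    proof
      fix g assume g: "g \<in> Sym L"
      note h = str_eq_hom[OF P Q g]
      show "str_eq1 V L g P Q \<cdot> p = str_eq2 V L g P Q \<cdot> p"
      proof (rule effective_sink_epi[OF *(1) cmp_hom[OF *(2) h(1)] cmp_hom[OF *(2) h(2)]])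
        fix A f assume Af: "(A, f) \<in> K"
        note f = effective_sink_hom[OF *(1) Af]
        show "str_eq1 V L g P Q \<cdot> p \<cdot> f = str_eq2 V L g P Q \<cdot> p \<cdot> f"
          using *(3)[OF Af] g by (simp only: cmp_assoc[OF f *(2) h(1)] cmp_assoc[OF f *(2) h(2)])
      qed
    qed
  qed (rule that; assumption)
  have "is_str_hom V L P Q (E, e)"
    unfolding is_str_hom_def using e by auto
  then have "is_str_hom V L P Q (SOME Ee. is_str_hom V L P Q Ee)" by (rule someI)
  then show ?thesis unfolding str_hom_def str_inc_def by simp
qed

text \<open>Evaluation \<open>Str(P,Q) \<otimes> UP -> UQ\<close>, the universal parametrized
  homomorphism.\<close>

definition eps :: "('o, 'm, 'f) struct \<Rightarrow> ('o, 'm, 'f) struct \<Rightarrow> 'm" where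
  "eps P Q = unc (fst P) (fst Q) (str_inc V L P Q)"

context
  fixes P Q assumes P: "P \<in> Ob StrL" and Q: "Q \<in> Ob StrL"
begin

lemma str_inc_hom: "str_inc V L P Q \<in> Hom V (SHom P Q) (ihom V (fst P) (fst Q))"
  using str_hom_exists[OF P Q] unfolding is_str_hom_def by simp

lemma SHom_ob: "SHom P Q \<in> Ob V"
  using str_inc_hom hom_ob by blast

lemma eps_phom: "phom (SHom P Q) P Q (eps P Q)"
  unfolding eps_def using str_hom_exists[OF P Q] phom_unc_iff[OF P Q str_inc_hom] unfolding is_str_hom_def by simp

lemma unc_inc: "u \<in> Hom V Z (SHom P Q) \<Longrightarrow> unc (fst P) (fst Q) (str_inc V L P Q \<cdot> u) = eps P Q \<cdot> (u \<odot> Idt V (fst P))"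
  unfolding eps_def by (rule unc_cmp[OF str_inc_hom _ Str_ob[OF P] Str_ob[OF Q]])

text \<open>\<open>SHom P Q\<close> represents the presheaf of parametrized homomorphisms from
  \<open>P\<close> to \<open>Q\<close>, since the equalizer condition on a transpose is exactly
  \<open>phom\<close>. Claims about hom-objects thereby become claims about families.\<close>

lemma eps_universal:
  assumes k: "phom Z P Q k"
  shows "\<exists>!u. u \<in> Hom V Z (SHom P Q) \<and> eps P Q \<cdot> (u \<odot> Idt V (fst P)) = k"
proof -
  note A = Str_ob[OF P] and B = Str_ob[OF Q]
  let ?k = "curry V Z (fst P) (fst Q) k"
  note kk = phomD[OF k]
  have c: "?k \<in> Hom V Z (ihom V (fst P) (fst Q))" "unc (fst P) (fst Q) ?k = k"
    using curry_unique[OF kk(1,5,4)] by auto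
  have "\<forall>f\<in>Sym L. str_eq1 V L f P Q \<cdot> ?k = str_eq2 V L f P Q \<cdot> ?k"
    using phom_unc_iff[OF P Q c(1)] c(2) k by simp
  then have "\<exists>!u. u \<in> Hom V Z (SHom P Q) \<and> str_inc V L P Q \<cdot> u = ?k"
    using str_hom_exists[OF P Q] c(1) unfolding is_str_hom_def by blast
  moreover have "str_inc V L P Q \<cdot> u = ?k \<longleftrightarrow> eps P Q \<cdot> (u \<odot> Idt V (fst P)) = k" if u: "u \<in> Hom V Z (SHom P Q)" for u
    using unc_inc[OF u] c unc_inject[OF _ cmp_hom[OF u str_inc_hom] c(1) A B] by metis
  ultimately show ?thesis by metis
qed

lemma eps_inject:
  assumes "u \<in> Hom V Z (SHom P Q)" "v \<in> Hom V Z (SHom P Q)"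
    "eps P Q \<cdot> (u \<odot> Idt V (fst P)) = eps P Q \<cdot> (v \<odot> Idt V (fst P))"
  shows "u = v"
  using eps_universal[OF phom_param[OF eps_phom assms(1)]] assms by metis

end

text \<open>Restates the definition of \<open>str_pre\<close>, given through inclusions into
  internal homs, in terms of \<open>eps\<close>; unique existence of the latter justifies the
  \<open>THE\<close>. The same is done for \<open>str_comp\<close>.\<close>

lemma str_pre:
  assumes t: "t \<in> Hom StrL P Q" and R: "R \<in> Ob StrL"
  shows "str_pre V L P Q R t \<in> Hom V (SHom Q R) (SHom P R)"
    "eps P R \<cdot> (str_pre V L P Q R t \<odot> Idt V (fst P)) = eps Q R \<cdot> (Idt V (SHom Q R) \<odot> t)"
proof -
  note t' = Str_homD[OF t]
  note A = Str_ob[OF t'(1)] and B = Str_ob[OF t'(2)] and C = Str_ob[OF R]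
  note p = str_inc_hom[OF t'(1) R] and q = str_inc_hom[OF t'(2) R]
  have iff: "str_inc V L P R \<cdot> u = pre V (fst P) (fst Q) (fst R) t \<cdot> str_inc V L Q R \<longleftrightarrow>
      eps P R \<cdot> (u \<odot> Idt V (fst P)) = eps Q R \<cdot> (Idt V (SHom Q R) \<odot> t)"
    if u: "u \<in> Hom V (SHom Q R) (SHom P R)" for u
    using unc_inc[OF t'(1) R u] unc_pre[OF t'(3) q C] unc_inject[OF _ cmp_hom[OF u p] cmp_hom[OF q pre_hom[OF t'(3) C]] A C]
    unfolding eps_def by metis
  moreover have "\<exists>!u. u \<in> Hom V (SHom Q R) (SHom P R) \<and> eps P R \<cdot> (u \<odot> Idt V (fst P)) = eps Q R \<cdot> (Idt V (SHom Q R) \<odot> t)"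
    by (rule eps_universal[OF t'(1) R phom_pre[OF eps_phom[OF t'(2) R] t]])
  ultimately have "\<exists>!u. u \<in> Hom V (SHom Q R) (SHom P R) \<and> str_inc V L P R \<cdot> u = pre V (fst P) (fst Q) (fst R) t \<cdot> str_inc V L Q R"
    by metis
  from theI'[OF this, folded str_pre_def] show "str_pre V L P Q R t \<in> Hom V (SHom Q R) (SHom P R)"
    "eps P R \<cdot> (str_pre V L P Q R t \<odot> Idt V (fst P)) = eps Q R \<cdot> (Idt V (SHom Q R) \<odot> t)"
    using iff by blast+
qed

lemma str_comp:
  assumes P: "P \<in> Ob StrL" and Q: "Q \<in> Ob StrL" and R: "R \<in> Ob StrL"
  shows "str_comp V L P Q R \<in> Hom V (SHom Q R \<otimes> SHom P Q) (SHom P R)"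
    "eps P R \<cdot> (str_comp V L P Q R \<odot> Idt V (fst P)) =
      eps Q R \<cdot> ((Idt V (SHom Q R) \<odot> eps P Q) \<cdot> asc V (SHom Q R) (SHom P Q) (fst P))"
proof -
  note A = Str_ob[OF P] and B = Str_ob[OF Q] and C = Str_ob[OF R]
  note p = str_inc_hom[OF P R] and q = str_inc_hom[OF Q R] and r = str_inc_hom[OF P Q]
  let ?i = "str_inc V L P Q" and ?j = "str_inc V L Q R" and ?PQ = "ihom V (fst P) (fst Q)" and ?QR = "ihom V (fst Q) (fst R)"
  note o = SHom_ob[OF P R] SHom_ob[OF Q R] SHom_ob[OF P Q] ihom_ob[OF A B] ihom_ob[OF B C]
  have t: "?j \<odot> ?i \<in> Hom V (SHom Q R \<otimes> SHom P Q) (?QR \<otimes> ?PQ)"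
    "(?j \<odot> ?i) \<odot> Idt V (fst P) \<in> Hom V ((SHom Q R \<otimes> SHom P Q) \<otimes> fst P) ((?QR \<otimes> ?PQ) \<otimes> fst P)"
    "asc V ?QR ?PQ (fst P) \<in> Hom V ((?QR \<otimes> ?PQ) \<otimes> fst P) (?QR \<otimes> (?PQ \<otimes> fst P))"
    "asc V (SHom Q R) (SHom P Q) (fst P) \<in> Hom V ((SHom Q R \<otimes> SHom P Q) \<otimes> fst P) (SHom Q R \<otimes> (SHom P Q \<otimes> fst P))"
    "?j \<odot> (?i \<odot> Idt V (fst P)) \<in> Hom V (SHom Q R \<otimes> (SHom P Q \<otimes> fst P)) (?QR \<otimes> (?PQ \<otimes> fst P))"
    "Idt V ?QR \<odot> ev V (fst P) (fst Q) \<in> Hom V (?QR \<otimes> (?PQ \<otimes> fst P)) (?QR \<otimes> fst Q)"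
    "ev V (fst Q) (fst R) \<in> Hom V (?QR \<otimes> fst Q) (fst R)"
    "ev V (fst P) (fst Q) \<in> Hom V (?PQ \<otimes> fst P) (fst Q)"
    "?j \<odot> Idt V (fst Q) \<in> Hom V (SHom Q R \<otimes> fst Q) (?QR \<otimes> fst Q)"
    "?i \<odot> Idt V (fst P) \<in> Hom V (SHom P Q \<otimes> fst P) (?PQ \<otimes> fst P)"
    using A B C p q r o by - (assumption | rule ten_hom idt_hom asc_hom ev_hom)+
  have e: "eps P Q \<in> Hom V (SHom P Q \<otimes> fst P) (fst Q)" by (rule phomD(4)[OF eps_phom[OF P Q]])
  have m: "(Idt V ?QR \<odot> ev V (fst P) (fst Q)) \<cdot> (?j \<odot> (?i \<odot> Idt V (fst P))) = (?j \<odot> Idt V (fst Q)) \<cdot> (Idt V (SHom Q R) \<odot> eps P Q)"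
    unfolding ten_left_right[OF q e]
    by (simp only: ten_cmp[OF q idt_hom[OF o(5)] t(10,8), symmetric] idt_left[OF q] eps_def unc_def)
  have ic: "icomp V (fst P) (fst Q) (fst R) \<cdot> (?j \<odot> ?i) \<in> Hom V (SHom Q R \<otimes> SHom P Q) (ihom V (fst P) (fst R))"
    by (rule cmp_hom[OF t(1) icomp_hom[OF A B C]])
  have "unc (fst P) (fst R) (icomp V (fst P) (fst Q) (fst R) \<cdot> (?j \<odot> ?i)) =
     ev V (fst Q) (fst R) \<cdot> (Idt V ?QR \<odot> ev V (fst P) (fst Q)) \<cdot> asc V ?QR ?PQ (fst P) \<cdot> ((?j \<odot> ?i) \<odot> Idt V (fst P))"
    by (simp only: unc_cmp[OF icomp_hom[OF A B C] t(1) A C] unc_icomp[OF A B C])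
  also have "\<dots> = ev V (fst Q) (fst R) \<cdot> ((Idt V ?QR \<odot> ev V (fst P) (fst Q)) \<cdot> (asc V ?QR ?PQ (fst P) \<cdot> ((?j \<odot> ?i) \<odot> Idt V (fst P))))"
    using t cmp_hom[OF t(6,7)] cmp_hom[OF t(3,6)] by (simp only: assocs)
  also have "\<dots> = ev V (fst Q) (fst R) \<cdot> (((Idt V ?QR \<odot> ev V (fst P) (fst Q)) \<cdot> (?j \<odot> (?i \<odot> Idt V (fst P)))) \<cdot> asc V (SHom Q R) (SHom P Q) (fst P))"
    unfolding asc_nat[OF q r idt_hom[OF A]] using t by (simp only: assocs)
  also have "\<dots> = eps Q R \<cdot> ((Idt V (SHom Q R) \<odot> eps P Q) \<cdot> asc V (SHom Q R) (SHom P Q) (fst P))"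
    unfolding m unfolding eps_def[of Q R] unc_def
    using t ten_hom[OF idt_hom[OF o(2)] e] by (simp only: assocs)
  finally have c: "unc (fst P) (fst R) (icomp V (fst P) (fst Q) (fst R) \<cdot> (?j \<odot> ?i)) =
     eps Q R \<cdot> ((Idt V (SHom Q R) \<odot> eps P Q) \<cdot> asc V (SHom Q R) (SHom P Q) (fst P))" .
  have iff: "str_inc V L P R \<cdot> u = icomp V (fst P) (fst Q) (fst R) \<cdot> (?j \<odot> ?i) \<longleftrightarrow>
      eps P R \<cdot> (u \<odot> Idt V (fst P)) = eps Q R \<cdot> ((Idt V (SHom Q R) \<odot> eps P Q) \<cdot> asc V (SHom Q R) (SHom P Q) (fst P))"
    if u: "u \<in> Hom V (SHom Q R \<otimes> SHom P Q) (SHom P R)" for u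
    using unc_inc[OF P R u] c unc_inject[OF _ cmp_hom[OF u p] ic A C] by metis
  moreover have "\<exists>!u. u \<in> Hom V (SHom Q R \<otimes> SHom P Q) (SHom P R) \<and>
      eps P R \<cdot> (u \<odot> Idt V (fst P)) = eps Q R \<cdot> ((Idt V (SHom Q R) \<odot> eps P Q) \<cdot> asc V (SHom Q R) (SHom P Q) (fst P))"
    by (rule eps_universal[OF P R phom_comp[OF eps_phom[OF Q R] eps_phom[OF P Q]]])
  ultimately have "\<exists>!u. u \<in> Hom V (SHom Q R \<otimes> SHom P Q) (SHom P R) \<and>
      str_inc V L P R \<cdot> u = icomp V (fst P) (fst Q) (fst R) \<cdot> (?j \<odot> ?i)"
    by metis
  from theI'[OF this, folded str_comp_def] show "str_comp V L P Q R \<in> Hom V (SHom Q R \<otimes> SHom P Q) (SHom P R)"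
    "eps P R \<cdot> (str_comp V L P Q R \<odot> Idt V (fst P)) =
      eps Q R \<cdot> ((Idt V (SHom Q R) \<odot> eps P Q) \<cdot> asc V (SHom Q R) (SHom P Q) (fst P))"
    using iff by blast+
qed

end


section \<open>Limits and powers of structures\<close>

context structures
begin

text \<open>The carrier represents the families satisfying \<open>cond\<close>, and
  \<open>closed\<close> says that applying an operation to such a family gives another one, so the
  operations are induced. A trivial condition yields products, a single index yields
  substructures.\<close>

lemma Str_limit:
  fixes I :: "'i set" and Q :: "'i \<Rightarrow> ('o, 'm, 'f) struct" and cond :: "'o \<Rightarrow> ('i \<Rightarrow> 'm) \<Rightarrow> bool"
  assumes sI: "small \<kappa> I" and Q: "\<And>i. i \<in> I \<Longrightarrow> Q i \<in> Ob StrL"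
    and stable: "\<And>Z Z' p p' f. \<lbrakk>f \<in> Hom V Z' Z; \<forall>i\<in>I. p i \<in> Hom V Z (fst (Q i)); cond Z p;
      \<forall>i\<in>I. p' i = p i \<cdot> f\<rbrakk> \<Longrightarrow> cond Z' p'"
    and local: "\<And>Z p K. \<lbrakk>effective_sink V K Z; \<forall>i\<in>I. p i \<in> Hom V Z (fst (Q i));
      \<forall>(A, f)\<in>K. cond A (\<lambda>i. p i \<cdot> f)\<rbrakk> \<Longrightarrow> cond Z p"
    and closed: "\<And>Z p f. \<lbrakk>Z \<in> Ob V; \<forall>i\<in>I. p i \<in> Hom V Z (fst (Q i)); cond Z p; f \<in> Sym L\<rbrakk> \<Longrightarrow>
      cond (ihom V (In L f) Z \<otimes> Out L f)
        (\<lambda>i. unc (Out L f) (fst (Q i)) (snd (Q i) f \<cdot> post V (In L f) Z (fst (Q i)) (p i)))"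
  obtains P q where "P \<in> Ob StrL" "\<And>i. i \<in> I \<Longrightarrow> q i \<in> Hom StrL P (Q i)" "cond (fst P) q"
    "\<And>Z p. \<lbrakk>Z \<in> Ob V; \<forall>i\<in>I. p i \<in> Hom V Z (fst (Q i)); cond Z p\<rbrakk>
      \<Longrightarrow> \<exists>u. u \<in> Hom V Z (fst P) \<and> (\<forall>i\<in>I. q i \<cdot> u = p i)"
    "\<And>Z u v. \<lbrakk>u \<in> Hom V Z (fst P); v \<in> Hom V Z (fst P); \<forall>i\<in>I. q i \<cdot> u = q i \<cdot> v\<rbrakk> \<Longrightarrow> u = v"
    "\<And>R u. \<lbrakk>u \<in> Hom V (fst R) (fst P); R \<in> Ob StrL; \<forall>i\<in>I. q i \<cdot> u \<in> Hom StrL R (Q i)\<rbrakk> \<Longrightarrow> u \<in> Hom StrL R P"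
proof -
  obtain T q where T: "T \<in> Ob V" and q: "\<And>i. i \<in> I \<Longrightarrow> q i \<in> Hom V T (fst (Q i))" and cT: "cond T q"
    and univ: "\<And>Z p. \<lbrakk>Z \<in> Ob V; \<forall>i\<in>I. p i \<in> Hom V Z (fst (Q i)); cond Z p\<rbrakk>
      \<Longrightarrow> \<exists>!u. u \<in> Hom V Z T \<and> (\<forall>i\<in>I. q i \<cdot> u = p i)"
    by (rule representable[OF sI Str_ob[OF Q] stable local]) (assumption | (rule that; assumption))+
  have uniq: "u = v" if u: "u \<in> Hom V Z T" "v \<in> Hom V Z T" and e: "\<And>i. i \<in> I \<Longrightarrow> q i \<cdot> u = q i \<cdot> v" for Z u v
  proof -
    have "cond Z (\<lambda>i. q i \<cdot> u)" by (rule stable[OF u(1) _ cT]) (use q in auto)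
    then have "\<exists>!w. w \<in> Hom V Z T \<and> (\<forall>i\<in>I. q i \<cdot> w = q i \<cdot> u)"
      using univ[of Z "\<lambda>i. q i \<cdot> u"] cmp_hom[OF u(1) q] hom_ob[OF u(1)] by simp
    moreover have "\<forall>i\<in>I. q i \<cdot> v = q i \<cdot> u" using e by simp
    ultimately show ?thesis using u by blast
  qed
  let ?p = "\<lambda>f i. unc (Out L f) (fst (Q i)) (snd (Q i) f \<cdot> post V (In L f) T (fst (Q i)) (q i))"
  have p_hom: "snd (Q i) f \<cdot> post V (In L f) T (fst (Q i)) (q i) \<in> Hom V (ihom V (In L f) T) (ihom V (Out L f) (fst (Q i)))"
    if "i \<in> I" "f \<in> Sym L" for i f
    by (rule cmp_hom[OF post_hom[OF q[OF that(1)] arity_ob(1)[OF that(2)]] Str_op[OF Q[OF that(1)] that(2)]])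
  \<comment> \<open>The universal property is applied to what \<open>closed\<close> makes of the
    universal family \<open>q\<close> itself; the resulting arrow is the transpose of the
    operation.\<close>
  have "\<exists>c. c \<in> Hom V (ihom V (In L f) T) (ihom V (Out L f) T) \<and> (\<forall>i\<in>I. post V (Out L f) T (fst (Q i)) (q i) \<cdot> c =
      snd (Q i) f \<cdot> post V (In L f) T (fst (Q i)) (q i))" if f: "f \<in> Sym L" for f
  proof -
    note X = arity_ob(1)[OF f] and Y = arity_ob(2)[OF f]
    note XT = ihom_ob[OF X T]
    have "\<exists>!u. u \<in> Hom V (ihom V (In L f) T \<otimes> Out L f) T \<and> (\<forall>i\<in>I. q i \<cdot> u = ?p f i)"
      by (rule univ[OF ten_ob[OF XT Y] _ closed[OF T _ cT f]])
        (use q unc_hom[OF p_hom[OF _ f] Y Str_ob[OF Q]] in auto)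
    then obtain u where u: "u \<in> Hom V (ihom V (In L f) T \<otimes> Out L f) T" "\<And>i. i \<in> I \<Longrightarrow> q i \<cdot> u = ?p f i" by blast
    note c = curry_hom[OF u(1) XT Y] unc_curry[OF u(1) XT Y]
    have "post V (Out L f) T (fst (Q i)) (q i) \<cdot> curry V (ihom V (In L f) T) (Out L f) T u =
      snd (Q i) f \<cdot> post V (In L f) T (fst (Q i)) (q i)" if i: "i \<in> I" for i
      by (rule unc_inject[OF _ cmp_hom[OF c(1) post_hom[OF q[OF i] Y]] p_hom[OF i f] Y Str_ob[OF Q[OF i]]])
        (simp only: unc_post[OF q[OF i] c(1) Y] c(2) u(2)[OF i])
    then show ?thesis using c(1) by blast
  qed
  then obtain c where c: "\<And>f. f \<in> Sym L \<Longrightarrow> c f \<in> Hom V (ihom V (In L f) T) (ihom V (Out L f) T)"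
    and qc: "\<And>f i. \<lbrakk>f \<in> Sym L; i \<in> I\<rbrakk> \<Longrightarrow> post V (Out L f) T (fst (Q i)) (q i) \<cdot> c f = snd (Q i) f \<cdot> post V (In L f) T (fst (Q i)) (q i)"
    by metis
  let ?P = "(T, restrict c (Sym L))"
  have P: "?P \<in> Ob StrL" by (rule Str_obI[OF T c])
  show ?thesis
  proof (rule that[of ?P q, unfolded fst_conv, OF P _ cT])
    show "q i \<in> Hom StrL ?P (Q i)" if "i \<in> I" for i
      unfolding Str_hom_iff using P Q[OF that] q[OF that] qc that by simp
    show "\<exists>u. u \<in> Hom V Z T \<and> (\<forall>i\<in>I. q i \<cdot> u = p i)"
      if "Z \<in> Ob V" "\<forall>i\<in>I. p i \<in> Hom V Z (fst (Q i))" "cond Z p" for Z p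
      using univ[of Z p] that by blast
    show "u = v" if "u \<in> Hom V Z T" "v \<in> Hom V Z T" "\<forall>i\<in>I. q i \<cdot> u = q i \<cdot> v" for Z u v
      using uniq that by blast
    fix R u assume u: "u \<in> Hom V (fst R) T" and R: "R \<in> Ob StrL" and h: "\<forall>i\<in>I. q i \<cdot> u \<in> Hom StrL R (Q i)"
    have "post V (Out L f) (fst R) T u \<cdot> snd R f = c f \<cdot> post V (In L f) (fst R) T u" if f: "f \<in> Sym L" for f
    proof -
      note X = arity_ob(1)[OF f] and Y = arity_ob(2)[OF f] and r = Str_op[OF R f]
      note uX = post_hom[OF u X] and uY = post_hom[OF u Y]
      note h1 = cmp_hom[OF r uY] and h2 = cmp_hom[OF uX c[OF f]]
      \<comment> \<open>After transposing, both sides are arrows into \<open>T\<close>, where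
        equality may be tested on the projections \<open>q i\<close>.\<close>
      show ?thesis
      proof (rule unc_inject[OF uniq h1 h2 Y T])
        fix i assume i: "i \<in> I"
        note k = Str_homD[OF bspec[OF h i]] and B = Str_ob[OF Q[OF i]] and qi = q[OF i]
        note qX = post_hom[OF qi X] and qY = post_hom[OF qi Y]
        have "q i \<cdot> unc (Out L f) T (post V (Out L f) (fst R) T u \<cdot> snd R f) =
            unc (Out L f) (fst (Q i)) (post V (Out L f) T (fst (Q i)) (q i) \<cdot> post V (Out L f) (fst R) T u \<cdot> snd R f)"
          by (simp only: cmp_assoc[OF r uY qY] unc_post[OF qi h1 Y])
        also have "\<dots> = unc (Out L f) (fst (Q i)) (snd (Q i) f \<cdot> (post V (In L f) T (fst (Q i)) (q i) \<cdot> post V (In L f) (fst R) T u))"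
          by (simp only: post_cmp[OF u qi X, symmetric] post_cmp[OF u qi Y, symmetric] k(4)[OF f])
        also have "\<dots> = unc (Out L f) (fst (Q i)) (post V (Out L f) T (fst (Q i)) (q i) \<cdot> (c f \<cdot> post V (In L f) (fst R) T u))"
          by (simp only: cmp_assoc[OF uX qX Str_op[OF Q[OF i] f], symmetric] qc[OF f i, symmetric] cmp_assoc[OF uX c[OF f] qY])
        also have "\<dots> = q i \<cdot> unc (Out L f) T (c f \<cdot> post V (In L f) (fst R) T u)"
          by (rule unc_post[OF qi h2 Y])
        finally show "q i \<cdot> unc (Out L f) T (post V (Out L f) (fst R) T u \<cdot> snd R f) =
            q i \<cdot> unc (Out L f) T (c f \<cdot> post V (In L f) (fst R) T u)" .
      qed (rule unc_hom[OF h1 Y T] unc_hom[OF h2 Y T])+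
    qed
    then show "u \<in> Hom StrL R ?P" unfolding Str_hom_iff using u R P by simp
  qed
qed

lemma Str_product:
  assumes "small \<kappa> I" "\<And>i. i \<in> I \<Longrightarrow> D i \<in> Ob StrL"
  obtains P p where "is_product StrL I D P p"
proof -
  obtain P q where P: "P \<in> Ob StrL" "\<And>i. i \<in> I \<Longrightarrow> q i \<in> Hom StrL P (D i)" "True"
    and ex: "\<And>Z p. \<lbrakk>Z \<in> Ob V; \<forall>i\<in>I. p i \<in> Hom V Z (fst (D i)); True\<rbrakk>
      \<Longrightarrow> \<exists>u. u \<in> Hom V Z (fst P) \<and> (\<forall>i\<in>I. q i \<cdot> u = p i)"
    and uniq: "\<And>Z u v. \<lbrakk>u \<in> Hom V Z (fst P); v \<in> Hom V Z (fst P); \<forall>i\<in>I. q i \<cdot> u = q i \<cdot> v\<rbrakk> \<Longrightarrow> u = v"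
    and hom: "\<And>R u. \<lbrakk>u \<in> Hom V (fst R) (fst P); R \<in> Ob StrL; \<forall>i\<in>I. q i \<cdot> u \<in> Hom StrL R (D i)\<rbrakk> \<Longrightarrow> u \<in> Hom StrL R P"
    by (rule Str_limit[of I D "\<lambda>_ _. True"]) (assumption | rule TrueI assms | (rule that; assumption))+
  have "is_product StrL I D P q"
    unfolding is_product_def
  proof (intro conjI ballI allI impI)
    fix R p assume R: "R \<in> Ob StrL" and p: "\<forall>i\<in>I. p i \<in> Hom StrL R (D i)"
    obtain u where u: "u \<in> Hom V (fst R) (fst P)" "\<forall>i\<in>I. q i \<cdot> u = p i"
      using ex[of "fst R" p] Str_ob[OF R] Str_homD(3) p by blast
    have "u \<in> Hom StrL R P" by (rule hom[OF u(1) R]) (use u(2) p in auto)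
    then show "\<exists>!u. u \<in> Hom StrL R P \<and> (\<forall>i\<in>I. q i \<cdot>\<^bsub>StrL\<^esub> u = p i)"
      unfolding Str_cmp
    proof (intro ex1I[of _ u] conjI u(2))
      fix v assume v: "v \<in> Hom StrL R P \<and> (\<forall>i\<in>I. q i \<cdot> v = p i)"
      show "v = u" by (rule uniq[OF Str_homD(3)[OF conjunct1[OF v]] u(1)]) (use u(2) v in simp)
    qed
  qed (use P in auto)
  then show ?thesis using that by blast
qed

text \<open>The substructure classified by a local condition that the operations respect. Equalizers
  and intersections of preimages, for families of any size, are of this form.\<close>

lemma Str_sub:
  assumes A: "A \<in> Ob StrL"
    and stable: "\<And>Z Z' p f. \<lbrakk>f \<in> Hom V Z' Z; p \<in> Hom V Z (fst A); cond Z p\<rbrakk> \<Longrightarrow> cond Z' (p \<cdot> f)"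
    and local: "\<And>Z p K. \<lbrakk>effective_sink V K Z; p \<in> Hom V Z (fst A); \<And>A f. (A, f) \<in> K \<Longrightarrow> cond A (p \<cdot> f)\<rbrakk> \<Longrightarrow> cond Z p"
    and closed: "\<And>Z p f. \<lbrakk>p \<in> Hom V Z (fst A); cond Z p; f \<in> Sym L\<rbrakk> \<Longrightarrow>
      cond (ihom V (In L f) Z \<otimes> Out L f) (unc (Out L f) (fst A) (snd A f \<cdot> post V (In L f) Z (fst A) p))"
  obtains M q where "q \<in> Hom StrL M A" "cond (fst M) q" "monomorphism V (fst M) (fst A) q"
    "\<And>Z p. \<lbrakk>p \<in> Hom V Z (fst A); cond Z p\<rbrakk> \<Longrightarrow> \<exists>u. u \<in> Hom V Z (fst M) \<and> q \<cdot> u = p"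
proof -
  have sI: "small \<kappa> {()}" by (rule small_finite) simp
  obtain P q where P: "P \<in> Ob StrL" "\<And>i. i \<in> {()} \<Longrightarrow> q i \<in> Hom StrL P A" "cond (fst P) (q ())"
    and ex: "\<And>Z p. \<lbrakk>Z \<in> Ob V; \<forall>i\<in>{()}. p i \<in> Hom V Z (fst A); cond Z (p ())\<rbrakk>
      \<Longrightarrow> \<exists>u. u \<in> Hom V Z (fst P) \<and> (\<forall>i\<in>{()}. q i \<cdot> u = p i)"
    and uniq: "\<And>Z u v. \<lbrakk>u \<in> Hom V Z (fst P); v \<in> Hom V Z (fst P); \<forall>i\<in>{()}. q i \<cdot> u = q i \<cdot> v\<rbrakk> \<Longrightarrow> u = v"
    and "\<And>R u. \<lbrakk>u \<in> Hom V (fst R) (fst P); R \<in> Ob StrL; \<forall>i\<in>{()}. q i \<cdot> u \<in> Hom StrL R A\<rbrakk> \<Longrightarrow> u \<in> Hom StrL R P"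
  proof (rule Str_limit[OF sI, of "\<lambda>_. A" "\<lambda>Z p. cond Z (p ())"])
    fix Z p K assume "effective_sink V K Z" "\<forall>i\<in>{()}. p i \<in> Hom V Z (fst A)" "\<forall>(A, f)\<in>K. cond A (p () \<cdot> f)"
    then show "cond Z (p ())" using local[of K Z "p ()"] by blast
  next
    fix Z Z' p p' f assume "f \<in> Hom V Z' Z" "\<forall>i\<in>{()}. p i \<in> Hom V Z (fst A)" "cond Z (p ())" "\<forall>i\<in>{()}. p' i = p i \<cdot> f"
    then show "cond Z' (p' ())" using stable[of f Z' Z "p ()"] by simp
  next
    fix Z p f assume "Z \<in> Ob V" "\<forall>i\<in>{()}. p i \<in> Hom V Z (fst A)" "cond Z (p ())" "f \<in> Sym L"
    then show "cond (ihom V (In L f) Z \<otimes> Out L f) (unc (Out L f) (fst A) (snd A f \<cdot> post V (In L f) Z (fst A) (p ())))"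
      using closed[of "p ()" Z f] by blast
  qed (rule A, (rule that; assumption))
  note q = Str_homD(3)[OF P(2)[OF singletonI]]
  show ?thesis
  proof (rule that[of "q ()" P])
    show "monomorphism V (fst P) (fst A) (q ())" unfolding monomorphism_def using q uniq by blast
    show "\<exists>u. u \<in> Hom V Z (fst P) \<and> q () \<cdot> u = p" if "p \<in> Hom V Z (fst A)" "cond Z p" for Z p
      using ex[of Z "\<lambda>_. p"] that hom_ob by blast
  qed (use P in auto)
qed

text \<open>Transposing turns the homomorphism equation into one between arrows into
  \<open>M\<close>, and there \<open>m\<close> may be cancelled.\<close>

lemma hom_lift:
  assumes m: "m \<in> Hom StrL M P" "monomorphism V (fst M) (fst P) m" and k: "k \<in> Hom StrL R P"
    and g: "g \<in> Hom V (fst R) (fst M)" "m \<cdot> g = k"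
  shows "g \<in> Hom StrL R M"
proof -
  note m' = Str_homD[OF m(1)] and k' = Str_homD[OF k]
  have "post V (Out L f) (fst R) (fst M) g \<cdot> snd R f = snd M f \<cdot> post V (In L f) (fst R) (fst M) g" if f: "f \<in> Sym L" for f
  proof -
    note X = arity_ob(1)[OF f] and Y = arity_ob(2)[OF f] and r = Str_op[OF k'(1) f] and mm = Str_op[OF m'(1) f] and p = Str_op[OF m'(2) f]
    note gX = post_hom[OF g(1) X] and gY = post_hom[OF g(1) Y] and mX = post_hom[OF m'(3) X] and mY = post_hom[OF m'(3) Y]
    note h1 = cmp_hom[OF r gY] and h2 = cmp_hom[OF gX mm]
    note o = Str_ob[OF m'(1)]
    have "m \<cdot> unc (Out L f) (fst M) (post V (Out L f) (fst R) (fst M) g \<cdot> snd R f) =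
        unc (Out L f) (fst P) (post V (Out L f) (fst M) (fst P) m \<cdot> post V (Out L f) (fst R) (fst M) g \<cdot> snd R f)"
      by (simp only: cmp_assoc[OF r gY mY] unc_post[OF m'(3) h1 Y])
    also have "\<dots> = unc (Out L f) (fst P) (snd P f \<cdot> (post V (In L f) (fst M) (fst P) m \<cdot> post V (In L f) (fst R) (fst M) g))"
      by (simp only: post_cmp[OF g(1) m'(3) X, symmetric] post_cmp[OF g(1) m'(3) Y, symmetric] g(2) k'(4)[OF f])
    also have "\<dots> = m \<cdot> unc (Out L f) (fst M) (snd M f \<cdot> post V (In L f) (fst R) (fst M) g)"
      by (simp only: cmp_assoc[OF gX mX p, symmetric] m'(4)[OF f, symmetric] cmp_assoc[OF gX mm mY] unc_post[OF m'(3) h2 Y])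
    finally show ?thesis
      by (rule unc_inject[OF monoD[OF m(2) _ unc_hom[OF h1 Y o] unc_hom[OF h2 Y o]] h1 h2 Y o])
  qed
  then show ?thesis unfolding Str_hom_iff using g k' m' by simp
qed


subsection \<open>Powers\<close>

text \<open>
  The power \<open>Q\<^sup>Z\<close> has carrier \<open>[Z,UQ]\<close>; its operations are forced by requiring evaluation to be a
  parametrized homomorphism.
\<close>

lemma power_structure:
  assumes Z: "Z \<in> Ob V" and Q: "Q \<in> Ob StrL"
  obtains P where "fst P = ihom V Z (fst Q)" "phom Z P Q (evs Z (fst Q))"
    "\<And>A k. phom Z A Q k \<Longrightarrow> \<exists>h. h \<in> Hom StrL A P \<and> evs Z (fst Q) \<cdot> (Idt V Z \<odot> h) = k"
    "\<And>W R g. \<lbrakk>phom (Z \<otimes> W) R Q g; W \<in> Ob V\<rbrakk> \<Longrightarrow>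
      \<exists>k. phom W R P k \<and> evs Z (fst Q) \<cdot> ((Idt V Z \<odot> k) \<cdot> asc V Z W (fst R)) = g"
proof -
  let ?B = "fst Q" and ?ZB = "ihom V Z (fst Q)" and ?E = "evs Z (fst Q)"
  note B = Str_ob[OF Q]
  note ZB = ihom_ob[OF Z B] and E = evs_hom[OF Z B] and iZ = idt_hom[OF Z]
  let ?e = "\<lambda>X. ext Z X ?ZB ?B ?E"
  \<comment> \<open>\<open>ext_evs_universal\<close> solves exactly the equation that makes
    evaluation a parametrized homomorphism.\<close>
  have "\<exists>c. c \<in> Hom V (ihom V (In L f) ?ZB) (ihom V (Out L f) ?ZB) \<and> ?e (Out L f) \<cdot> (Idt V Z \<odot> c) = snd Q f \<cdot> ?e (In L f)"
    if f: "f \<in> Sym L" for f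
  proof -
    note X = arity_ob(1)[OF f] and Y = arity_ob(2)[OF f]
    show ?thesis
      by (rule ext_evs_universal[OF cmp_hom[OF ext_hom[OF E Z X ZB] Str_op[OF Q f]] Z Y B ihom_ob[OF X ZB]]) blast
  qed
  then obtain c where c: "\<And>f. f \<in> Sym L \<Longrightarrow> c f \<in> Hom V (ihom V (In L f) ?ZB) (ihom V (Out L f) ?ZB)"
    and ec: "\<And>f. f \<in> Sym L \<Longrightarrow> ?e (Out L f) \<cdot> (Idt V Z \<odot> c f) = snd Q f \<cdot> ?e (In L f)" by metis
  let ?P = "(?ZB, restrict c (Sym L))"
  have P: "?P \<in> Ob StrL" by (rule Str_obI[OF ZB c])
  have ph: "phom Z ?P Q ?E" unfolding phom_def using Z P Q E ec by simp
  show ?thesis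
  proof (rule that[of ?P, unfolded fst_conv, OF refl ph])
    fix A k assume k: "phom Z A Q k"
    note k = phomD[OF k]
    obtain h where h: "h \<in> Hom V (fst A) ?ZB" "?E \<cdot> (Idt V Z \<odot> h) = k" by (rule evs_universal[OF k(4) Z k(5)])
    have "post V (Out L f) (fst A) ?ZB h \<cdot> snd A f = c f \<cdot> post V (In L f) (fst A) ?ZB h" if f: "f \<in> Sym L" for f
    proof -
      note X = arity_ob(1)[OF f] and Y = arity_ob(2)[OF f]
      note hX = post_hom[OF h(1) X] and hY = post_hom[OF h(1) Y] and a = Str_op[OF k(2) f] and b = Str_op[OF Q f]
      note e = ext_hom[OF E Z X ZB] ext_hom[OF E Z Y ZB]
      have "?e (Out L f) \<cdot> (Idt V Z \<odot> (post V (Out L f) (fst A) ?ZB h \<cdot> snd A f)) = ext Z (Out L f) (fst A) ?B k \<cdot> (Idt V Z \<odot> snd A f)"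
        by (simp only: ten_cmp_right[OF a hY Z] cmp_assoc[OF ten_hom[OF iZ a] ten_hom[OF iZ hY] e(2), symmetric]
          ext_arg[OF E h(1) Z Y, symmetric] h(2))
      also have "\<dots> = snd Q f \<cdot> (?e (In L f) \<cdot> (Idt V Z \<odot> post V (In L f) (fst A) ?ZB h))"
        by (simp only: k(7)[OF f, symmetric] ext_arg[OF E h(1) Z X, symmetric] h(2))
      also have "\<dots> = ?e (Out L f) \<cdot> (Idt V Z \<odot> (c f \<cdot> post V (In L f) (fst A) ?ZB h))"
        by (simp only: ten_cmp_right[OF hX c[OF f] Z] cmp_assoc[OF ten_hom[OF iZ hX] ten_hom[OF iZ c[OF f]] e(2), symmetric]
          ec[OF f] cmp_assoc[OF ten_hom[OF iZ hX] e(1) b])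
      finally show ?thesis by (rule ext_evs_inject[OF _ cmp_hom[OF a hY] cmp_hom[OF hX c[OF f]] Z Y B])
    qed
    then have "h \<in> Hom StrL A ?P" unfolding Str_hom_iff using h P k by simp
    then show "\<exists>h. h \<in> Hom StrL A ?P \<and> ?E \<cdot> (Idt V Z \<odot> h) = k" using h(2) by blast
  next
    \<comment> \<open>The preceding case gives an ordinary universal property; the additional
      parameter \<open>W\<close> is what the enriched one requires. The equation for
      \<open>k\<close> is checked after evaluation and reassociation, both of which can be
      cancelled.\<close>
    fix W R g assume g: "phom (Z \<otimes> W) R Q g" and W: "W \<in> Ob V"
    note R = Str_ob[OF phomD(2)[OF g]] and g = phomD[OF g]
    obtain i where i: "asc V Z W (fst R) \<in> Hom V ((Z \<otimes> W) \<otimes> fst R) (Z \<otimes> (W \<otimes> fst R))" "i \<in> Hom V (Z \<otimes> (W \<otimes> fst R)) ((Z \<otimes> W) \<otimes> fst R)"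
      "i \<cdot> asc V Z W (fst R) = Idt V ((Z \<otimes> W) \<otimes> fst R)" "asc V Z W (fst R) \<cdot> i = Idt V (Z \<otimes> (W \<otimes> fst R))"
      by (rule isoE[OF asc_iso[OF Z W R]])
    obtain k where k: "k \<in> Hom V (W \<otimes> fst R) ?ZB" "?E \<cdot> (Idt V Z \<odot> k) = g \<cdot> i"
      by (rule evs_universal[OF cmp_hom[OF i(2) g(4)] Z ten_ob[OF W R]])
    have kg: "?E \<cdot> ((Idt V Z \<odot> k) \<cdot> asc V Z W (fst R)) = g"
      by (simp only: cmp_assoc[OF i(1) ten_hom[OF iZ k(1)] E, symmetric] k(2) cmp_assoc[OF i(1,2) g(4)] i(3) idt_right[OF g(4)])
    have "c f \<cdot> ext W (In L f) (fst R) ?ZB k = ext W (Out L f) (fst R) ?ZB k \<cdot> (Idt V W \<odot> snd R f)" if f: "f \<in> Sym L" for f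
    proof -
      note X = arity_ob(1)[OF f] and Y = arity_ob(2)[OF f]
      note r = Str_op[OF g(2) f] and b = Str_op[OF Q f] and XR = ihom_ob[OF X R] and YR = ihom_ob[OF Y R]
      note e = ext_hom[OF E Z X ZB] ext_hom[OF E Z Y ZB] and eX = ext_hom[OF k(1) W X R] and eY = ext_hom[OF k(1) W Y R]
      note Wr = ten_hom[OF idt_hom[OF W] r]
      note t = ten_hom[OF iZ eX] ten_hom[OF iZ eY] ten_hom[OF iZ c[OF f]] ten_hom[OF iZ Wr]
        asc_hom[OF Z W XR] asc_hom[OF Z W YR] ten_hom[OF idt_hom[OF ten_ob[OF Z W]] r]
      have n: "asc V Z W (ihom V (Out L f) (fst R)) \<cdot> (Idt V (Z \<otimes> W) \<odot> snd R f) =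
          (Idt V Z \<odot> (Idt V W \<odot> snd R f)) \<cdot> asc V Z W (ihom V (In L f) (fst R))"
        using asc_nat[OF iZ idt_hom[OF W] r] ten_idt[OF Z W] by simp
      have "?e (Out L f) \<cdot> (Idt V Z \<odot> (c f \<cdot> ext W (In L f) (fst R) ?ZB k)) \<cdot> asc V Z W (ihom V (In L f) (fst R)) =
          snd Q f \<cdot> (?e (In L f) \<cdot> ((Idt V Z \<odot> ext W (In L f) (fst R) ?ZB k) \<cdot> asc V Z W (ihom V (In L f) (fst R))))"
        by (simp only: ten_cmp_right[OF eX c[OF f] Z] cmp_assoc[OF t(1,3) e(2), symmetric] ec[OF f]
          cmp_assoc[OF t(5,1) cmp_hom[OF e(1) b]] cmp_assoc[OF cmp_hom[OF t(5,1)] e(1) b])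
      also have "\<dots> = ext (Z \<otimes> W) (Out L f) (fst R) ?B g \<cdot> (Idt V (Z \<otimes> W) \<odot> snd R f)"
        by (simp only: ext_comp[OF E k(1) Z W R X, symmetric] kg g(7)[OF f])
      also have "\<dots> = ?e (Out L f) \<cdot> ((Idt V Z \<odot> ext W (Out L f) (fst R) ?ZB k) \<cdot> asc V Z W (ihom V (Out L f) (fst R))) \<cdot> (Idt V (Z \<otimes> W) \<odot> snd R f)"
        by (simp only: ext_comp[OF E k(1) Z W R Y, symmetric] kg)
      also have "\<dots> = ?e (Out L f) \<cdot> ((Idt V Z \<odot> ext W (Out L f) (fst R) ?ZB k) \<cdot> (asc V Z W (ihom V (Out L f) (fst R)) \<cdot> (Idt V (Z \<otimes> W) \<odot> snd R f)))"
        by (simp only: cmp_assoc[OF t(7) cmp_hom[OF t(6,2)] e(2)] cmp_assoc[OF t(7,6,2)])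
      also have "\<dots> = ?e (Out L f) \<cdot> (Idt V Z \<odot> (ext W (Out L f) (fst R) ?ZB k \<cdot> (Idt V W \<odot> snd R f))) \<cdot> asc V Z W (ihom V (In L f) (fst R))"
        by (simp only: n ten_cmp_right[OF Wr eY Z] cmp_assoc[OF t(5) cmp_hom[OF t(4,2)] e(2)] cmp_assoc[OF t(5,4,2)])
      finally have "?e (Out L f) \<cdot> (Idt V Z \<odot> (c f \<cdot> ext W (In L f) (fst R) ?ZB k)) =
          ?e (Out L f) \<cdot> (Idt V Z \<odot> (ext W (Out L f) (fst R) ?ZB k \<cdot> (Idt V W \<odot> snd R f)))"
        by (rule iso_epi[OF asc_iso[OF Z W XR] cmp_hom[OF ten_hom[OF iZ cmp_hom[OF eX c[OF f]]] e(2)]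
            cmp_hom[OF ten_hom[OF iZ cmp_hom[OF Wr eY]] e(2)]])
      then show ?thesis by (rule ext_evs_inject[OF _ cmp_hom[OF eX c[OF f]] cmp_hom[OF Wr eY] Z Y B])
    qed
    then have "phom W R ?P k" unfolding phom_def using W g(2) P k(1) by simp
    then show "\<exists>k. phom W R ?P k \<and> ?E \<cdot> ((Idt V Z \<odot> k) \<cdot> asc V Z W (fst R)) = g" using kg by blast
  qed
qed

abbreviation power_comparison where
  "power_comparison Z Q P \<pi> R \<equiv> curry V (SHom R P) Z (SHom R Q)
     (str_comp V L R P Q \<cdot> (\<pi> \<odot> Idt V (SHom R P)) \<cdot> sym V (SHom R P) Z)"

text \<open>Computes the comparison map in \<open>is_power\<close> on a generalized element: its
  effect on a family is to tensor with \<open>Z\<close> and evaluate. The symmetry only reorders the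
  parameters.\<close>

lemma power_comparison:
  assumes P: "P \<in> Ob StrL" and Q: "Q \<in> Ob StrL" and R: "R \<in> Ob StrL" and Z: "Z \<in> Ob V" and \<pi>: "\<pi> \<in> Hom V Z (SHom P Q)"
  shows "power_comparison Z Q P \<pi> R \<in> Hom V (SHom R P) (ihom V Z (SHom R Q))"
    and "u \<in> Hom V W (SHom R P) \<Longrightarrow>
      eps R Q \<cdot> (unc Z (SHom R Q) (power_comparison Z Q P \<pi> R \<cdot> u) \<odot> Idt V (fst R)) =
      eps P Q \<cdot> (\<pi> \<odot> Idt V (fst P)) \<cdot> ((Idt V Z \<odot> (eps R P \<cdot> (u \<odot> Idt V (fst R)))) \<cdot> asc V Z W (fst R)) \<cdot> (sym V W Z \<odot> Idt V (fst R))"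
proof -
  note A = Str_ob[OF R] and B = Str_ob[OF P] and C = Str_ob[OF Q]
  note o = SHom_ob[OF R P] SHom_ob[OF R Q] SHom_ob[OF P Q]
  note sc = str_comp[OF R P Q]
  note m = ten_hom[OF \<pi> idt_hom[OF o(1)]] sym_hom[OF o(1) Z]
  note e = phomD(4)[OF eps_phom[OF P Q]] phomD(4)[OF eps_phom[OF R P]] phomD(4)[OF eps_phom[OF R Q]]
  have f: "str_comp V L R P Q \<cdot> (\<pi> \<odot> Idt V (SHom R P)) \<cdot> sym V (SHom R P) Z \<in> Hom V (SHom R P \<otimes> Z) (SHom R Q)"
    by (rule cmp_hom[OF m(2) cmp_hom[OF m(1) sc(1)]])
  note c = curry_hom[OF f o(1) Z] unc_curry[OF f o(1) Z]
  show "power_comparison Z Q P \<pi> R \<in> Hom V (SHom R P) (ihom V Z (SHom R Q))" by (rule c)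
  assume u: "u \<in> Hom V W (SHom R P)"
  have W: "W \<in> Ob V" using u hom_ob by blast
  let ?k = "eps R P \<cdot> (u \<odot> Idt V (fst R))"
  have t: "Idt V Z \<odot> u \<in> Hom V (Z \<otimes> W) (Z \<otimes> SHom R P)" "u \<odot> Idt V Z \<in> Hom V (W \<otimes> Z) (SHom R P \<otimes> Z)"
    "sym V W Z \<in> Hom V (W \<otimes> Z) (Z \<otimes> W)" "\<pi> \<odot> u \<in> Hom V (Z \<otimes> W) (SHom P Q \<otimes> SHom R P)"
    "(\<pi> \<odot> u) \<odot> Idt V (fst R) \<in> Hom V ((Z \<otimes> W) \<otimes> fst R) ((SHom P Q \<otimes> SHom R P) \<otimes> fst R)"
    "str_comp V L R P Q \<odot> Idt V (fst R) \<in> Hom V ((SHom P Q \<otimes> SHom R P) \<otimes> fst R) (SHom R Q \<otimes> fst R)"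
    "sym V W Z \<odot> Idt V (fst R) \<in> Hom V ((W \<otimes> Z) \<otimes> fst R) ((Z \<otimes> W) \<otimes> fst R)"
    "asc V (SHom P Q) (SHom R P) (fst R) \<in> Hom V ((SHom P Q \<otimes> SHom R P) \<otimes> fst R) (SHom P Q \<otimes> (SHom R P \<otimes> fst R))"
    "asc V Z W (fst R) \<in> Hom V ((Z \<otimes> W) \<otimes> fst R) (Z \<otimes> (W \<otimes> fst R))"
    "u \<odot> Idt V (fst R) \<in> Hom V (W \<otimes> fst R) (SHom R P \<otimes> fst R)"
    "\<pi> \<odot> (u \<odot> Idt V (fst R)) \<in> Hom V (Z \<otimes> (W \<otimes> fst R)) (SHom P Q \<otimes> (SHom R P \<otimes> fst R))"
    "Idt V (SHom P Q) \<odot> eps R P \<in> Hom V (SHom P Q \<otimes> (SHom R P \<otimes> fst R)) (SHom P Q \<otimes> fst P)"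
    "\<pi> \<odot> Idt V (fst P) \<in> Hom V (Z \<otimes> fst P) (SHom P Q \<otimes> fst P)"
    using u W Z A B o \<pi> sc(1) e by - (assumption | rule ten_hom idt_hom asc_hom sym_hom)+
  have k: "?k \<in> Hom V (W \<otimes> fst R) (fst P)" by (rule cmp_hom[OF t(10) e(2)])
  have Zk: "Idt V Z \<odot> ?k \<in> Hom V (Z \<otimes> (W \<otimes> fst R)) (Z \<otimes> fst P)" by (rule ten_hom[OF idt_hom[OF Z] k])
  have "unc Z (SHom R Q) (power_comparison Z Q P \<pi> R \<cdot> u) =
      str_comp V L R P Q \<cdot> (\<pi> \<odot> Idt V (SHom R P)) \<cdot> sym V (SHom R P) Z \<cdot> (u \<odot> Idt V Z)"
    by (simp only: unc_cmp[OF c(1) u Z o(2)] c(2))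
  also have "\<dots> = str_comp V L R P Q \<cdot> ((\<pi> \<odot> Idt V (SHom R P)) \<cdot> (sym V (SHom R P) Z \<cdot> (u \<odot> Idt V Z)))"
    using t m sc(1) cmp_hom[OF m(1) sc(1)] cmp_hom[OF m(2,1)] by (simp only: assocs)
  also have "\<dots> = str_comp V L R P Q \<cdot> ((\<pi> \<odot> Idt V (SHom R P)) \<cdot> (Idt V Z \<odot> u) \<cdot> sym V W Z)"
    unfolding sym_nat[OF u idt_hom[OF Z]] using t m by (simp only: assocs)
  also have "\<dots> = str_comp V L R P Q \<cdot> ((\<pi> \<odot> u) \<cdot> sym V W Z)"
    by (simp only: ten_left_right[OF \<pi> u])
  finally have "eps R Q \<cdot> (unc Z (SHom R Q) (power_comparison Z Q P \<pi> R \<cdot> u) \<odot> Idt V (fst R)) =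
     eps R Q \<cdot> ((str_comp V L R P Q \<odot> Idt V (fst R)) \<cdot> (((\<pi> \<odot> u) \<odot> Idt V (fst R)) \<cdot> (sym V W Z \<odot> Idt V (fst R))))"
    by (simp only: ten_cmp_left[OF t(3,4) A] ten_cmp_left[OF cmp_hom[OF t(3,4)] sc(1) A])
  also have "\<dots> = eps P Q \<cdot> ((Idt V (SHom P Q) \<odot> eps R P) \<cdot> asc V (SHom P Q) (SHom R P) (fst R)) \<cdot>
      (((\<pi> \<odot> u) \<odot> Idt V (fst R)) \<cdot> (sym V W Z \<odot> Idt V (fst R)))"
    unfolding sc(2)[symmetric] by (rule cmp_assoc[OF cmp_hom[OF t(7,5)] t(6) e(3), symmetric])
  also have "\<dots> = eps P Q \<cdot> ((Idt V (SHom P Q) \<odot> eps R P) \<cdot> ((asc V (SHom P Q) (SHom R P) (fst R) \<cdot>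
      ((\<pi> \<odot> u) \<odot> Idt V (fst R))) \<cdot> (sym V W Z \<odot> Idt V (fst R))))"
    using t e cmp_hom[OF t(8,12)] by (simp only: assocs)
  also have "\<dots> = eps P Q \<cdot> (((Idt V (SHom P Q) \<odot> eps R P) \<cdot> (\<pi> \<odot> (u \<odot> Idt V (fst R)))) \<cdot> (asc V Z W (fst R) \<cdot> (sym V W Z \<odot> Idt V (fst R))))"
    unfolding asc_nat[OF \<pi> u idt_hom[OF A]] using t e by (simp only: assocs)
  also have "(Idt V (SHom P Q) \<odot> eps R P) \<cdot> (\<pi> \<odot> (u \<odot> Idt V (fst R))) = (\<pi> \<odot> Idt V (fst P)) \<cdot> (Idt V Z \<odot> ?k)"
    by (simp only: ten_cmp[OF \<pi> idt_hom[OF o(3)] t(10) e(2), symmetric] idt_left[OF \<pi>] ten_left_right[OF \<pi> k])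
  also have "eps P Q \<cdot> ((\<pi> \<odot> Idt V (fst P)) \<cdot> (Idt V Z \<odot> ?k) \<cdot> (asc V Z W (fst R) \<cdot> (sym V W Z \<odot> Idt V (fst R)))) =
      eps P Q \<cdot> (\<pi> \<odot> Idt V (fst P)) \<cdot> ((Idt V Z \<odot> ?k) \<cdot> asc V Z W (fst R)) \<cdot> (sym V W Z \<odot> Idt V (fst R))"
    using t e Zk cmp_hom[OF t(13) e(1)] cmp_hom[OF t(9) Zk] cmp_hom[OF cmp_hom[OF t(9) Zk] t(13)] by (simp only: assocs)
  finally show "eps R Q \<cdot> (unc Z (SHom R Q) (power_comparison Z Q P \<pi> R \<cdot> u) \<odot> Idt V (fst R)) =
      eps P Q \<cdot> (\<pi> \<odot> Idt V (fst P)) \<cdot> ((Idt V Z \<odot> ?k) \<cdot> asc V Z W (fst R)) \<cdot> (sym V W Z \<odot> Idt V (fst R))" .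
qed

text \<open>Stated for an arbitrary power, as in the definition of a Birkhoff subcategory, whose
  carrier is not known to be an internal hom; only invertibility of the comparison map can be
  used.\<close>

lemma power_inject:
  assumes pw: "is_power V L Z Q P \<pi>" and Q: "Q \<in> Ob StrL" and Z: "Z \<in> Ob V"
    and k: "phom W R P k" "phom W R P k'"
    and e: "eps P Q \<cdot> (\<pi> \<odot> Idt V (fst P)) \<cdot> ((Idt V Z \<odot> k) \<cdot> asc V Z W (fst R)) =
      eps P Q \<cdot> (\<pi> \<odot> Idt V (fst P)) \<cdot> ((Idt V Z \<odot> k') \<cdot> asc V Z W (fst R))"
  shows "k = k'"
proof -
  note R = phomD(2)[OF k(1)] and W = phomD(1)[OF k(1)]
  have P: "P \<in> Ob StrL" and \<pi>: "\<pi> \<in> Hom V Z (SHom P Q)" and iso: "iso V (SHom R P) (ihom V Z (SHom R Q)) (power_comparison Z Q P \<pi> R)"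
    using pw R unfolding is_power_def by auto
  note c = power_comparison[OF P Q R Z \<pi>]
  note o = SHom_ob[OF R Q]
  obtain u where u: "u \<in> Hom V W (SHom R P)" "eps R P \<cdot> (u \<odot> Idt V (fst R)) = k"
    using eps_universal[OF R P k(1)] by blast
  obtain u' where u': "u' \<in> Hom V W (SHom R P)" "eps R P \<cdot> (u' \<odot> Idt V (fst R)) = k'"
    using eps_universal[OF R P k(2)] by blast
  note h = cmp_hom[OF u(1) c(1)] cmp_hom[OF u'(1) c(1)]
  have "eps R Q \<cdot> (unc Z (SHom R Q) (power_comparison Z Q P \<pi> R \<cdot> u) \<odot> Idt V (fst R)) =
      eps R Q \<cdot> (unc Z (SHom R Q) (power_comparison Z Q P \<pi> R \<cdot> u') \<odot> Idt V (fst R))"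
    by (simp only: c(2)[OF u(1)] c(2)[OF u'(1)] u(2) u'(2) e)
  then have "unc Z (SHom R Q) (power_comparison Z Q P \<pi> R \<cdot> u) = unc Z (SHom R Q) (power_comparison Z Q P \<pi> R \<cdot> u')"
    by (rule eps_inject[OF R Q unc_hom[OF h(1) Z o] unc_hom[OF h(2) Z o]])
  then have "power_comparison Z Q P \<pi> R \<cdot> u = power_comparison Z Q P \<pi> R \<cdot> u'"
    by (rule unc_inject[OF _ h Z o])
  then have "u = u'" by (rule iso_mono[OF iso u(1) u'(1)])
  then show ?thesis using u u' by simp
qed

text \<open>The power constructed here also has carrier \<open>[Z,UQ]\<close> and turns families
  over \<open>Z\<close> into ordinary homomorphisms. This is how enriched universal properties are
  reduced to ordinary ones below.\<close>

lemma power_exists: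
  assumes Z: "Z \<in> Ob V" and Q: "Q \<in> Ob StrL"
  obtains P \<pi> where "is_power V L Z Q P \<pi>" "\<And>A k. phom Z A Q k \<Longrightarrow> \<exists>h. h \<in> Hom StrL A P \<and> evs Z (fst Q) \<cdot> (Idt V Z \<odot> h) = k"
    "phom Z P Q (evs Z (fst Q))" "fst P = ihom V Z (fst Q)"
proof -
  obtain P where P1: "fst P = ihom V Z (fst Q)" and P2: "phom Z P Q (evs Z (fst Q))"
    and P3: "\<And>A k. phom Z A Q k \<Longrightarrow> \<exists>h. h \<in> Hom StrL A P \<and> evs Z (fst Q) \<cdot> (Idt V Z \<odot> h) = k"
    and P4: "\<And>W R g. \<lbrakk>phom (Z \<otimes> W) R Q g; W \<in> Ob V\<rbrakk> \<Longrightarrow>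
      \<exists>k. phom W R P k \<and> evs Z (fst Q) \<cdot> ((Idt V Z \<odot> k) \<cdot> asc V Z W (fst R)) = g"
    using power_structure[OF Z Q] by metis
  note P = phomD(2)[OF P2] and B = Str_ob[OF Q]
  obtain \<pi> where \<pi>: "\<pi> \<in> Hom V Z (SHom P Q)" "eps P Q \<cdot> (\<pi> \<odot> Idt V (fst P)) = evs Z (fst Q)"
    using eps_universal[OF P Q P2] by blast
  have "iso V (SHom R P) (ihom V Z (SHom R Q)) (power_comparison Z Q P \<pi> R)" if R: "R \<in> Ob StrL" for R
  proof -
    note c = power_comparison[OF P Q R Z \<pi>(1), unfolded \<pi>(2)] and A = Str_ob[OF R] and o = SHom_ob[OF R Q]
    show ?thesis
    proof (rule isoI_elements[OF c(1)])
      fix W v assume v: "v \<in> Hom V W (ihom V Z (SHom R Q))"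
      have W: "W \<in> Ob V" using v hom_ob by blast
      note uv = unc_hom[OF v Z o]
      note s = sym_hom[OF Z W] sym_hom[OF W Z]
      let ?g' = "eps R Q \<cdot> (unc Z (SHom R Q) v \<odot> Idt V (fst R))"
      have g': "phom (W \<otimes> Z) R Q ?g'" by (rule phom_param[OF eps_phom[OF R Q] uv])
      obtain k where k: "phom W R P k"
        "evs Z (fst Q) \<cdot> ((Idt V Z \<odot> k) \<cdot> asc V Z W (fst R)) = ?g' \<cdot> (sym V Z W \<odot> Idt V (fst R))"
        using P4[OF phom_param[OF g' s(1)] W] by blast
      obtain u where u: "u \<in> Hom V W (SHom R P)" "eps R P \<cdot> (u \<odot> Idt V (fst R)) = k"
        using eps_universal[OF R P k(1)] by blast
      note h = cmp_hom[OF u(1) c(1)]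
      have "eps R Q \<cdot> (unc Z (SHom R Q) (power_comparison Z Q P \<pi> R \<cdot> u) \<odot> Idt V (fst R)) =
          ?g' \<cdot> (sym V Z W \<odot> Idt V (fst R)) \<cdot> (sym V W Z \<odot> Idt V (fst R))"
        by (simp only: c(2)[OF u(1)] u(2) k(2))
      also have "\<dots> = ?g'"
        by (simp only: cmp_assoc[OF ten_hom[OF s(2) idt_hom[OF A]] ten_hom[OF s(1) idt_hom[OF A]] phomD(4)[OF g']]
          ten_cmp_left[OF s(2,1) A, symmetric] sym_inv[OF W Z] ten_idt[OF ten_ob[OF W Z] A] idt_right[OF phomD(4)[OF g']])
      finally have "unc Z (SHom R Q) (power_comparison Z Q P \<pi> R \<cdot> u) = unc Z (SHom R Q) v"
        by (rule eps_inject[OF R Q unc_hom[OF h Z o] uv])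
      then have "power_comparison Z Q P \<pi> R \<cdot> u = v" by (rule unc_inject[OF _ h v Z o])
      then show "\<exists>u. u \<in> Hom V W (SHom R P) \<and> power_comparison Z Q P \<pi> R \<cdot> u = v" using u(1) by blast
    next
      fix W u u' assume u: "u \<in> Hom V W (SHom R P)" and u': "u' \<in> Hom V W (SHom R P)"
        and eq: "power_comparison Z Q P \<pi> R \<cdot> u = power_comparison Z Q P \<pi> R \<cdot> u'"
      have W: "W \<in> Ob V" using u hom_ob by blast
      let ?k = "eps R P \<cdot> (u \<odot> Idt V (fst R))" and ?k' = "eps R P \<cdot> (u' \<odot> Idt V (fst R))"
      note k = phomD(4)[OF phom_param[OF eps_phom[OF R P] u]] phomD(4)[OF phom_param[OF eps_phom[OF R P] u']]
      note t = ten_hom[OF idt_hom[OF Z] k(1)] ten_hom[OF idt_hom[OF Z] k(2)] and a = asc_hom[OF Z W A] and E = phomD(4)[OF P2]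
      have "evs Z (fst Q) \<cdot> ((Idt V Z \<odot> ?k) \<cdot> asc V Z W (fst R)) \<cdot> (sym V W Z \<odot> Idt V (fst R)) =
          evs Z (fst Q) \<cdot> ((Idt V Z \<odot> ?k') \<cdot> asc V Z W (fst R)) \<cdot> (sym V W Z \<odot> Idt V (fst R))"
        by (simp only: c(2)[OF u, symmetric] c(2)[OF u', symmetric] eq)
      then have "evs Z (fst Q) \<cdot> ((Idt V Z \<odot> ?k) \<cdot> asc V Z W (fst R)) = evs Z (fst Q) \<cdot> ((Idt V Z \<odot> ?k') \<cdot> asc V Z W (fst R))"
        by (rule iso_epi[OF iso_ten_left[OF sym_iso[OF W Z] A] cmp_hom[OF cmp_hom[OF a t(1)] E] cmp_hom[OF cmp_hom[OF a t(2)] E]])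
      then have "evs Z (fst Q) \<cdot> (Idt V Z \<odot> ?k) \<cdot> asc V Z W (fst R) = evs Z (fst Q) \<cdot> (Idt V Z \<odot> ?k') \<cdot> asc V Z W (fst R)"
        by (simp only: cmp_assoc[OF a t(1) E] cmp_assoc[OF a t(2) E])
      then have "evs Z (fst Q) \<cdot> (Idt V Z \<odot> ?k) = evs Z (fst Q) \<cdot> (Idt V Z \<odot> ?k')"
        by (rule iso_epi[OF asc_iso[OF Z W A] cmp_hom[OF t(1) E] cmp_hom[OF t(2) E]])
      then have "?k = ?k'" by (rule evs_inject[OF _ k[unfolded P1] Z B])
      then show "u = u'" by (rule eps_inject[OF R P u u'])
    qed
  qed
  then have "is_power V L Z Q P \<pi>" unfolding is_power_def using P \<pi>(1) by blast
  then show ?thesis using that P1 P2 P3 by blast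
qed

end


section \<open>Internal homs out of presentable objects\<close>

context structures
begin

lemma Well_order_l: "Well_order l" and Card_order_l: "Card_order l" and infinite_l: "infinite (Field l)"
  and regularCard_l: "regularCard l"
  using regular_l unfolding regular_cardinal_def by (auto simp: card_order_on_well_order_on)

lemma directed_pair:
  assumes J: "directed_poset \<kappa> l J" and i: "i \<in> Ob J" "j \<in> Ob J"
  obtains k a b where "k \<in> Ob J" "a \<in> Hom J i k" "b \<in> Hom J j k"
proof -
  have "|{i, j}| <o l"
    by (rule finite_ordLess_infinite[OF card_of_Well_order Well_order_l _ infinite_l]) (simp add: Field_card_of)
  moreover have "{i, j} \<subseteq> Ob J" using i by simp
  ultimately obtain k where "k \<in> Ob J" "\<forall>m\<in>{i, j}. Hom J m k \<noteq> {}"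
    using J unfolding directed_poset_def by blast
  then show ?thesis using that by blast
qed

lemma presentable_ten: "\<lbrakk>presentable \<kappa> l V X; presentable \<kappa> l V Y\<rbrakk> \<Longrightarrow> presentable \<kappa> l V (X \<otimes> Y)"
  using presentable_unit_ten unfolding locally_presentable_closed_def by blast

lemma presentable_factor:
  assumes "presentable \<kappa> l V X" "directed_poset \<kappa> l (J :: ('u, 'u) cat)" "diagram J V D d" "colimit J V D d Y c" "f \<in> Hom V X Y"
  obtains i g where "i \<in> Ob J" "g \<in> Hom V X (D i)" "f = c i \<cdot> g"
  using assms unfolding presentable_def by blast

lemma presentable_eq:
  assumes "presentable \<kappa> l V X" "directed_poset \<kappa> l (J :: ('u, 'u) cat)" "diagram J V D d" "colimit J V D d Y c" "i \<in> Ob J"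
    "g \<in> Hom V X (D i)" "h \<in> Hom V X (D i)" "c i \<cdot> g = c i \<cdot> h"
  obtains j a where "j \<in> Ob J" "a \<in> Hom J i j" "d i j a \<cdot> g = d i j a \<cdot> h"
  using assms unfolding presentable_def by blast

context
  fixes J :: "('u, 'u) cat" and D d C c X
  assumes J: "directed_poset \<kappa> l J" and dg: "diagram J V D d" and col: "colimit J V D d C c" and X: "presentable \<kappa> l V X"
begin

private lemma Xo: "X \<in> Ob V" using X unfolding presentable_def by blast
private lemma c: "i \<in> Ob J \<Longrightarrow> c i \<in> Hom V (D i) C" "a \<in> Hom J i j \<Longrightarrow> c j \<cdot> d i j a = c i" and C: "C \<in> Ob V"
  using colimitD[OF col] by blast+
private lemma d: "a \<in> Hom J i j \<Longrightarrow> d i j a \<in> Hom V (D i) (D j)" and D: "i \<in> Ob J \<Longrightarrow> D i \<in> Ob V"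
  using dg unfolding diagram_def by blast+
private lemma d_cmp: "\<lbrakk>a \<in> Hom J i j; b \<in> Hom J j k\<rbrakk> \<Longrightarrow> d i k (b \<cdot>\<^bsub>J\<^esub> a) = d j k b \<cdot> d i j a"
  using dg unfolding diagram_def by blast
private lemma cX: "i \<in> Ob J \<Longrightarrow> post V X (D i) C (c i) \<in> Hom V (ihom V X (D i)) (ihom V X C)"
  by (rule post_hom[OF c(1) Xo])

text \<open>The transpose of \<open>a\<close> starts in \<open>G \<otimes> X\<close>, a tensor
  product of presentable objects and hence presentable, so it factors through a stage.\<close>

private lemma factor:
  assumes G: "G \<in> Gen" and a: "a \<in> Hom V G (ihom V X C)"
  obtains i h where "i \<in> Ob J" "h \<in> Hom V G (ihom V X (D i))" "a = post V X (D i) C (c i) \<cdot> h"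
proof -
  note Go = Gen_ob[OF G]
  obtain i g where i: "i \<in> Ob J" and g: "g \<in> Hom V (G \<otimes> X) (D i)" "unc X C a = c i \<cdot> g"
    by (rule presentable_factor[OF presentable_ten[OF Gen(2)[OF G] X] J dg col unc_hom[OF a Xo C]])
  note h = curry_hom[OF g(1) Go Xo] unc_curry[OF g(1) Go Xo]
  have "unc X C a = unc X C (post V X (D i) C (c i) \<cdot> curry V G X (D i) g)"
    by (simp only: unc_post[OF c(1)[OF i] h(1) Xo] h(2) g(2))
  then have "a = post V X (D i) C (c i) \<cdot> curry V G X (D i) g"
    by (rule unc_inject[OF _ a cmp_hom[OF h(1) cX[OF i]] Xo C])
  then show ?thesis using that i h(1) by blast
qed

text \<open>Directedness brings both arrows to a common stage; presentability of
  \<open>G \<otimes> X\<close> then makes their transposes equal at a later one.\<close>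

private lemma identify:
  assumes G: "G \<in> Gen" and i: "i \<in> Ob J" "j \<in> Ob J" and h: "h \<in> Hom V G (ihom V X (D i))" and h': "h' \<in> Hom V G (ihom V X (D j))"
    and e: "post V X (D i) C (c i) \<cdot> h = post V X (D j) C (c j) \<cdot> h'"
  obtains k a b where "a \<in> Hom J i k" "b \<in> Hom J j k" "k \<in> Ob J"
    "post V X (D i) (D k) (d i k a) \<cdot> h = post V X (D j) (D k) (d j k b) \<cdot> h'"
proof -
  interpret J: category J by (rule directed_posetD[OF J])
  obtain k a b where k: "k \<in> Ob J" "a \<in> Hom J i k" "b \<in> Hom J j k" using directed_pair[OF J i] .
  note u = unc_hom[OF h Xo D[OF i(1)]] unc_hom[OF h' Xo D[OF i(2)]]
  note t = cmp_hom[OF u(1) d[OF k(2)]] cmp_hom[OF u(2) d[OF k(3)]]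
  have "c i \<cdot> unc X (D i) h = c j \<cdot> unc X (D j) h'"
    using unc_post[OF c(1)[OF i(1)] h Xo] unc_post[OF c(1)[OF i(2)] h' Xo] e by simp
  then have "c k \<cdot> (d i k a \<cdot> unc X (D i) h) = c k \<cdot> (d j k b \<cdot> unc X (D j) h')"
    by (simp only: cmp_assoc[OF u(1) d[OF k(2)] c(1)[OF k(1)], symmetric] cmp_assoc[OF u(2) d[OF k(3)] c(1)[OF k(1)], symmetric]
      c(2)[OF k(2)] c(2)[OF k(3)])
  then obtain m n where m: "m \<in> Ob J" "n \<in> Hom J k m"
    and dm: "d k m n \<cdot> (d i k a \<cdot> unc X (D i) h) = d k m n \<cdot> (d j k b \<cdot> unc X (D j) h')"
    using presentable_eq[OF presentable_ten[OF Gen(2)[OF G] X] J dg col k(1) t] by metis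
  note na = J.cmp_hom[OF k(2) m(2)] J.cmp_hom[OF k(3) m(2)]
  note p = post_hom[OF d[OF na(1)] Xo] post_hom[OF d[OF na(2)] Xo]
  have "unc X (D m) (post V X (D i) (D m) (d i m (n \<cdot>\<^bsub>J\<^esub> a)) \<cdot> h) = unc X (D m) (post V X (D j) (D m) (d j m (n \<cdot>\<^bsub>J\<^esub> b)) \<cdot> h')"
    using dm by (simp only: unc_post[OF d[OF na(1)] h Xo] unc_post[OF d[OF na(2)] h' Xo], simp only: d_cmp[OF k(2) m(2)] d_cmp[OF k(3) m(2)]
      cmp_assoc[OF u(1) d[OF k(2)] d[OF m(2)]] cmp_assoc[OF u(2) d[OF k(3)] d[OF m(2)]])
  then have "post V X (D i) (D m) (d i m (n \<cdot>\<^bsub>J\<^esub> a)) \<cdot> h = post V X (D j) (D m) (d j m (n \<cdot>\<^bsub>J\<^esub> b)) \<cdot> h'"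
    by (rule unc_inject[OF _ cmp_hom[OF h p(1)] cmp_hom[OF h' p(2)] Xo D[OF m(1)]])
  then show ?thesis using that na m(1) by blast
qed

text \<open>Generators detect equality, and by \<open>factor\<close> every arrow from one of them
  into \<open>[X,C]\<close> comes from a stage.\<close>

lemma ihom_colimit_epi:
  assumes u: "u \<in> Hom V (ihom V X C) W" "v \<in> Hom V (ihom V X C) W"
    and e: "\<And>i. i \<in> Ob J \<Longrightarrow> u \<cdot> post V X (D i) C (c i) = v \<cdot> post V X (D i) C (c i)"
  shows "u = v"
proof (rule Gen_epi[OF u])
  fix G a assume G: "G \<in> Gen" and a: "a \<in> Hom V G (ihom V X C)"
  obtain i h where i: "i \<in> Ob J" and h: "h \<in> Hom V G (ihom V X (D i))" and ah: "a = post V X (D i) C (c i) \<cdot> h"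
    by (rule factor[OF G a])
  show "u \<cdot> a = v \<cdot> a"
    unfolding ah by (simp only: cmp_assoc[OF h cX[OF i] u(1), symmetric] cmp_assoc[OF h cX[OF i] u(2), symmetric] e[OF i])
qed

text \<open>Together with \<open>ihom_colimit_epi\<close>: \<open>[X,-]\<close> preserves the
  colimit. The arrow is first defined on generalized elements with generators as domains and then
  glued along a presentation of \<open>[X,C]\<close> by generators.\<close>

lemma ihom_colimit_glue:
  assumes W: "W \<in> Ob V" and z: "\<And>i. i \<in> Ob J \<Longrightarrow> z i \<in> Hom V (ihom V X (D i)) W"
    and zz: "\<And>i j a. a \<in> Hom J i j \<Longrightarrow> z j \<cdot> post V X (D i) (D j) (d i j a) = z i"
  obtains u where "u \<in> Hom V (ihom V X C) W" "\<And>i. i \<in> Ob J \<Longrightarrow> u \<cdot> post V X (D i) C (c i) = z i"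
proof -
  interpret J: category J by (rule directed_posetD[OF J])
  \<comment> \<open>\<open>w\<close> is the value forced on \<open>a\<close> by some factorization
    of \<open>a\<close> through a stage; a relation avoids choosing the factorization.
    \<open>factor\<close> makes it total and \<open>identify\<close> single valued.\<close>
  define R where "R G a w \<longleftrightarrow> (\<exists>i\<in>Ob J. \<exists>h\<in>Hom V G (ihom V X (D i)). a = post V X (D i) C (c i) \<cdot> h \<and> w = z i \<cdot> h)" for G a w
  have total: "\<exists>w. R G a w" if "G \<in> Gen" "a \<in> Hom V G (ihom V X C)" for G a
    using factor[OF that] unfolding R_def by metis
  have R_hom: "w \<in> Hom V G W" if "R G a w" for G a w
    using that cmp_hom z unfolding R_def by blast
  have R_unique: "w = w'" if G: "G \<in> Gen" and r: "R G a w" "R G a w'" for G a w w'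
  proof -
    obtain i h where i: "i \<in> Ob J" and h: "h \<in> Hom V G (ihom V X (D i))" and ah: "a = post V X (D i) C (c i) \<cdot> h" "w = z i \<cdot> h"
      using r(1) unfolding R_def by blast
    obtain j h' where j: "j \<in> Ob J" and h': "h' \<in> Hom V G (ihom V X (D j))" and ah': "a = post V X (D j) C (c j) \<cdot> h'" "w' = z j \<cdot> h'"
      using r(2) unfolding R_def by blast
    obtain k a' b where k: "a' \<in> Hom J i k" "b \<in> Hom J j k" "k \<in> Ob J"
      and e: "post V X (D i) (D k) (d i k a') \<cdot> h = post V X (D j) (D k) (d j k b) \<cdot> h'"
      by (rule identify[OF G i j h h']) (use ah ah' in auto)
    have "z i \<cdot> h = z k \<cdot> (post V X (D i) (D k) (d i k a') \<cdot> h)"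
      by (simp only: cmp_assoc[OF h post_hom[OF d[OF k(1)] Xo] z[OF k(3)], symmetric] zz[OF k(1)])
    also have "\<dots> = z j \<cdot> h'"
      unfolding e by (simp only: cmp_assoc[OF h' post_hom[OF d[OF k(2)] Xo] z[OF k(3)], symmetric] zz[OF k(2)])
    finally show ?thesis using ah ah' by simp
  qed
  have R_cmp: "R G' (a \<cdot> t) (w \<cdot> t)" if r: "R G a w" and t: "t \<in> Hom V G' G" for G a w G' t
  proof -
    obtain i h where i: "i \<in> Ob J" and h: "h \<in> Hom V G (ihom V X (D i))" and ah: "a = post V X (D i) C (c i) \<cdot> h" "w = z i \<cdot> h"
      using r unfolding R_def by blast
    have "a \<cdot> t = post V X (D i) C (c i) \<cdot> (h \<cdot> t)" "w \<cdot> t = z i \<cdot> (h \<cdot> t)"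
      unfolding ah by (rule cmp_assoc[OF t h cX[OF i]] cmp_assoc[OF t h z[OF i]])+
    then show ?thesis using i cmp_hom[OF t h] unfolding R_def by blast
  qed
  obtain J' :: "('u, 'u) cat" and D' d' e where J': "directed_poset \<kappa> l J'" "diagram J' V D' d'" "D' ` Ob J' \<subseteq> Gen"
    and col': "colimit J' V D' d' (ihom V X C) e" using Gen(3)[OF ihom_ob[OF Xo C]] by blast
  interpret J': category J' by (rule directed_posetD[OF J'(1)])
  note e = colimitD[OF col']
  have D'G: "D' j \<in> Gen" if "j \<in> Ob J'" for j using J'(3) that by blast
  define y where "y j = (SOME w. R (D' j) (e j) w)" for j
  have y: "R (D' j) (e j) (y j)" if "j \<in> Ob J'" for j
    unfolding y_def by (rule someI_ex[OF total[OF D'G[OF that] e(2)[OF that]]])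
  obtain u where u: "u \<in> Hom V (ihom V X C) W" "\<And>j. j \<in> Ob J' \<Longrightarrow> u \<cdot> e j = y j"
  proof (rule colimit_glue[OF col' W, of y])
    show "y j \<in> Hom V (D' j) W" if "j \<in> Ob J'" for j by (rule R_hom[OF y[OF that]])
    fix i j a assume a: "a \<in> Hom J' i j"
    then have ij: "i \<in> Ob J'" "j \<in> Ob J'" using J'.hom_ob by blast+
    have da: "d' i j a \<in> Hom V (D' i) (D' j)" using J'(2) a unfolding diagram_def by blast
    have "R (D' i) (e i) (y j \<cdot> d' i j a)" using R_cmp[OF y[OF ij(2)] da] e(3)[OF a] by simp
    then show "y j \<cdot> d' i j a = y i" using R_unique[OF D'G[OF ij(1)]] y[OF ij(1)] by blast
  qed (rule that; assumption)
  \<comment> \<open>The presentation used to glue \<open>u\<close> has nothing to do with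
    \<open>J\<close>. An arrow from a generator also factors through that presentation, and
    single-valuedness of \<open>R\<close> compares the two results.\<close>
  have "u \<cdot> post V X (D i) C (c i) = z i" if i: "i \<in> Ob J" for i
  proof (rule Gen_epi[OF cmp_hom[OF cX[OF i] u(1)] z[OF i]])
    fix G a assume G: "G \<in> Gen" and a: "a \<in> Hom V G (ihom V X (D i))"
    let ?a = "post V X (D i) C (c i) \<cdot> a"
    have R1: "R G ?a (z i \<cdot> a)" unfolding R_def using i a by blast
    obtain j t where j: "j \<in> Ob J'" and t: "t \<in> Hom V G (D' j)" "?a = e j \<cdot> t"
      by (rule presentable_factor[OF Gen(2)[OF G] J'(1,2) col' cmp_hom[OF a cX[OF i]]])
    have "R G ?a (y j \<cdot> t)" using R_cmp[OF y[OF j] t(1)] t(2) by simp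
    then have "z i \<cdot> a = y j \<cdot> t" using R_unique[OF G] R1 by blast
    also have "\<dots> = u \<cdot> ?a" by (simp only: t(2) u(2)[OF j, symmetric] cmp_assoc[OF t(1) e(2)[OF j] u(1)])
    finally show "u \<cdot> post V X (D i) C (c i) \<cdot> a = z i \<cdot> a" by (simp only: cmp_assoc[OF a cX[OF i] u(1)])
  qed
  then show ?thesis using that u(1) by blast
qed

end

end


section \<open>Free structures\<close>

text \<open>Needed for the recursion defining the chain, where values at indices that are not
  earlier are cut off.\<close>

lemma graph_colimit_cong:
  assumes "\<And>i. i \<in> I \<Longrightarrow> D i = D' i"
  shows "graph_colimit C I D R = graph_colimit C I D' R"
proof -
  have "graph_cocone C I D R X c = graph_cocone C I D' R X c" for X c
    unfolding graph_cocone_def using assms by auto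
  then show ?thesis unfolding graph_colimit_def by presburger
qed

locale free_chain = structures V \<kappa> l L
  for V :: "('o, 'm, 'x) smc_scheme" (structure) and \<kappa> :: "'u rel" and l :: "'l rel" and L :: "('f, 'o) language" +
  fixes X :: 'o
  assumes X_ob: "X \<in> Ob V"
begin

definition lt :: "'l rel" where "lt = l - Id"

text \<open>Unlike \<open>l\<close>, this is reflexive on the whole type: the chain is defined at
  every element of \<open>'l\<close>, those outside \<open>Field l\<close> having no predecessors
  under \<open>lt\<close>.\<close>

definition le :: "'l \<Rightarrow> 'l \<Rightarrow> bool" where "le a b \<longleftrightarrow> a = b \<or> (a, b) \<in> lt"

section \<open>The well-order indexing the chain\<close>

lemma wf_lt: "wf lt"
  using Well_order_l unfolding lt_def well_order_on_def by blast

lemma l_order: "trans l" "antisym l" "total_on (Field l) l" "refl_on (Field l) l"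
  using Well_order_l unfolding well_order_on_def linear_order_on_def partial_order_on_def preorder_on_def by auto

lemma lt_trans: "\<lbrakk>(a, b) \<in> lt; (b, c) \<in> lt\<rbrakk> \<Longrightarrow> (a, c) \<in> lt"
  using l_order unfolding lt_def trans_def antisym_def by blast

lemma lt_le_trans: "\<lbrakk>(a, b) \<in> lt; le b c\<rbrakk> \<Longrightarrow> (a, c) \<in> lt"
  unfolding le_def using lt_trans by blast

lemma le_trans: "\<lbrakk>le a b; le b c\<rbrakk> \<Longrightarrow> le a c"
  unfolding le_def using lt_trans by blast

lemma le_iff: "\<lbrakk>a \<in> Field l; b \<in> Field l\<rbrakk> \<Longrightarrow> le a b \<longleftrightarrow> (a, b) \<in> l"
  using l_order(4) unfolding le_def lt_def refl_on_def by auto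

lemma le_total: "\<lbrakk>a \<in> Field l; b \<in> Field l\<rbrakk> \<Longrightarrow> le a b \<or> le b a"
  using l_order(3) unfolding le_def lt_def total_on_def by auto

lemma lt_Field: "(a, b) \<in> lt \<Longrightarrow> a \<in> Field l \<and> b \<in> Field l"
  unfolding lt_def Field_def by auto

text \<open>An infinite cardinal has no last element, so the operations applied to any stage land in
  a later one.\<close>

lemma lt_next: "a \<in> Field l \<Longrightarrow> \<exists>b. (a, b) \<in> lt"
  using infinite_Card_order_limit[OF Card_order_l infinite_l] unfolding lt_def by blast

lemma small_Field_l: "small \<kappa> (Field l)"
  unfolding small_def by (rule ordIso_ordLess_trans[OF card_of_Field_ordIso[OF Card_order_l] l_less])

text \<open>By transposition an operation \<open>[In f, A] -> [Out f, A]\<close> is an arrow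
  \<open>Hob f A -> A\<close>; structures are thus algebras for the functors \<open>Hob f\<close>,
  with \<open>Har\<close> their action on arrows, and the chain is the usual free algebra
  construction.\<close>

definition Hob :: "'f \<Rightarrow> 'o \<Rightarrow> 'o" where "Hob f A = ihom V (In L f) A \<otimes> Out L f"
definition Har :: "'f \<Rightarrow> 'o \<Rightarrow> 'o \<Rightarrow> 'm \<Rightarrow> 'm" where "Har f A B t = post V (In L f) A B t \<odot> Idt V (Out L f)"

lemma Hob_ob: "\<lbrakk>f \<in> Sym L; A \<in> Ob V\<rbrakk> \<Longrightarrow> Hob f A \<in> Ob V"
  unfolding Hob_def by (intro ten_ob ihom_ob arity_ob)

lemma Har_hom: "\<lbrakk>f \<in> Sym L; t \<in> Hom V A B\<rbrakk> \<Longrightarrow> Har f A B t \<in> Hom V (Hob f A) (Hob f B)"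
  unfolding Hob_def Har_def by (intro ten_hom post_hom idt_hom arity_ob)

lemma Har_cmp: "\<lbrakk>f \<in> Sym L; t \<in> Hom V A B; u \<in> Hom V B C\<rbrakk> \<Longrightarrow> Har f A C (u \<cdot> t) = Har f B C u \<cdot> Har f A B t"
  unfolding Har_def
  by (simp only: post_cmp[OF _ _ arity_ob(1)] ten_cmp_left[OF post_hom[OF _ arity_ob(1)] post_hom[OF _ arity_ob(1)] arity_ob(2)])

text \<open>
  The underlying object of the free structure on \<open>X\<close> is the colimit of a transfinite chain in which
  the stage \<open>\<alpha>\<close> is the colimit of \<open>X\<close> and of the objects \<open>[In f, A \<beta>] \<otimes> Out f\<close> for \<open>\<beta> < \<alpha>\<close>.  A stage
  is a pair of an object and its colimit cocone; \<open>None\<close> indexes \<open>X\<close> and \<open>Some (f, \<beta>)\<close> the other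
  summands.
\<close>

definition idx :: "'l \<Rightarrow> ('f \<times> 'l) option set" where
  "idx \<alpha> = insert None {Some (f, \<beta>) | f \<beta>. f \<in> Sym L \<and> (\<beta>, \<alpha>) \<in> lt}"

definition summand :: "('l \<Rightarrow> 'o \<times> (('f \<times> 'l) option \<Rightarrow> 'm)) \<Rightarrow> ('f \<times> 'l) option \<Rightarrow> 'o" where
  "summand c i = (case i of None \<Rightarrow> X | Some (f, \<beta>) \<Rightarrow> Hob f (fst (c \<beta>)))"

text \<open>Later stages need the transition maps between earlier ones. Recovering these from their
  uniqueness lets the recursion produce only objects with cocones.\<close>

definition trn :: "('l \<Rightarrow> 'o \<times> (('f \<times> 'l) option \<Rightarrow> 'm)) \<Rightarrow> 'l \<Rightarrow> 'l \<Rightarrow> 'm" where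
  "trn c \<beta> \<alpha> = (THE t. t \<in> Hom V (fst (c \<beta>)) (fst (c \<alpha>)) \<and> (\<forall>i\<in>idx \<beta>. t \<cdot> snd (c \<beta>) i = snd (c \<alpha>) i))"

definition edges :: "('l \<Rightarrow> 'o \<times> (('f \<times> 'l) option \<Rightarrow> 'm)) \<Rightarrow> 'l \<Rightarrow> (('f \<times> 'l) option \<times> ('f \<times> 'l) option \<times> 'm) set" where
  "edges c \<alpha> = {(Some (f, \<beta>), Some (f, \<gamma>), Har f (fst (c \<beta>)) (fst (c \<gamma>)) (trn c \<beta> \<gamma>)) | f \<beta> \<gamma>.
     f \<in> Sym L \<and> (\<beta>, \<gamma>) \<in> lt \<and> (\<gamma>, \<alpha>) \<in> lt}"

definition is_stage :: "('l \<Rightarrow> 'o \<times> (('f \<times> 'l) option \<Rightarrow> 'm)) \<Rightarrow> 'l \<Rightarrow> 'o \<times> (('f \<times> 'l) option \<Rightarrow> 'm) \<Rightarrow> bool" where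
  "is_stage c \<alpha> p \<longleftrightarrow> graph_colimit V (idx \<alpha>) (summand c) (edges c \<alpha>) (fst p) (snd p)"

definition chain :: "'l \<Rightarrow> 'o \<times> (('f \<times> 'l) option \<Rightarrow> 'm)" where
  "chain = wfrec lt (\<lambda>c \<alpha>. SOME p. is_stage c \<alpha> p)"

abbreviation A where "A \<alpha> \<equiv> fst (chain \<alpha>)"
abbreviation s where "s \<alpha> \<equiv> snd (chain \<alpha>)"
abbreviation t where "t \<equiv> trn chain"

text \<open>A stage refers to strictly earlier ones only, which turns the well-founded recursion
  into a usable fixed point equation.\<close>

lemma is_stage_cong:
  assumes "\<And>\<beta>. (\<beta>, \<alpha>) \<in> lt \<Longrightarrow> c \<beta> = c' \<beta>"
  shows "is_stage c \<alpha> p = is_stage c' \<alpha> p"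
proof -
  have trn: "trn c \<beta> \<gamma> = trn c' \<beta> \<gamma>" if "(\<beta>, \<alpha>) \<in> lt" "(\<gamma>, \<alpha>) \<in> lt" for \<beta> \<gamma>
    unfolding trn_def using assms that by simp
  have e: "(Some (f, \<beta>), Some (f, \<gamma>), Har f (fst (c \<beta>)) (fst (c \<gamma>)) (trn c \<beta> \<gamma>)) =
      (Some (f, \<beta>), Some (f, \<gamma>), Har f (fst (c' \<beta>)) (fst (c' \<gamma>)) (trn c' \<beta> \<gamma>))"
    if "(\<beta>, \<gamma>) \<in> lt" "(\<gamma>, \<alpha>) \<in> lt" for f \<beta> \<gamma>
    using assms trn that lt_trans by metis
  have "edges c \<alpha> = edges c' \<alpha>"
    unfolding edges_def by (intro Collect_cong ex_cong1 rev_conj_cong refl) (elim conjE, simp only: e)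
  moreover have "summand c i = summand c' i" if "i \<in> idx \<alpha>" for i
    using that assms unfolding idx_def summand_def by auto
  ultimately show ?thesis unfolding is_stage_def using graph_colimit_cong[of "idx \<alpha>"] by metis
qed

lemma chain_unfold: "chain \<alpha> = (SOME p. is_stage chain \<alpha> p)"
proof -
  have "chain \<alpha> = (SOME p. is_stage (cut chain lt \<alpha>) \<alpha> p)"
    unfolding chain_def by (subst wfrec[OF wf_lt]) (rule refl)
  also have "is_stage (cut chain lt \<alpha>) \<alpha> = is_stage chain \<alpha>"
    by (rule ext, rule is_stage_cong) (simp add: cut_apply)
  finally show ?thesis .
qed

lemma idx_mono: "le \<beta> \<alpha> \<Longrightarrow> idx \<beta> \<subseteq> idx \<alpha>"
  unfolding idx_def using lt_le_trans by blast

lemma edges_mono: "le \<beta> \<alpha> \<Longrightarrow> edges c \<beta> \<subseteq> edges c \<alpha>"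
  unfolding edges_def using lt_le_trans by blast

lemma trn_stages:
  assumes b: "is_stage chain \<beta> (chain \<beta>)" and a: "is_stage chain \<alpha> (chain \<alpha>)" and le: "le \<beta> \<alpha>"
  shows "t \<beta> \<alpha> \<in> Hom V (A \<beta>) (A \<alpha>) \<and> (\<forall>i\<in>idx \<beta>. t \<beta> \<alpha> \<cdot> s \<beta> i = s \<alpha> i)"
  unfolding trn_def
proof (rule theI')
  have "graph_cocone V (idx \<beta>) (summand chain) (edges chain \<beta>) (A \<alpha>) (s \<alpha>)"
    using a idx_mono[OF le] edges_mono[OF le] unfolding is_stage_def graph_colimit_def graph_cocone_def by blast
  then show "\<exists>!t. t \<in> Hom V (A \<beta>) (A \<alpha>) \<and> (\<forall>i\<in>idx \<beta>. t \<cdot> s \<beta> i = s \<alpha> i)"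
    using b unfolding is_stage_def graph_colimit_def by blast
qed

text \<open>Both claims need one induction: the edges are arrows only once transitions between
  earlier stages exist, and these exist because the earlier stages are colimits.\<close>

lemma stage_aux:
  "graph_diagram V (idx \<alpha>) (summand chain) (edges chain \<alpha>) \<and> is_stage chain \<alpha> (chain \<alpha>)"
proof (induction \<alpha> rule: wf_induct_rule[OF wf_lt])
  case (1 \<alpha>)
  have Ao: "A \<beta> \<in> Ob V" if "(\<beta>, \<alpha>) \<in> lt" for \<beta>
    using 1[OF that] graph_colimitD(1) unfolding is_stage_def by blast
  have gd: "graph_diagram V (idx \<alpha>) (summand chain) (edges chain \<alpha>)"
    unfolding graph_diagram_def
  proof (intro conjI ballI)
    fix i assume "i \<in> idx \<alpha>" then show "summand chain i \<in> Ob V"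
      using X_ob Hob_ob Ao unfolding idx_def summand_def by auto
  next
    fix e assume "e \<in> edges chain \<alpha>"
    then obtain f \<beta> \<gamma> where e: "e = (Some (f, \<beta>), Some (f, \<gamma>), Har f (A \<beta>) (A \<gamma>) (t \<beta> \<gamma>))"
      and f: "f \<in> Sym L" "(\<beta>, \<gamma>) \<in> lt" "(\<gamma>, \<alpha>) \<in> lt" unfolding edges_def by blast
    have "t \<beta> \<gamma> \<in> Hom V (A \<beta>) (A \<gamma>)"
      using trn_stages[of \<beta> \<gamma>] 1[OF lt_trans[OF f(2,3)]] 1[OF f(3)] f(2) unfolding le_def by blast
    then show "case e of (i, j, a) \<Rightarrow> i \<in> idx \<alpha> \<and> j \<in> idx \<alpha> \<and> a \<in> Hom V (summand chain i) (summand chain j)"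
      unfolding e using f lt_trans[OF f(2,3)] Har_hom[OF f(1)] by (simp add: idx_def summand_def)
  qed
  have smL: "small \<kappa> (Sym L)" using language unfolding ary_language_def by blast
  have "idx \<alpha> \<subseteq> insert None (Some ` (Sym L \<times> Field l))" unfolding idx_def using lt_Field by auto
  moreover have "small \<kappa> ({None} \<union> Some ` (Sym L \<times> Field l))"
    by (intro small_Un small_image small_Sigma smL small_Field_l small_finite) auto
  ultimately have sI: "small \<kappa> (idx \<alpha>)" by (metis insert_is_Un small_subset)
  have "edges chain \<alpha> \<subseteq> (\<lambda>(f, \<beta>, \<gamma>). (Some (f, \<beta>), Some (f, \<gamma>), Har f (A \<beta>) (A \<gamma>) (t \<beta> \<gamma>))) ` (Sym L \<times> Field l \<times> Field l)"
    unfolding edges_def using lt_Field by force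
  then have sR: "small \<kappa> (edges chain \<alpha>)"
    by (rule small_subset) (intro small_image small_Sigma smL small_Field_l)
  obtain P c where "graph_colimit V (idx \<alpha>) (summand chain) (edges chain \<alpha>) P c" by (rule graph_colimit[OF gd sI sR])
  then have "is_stage chain \<alpha> (P, c)" unfolding is_stage_def by simp
  then have "is_stage chain \<alpha> (chain \<alpha>)" unfolding chain_unfold[of \<alpha>] by (rule someI)
  then show ?case using gd by blast
qed

section \<open>Stages and their transition maps\<close>

lemma stage_colimit: "graph_colimit V (idx \<alpha>) (summand chain) (edges chain \<alpha>) (A \<alpha>) (s \<alpha>)"
  and stage_diagram: "graph_diagram V (idx \<alpha>) (summand chain) (edges chain \<alpha>)"
  using stage_aux unfolding is_stage_def by blast+

lemma A_ob: "A \<alpha> \<in> Ob V"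
  using graph_colimitD(1)[OF stage_colimit] .

lemma s_None: "s \<alpha> None \<in> Hom V X (A \<alpha>)"
  using graph_colimitD(2)[OF stage_colimit, of None \<alpha>] unfolding idx_def summand_def by simp

lemma s_Some: "\<lbrakk>f \<in> Sym L; (\<beta>, \<alpha>) \<in> lt\<rbrakk> \<Longrightarrow> s \<alpha> (Some (f, \<beta>)) \<in> Hom V (Hob f (A \<beta>)) (A \<alpha>)"
  using graph_colimitD(2)[OF stage_colimit, of "Some (f, \<beta>)" \<alpha>] unfolding idx_def summand_def by simp

lemma s_edge: "\<lbrakk>f \<in> Sym L; (\<beta>, \<gamma>) \<in> lt; (\<gamma>, \<alpha>) \<in> lt\<rbrakk> \<Longrightarrow>
    s \<alpha> (Some (f, \<gamma>)) \<cdot> Har f (A \<beta>) (A \<gamma>) (t \<beta> \<gamma>) = s \<alpha> (Some (f, \<beta>))"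
  using graph_colimitD(3)[OF stage_colimit, of "Some (f, \<beta>)" "Some (f, \<gamma>)" _ \<alpha>] unfolding edges_def by blast

lemma t_hom: "le \<beta> \<alpha> \<Longrightarrow> t \<beta> \<alpha> \<in> Hom V (A \<beta>) (A \<alpha>)"
  and t_None: "le \<beta> \<alpha> \<Longrightarrow> t \<beta> \<alpha> \<cdot> s \<beta> None = s \<alpha> None"
  and t_Some: "\<lbrakk>le \<beta> \<alpha>; f \<in> Sym L; (\<gamma>, \<beta>) \<in> lt\<rbrakk> \<Longrightarrow> t \<beta> \<alpha> \<cdot> s \<beta> (Some (f, \<gamma>)) = s \<alpha> (Some (f, \<gamma>))"
  using trn_stages[of \<beta> \<alpha>] stage_aux unfolding idx_def by blast+

lemma stage_epi:
  assumes "u \<in> Hom V (A \<alpha>) Y" "v \<in> Hom V (A \<alpha>) Y" "u \<cdot> s \<alpha> None = v \<cdot> s \<alpha> None"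
    "\<And>f \<beta>. \<lbrakk>f \<in> Sym L; (\<beta>, \<alpha>) \<in> lt\<rbrakk> \<Longrightarrow> u \<cdot> s \<alpha> (Some (f, \<beta>)) = v \<cdot> s \<alpha> (Some (f, \<beta>))"
  shows "u = v"
  by (rule graph_colimit_epi[OF stage_colimit stage_diagram assms(1,2)]) (use assms(3,4) in \<open>auto simp: idx_def\<close>)

lemma stage_glue:
  assumes Y: "Y \<in> Ob V" and y0: "y0 \<in> Hom V X Y"
    and y: "\<And>f \<beta>. \<lbrakk>f \<in> Sym L; (\<beta>, \<alpha>) \<in> lt\<rbrakk> \<Longrightarrow> y f \<beta> \<in> Hom V (Hob f (A \<beta>)) Y"
    and yy: "\<And>f \<beta> \<gamma>. \<lbrakk>f \<in> Sym L; (\<beta>, \<gamma>) \<in> lt; (\<gamma>, \<alpha>) \<in> lt\<rbrakk> \<Longrightarrow> y f \<gamma> \<cdot> Har f (A \<beta>) (A \<gamma>) (t \<beta> \<gamma>) = y f \<beta>"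
  obtains u where "u \<in> Hom V (A \<alpha>) Y" "u \<cdot> s \<alpha> None = y0"
    "\<And>f \<beta>. \<lbrakk>f \<in> Sym L; (\<beta>, \<alpha>) \<in> lt\<rbrakk> \<Longrightarrow> u \<cdot> s \<alpha> (Some (f, \<beta>)) = y f \<beta>"
proof -
  let ?y = "\<lambda>i. case i of None \<Rightarrow> y0 | Some (f, \<beta>) \<Rightarrow> y f \<beta>"
  obtain u where u: "u \<in> Hom V (A \<alpha>) Y" "\<And>i. i \<in> idx \<alpha> \<Longrightarrow> u \<cdot> s \<alpha> i = ?y i"
  proof (rule graph_colimit_glue[OF stage_colimit Y, of \<alpha> ?y])
    show "?y i \<in> Hom V (summand chain i) Y" if "i \<in> idx \<alpha>" for i
      using that y0 y unfolding idx_def summand_def by auto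
    show "?y j \<cdot> a = ?y i" if "(i, j, a) \<in> edges chain \<alpha>" for i j a
      using that yy unfolding edges_def by auto
  qed (rule that; assumption)
  show ?thesis
    by (rule that[OF u(1)]) (use u(2) in \<open>auto simp: idx_def\<close>)
qed

lemma t_idt: "t \<alpha> \<alpha> = Idt V (A \<alpha>)"
proof -
  have le: "le \<alpha> \<alpha>" unfolding le_def by simp
  show ?thesis
    by (rule stage_epi[OF t_hom[OF le] idt_hom[OF A_ob]])
      (simp_all only: t_None[OF le] t_Some[OF le] idt_left[OF s_None] idt_left[OF s_Some])
qed

lemma t_cmp:
  assumes b: "le \<beta> \<gamma>" and c: "le \<gamma> \<alpha>" shows "t \<gamma> \<alpha> \<cdot> t \<beta> \<gamma> = t \<beta> \<alpha>"
proof -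
  note a = le_trans[OF b c]
  show ?thesis
  proof (rule stage_epi[OF cmp_hom[OF t_hom[OF b] t_hom[OF c]] t_hom[OF a]])
    show "t \<gamma> \<alpha> \<cdot> t \<beta> \<gamma> \<cdot> s \<beta> None = t \<beta> \<alpha> \<cdot> s \<beta> None"
      by (simp only: cmp_assoc[OF s_None t_hom[OF b] t_hom[OF c]] t_None[OF b] t_None[OF c] t_None[OF a])
    fix f \<delta> assume f: "f \<in> Sym L" "(\<delta>, \<beta>) \<in> lt"
    show "t \<gamma> \<alpha> \<cdot> t \<beta> \<gamma> \<cdot> s \<beta> (Some (f, \<delta>)) = t \<beta> \<alpha> \<cdot> s \<beta> (Some (f, \<delta>))"
      by (simp only: cmp_assoc[OF s_Some[OF f] t_hom[OF b] t_hom[OF c]] t_Some[OF b f] t_Some[OF c f(1) lt_le_trans[OF f(2) b]]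
        t_Some[OF a f])
  qed
qed


subsection \<open>Homomorphisms out of the chain\<close>

context
  fixes Q x assumes Q: "Q \<in> Ob StrL" and x: "x \<in> Hom V X (fst Q)"
begin

abbreviation ub :: "'f \<Rightarrow> 'm" where "ub f \<equiv> unc (Out L f) (fst Q) (snd Q f)"

lemma ub_hom: "f \<in> Sym L \<Longrightarrow> ub f \<in> Hom V (Hob f (fst Q)) (fst Q)"
  unfolding Hob_def by (rule unc_hom[OF Str_op[OF Q] arity_ob(2) Str_ob[OF Q]])

text \<open>What the restriction to stage \<open>\<alpha>\<close> of a homomorphism extending
  \<open>x\<close> must satisfy: its value on the summand \<open>(f, \<beta>)\<close> is forced by
  its restriction to stage \<open>\<beta>\<close>.\<close>

definition good :: "'l \<Rightarrow> 'm \<Rightarrow> bool" where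
  "good \<alpha> h \<longleftrightarrow> h \<in> Hom V (A \<alpha>) (fst Q) \<and> h \<cdot> s \<alpha> None = x \<and>
     (\<forall>f\<in>Sym L. \<forall>\<beta>. (\<beta>, \<alpha>) \<in> lt \<longrightarrow> h \<cdot> s \<alpha> (Some (f, \<beta>)) = ub f \<cdot> Har f (A \<beta>) (fst Q) (h \<cdot> t \<beta> \<alpha>))"

lemma goodD:
  assumes "good \<alpha> h"
  shows "h \<in> Hom V (A \<alpha>) (fst Q)" "h \<cdot> s \<alpha> None = x"
    "\<lbrakk>f \<in> Sym L; (\<beta>, \<alpha>) \<in> lt\<rbrakk> \<Longrightarrow> h \<cdot> s \<alpha> (Some (f, \<beta>)) = ub f \<cdot> Har f (A \<beta>) (fst Q) (h \<cdot> t \<beta> \<alpha>)"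
  using assms unfolding good_def by blast+

lemma good_restrict:
  assumes g: "good \<alpha> h" and b: "le \<beta> \<alpha>" shows "good \<beta> (h \<cdot> t \<beta> \<alpha>)"
  unfolding good_def
proof (intro conjI ballI allI impI)
  note h = goodD[OF g] and tb = t_hom[OF b]
  show "h \<cdot> t \<beta> \<alpha> \<in> Hom V (A \<beta>) (fst Q)" by (rule cmp_hom[OF tb h(1)])
  show "h \<cdot> t \<beta> \<alpha> \<cdot> s \<beta> None = x" by (simp only: cmp_assoc[OF s_None tb h(1)] t_None[OF b] h(2))
  fix f \<gamma> assume f: "f \<in> Sym L" "(\<gamma>, \<beta>) \<in> lt"
  have gb: "le \<gamma> \<beta>" using f(2) unfolding le_def by blast
  show "h \<cdot> t \<beta> \<alpha> \<cdot> s \<beta> (Some (f, \<gamma>)) = ub f \<cdot> Har f (A \<gamma>) (fst Q) (h \<cdot> t \<beta> \<alpha> \<cdot> t \<gamma> \<beta>)"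
    by (simp only: cmp_assoc[OF s_Some[OF f] tb h(1)] t_Some[OF b f] h(3)[OF f(1) lt_le_trans[OF f(2) b]]
      cmp_assoc[OF t_hom[OF gb] tb h(1)] t_cmp[OF gb b])
qed

text \<open>By uniqueness at earlier stages the good arrows there are compatible, so they prescribe
  a cocone on stage \<open>\<alpha>\<close>.\<close>

lemma good_ex1: "\<exists>!h. good \<alpha> h"
proof (induction \<alpha> rule: wf_induct_rule[OF wf_lt])
  case (1 \<alpha>)
  define hh where "hh \<beta> = (THE h. good \<beta> h)" for \<beta>
  have hh: "good \<beta> (hh \<beta>)" if "(\<beta>, \<alpha>) \<in> lt" for \<beta> unfolding hh_def by (rule theI'[OF 1[OF that]])
  have hh_unique: "h = hh \<beta>" if "(\<beta>, \<alpha>) \<in> lt" "good \<beta> h" for \<beta> h using 1[OF that(1)] hh[OF that(1)] that(2) by blast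
  have hh_t: "hh \<gamma> \<cdot> t \<beta> \<gamma> = hh \<beta>" if "(\<beta>, \<gamma>) \<in> lt" "(\<gamma>, \<alpha>) \<in> lt" for \<beta> \<gamma>
    using hh_unique[OF lt_trans[OF that] good_restrict[OF hh[OF that(2)]]] that(1) unfolding le_def by blast
  have Hhh: "Har f (A \<beta>) (fst Q) (hh \<beta>) \<in> Hom V (Hob f (A \<beta>)) (Hob f (fst Q))" if "f \<in> Sym L" "(\<beta>, \<alpha>) \<in> lt" for f \<beta>
    by (rule Har_hom[OF that(1) goodD(1)[OF hh[OF that(2)]]])
  obtain u where u: "u \<in> Hom V (A \<alpha>) (fst Q)" "u \<cdot> s \<alpha> None = x"
    and us: "\<And>f \<beta>. \<lbrakk>f \<in> Sym L; (\<beta>, \<alpha>) \<in> lt\<rbrakk> \<Longrightarrow> u \<cdot> s \<alpha> (Some (f, \<beta>)) = ub f \<cdot> Har f (A \<beta>) (fst Q) (hh \<beta>)"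
  proof (rule stage_glue[OF Str_ob[OF Q] x, of \<alpha> "\<lambda>f \<beta>. ub f \<cdot> Har f (A \<beta>) (fst Q) (hh \<beta>)"])
    show "ub f \<cdot> Har f (A \<beta>) (fst Q) (hh \<beta>) \<in> Hom V (Hob f (A \<beta>)) (fst Q)" if "f \<in> Sym L" "(\<beta>, \<alpha>) \<in> lt" for f \<beta>
      by (rule cmp_hom[OF Hhh[OF that] ub_hom[OF that(1)]])
    fix f \<beta> \<gamma> assume f: "f \<in> Sym L" "(\<beta>, \<gamma>) \<in> lt" "(\<gamma>, \<alpha>) \<in> lt"
    have tb: "t \<beta> \<gamma> \<in> Hom V (A \<beta>) (A \<gamma>)" by (rule t_hom) (use f(2) le_def in blast)
    show "ub f \<cdot> Har f (A \<gamma>) (fst Q) (hh \<gamma>) \<cdot> Har f (A \<beta>) (A \<gamma>) (t \<beta> \<gamma>) = ub f \<cdot> Har f (A \<beta>) (fst Q) (hh \<beta>)"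
      by (simp only: cmp_assoc[OF Har_hom[OF f(1) tb] Hhh[OF f(1,3)] ub_hom[OF f(1)]]
        Har_cmp[OF f(1) tb goodD(1)[OF hh[OF f(3)]], symmetric] hh_t[OF f(2,3)])
  qed (rule that; assumption)
  \<comment> \<open>\<open>u\<close> was glued from the arrows \<open>hh \<beta>\<close>, whereas
    \<open>good\<close> speaks of the restrictions of \<open>u\<close> itself, so these have to be
    identified.\<close>
  have ut: "u \<cdot> t \<beta> \<alpha> = hh \<beta>" if b: "(\<beta>, \<alpha>) \<in> lt" for \<beta>
  proof -
    have le: "le \<beta> \<alpha>" using b unfolding le_def by blast
    note tb = t_hom[OF le] and hb = goodD[OF hh[OF b]]
    show ?thesis
    proof (rule stage_epi[OF cmp_hom[OF tb u(1)] hb(1)])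
      show "u \<cdot> t \<beta> \<alpha> \<cdot> s \<beta> None = hh \<beta> \<cdot> s \<beta> None"
        by (simp only: cmp_assoc[OF s_None tb u(1)] t_None[OF le] u(2) hb(2))
      fix f \<gamma> assume f: "f \<in> Sym L" "(\<gamma>, \<beta>) \<in> lt"
      show "u \<cdot> t \<beta> \<alpha> \<cdot> s \<beta> (Some (f, \<gamma>)) = hh \<beta> \<cdot> s \<beta> (Some (f, \<gamma>))"
        by (simp only: cmp_assoc[OF s_Some[OF f] tb u(1)] t_Some[OF le f] us[OF f(1) lt_trans[OF f(2) b]] hb(3)[OF f] hh_t[OF f(2) b])
    qed
  qed
  have gu: "good \<alpha> u" unfolding good_def using u us ut by simp
  show ?case
  proof (rule ex1I[of _ u])
    show "good \<alpha> u" by (rule gu)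
  next
    fix h assume h: "good \<alpha> h"
    have ht: "h \<cdot> t \<beta> \<alpha> = hh \<beta>" if "(\<beta>, \<alpha>) \<in> lt" for \<beta>
      using hh_unique[OF that good_restrict[OF h]] that unfolding le_def by blast
    show "h = u"
      by (rule stage_epi[OF goodD(1)[OF h] u(1)]) (simp_all only: goodD(2)[OF h] u(2) goodD(3)[OF h] us ht)
  qed
qed

end


subsection \<open>The colimit of the chain\<close>

text \<open>Regularity of \<open>l\<close>: a subset with fewer than \<open>l\<close> elements is
  not cofinal. Hence the chain is \<open>l\<close>-directed, as presentability of the arities
  demands.\<close>

lemma bounded: "\<lbrakk>K \<subseteq> Field l; |K| <o l\<rbrakk> \<Longrightarrow> \<exists>b\<in>Field l. \<forall>a\<in>K. (a, b) \<in> l"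
proof -
  assume K: "K \<subseteq> Field l" "|K| <o l"
  have "\<not> cofinal K l"
    using regularCard_l K not_ordLess_ordIso unfolding regularCard_def by blast
  then obtain b where b: "b \<in> Field l" "\<forall>a\<in>K. b = a \<or> (b, a) \<notin> l" unfolding cofinal_def by blast
  have "(a, b) \<in> l" if "a \<in> K" for a
    using b that K(1) le_total[of a b] le_iff[of a b] le_iff[of b a] unfolding le_def lt_def by blast
  then show ?thesis using b by blast
qed

text \<open>Copies the chain to an index category in \<open>'u\<close> and records the universal
  properties of its colimit \<open>C\<close> and, for presentable \<open>P\<close>, of
  \<open>[P,C]\<close>, with indices back in \<open>Field l\<close>.\<close>

lemma chain_colimit:
  obtains C k where "C \<in> Ob V" "\<And>\<alpha>. \<alpha> \<in> Field l \<Longrightarrow> k \<alpha> \<in> Hom V (A \<alpha>) C"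
    "\<And>\<alpha> \<beta>. (\<beta>, \<alpha>) \<in> lt \<Longrightarrow> k \<alpha> \<cdot> t \<beta> \<alpha> = k \<beta>"
    "\<And>u v Y. \<lbrakk>u \<in> Hom V C Y; v \<in> Hom V C Y; \<forall>\<alpha>\<in>Field l. u \<cdot> k \<alpha> = v \<cdot> k \<alpha>\<rbrakk> \<Longrightarrow> u = v"
    "\<And>Y y. \<lbrakk>Y \<in> Ob V; \<forall>\<alpha>\<in>Field l. y \<alpha> \<in> Hom V (A \<alpha>) Y; \<forall>\<alpha> \<beta>. (\<beta>, \<alpha>) \<in> lt \<longrightarrow> y \<alpha> \<cdot> t \<beta> \<alpha> = y \<beta>\<rbrakk>
      \<Longrightarrow> \<exists>u. u \<in> Hom V C Y \<and> (\<forall>\<alpha>\<in>Field l. u \<cdot> k \<alpha> = y \<alpha>)"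
    "\<And>P u v Y. \<lbrakk>presentable \<kappa> l V P; u \<in> Hom V (ihom V P C) Y; v \<in> Hom V (ihom V P C) Y;
      \<forall>\<alpha>\<in>Field l. u \<cdot> post V P (A \<alpha>) C (k \<alpha>) = v \<cdot> post V P (A \<alpha>) C (k \<alpha>)\<rbrakk> \<Longrightarrow> u = v"
    "\<And>P Y y. \<lbrakk>presentable \<kappa> l V P; Y \<in> Ob V; \<forall>\<alpha>\<in>Field l. y \<alpha> \<in> Hom V (ihom V P (A \<alpha>)) Y;
      \<forall>\<alpha> \<beta>. (\<beta>, \<alpha>) \<in> lt \<longrightarrow> y \<alpha> \<cdot> post V P (A \<beta>) (A \<alpha>) (t \<beta> \<alpha>) = y \<beta>\<rbrakk>
      \<Longrightarrow> \<exists>u. u \<in> Hom V (ihom V P C) Y \<and> (\<forall>\<alpha>\<in>Field l. u \<cdot> post V P (A \<alpha>) C (k \<alpha>) = y \<alpha>)"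
proof -
  obtain \<iota> :: "'l \<Rightarrow> 'u" where \<iota>: "inj_on \<iota> (Field l)" using small_embed[OF small_Field_l] .
  \<comment> \<open>One label for all arrows of the thin category \<open>J\<close>.\<close>
  obtain u0 :: 'u where True by blast
  define dec where "dec = the_inv_into (Field l) \<iota>"
  have dec: "dec (\<iota> a) = a" if "a \<in> Field l" for a
    using that \<iota> unfolding dec_def by (simp add: the_inv_into_f_f)
  have decF: "dec x \<in> Field l" "\<iota> (dec x) = x" if "x \<in> \<iota> ` Field l" for x using that dec by auto
  define J :: "('u, 'u) cat" where "J = \<lparr>Ob = \<iota> ` Field l,
     Hom = (\<lambda>x y. {w. w = u0 \<and> x \<in> \<iota> ` Field l \<and> y \<in> \<iota> ` Field l \<and> (dec x, dec y) \<in> l}),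
     Idt = (\<lambda>_. u0), Cmp = (\<lambda>_ _. u0)\<rparr>"
  have J_sel: "Ob J = \<iota> ` Field l" "Idt J x = u0" "Cmp J g f = u0" for x g f unfolding J_def by auto
  have HomJ: "w \<in> Hom J x y \<longleftrightarrow> w = u0 \<and> x \<in> \<iota> ` Field l \<and> y \<in> \<iota> ` Field l \<and> (dec x, dec y) \<in> l" for w x y
    unfolding J_def by simp
  have refl: "(a, a) \<in> l" if "a \<in> Field l" for a using l_order(4) that unfolding refl_on_def by blast
  have catJ: "category J"
  proof
    fix f A B assume "f \<in> Hom J A B" then show "A \<in> Ob J \<and> B \<in> Ob J" unfolding HomJ J_sel by blast
  next
    fix A assume "A \<in> Ob J" then show "Idt J A \<in> Hom J A A" unfolding HomJ J_sel using decF(1) refl by blast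
  next
    fix f A B g E assume "f \<in> Hom J A B" "g \<in> Hom J B E"
    then show "g \<cdot>\<^bsub>J\<^esub> f \<in> Hom J A E" unfolding HomJ J_sel using l_order(1) unfolding trans_def by blast
  next
    fix f A B assume "f \<in> Hom J A B" then show "Idt J B \<cdot>\<^bsub>J\<^esub> f = f" "f \<cdot>\<^bsub>J\<^esub> Idt J A = f" unfolding HomJ J_sel by auto
  next
    fix f A B g E h G show "h \<cdot>\<^bsub>J\<^esub> g \<cdot>\<^bsub>J\<^esub> f = h \<cdot>\<^bsub>J\<^esub> (g \<cdot>\<^bsub>J\<^esub> f)" unfolding J_sel ..
  qed
  have "small \<kappa> (Hom J x y)" for x y
    by (rule small_subset[OF _ small_finite[of "{u0}"]]) (auto simp: HomJ)
  then have smJ: "small_category \<kappa> J"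
    using catJ small_image[OF small_Field_l] unfolding small_category_def J_sel by blast
  have J: "directed_poset \<kappa> l J"
    unfolding directed_poset_def
  proof (intro conjI allI ballI impI smJ)
    fix x y w w' assume "w \<in> Hom J x y" "w' \<in> Hom J x y" then show "w = w'" unfolding HomJ by blast
  next
    fix x y assume "Hom J x y \<noteq> {} \<and> Hom J y x \<noteq> {}"
    then have "u0 \<in> Hom J x y" "u0 \<in> Hom J y x" using HomJ by blast+
    then have "dec x = dec y" "x \<in> \<iota> ` Field l" "y \<in> \<iota> ` Field l" using l_order(2) unfolding HomJ antisym_def by blast+
    then show "x = y" using decF(2) by metis
  next
    fix S assume S: "S \<subseteq> Ob J" "|S| <o l"
    have "dec ` S \<subseteq> Field l" using S(1) decF(1) unfolding J_sel by blast
    moreover have "|dec ` S| <o l" using ordLeq_ordLess_trans[OF card_of_image S(2)] .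
    ultimately obtain b where b: "b \<in> Field l" "\<forall>a\<in>dec ` S. (a, b) \<in> l" using bounded by blast
    have "u0 \<in> Hom J x (\<iota> b)" if "x \<in> S" for x
      using that S(1) b dec[OF b(1)] unfolding HomJ J_sel by auto
    then show "\<exists>j\<in>Ob J. \<forall>i\<in>S. Hom J i j \<noteq> {}" using b(1) unfolding J_sel by blast
  qed
  define D where "D x = A (dec x)" for x
  define d where "d x y (w :: 'u) = t (dec x) (dec y)" for x y w
  have leJ: "le (dec x) (dec y)" if "w \<in> Hom J x y" for w x y
    using that le_iff decF(1) unfolding HomJ by blast
  have dg: "diagram J V D d"
    unfolding diagram_def D_def d_def
  proof (intro conjI ballI allI)
    fix i j k a b assume ab: "a \<in> Hom J i j" "b \<in> Hom J j k"
    show "t (dec i) (dec k) = t (dec j) (dec k) \<cdot> t (dec i) (dec j)"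
      by (rule t_cmp[OF leJ[OF ab(1)] leJ[OF ab(2)], symmetric])
  next
    fix i j a assume "a \<in> Hom J i j"
    then show "t (dec i) (dec j) \<in> Hom V (A (dec i)) (A (dec j))" by (rule t_hom[OF leJ])
  qed (rule A_ob t_idt)+
  obtain C c where col: "colimit J V D d C c"
    using cocomplete[OF smJ dg] by blast
  note cc = colimitD[OF col]
  have \<iota>J: "\<iota> a \<in> Ob J" if "a \<in> Field l" for a using that unfolding J_sel by blast
  have \<iota>H: "u0 \<in> Hom J (\<iota> b) (\<iota> a)" if "(b, a) \<in> lt" for a b
    using that lt_Field[OF that] dec unfolding HomJ lt_def by auto
  have D\<iota>: "D (\<iota> a) = A a" if "a \<in> Field l" for a using dec[OF that] unfolding D_def by simp
  \<comment> \<open>The ends of an arrow are equal or strictly ordered; the first case is settled by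
    \<open>t_idt\<close>. \<open>F\<close> stands for the identity or for the action of
    \<open>[P,-]\<close>, so both gluing statements use this.\<close>
  have compat: "y (dec j) \<cdot> F (dec i) (dec j) (d i j a) = y (dec i)"
    if a: "a \<in> Hom J i j" and y: "\<forall>\<alpha> \<beta>. (\<beta>, \<alpha>) \<in> lt \<longrightarrow> y \<alpha> \<cdot> F \<beta> \<alpha> (t \<beta> \<alpha>) = y \<beta>"
      and i: "y (dec i) \<cdot> F (dec i) (dec i) (Idt V (A (dec i))) = y (dec i)" for F y i j a
    using leJ[OF a] y i t_idt unfolding d_def le_def by metis
  show ?thesis
  proof (rule that[of C "\<lambda>a. c (\<iota> a)"])
    show "C \<in> Ob V" by (rule cc)
    show "c (\<iota> a) \<in> Hom V (A a) C" if "a \<in> Field l" for a using cc(2)[OF \<iota>J[OF that]] D\<iota>[OF that] by simp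
    show "c (\<iota> a) \<cdot> t b a = c (\<iota> b)" if "(b, a) \<in> lt" for a b
      using cc(3)[OF \<iota>H[OF that]] dec lt_Field[OF that] unfolding d_def by simp
    show "u = v" if "u \<in> Hom V C Y" "v \<in> Hom V C Y" "\<forall>a\<in>Field l. u \<cdot> c (\<iota> a) = v \<cdot> c (\<iota> a)" for u v Y
      by (rule colimit_epi[OF col catJ dg that(1,2)]) (use that(3) in \<open>auto simp: J_sel\<close>)
    show "\<exists>u. u \<in> Hom V C Y \<and> (\<forall>a\<in>Field l. u \<cdot> c (\<iota> a) = y a)"
      if Y: "Y \<in> Ob V" and y: "\<forall>a\<in>Field l. y a \<in> Hom V (A a) Y" "\<forall>\<alpha> \<beta>. (\<beta>, \<alpha>) \<in> lt \<longrightarrow> y \<alpha> \<cdot> t \<beta> \<alpha> = y \<beta>" for Y y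
    proof -
      obtain u where "u \<in> Hom V C Y" "\<And>x. x \<in> Ob J \<Longrightarrow> u \<cdot> c x = y (dec x)"
      proof (rule colimit_glue[OF col Y, of "\<lambda>x. y (dec x)"])
        show yh: "y (dec x) \<in> Hom V (D x) Y" if "x \<in> Ob J" for x
          using that y(1) decF(1) unfolding J_sel D_def by blast
        fix i j a assume a: "a \<in> Hom J i j"
        have "i \<in> Ob J" using a category.hom_ob[OF catJ] by blast
        then show "y (dec j) \<cdot> d i j a = y (dec i)"
          using compat[OF a, of y "\<lambda>_ _ w. w"] y(2) idt_right[OF yh] unfolding D_def by blast
      qed (rule that; assumption)
      then show ?thesis using dec \<iota>J by metis
    qed
    show "u = v" if P: "presentable \<kappa> l V P" and u: "u \<in> Hom V (ihom V P C) Y" "v \<in> Hom V (ihom V P C) Y"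
      and e: "\<forall>a\<in>Field l. u \<cdot> post V P (A a) C (c (\<iota> a)) = v \<cdot> post V P (A a) C (c (\<iota> a))" for P u v Y
      by (rule ihom_colimit_epi[OF J dg col P u]) (use e dec in \<open>auto simp: J_sel D_def\<close>)
    show "\<exists>u. u \<in> Hom V (ihom V P C) Y \<and> (\<forall>a\<in>Field l. u \<cdot> post V P (A a) C (c (\<iota> a)) = y a)"
      if P: "presentable \<kappa> l V P" and Y: "Y \<in> Ob V" and y: "\<forall>a\<in>Field l. y a \<in> Hom V (ihom V P (A a)) Y"
        "\<forall>\<alpha> \<beta>. (\<beta>, \<alpha>) \<in> lt \<longrightarrow> y \<alpha> \<cdot> post V P (A \<beta>) (A \<alpha>) (t \<beta> \<alpha>) = y \<beta>" for P Y y
    proof -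
      have Po: "P \<in> Ob V" using P unfolding presentable_def by blast
      obtain u where "u \<in> Hom V (ihom V P C) Y" "\<And>x. x \<in> Ob J \<Longrightarrow> u \<cdot> post V P (D x) C (c x) = y (dec x)"
      proof (rule ihom_colimit_glue[OF J dg col P Y, of "\<lambda>x. y (dec x)"])
        show yh: "y (dec x) \<in> Hom V (ihom V P (D x)) Y" if "x \<in> Ob J" for x
          using that y(1) decF(1) unfolding J_sel D_def by blast
        fix i j a assume a: "a \<in> Hom J i j"
        have i: "i \<in> Ob J" using a category.hom_ob[OF catJ] by blast
        show "y (dec j) \<cdot> post V P (D i) (D j) (d i j a) = y (dec i)"
          using compat[OF a, of y "\<lambda>b a. post V P (A b) (A a)"] y(2) idt_right[OF yh[OF i]] post_idt[OF A_ob Po]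
          unfolding D_def by simp
      qed (rule that; assumption)
      then show ?thesis using dec \<iota>J D\<iota> by metis
    qed
  qed
qed

text \<open>The chain need not become stationary: since \<open>[In f, C]\<close> is the colimit of
  the \<open>[In f, A \<alpha>]\<close>, the maps from each stage into later ones already define
  operations on \<open>C\<close>. Only the ordinary universal property is obtained here.\<close>

lemma free_structure:
  obtains P \<eta> where "P \<in> Ob StrL" "\<eta> \<in> Hom V X (fst P)"
    "\<And>Q x. \<lbrakk>Q \<in> Ob StrL; x \<in> Hom V X (fst Q)\<rbrakk> \<Longrightarrow> \<exists>!h. h \<in> Hom StrL P Q \<and> h \<cdot> \<eta> = x"
proof -
  obtain C k where C: "C \<in> Ob V" and k: "\<And>\<alpha>. \<alpha> \<in> Field l \<Longrightarrow> k \<alpha> \<in> Hom V (A \<alpha>) C"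
    and kt: "\<And>\<alpha> \<beta>. (\<beta>, \<alpha>) \<in> lt \<Longrightarrow> k \<alpha> \<cdot> t \<beta> \<alpha> = k \<beta>"
    and C_epi: "\<And>u v Y. \<lbrakk>u \<in> Hom V C Y; v \<in> Hom V C Y; \<forall>\<alpha>\<in>Field l. u \<cdot> k \<alpha> = v \<cdot> k \<alpha>\<rbrakk> \<Longrightarrow> u = v"
    and C_glue: "\<And>Y y. \<lbrakk>Y \<in> Ob V; \<forall>\<alpha>\<in>Field l. y \<alpha> \<in> Hom V (A \<alpha>) Y; \<forall>\<alpha> \<beta>. (\<beta>, \<alpha>) \<in> lt \<longrightarrow> y \<alpha> \<cdot> t \<beta> \<alpha> = y \<beta>\<rbrakk>
      \<Longrightarrow> \<exists>u. u \<in> Hom V C Y \<and> (\<forall>\<alpha>\<in>Field l. u \<cdot> k \<alpha> = y \<alpha>)"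
    and H_epi: "\<And>P u v Y. \<lbrakk>presentable \<kappa> l V P; u \<in> Hom V (ihom V P C) Y; v \<in> Hom V (ihom V P C) Y;
      \<forall>\<alpha>\<in>Field l. u \<cdot> post V P (A \<alpha>) C (k \<alpha>) = v \<cdot> post V P (A \<alpha>) C (k \<alpha>)\<rbrakk> \<Longrightarrow> u = v"
    and H_glue: "\<And>P Y y. \<lbrakk>presentable \<kappa> l V P; Y \<in> Ob V; \<forall>\<alpha>\<in>Field l. y \<alpha> \<in> Hom V (ihom V P (A \<alpha>)) Y;
      \<forall>\<alpha> \<beta>. (\<beta>, \<alpha>) \<in> lt \<longrightarrow> y \<alpha> \<cdot> post V P (A \<beta>) (A \<alpha>) (t \<beta> \<alpha>) = y \<beta>\<rbrakk>
      \<Longrightarrow> \<exists>u. u \<in> Hom V (ihom V P C) Y \<and> (\<forall>\<alpha>\<in>Field l. u \<cdot> post V P (A \<alpha>) C (k \<alpha>) = y \<alpha>)"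
    by (rule chain_colimit) (rule that; assumption)
  obtain a0 where a0: "a0 \<in> Field l" using infinite_l by fastforce
  have kt': "k \<alpha> \<cdot> t \<beta> \<alpha> = k \<beta>" if "le \<beta> \<alpha>" "\<alpha> \<in> Field l" for \<alpha> \<beta>
    using that kt t_idt idt_right[OF k] unfolding le_def by metis
  have k_None: "k \<alpha> \<cdot> s \<alpha> None = k \<beta> \<cdot> s \<beta> None" if "le \<beta> \<alpha>" "\<alpha> \<in> Field l" "\<beta> \<in> Field l" for \<alpha> \<beta>
    by (simp only: kt'[OF that(1,2), symmetric] cmp_assoc[OF s_None t_hom[OF that(1)] k[OF that(2)]] t_None[OF that(1)])
  define \<eta> where "\<eta> = k a0 \<cdot> s a0 None"
  have \<eta>: "\<eta> \<in> Hom V X C" unfolding \<eta>_def by (rule cmp_hom[OF s_None k[OF a0]])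
  have k_\<eta>: "k \<alpha> \<cdot> s \<alpha> None = \<eta>" if "\<alpha> \<in> Field l" for \<alpha>
    using le_total[OF that a0] k_None that a0 unfolding \<eta>_def by metis
  \<comment> \<open>The summand \<open>(f, \<beta>)\<close> occurs only after stage
    \<open>\<beta>\<close>, so some later stage has to be chosen; \<open>\<sigma>\<close> does not
    depend on the choice.\<close>
  define nx where "nx \<beta> = (SOME \<alpha>. (\<beta>, \<alpha>) \<in> lt)" for \<beta>
  have nx: "(\<beta>, nx \<beta>) \<in> lt" if "\<beta> \<in> Field l" for \<beta> unfolding nx_def by (rule someI_ex[OF lt_next[OF that]])
  define \<sigma> where "\<sigma> f \<beta> = k (nx \<beta>) \<cdot> s (nx \<beta>) (Some (f, \<beta>))" for f \<beta>
  have k_Some: "k \<alpha> \<cdot> s \<alpha> (Some (f, \<gamma>)) = k \<beta> \<cdot> s \<beta> (Some (f, \<gamma>))"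
    if "le \<beta> \<alpha>" "\<alpha> \<in> Field l" "\<beta> \<in> Field l" "f \<in> Sym L" "(\<gamma>, \<beta>) \<in> lt" for \<alpha> \<beta> \<gamma> f
    by (simp only: kt'[OF that(1,2), symmetric] cmp_assoc[OF s_Some[OF that(4,5)] t_hom[OF that(1)] k[OF that(2)]] t_Some[OF that(1,4,5)])
  have \<sigma>: "k \<alpha> \<cdot> s \<alpha> (Some (f, \<beta>)) = \<sigma> f \<beta>" if "f \<in> Sym L" "(\<beta>, \<alpha>) \<in> lt" for \<alpha> \<beta> f
  proof -
    have F: "\<alpha> \<in> Field l" "\<beta> \<in> Field l" using lt_Field[OF that(2)] by auto
    have F': "nx \<beta> \<in> Field l" using lt_Field[OF nx[OF F(2)]] by blast
    show ?thesis unfolding \<sigma>_def using le_total[OF F(1) F'] k_Some F F' that nx[OF F(2)] by metis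
  qed
  have \<sigma>_hom: "\<sigma> f \<beta> \<in> Hom V (Hob f (A \<beta>)) C" if "f \<in> Sym L" "\<beta> \<in> Field l" for f \<beta>
    unfolding \<sigma>_def using cmp_hom[OF s_Some[OF that(1) nx[OF that(2)]] k] lt_Field[OF nx[OF that(2)]] by blast
  have \<sigma>_nat: "\<sigma> f \<gamma> \<cdot> Har f (A \<beta>) (A \<gamma>) (t \<beta> \<gamma>) = \<sigma> f \<beta>" if "f \<in> Sym L" "(\<beta>, \<gamma>) \<in> lt" for f \<beta> \<gamma>
  proof -
    have F: "\<gamma> \<in> Field l" using lt_Field[OF that(2)] by blast
    note n = nx[OF F]
    have F': "nx \<gamma> \<in> Field l" using lt_Field[OF n] by blast
    have tb: "t \<beta> \<gamma> \<in> Hom V (A \<beta>) (A \<gamma>)" by (rule t_hom) (use that(2) le_def in blast)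
    show ?thesis
      by (simp only: \<sigma>[OF that(1) n, symmetric] cmp_assoc[OF Har_hom[OF that(1) tb] s_Some[OF that(1) n] k[OF F']]
        s_edge[OF that(1,2) n] \<sigma>[OF that(1) lt_trans[OF that(2) n]])
  qed
  let ?z = "\<lambda>f \<beta>. curry V (ihom V (In L f) (A \<beta>)) (Out L f) C (\<sigma> f \<beta>)"
  have z: "?z f \<beta> \<in> Hom V (ihom V (In L f) (A \<beta>)) (ihom V (Out L f) C)" "unc (Out L f) C (?z f \<beta>) = \<sigma> f \<beta>"
    if "f \<in> Sym L" "\<beta> \<in> Field l" for f \<beta>
    using curry_unique[OF ihom_ob[OF arity_ob(1)[OF that(1)] A_ob] arity_ob(2)[OF that(1)] \<sigma>_hom[OF that, unfolded Hob_def]] by auto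
  \<comment> \<open>The operation is prescribed on the stages of \<open>[In f, C]\<close> by the
    transposes of \<open>\<sigma> f \<alpha>\<close>; gluing them needs the input arity to be
    presentable.\<close>
  have "\<exists>c. c \<in> Hom V (ihom V (In L f) C) (ihom V (Out L f) C) \<and> (\<forall>\<alpha>\<in>Field l. c \<cdot> post V (In L f) (A \<alpha>) C (k \<alpha>) = ?z f \<alpha>)"
    if f: "f \<in> Sym L" for f
  proof (rule H_glue[OF arity_presentable(1)[OF f] ihom_ob[OF arity_ob(2)[OF f] C]])
    show "\<forall>\<alpha>\<in>Field l. ?z f \<alpha> \<in> Hom V (ihom V (In L f) (A \<alpha>)) (ihom V (Out L f) C)" using z(1)[OF f] by blast
    show "\<forall>\<alpha> \<beta>. (\<beta>, \<alpha>) \<in> lt \<longrightarrow> ?z f \<alpha> \<cdot> post V (In L f) (A \<beta>) (A \<alpha>) (t \<beta> \<alpha>) = ?z f \<beta>"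
    proof (intro allI impI)
      fix \<alpha> \<beta> assume ba: "(\<beta>, \<alpha>) \<in> lt"
      have F: "\<alpha> \<in> Field l" "\<beta> \<in> Field l" using lt_Field[OF ba] by auto
      have tb: "t \<beta> \<alpha> \<in> Hom V (A \<beta>) (A \<alpha>)" by (rule t_hom) (use ba le_def in blast)
      note p = post_hom[OF tb arity_ob(1)[OF f]]
      have "unc (Out L f) C (?z f \<alpha> \<cdot> post V (In L f) (A \<beta>) (A \<alpha>) (t \<beta> \<alpha>)) = unc (Out L f) C (?z f \<beta>)"
        using \<sigma>_nat[OF f ba] unfolding Har_def
        by (simp only: unc_cmp[OF z(1)[OF f F(1)] p arity_ob(2)[OF f] C] z(2)[OF f F(1)] z(2)[OF f F(2)])
      then show "?z f \<alpha> \<cdot> post V (In L f) (A \<beta>) (A \<alpha>) (t \<beta> \<alpha>) = ?z f \<beta>"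
        by (rule unc_inject[OF _ cmp_hom[OF p z(1)[OF f F(1)]] z(1)[OF f F(2)] arity_ob(2)[OF f] C])
    qed
  qed
  then obtain c where c: "\<And>f. f \<in> Sym L \<Longrightarrow> c f \<in> Hom V (ihom V (In L f) C) (ihom V (Out L f) C)"
    and ck: "\<And>f \<alpha>. \<lbrakk>f \<in> Sym L; \<alpha> \<in> Field l\<rbrakk> \<Longrightarrow> c f \<cdot> post V (In L f) (A \<alpha>) C (k \<alpha>) = ?z f \<alpha>" by metis
  let ?P = "(C, restrict c (Sym L))"
  have P: "?P \<in> Ob StrL" by (rule Str_obI[OF C c])
  show ?thesis
  proof (rule that[of ?P \<eta>, unfolded fst_conv, OF P \<eta>])
    fix Q x assume Q: "Q \<in> Ob StrL" and x: "x \<in> Hom V X (fst Q)"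
    note B = Str_ob[OF Q]
    define hh where "hh \<alpha> = (THE h. good Q x \<alpha> h)" for \<alpha>
    have hh: "good Q x \<alpha> (hh \<alpha>)" for \<alpha> unfolding hh_def by (rule theI'[OF good_ex1[OF Q x]])
    have hh_unique: "h = hh \<alpha>" if "good Q x \<alpha> h" for \<alpha> h using good_ex1[OF Q x, of \<alpha>] hh[of \<alpha>] that by blast
    note hg = goodD[OF Q x hh]
    have hh_t: "hh \<alpha> \<cdot> t \<beta> \<alpha> = hh \<beta>" if "(\<beta>, \<alpha>) \<in> lt" for \<alpha> \<beta>
      using hh_unique[OF good_restrict[OF Q x hh]] that unfolding le_def by blast
    obtain h where h: "h \<in> Hom V C (fst Q)" "\<forall>\<alpha>\<in>Field l. h \<cdot> k \<alpha> = hh \<alpha>"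
      using C_glue[OF B, of hh] hg(1) hh_t by blast
    have h\<eta>: "h \<cdot> \<eta> = x"
      unfolding \<eta>_def using cmp_assoc[OF s_None k[OF a0] h(1)] h(2) a0 hg(2) by simp
    \<comment> \<open>The stages of \<open>[In f, C]\<close> are jointly epic, and on stage
      \<open>\<alpha>\<close> the claim is the condition in \<open>good\<close> at the later stage
      \<open>nx \<alpha>\<close>.\<close>
    have hom: "post V (Out L f) C (fst Q) h \<cdot> c f = snd Q f \<cdot> post V (In L f) C (fst Q) h" if f: "f \<in> Sym L" for f
    proof (rule H_epi[OF arity_presentable(1)[OF f]])
      note Xf = arity_ob(1)[OF f] and Yf = arity_ob(2)[OF f]
      note hX = post_hom[OF h(1) Xf] and hY = post_hom[OF h(1) Yf] and b = Str_op[OF Q f]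
      show "post V (Out L f) C (fst Q) h \<cdot> c f \<in> Hom V (ihom V (In L f) C) (ihom V (Out L f) (fst Q))"
        by (rule cmp_hom[OF c[OF f] hY])
      show "snd Q f \<cdot> post V (In L f) C (fst Q) h \<in> Hom V (ihom V (In L f) C) (ihom V (Out L f) (fst Q))"
        by (rule cmp_hom[OF hX b])
      show "\<forall>\<alpha>\<in>Field l. post V (Out L f) C (fst Q) h \<cdot> c f \<cdot> post V (In L f) (A \<alpha>) C (k \<alpha>) =
          snd Q f \<cdot> post V (In L f) C (fst Q) h \<cdot> post V (In L f) (A \<alpha>) C (k \<alpha>)"
      proof
        fix \<alpha> assume \<alpha>: "\<alpha> \<in> Field l"
        note n = nx[OF \<alpha>]
        have F': "nx \<alpha> \<in> Field l" using lt_Field[OF n] by blast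
        note ka = k[OF \<alpha>] and kX = post_hom[OF k[OF \<alpha>] Xf] and hhX = post_hom[OF hg(1) Xf]
        have "unc (Out L f) (fst Q) (post V (Out L f) C (fst Q) h \<cdot> ?z f \<alpha>) = h \<cdot> k (nx \<alpha>) \<cdot> s (nx \<alpha>) (Some (f, \<alpha>))"
          by (simp only: unc_post[OF h(1) z(1)[OF f \<alpha>] Yf] z(2)[OF f \<alpha>] cmp_assoc[OF s_Some[OF f n] k[OF F'] h(1)] \<sigma>[OF f n])
        also have "\<dots> = unc (Out L f) (fst Q) (snd Q f) \<cdot> Har f (A \<alpha>) (fst Q) (hh \<alpha>)"
          using h(2) F' hg(3)[OF f n] hh_t[OF n] by simp
        also have "\<dots> = unc (Out L f) (fst Q) (snd Q f \<cdot> post V (In L f) (A \<alpha>) (fst Q) (hh \<alpha>))"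
          unfolding Har_def by (rule unc_cmp[OF b hhX Yf B, symmetric])
        finally have "post V (Out L f) C (fst Q) h \<cdot> ?z f \<alpha> = snd Q f \<cdot> post V (In L f) (A \<alpha>) (fst Q) (hh \<alpha>)"
          by (rule unc_inject[OF _ cmp_hom[OF z(1)[OF f \<alpha>] hY] cmp_hom[OF hhX b] Yf B])
        then show "post V (Out L f) C (fst Q) h \<cdot> c f \<cdot> post V (In L f) (A \<alpha>) C (k \<alpha>) =
          snd Q f \<cdot> post V (In L f) C (fst Q) h \<cdot> post V (In L f) (A \<alpha>) C (k \<alpha>)"
          using h(2) \<alpha> by (simp only: cmp_assoc[OF kX c[OF f] hY] ck[OF f \<alpha>] cmp_assoc[OF kX hX b] post_cmp[OF ka h(1) Xf, symmetric])
      qed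
    qed
    show "\<exists>!h. h \<in> Hom StrL ?P Q \<and> h \<cdot> \<eta> = x"
    proof (rule ex1I[of _ h])
      show "h \<in> Hom StrL ?P Q \<and> h \<cdot> \<eta> = x" unfolding Str_hom_iff using P Q h(1) h\<eta> hom by simp
      fix g assume g: "g \<in> Hom StrL ?P Q \<and> g \<cdot> \<eta> = x"
      then have gh: "g \<in> Hom V C (fst Q)"
        and gc: "\<And>f. f \<in> Sym L \<Longrightarrow> post V (Out L f) C (fst Q) g \<cdot> c f = snd Q f \<cdot> post V (In L f) C (fst Q) g"
        unfolding Str_hom_iff by auto
      \<comment> \<open>Uniqueness: every homomorphism extending \<open>x\<close> restricts to good
        arrows, of which there is one at each stage.\<close>
      have "good Q x \<alpha> (g \<cdot> k \<alpha>)" if \<alpha>: "\<alpha> \<in> Field l" for \<alpha>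
        unfolding good_def[OF Q x]
      proof (intro conjI ballI allI impI)
        show "g \<cdot> k \<alpha> \<in> Hom V (A \<alpha>) (fst Q)" by (rule cmp_hom[OF k[OF \<alpha>] gh])
        show "g \<cdot> k \<alpha> \<cdot> s \<alpha> None = x" using g by (simp only: cmp_assoc[OF s_None k[OF \<alpha>] gh] k_\<eta>[OF \<alpha>])
        fix f \<beta> assume f: "f \<in> Sym L" and b: "(\<beta>, \<alpha>) \<in> lt"
        have \<beta>: "\<beta> \<in> Field l" using lt_Field[OF b] by blast
        have tb: "t \<beta> \<alpha> \<in> Hom V (A \<beta>) (A \<alpha>)" by (rule t_hom) (use b le_def in blast)
        note Xf = arity_ob(1)[OF f] and Yf = arity_ob(2)[OF f] and o = Str_op[OF Q f]
        note gX = post_hom[OF gh Xf] and gY = post_hom[OF gh Yf] and kX = post_hom[OF k[OF \<beta>] Xf]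
        have "g \<cdot> k \<alpha> \<cdot> s \<alpha> (Some (f, \<beta>)) = unc (Out L f) (fst Q) (post V (Out L f) C (fst Q) g \<cdot> (c f \<cdot> post V (In L f) (A \<beta>) C (k \<beta>)))"
          by (simp only: cmp_assoc[OF s_Some[OF f b] k[OF \<alpha>] gh] \<sigma>[OF f b] ck[OF f \<beta>] unc_post[OF gh z(1)[OF f \<beta>] Yf] z(2)[OF f \<beta>])
        also have "\<dots> = unc (Out L f) (fst Q) (snd Q f \<cdot> (post V (In L f) C (fst Q) g \<cdot> post V (In L f) (A \<beta>) C (k \<beta>)))"
          by (simp only: cmp_assoc[OF kX c[OF f] gY, symmetric] gc[OF f] cmp_assoc[OF kX gX o])
        also have "\<dots> = unc (Out L f) (fst Q) (snd Q f) \<cdot> Har f (A \<beta>) (fst Q) (g \<cdot> k \<beta>)"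
          unfolding Har_def by (simp only: post_cmp[OF k[OF \<beta>] gh Xf, symmetric] unc_cmp[OF o post_hom[OF cmp_hom[OF k[OF \<beta>] gh] Xf] Yf B])
        finally show "g \<cdot> k \<alpha> \<cdot> s \<alpha> (Some (f, \<beta>)) = unc (Out L f) (fst Q) (snd Q f) \<cdot> Har f (A \<beta>) (fst Q) (g \<cdot> k \<alpha> \<cdot> t \<beta> \<alpha>)"
          by (simp only: cmp_assoc[OF tb k[OF \<alpha>] gh] kt[OF b])
      qed
      then have "g \<cdot> k \<alpha> = h \<cdot> k \<alpha>" if "\<alpha> \<in> Field l" for \<alpha> using hh_unique h(2) that by metis
      then show "g = h" using C_epi[OF gh h(1)] by blast
    qed
  qed
qed

end


section \<open>The left adjoint \<open>F\<close> and its universal property\<close>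

context structures
begin

text \<open>The converse of \<open>phom_unit\<close>. \<open>F\<close> is chosen by its enriched
  property, so ordinary homomorphisms have to be extracted from families over the unit.\<close>

lemma phom_unitD:
  assumes k: "phom (unit V) P Q (h \<cdot> lun V (fst P))" and h: "h \<in> Hom V (fst P) (fst Q)"
  shows "h \<in> Hom StrL P Q"
  unfolding Str_hom_iff
proof (intro conjI ballI h)
  note k = phomD[OF k]
  show "P \<in> Ob StrL" "Q \<in> Ob StrL" by (rule k)+
  fix f assume f: "f \<in> Sym L"
  note X = arity_ob(1)[OF f] and Y = arity_ob(2)[OF f]
  note p = Str_op[OF k(2) f] Str_op[OF k(3) f] post_hom[OF h X] post_hom[OF h Y]
    lun_hom[OF ihom_ob[OF X k(5)]] lun_hom[OF ihom_ob[OF Y k(5)]] ten_hom[OF idt_hom[OF unit_ob] Str_op[OF k(2) f]]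
  have "snd Q f \<cdot> (post V (In L f) (fst P) (fst Q) h \<cdot> lun V (ihom V (In L f) (fst P))) =
      post V (Out L f) (fst P) (fst Q) h \<cdot> lun V (ihom V (Out L f) (fst P)) \<cdot> (Idt V (unit V) \<odot> snd P f)"
    using k(7)[OF f] by (simp only: ext_unit[OF h X] ext_unit[OF h Y])
  then have "post V (Out L f) (fst P) (fst Q) h \<cdot> snd P f \<cdot> lun V (ihom V (In L f) (fst P)) =
      snd Q f \<cdot> post V (In L f) (fst P) (fst Q) h \<cdot> lun V (ihom V (In L f) (fst P))"
    by (simp only: cmp_assoc[OF p(5,3,2)] cmp_assoc[OF p(7,6,4)] cmp_assoc[OF p(5,1,4)] lun_nat[OF p(1)])
  then show "post V (Out L f) (fst P) (fst Q) h \<cdot> snd P f = snd Q f \<cdot> post V (In L f) (fst P) (fst Q) h"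
    by (rule iso_epi[OF lun_iso[OF ihom_ob[OF X k(5)]] cmp_hom[OF p(1,4)] cmp_hom[OF p(3,2)]])
qed

text \<open>On generalized elements the transposition map restricts a family of homomorphisms along
  the unit.\<close>

lemma unc_transpose:
  assumes P: "P \<in> Ob StrL" and Q: "Q \<in> Ob StrL" and \<eta>: "\<eta> \<in> Hom V X (fst P)"
  shows "transpose V L X P \<eta> Q \<in> Hom V (SHom P Q) (ihom V X (fst Q))"
    and "u \<in> Hom V W (SHom P Q) \<Longrightarrow>
      unc X (fst Q) (transpose V L X P \<eta> Q \<cdot> u) = eps P Q \<cdot> (u \<odot> Idt V (fst P)) \<cdot> (Idt V W \<odot> \<eta>)"
proof -
  note B = Str_ob[OF Q] and i = str_inc_hom[OF P Q]
  show "transpose V L X P \<eta> Q \<in> Hom V (SHom P Q) (ihom V X (fst Q))"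
    unfolding transpose_def by (rule cmp_hom[OF i pre_hom[OF \<eta> B]])
  assume u: "u \<in> Hom V W (SHom P Q)"
  show "unc X (fst Q) (transpose V L X P \<eta> Q \<cdot> u) = eps P Q \<cdot> (u \<odot> Idt V (fst P)) \<cdot> (Idt V W \<odot> \<eta>)"
    unfolding transpose_def
    by (simp only: cmp_assoc[OF u i pre_hom[OF \<eta> B]] unc_pre[OF \<eta> cmp_hom[OF u i] B] unc_inc[OF P Q u])
qed

text \<open>An ordinary universal arrow is an enriched one because structures have powers.\<close>

lemma is_free_exists:
  assumes X: "X \<in> Ob V" obtains p where "is_free V L X p"
proof -
  interpret free_chain V \<kappa> l L X by unfold_locales (rule X)
  obtain P \<eta> where P: "P \<in> Ob StrL" and \<eta>: "\<eta> \<in> Hom V X (fst P)"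
    and free: "\<And>Q x. \<lbrakk>Q \<in> Ob StrL; x \<in> Hom V X (fst Q)\<rbrakk> \<Longrightarrow> \<exists>!h. h \<in> Hom StrL P Q \<and> h \<cdot> \<eta> = x"
    by (rule free_structure) (rule that; assumption)
  have "iso V (SHom P Q) (ihom V X (fst Q)) (transpose V L X P \<eta> Q)" if Q: "Q \<in> Ob StrL" for Q
  proof -
    note B = Str_ob[OF Q] and tr = unc_transpose[OF P Q \<eta>]
    have power: "\<exists>P'. P' \<in> Ob StrL \<and> fst P' = ihom V W (fst Q) \<and> phom W P' Q (evs W (fst Q)) \<and>
        (\<forall>A k. phom W A Q k \<longrightarrow> (\<exists>h. h \<in> Hom StrL A P' \<and> evs W (fst Q) \<cdot> (Idt V W \<odot> h) = k))" if "W \<in> Ob V" for W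
      using power_exists[OF that Q] phomD(2) by metis
    show ?thesis
    proof (rule isoI_elements[OF tr(1)])
      fix W v assume v: "v \<in> Hom V W (ihom V X (fst Q))"
      have W: "W \<in> Ob V" using v hom_ob by blast
      obtain P' where P': "P' \<in> Ob StrL" "fst P' = ihom V W (fst Q)" "phom W P' Q (evs W (fst Q))" using power[OF W] by blast
      note E = evs_hom[OF W B] and uv = unc_hom[OF v X B]
      \<comment> \<open>Read with \<open>W\<close> as exponent, the family
        \<open>W \<otimes> X -> UQ\<close> is a single arrow from \<open>X\<close> into the carrier
        of the power \<open>P'\<close>, to which ordinary freeness applies.\<close>
      obtain x where x: "x \<in> Hom V X (ihom V W (fst Q))" "evs W (fst Q) \<cdot> (Idt V W \<odot> x) = unc X (fst Q) v"
        by (rule evs_universal[OF uv W X])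
      obtain h where h: "h \<in> Hom StrL P P'" "h \<cdot> \<eta> = x" using free[OF P'(1)] x(1) P'(2) by metis
      note h' = Str_homD(3)[OF h(1), unfolded P'(2)]
      let ?k = "evs W (fst Q) \<cdot> (Idt V W \<odot> h)"
      obtain u where u: "u \<in> Hom V W (SHom P Q)" "eps P Q \<cdot> (u \<odot> Idt V (fst P)) = ?k"
        using eps_universal[OF P Q phom_pre[OF P'(3) h(1)]] by blast
      have "unc X (fst Q) (transpose V L X P \<eta> Q \<cdot> u) = unc X (fst Q) v"
        by (simp only: tr(2)[OF u(1)] u(2) cmp_assoc[OF ten_hom[OF idt_hom[OF W] \<eta>] ten_hom[OF idt_hom[OF W] h'] E]
          ten_cmp_right[OF \<eta> h' W, symmetric] h(2) x(2))
      then have "transpose V L X P \<eta> Q \<cdot> u = v" by (rule unc_inject[OF _ cmp_hom[OF u(1) tr(1)] v X B])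
      then show "\<exists>u. u \<in> Hom V W (SHom P Q) \<and> transpose V L X P \<eta> Q \<cdot> u = v" using u(1) by blast
    next
      fix W u u' assume u: "u \<in> Hom V W (SHom P Q)" and u': "u' \<in> Hom V W (SHom P Q)"
        and e: "transpose V L X P \<eta> Q \<cdot> u = transpose V L X P \<eta> Q \<cdot> u'"
      have W: "W \<in> Ob V" using u hom_ob by blast
      note E = evs_hom[OF W B]
      note k = phom_param[OF eps_phom[OF P Q] u] phom_param[OF eps_phom[OF P Q] u']
      obtain P' where P': "P' \<in> Ob StrL" "fst P' = ihom V W (fst Q)"
        and pw: "\<And>A k. phom W A Q k \<Longrightarrow> \<exists>h. h \<in> Hom StrL A P' \<and> evs W (fst Q) \<cdot> (Idt V W \<odot> h) = k"
        using power[OF W] by blast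
      obtain h where h: "h \<in> Hom StrL P P'" "evs W (fst Q) \<cdot> (Idt V W \<odot> h) = eps P Q \<cdot> (u \<odot> Idt V (fst P))"
        using pw[OF k(1)] by blast
      obtain h' where h': "h' \<in> Hom StrL P P'" "evs W (fst Q) \<cdot> (Idt V W \<odot> h') = eps P Q \<cdot> (u' \<odot> Idt V (fst P))"
        using pw[OF k(2)] by blast
      note hh = Str_homD(3)[OF h(1), unfolded P'(2)] Str_homD(3)[OF h'(1), unfolded P'(2)]
      note i\<eta> = ten_hom[OF idt_hom[OF W] \<eta>]
      have "evs W (fst Q) \<cdot> (Idt V W \<odot> (h \<cdot> \<eta>)) = unc X (fst Q) (transpose V L X P \<eta> Q \<cdot> u)"
        by (simp only: tr(2)[OF u] h(2)[symmetric] cmp_assoc[OF i\<eta> ten_hom[OF idt_hom[OF W] hh(1)] E] ten_cmp_right[OF \<eta> hh(1) W])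
      also have "\<dots> = evs W (fst Q) \<cdot> (Idt V W \<odot> (h' \<cdot> \<eta>))"
        unfolding e
        by (simp only: tr(2)[OF u'] h'(2)[symmetric] cmp_assoc[OF i\<eta> ten_hom[OF idt_hom[OF W] hh(2)] E] ten_cmp_right[OF \<eta> hh(2) W])
      finally have "h \<cdot> \<eta> = h' \<cdot> \<eta>" by (rule evs_inject[OF _ cmp_hom[OF \<eta> hh(1)] cmp_hom[OF \<eta> hh(2)] W B])
      moreover have "h \<cdot> \<eta> \<in> Hom V X (fst P')" using cmp_hom[OF \<eta> hh(1)] P'(2) by simp
      ultimately have "h = h'" using free[OF P'(1), of "h \<cdot> \<eta>"] h(1) h'(1) by metis
      then have "eps P Q \<cdot> (u \<odot> Idt V (fst P)) = eps P Q \<cdot> (u' \<odot> Idt V (fst P))" using h(2) h'(2) by simp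
      then show "u = u'" by (rule eps_inject[OF P Q u u'])
    qed
  qed
  then have "is_free V L X (P, \<eta>)" unfolding is_free_def using P \<eta> by blast
  then show ?thesis using that by blast
qed

abbreviation F where "F \<equiv> Free V L"
abbreviation \<eta> where "\<eta> \<equiv> free_unit V L"

context
  fixes X assumes X: "X \<in> Ob V"
begin

lemma is_free_Free: "is_free V L X (F X, \<eta> X)"
  unfolding Free_def free_unit_def using is_free_exists[OF X] by (metis prod.collapse someI_ex)

lemma F_ob: "F X \<in> Ob StrL" and \<eta>_hom: "\<eta> X \<in> Hom V X (fst (F X))"
  and adj_iso: "Q \<in> Ob StrL \<Longrightarrow> iso V (SHom (F X) Q) (ihom V X (fst Q)) (adj V L X Q)"
  using is_free_Free unfolding is_free_def adj_def by auto

text \<open>Surjectivity of \<open>adj\<close> on generalized elements; \<open>free_inject\<close>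
  is its injectivity. All later uses of the enriched adjunction go through these two forms or their
  unit cases.\<close>

lemma free_extend:
  assumes Q: "Q \<in> Ob StrL" and g: "g \<in> Hom V (W \<otimes> X) (fst Q)" and W: "W \<in> Ob V"
  obtains k where "phom W (F X) Q k" "k \<cdot> (Idt V W \<odot> \<eta> X) = g"
proof -
  note tr = unc_transpose[OF F_ob Q \<eta>_hom, folded adj_def]
  note c = curry_hom[OF g W X] unc_curry[OF g W X]
  obtain i where i: "i \<in> Hom V (ihom V X (fst Q)) (SHom (F X) Q)" "adj V L X Q \<cdot> i = Idt V (ihom V X (fst Q))"
    by (rule isoE[OF adj_iso[OF Q]])
  let ?u = "i \<cdot> curry V W X (fst Q) g"
  note u = cmp_hom[OF c(1) i(1)]
  have "adj V L X Q \<cdot> ?u = curry V W X (fst Q) g"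
    by (simp only: cmp_assoc[OF c(1) i(1) tr(1), symmetric] i(2) idt_left[OF c(1)])
  then have "eps (F X) Q \<cdot> (?u \<odot> Idt V (fst (F X))) \<cdot> (Idt V W \<odot> \<eta> X) = g"
    using tr(2)[OF u] c(2) by simp
  then show ?thesis using that phom_param[OF eps_phom[OF F_ob Q] u] by blast
qed

lemma free_inject:
  assumes k: "phom W (F X) Q k" "phom W (F X) Q k'" and e: "k \<cdot> (Idt V W \<odot> \<eta> X) = k' \<cdot> (Idt V W \<odot> \<eta> X)"
  shows "k = k'"
proof -
  note Q = phomD(3)[OF k(1)]
  note tr = unc_transpose[OF F_ob Q \<eta>_hom, folded adj_def]
  obtain u where u: "u \<in> Hom V W (SHom (F X) Q)" "eps (F X) Q \<cdot> (u \<odot> Idt V (fst (F X))) = k"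
    using eps_universal[OF F_ob Q k(1)] by blast
  obtain u' where u': "u' \<in> Hom V W (SHom (F X) Q)" "eps (F X) Q \<cdot> (u' \<odot> Idt V (fst (F X))) = k'"
    using eps_universal[OF F_ob Q k(2)] by blast
  have "unc X (fst Q) (adj V L X Q \<cdot> u) = unc X (fst Q) (adj V L X Q \<cdot> u')"
    by (simp only: tr(2)[OF u(1)] tr(2)[OF u'(1)] u(2) u'(2) e)
  then have "adj V L X Q \<cdot> u = adj V L X Q \<cdot> u'"
    by (rule unc_inject[OF _ cmp_hom[OF u(1) tr(1)] cmp_hom[OF u'(1) tr(1)] X Str_ob[OF Q]])
  then have "u = u'" by (rule iso_mono[OF adj_iso[OF Q] u(1) u'(1)])
  then show ?thesis using u u' by simp
qed

text \<open>The parameter is the unit, which recovers the ordinary adjunction for the structure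
  picked by \<open>Free\<close>.\<close>

lemma free_hom_extend:
  assumes Q: "Q \<in> Ob StrL" and x: "x \<in> Hom V X (fst Q)"
  obtains h where "h \<in> Hom StrL (F X) Q" "h \<cdot> \<eta> X = x"
proof -
  note o = Str_ob[OF F_ob] and I = unit_ob
  note l = lun_hom[OF X] lun_hom[OF o]
  obtain k where k: "phom (unit V) (F X) Q k" "k \<cdot> (Idt V (unit V) \<odot> \<eta> X) = x \<cdot> lun V X"
    by (rule free_extend[OF Q cmp_hom[OF l(1) x] I])
  note kh = phomD(4)[OF k(1)]
  obtain i where i: "i \<in> Hom V (fst (F X)) (unit V \<otimes> fst (F X))" "i \<cdot> lun V (fst (F X)) = Idt V (unit V \<otimes> fst (F X))"
    by (rule isoE[OF lun_iso[OF o]])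
  let ?h = "k \<cdot> i"
  note h = cmp_hom[OF i(1) kh]
  have hk: "?h \<cdot> lun V (fst (F X)) = k" by (simp only: cmp_assoc[OF l(2) i(1) kh] i(2) idt_right[OF kh])
  have "?h \<in> Hom StrL (F X) Q" by (rule phom_unitD[OF _ h]) (use k(1) hk in simp)
  moreover have "?h \<cdot> \<eta> X \<cdot> lun V X = x \<cdot> lun V X"
    by (simp only: cmp_assoc[OF l(1) \<eta>_hom h] lun_nat[OF \<eta>_hom, symmetric]
      cmp_assoc[OF ten_hom[OF idt_hom[OF I] \<eta>_hom] l(2) h, symmetric] hk k(2))
  then have "?h \<cdot> \<eta> X = x" by (rule iso_epi[OF lun_iso[OF X] cmp_hom[OF \<eta>_hom h] x])
  ultimately show ?thesis using that by blast
qed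

lemma free_hom_inject:
  assumes h: "h \<in> Hom StrL (F X) Q" "h' \<in> Hom StrL (F X) Q" and e: "h \<cdot> \<eta> X = h' \<cdot> \<eta> X"
  shows "h = h'"
proof -
  note o = Str_ob[OF F_ob] and I = unit_ob
  note l = lun_hom[OF X] lun_hom[OF o] and i\<eta> = ten_hom[OF idt_hom[OF unit_ob] \<eta>_hom]
  note h' = Str_homD(3)[OF h(1)] Str_homD(3)[OF h(2)]
  have "h \<cdot> lun V (fst (F X)) \<cdot> (Idt V (unit V) \<odot> \<eta> X) = h' \<cdot> lun V (fst (F X)) \<cdot> (Idt V (unit V) \<odot> \<eta> X)"
    by (simp only: cmp_assoc[OF i\<eta> l(2) h'(1)] cmp_assoc[OF i\<eta> l(2) h'(2)] lun_nat[OF \<eta>_hom]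
      cmp_assoc[OF l(1) \<eta>_hom h'(1), symmetric] cmp_assoc[OF l(1) \<eta>_hom h'(2), symmetric] e)
  then have "h \<cdot> lun V (fst (F X)) = h' \<cdot> lun V (fst (F X))"
    by (rule free_inject[OF phom_unit[OF h(1)] phom_unit[OF h(2)]])
  then show ?thesis by (rule iso_epi[OF lun_iso[OF o] h'])
qed

end

text \<open>The forgetful functor is a right adjoint: arrows \<open>X -> UA\<close> are
  homomorphisms \<open>F X -> A\<close>, on which \<open>m\<close> can be cancelled.\<close>

lemma Str_mono_V:
  assumes m: "monomorphism StrL A B m" shows "monomorphism V (fst A) (fst B) m"
proof -
  have mh: "m \<in> Hom StrL A B" using m unfolding monomorphism_def by blast
  note m' = Str_homD[OF mh]
  have "f = g" if f: "f \<in> Hom V X (fst A)" and g: "g \<in> Hom V X (fst A)" and e: "m \<cdot> f = m \<cdot> g" for X f g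
  proof -
    have X: "X \<in> Ob V" using f hom_ob by blast
    obtain h where h: "h \<in> Hom StrL (F X) A" "h \<cdot> \<eta> X = f" by (rule free_hom_extend[OF X m'(1) f])
    obtain k where k: "k \<in> Hom StrL (F X) A" "k \<cdot> \<eta> X = g" by (rule free_hom_extend[OF X m'(1) g])
    note n = \<eta>_hom[OF X]
    have "m \<cdot> h = m \<cdot> k"
      by (rule free_hom_inject[OF X Str_comp[OF h(1) mh] Str_comp[OF k(1) mh]])
        (simp only: cmp_assoc[OF n Str_homD(3)[OF h(1)] m'(3)] cmp_assoc[OF n Str_homD(3)[OF k(1)] m'(3)] h(2) k(2) e)
    then have "h = k" using m h(1) k(1) unfolding monomorphism_def Str_cmp by blast
    then show ?thesis using h k by simp
  qed
  then show ?thesis unfolding monomorphism_def using m'(3) by blast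
qed

lemma is_product_universal:
  assumes p: "is_product StrL I D P p" and R: "R \<in> Ob StrL" and q: "\<And>i. i \<in> I \<Longrightarrow> q i \<in> Hom StrL R (D i)"
  shows "\<exists>!u. u \<in> Hom StrL R P \<and> (\<forall>i\<in>I. p i \<cdot> u = q i)"
proof -
  have "\<forall>R\<in>Ob StrL. \<forall>q. (\<forall>i\<in>I. q i \<in> Hom StrL R (D i)) \<longrightarrow> (\<exists>!u. u \<in> Hom StrL R P \<and> (\<forall>i\<in>I. p i \<cdot> u = q i))"
    using p unfolding is_product_def Str_cmp by (elim conjE)
  from spec[OF bspec[OF this R], of q] q show ?thesis by simp
qed

text \<open>Again by passing to homomorphisms out of \<open>F X\<close>, so it holds for every
  product in the category of structures and not just for the one constructed.\<close>

lemma Str_product_joint_mono: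
  assumes p: "is_product StrL I D P p" and f: "f \<in> Hom V X (fst P)" and g: "g \<in> Hom V X (fst P)"
    and e: "\<And>i. i \<in> I \<Longrightarrow> p i \<cdot> f = p i \<cdot> g"
  shows "f = g"
proof -
  have X: "X \<in> Ob V" using f hom_ob by blast
  have P: "P \<in> Ob StrL" and ph: "\<And>i. i \<in> I \<Longrightarrow> p i \<in> Hom StrL P (D i)" using p unfolding is_product_def by auto
  obtain h where h: "h \<in> Hom StrL (F X) P" "h \<cdot> \<eta> X = f" by (rule free_hom_extend[OF X P f])
  obtain k where k: "k \<in> Hom StrL (F X) P" "k \<cdot> \<eta> X = g" by (rule free_hom_extend[OF X P g])
  note n = \<eta>_hom[OF X]
  have pe: "p i \<cdot> h = p i \<cdot> k" if i: "i \<in> I" for i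
    by (rule free_hom_inject[OF X Str_comp[OF h(1) ph[OF i]] Str_comp[OF k(1) ph[OF i]]])
      (simp only: cmp_assoc[OF n Str_homD(3)[OF h(1)] Str_homD(3)[OF ph[OF i]]]
        cmp_assoc[OF n Str_homD(3)[OF k(1)] Str_homD(3)[OF ph[OF i]]] h(2) k(2) e[OF i])
  have "\<exists>!u. u \<in> Hom StrL (F X) P \<and> (\<forall>i\<in>I. p i \<cdot> u = p i \<cdot> k)"
    by (rule is_product_universal[OF p F_ob[OF X] Str_comp[OF k(1) ph]])
  moreover have "\<forall>i\<in>I. p i \<cdot> h = p i \<cdot> k" "\<forall>i\<in>I. p i \<cdot> k = p i \<cdot> k" using pe by auto
  ultimately have "h = k" using h(1) k(1) by blast
  then show ?thesis using h k by simp
qed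


section \<open>Satisfaction of equations\<close>

definition sat :: "'o \<Rightarrow> 'm \<Rightarrow> 'm \<Rightarrow> ('o, 'm, 'f) struct \<Rightarrow> bool" where
  "sat X s t Q \<longleftrightarrow> (\<forall>W k. phom W (F X) Q k \<longrightarrow> k \<cdot> (Idt V W \<odot> s) = k \<cdot> (Idt V W \<odot> t))"

text \<open>The adjunction isomorphisms on both sides of \<open>interp\<close> cancel. The remaining
  equation is tested on the universal family \<open>eps\<close>, and every other family is a
  reindexing of it.\<close>

lemma interp_eq_iff:
  assumes X: "X \<in> Ob V" and Y: "Y \<in> Ob V" and s: "s \<in> Hom StrL (F Y) (F X)" and t: "t \<in> Hom StrL (F Y) (F X)"
    and Q: "Q \<in> Ob StrL"
  shows "interp V L X Y s Q = interp V L X Y t Q \<longleftrightarrow> sat X s t Q"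
proof -
  note FX = F_ob[OF X] and FY = F_ob[OF Y]
  note iX = adj_iso[OF X Q] and iY = adj_iso[OF Y Q]
  have aY: "adj V L Y Q \<in> Hom V (SHom (F Y) Q) (ihom V Y (fst Q))" using iY by (rule isoE)
  let ?i = "the_inverse V (SHom (F X) Q) (ihom V X (fst Q)) (adj V L X Q)"
  have inv: "?i \<in> Hom V (ihom V X (fst Q)) (SHom (F X) Q)" and iso_i: "iso V (ihom V X (fst Q)) (SHom (F X) Q) ?i"
    using the_inverse[OF iX] unfolding iso_def is_inverse_def by blast+
  note ps = str_pre[OF s Q] and pt = str_pre[OF t Q]
  have "interp V L X Y s Q = interp V L X Y t Q \<longleftrightarrow> str_pre V L (F Y) (F X) Q s = str_pre V L (F Y) (F X) Q t"
  proof
    assume "interp V L X Y s Q = interp V L X Y t Q"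
    then have "adj V L Y Q \<cdot> str_pre V L (F Y) (F X) Q s = adj V L Y Q \<cdot> str_pre V L (F Y) (F X) Q t"
      unfolding interp_def by (rule iso_epi[OF iso_i cmp_hom[OF ps(1) aY] cmp_hom[OF pt(1) aY]])
    then show "str_pre V L (F Y) (F X) Q s = str_pre V L (F Y) (F X) Q t" by (rule iso_mono[OF iY ps(1) pt(1)])
  qed (simp add: interp_def)
  also have "\<dots> \<longleftrightarrow> eps (F X) Q \<cdot> (Idt V (SHom (F X) Q) \<odot> s) = eps (F X) Q \<cdot> (Idt V (SHom (F X) Q) \<odot> t)"
    using ps(2) pt(2) eps_inject[OF FY Q ps(1) pt(1)] by metis
  also have "\<dots> \<longleftrightarrow> sat X s t Q"
  proof
    assume e: "eps (F X) Q \<cdot> (Idt V (SHom (F X) Q) \<odot> s) = eps (F X) Q \<cdot> (Idt V (SHom (F X) Q) \<odot> t)"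
    show "sat X s t Q"
      unfolding sat_def
    proof (intro allI impI)
      fix W k assume k: "phom W (F X) Q k"
      have W: "W \<in> Ob V" by (rule phomD(1)[OF k])
      obtain u where u: "u \<in> Hom V W (SHom (F X) Q)" "eps (F X) Q \<cdot> (u \<odot> Idt V (fst (F X))) = k"
        using eps_universal[OF FX Q k] by blast
      have n: "k \<cdot> (Idt V W \<odot> r) = eps (F X) Q \<cdot> (Idt V (SHom (F X) Q) \<odot> r) \<cdot> (u \<odot> Idt V (fst (F Y)))"
        if r: "r \<in> Hom StrL (F Y) (F X)" for r
      proof -
        note r' = Str_homD(3)[OF r] and e = phomD(4)[OF eps_phom[OF FX Q]] and i = idt_hom[OF SHom_ob[OF FX Q]]
        show ?thesis
          unfolding u(2)[symmetric]
          by (simp only: cmp_assoc[OF ten_hom[OF idt_hom[OF W] r'] ten_hom[OF u(1) idt_hom[OF Str_ob[OF FX]]] e]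
            cmp_assoc[OF ten_hom[OF u(1) idt_hom[OF Str_ob[OF FY]]] ten_hom[OF i r'] e] ten_swap[OF u(1) r'])
      qed
      show "k \<cdot> (Idt V W \<odot> s) = k \<cdot> (Idt V W \<odot> t)" by (simp only: n[OF s] n[OF t] e)
    qed
  qed (use eps_phom[OF FX Q] in \<open>simp add: sat_def\<close>)
  finally show ?thesis .
qed

lemma Mod_iff:
  assumes "ext_theory V L E"
  shows "Q \<in> Mod V L E \<longleftrightarrow> Q \<in> Ob StrL \<and> (\<forall>(X, Y, s, t) \<in> E. sat X s t Q)"
proof -
  have "interp V L X Y s Q = interp V L X Y t Q \<longleftrightarrow> sat X s t Q" if "(X, Y, s, t) \<in> E" "Q \<in> Ob StrL" for X Y s t
    using interp_eq_iff[OF _ _ _ _ that(2)] assms that(1) unfolding ext_theory_def by blast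
  then show ?thesis unfolding Mod_def by auto
qed

section \<open>Closure properties of the structures satisfying one equation\<close>

context
  fixes X Y s t assumes X: "X \<in> Ob V" and Y: "Y \<in> Ob V"
    and s: "s \<in> Hom StrL (F Y) (F X)" and t: "t \<in> Hom StrL (F Y) (F X)"
begin

private lemma st: "r \<in> {s, t} \<Longrightarrow> W \<in> Ob V \<Longrightarrow> Idt V W \<odot> r \<in> Hom V (W \<otimes> fst (F Y)) (W \<otimes> fst (F X))"
  using ten_hom[OF idt_hom Str_homD(3)[OF s]] ten_hom[OF idt_hom Str_homD(3)[OF t]] by auto

private lemma post_eq:
  assumes k: "phom W (F X) A k" and h: "h \<in> Hom StrL A B" and B: "sat X s t B"
  shows "h \<cdot> (k \<cdot> (Idt V W \<odot> s)) = h \<cdot> (k \<cdot> (Idt V W \<odot> t))"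
proof -
  note k' = phomD[OF k] and h' = Str_homD(3)[OF h]
  have "h \<cdot> k \<cdot> (Idt V W \<odot> s) = h \<cdot> k \<cdot> (Idt V W \<odot> t)"
    using B phom_post[OF k h] unfolding sat_def by blast
  then show ?thesis
    by (simp only: cmp_assoc[OF st[OF insertI1 k'(1)] k'(4) h'] cmp_assoc[OF st[OF insertI2[OF singletonI] k'(1)] k'(4) h'])
qed

private lemma k_hom:
  assumes k: "phom W (F X) A k" and r: "r \<in> {s, t}" shows "k \<cdot> (Idt V W \<odot> r) \<in> Hom V (W \<otimes> fst (F Y)) (fst A)"
  by (rule cmp_hom[OF st[OF r phomD(1)[OF k]] phomD(4)[OF k]])

lemma sat_sub:
  assumes m: "m \<in> Hom StrL A B" "monomorphism V (fst A) (fst B) m" and B: "sat X s t B"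
  shows "sat X s t A"
  unfolding sat_def
proof (intro allI impI)
  fix W k assume k: "phom W (F X) A k"
  show "k \<cdot> (Idt V W \<odot> s) = k \<cdot> (Idt V W \<odot> t)"
    by (rule monoD[OF m(2) post_eq[OF k m(1) B] k_hom[OF k insertI1] k_hom[OF k insertI2[OF singletonI]]])
qed

lemma sat_product:
  assumes p: "is_product StrL I D P p" and D: "\<And>i. i \<in> I \<Longrightarrow> sat X s t (D i)"
  shows "sat X s t P"
  unfolding sat_def
proof (intro allI impI)
  fix W k assume k: "phom W (F X) P k"
  show "k \<cdot> (Idt V W \<odot> s) = k \<cdot> (Idt V W \<odot> t)"
  proof (rule Str_product_joint_mono[OF p k_hom[OF k insertI1] k_hom[OF k insertI2[OF singletonI]]])
    fix i assume i: "i \<in> I"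
    have "p i \<in> Hom StrL P (D i)" using p i unfolding is_product_def by blast
    then show "p i \<cdot> (k \<cdot> (Idt V W \<odot> s)) = p i \<cdot> (k \<cdot> (Idt V W \<odot> t))" by (rule post_eq[OF k _ D[OF i]])
  qed
qed

lemma sat_split_quotient:
  assumes e: "e \<in> Hom StrL A B" and sp: "split_epi V (fst A) (fst B) e" and A: "sat X s t A"
  shows "sat X s t B"
  unfolding sat_def
proof (intro allI impI)
  fix W k assume k: "phom W (F X) B k"
  note W = phomD(1)[OF k] and kh = phomD(4)[OF k] and e' = Str_homD[OF e] and n = ten_hom[OF idt_hom[OF phomD(1)[OF k]] \<eta>_hom[OF X]]
  obtain r where r: "r \<in> Hom V (fst B) (fst A)" "e \<cdot> r = Idt V (fst B)" using sp unfolding split_epi_def by blast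
  note kn = cmp_hom[OF n kh]
  \<comment> \<open>The section \<open>r\<close> need not be a homomorphism, so it is applied only
    to the restriction of \<open>k\<close> to \<open>X\<close>; freeness extends the result to a
    family in \<open>A\<close>, which lies over \<open>k\<close> by
    \<open>free_inject\<close>.\<close>
  obtain k' where k': "phom W (F X) A k'" "k' \<cdot> (Idt V W \<odot> \<eta> X) = r \<cdot> (k \<cdot> (Idt V W \<odot> \<eta> X))"
    by (rule free_extend[OF X e'(1) cmp_hom[OF kn r(1)] W])
  have "e \<cdot> k' \<cdot> (Idt V W \<odot> \<eta> X) = k \<cdot> (Idt V W \<odot> \<eta> X)"
    by (simp only: cmp_assoc[OF n phomD(4)[OF k'(1)] e'(3)] k'(2) cmp_assoc[OF kn r(1) e'(3), symmetric] r(2) idt_left[OF kn])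
  then have ek: "e \<cdot> k' = k" by (rule free_inject[OF X phom_post[OF k'(1) e] k])
  have "k' \<cdot> (Idt V W \<odot> s) = k' \<cdot> (Idt V W \<odot> t)" using A k'(1) unfolding sat_def by blast
  then show "k \<cdot> (Idt V W \<odot> s) = k \<cdot> (Idt V W \<odot> t)"
    unfolding ek[symmetric]
    by (simp only: cmp_assoc[OF st[OF insertI1 W] phomD(4)[OF k'(1)] e'(3)] cmp_assoc[OF st[OF insertI2[OF singletonI] W] phomD(4)[OF k'(1)] e'(3)])
qed

text \<open>A family over \<open>W\<close> with values in the power amounts to a family over
  \<open>Z \<otimes> W\<close> with values in \<open>Q\<close>, and satisfaction quantifies over all
  parameters.\<close>

lemma sat_power:
  assumes pw: "is_power V L Z Q P \<pi>" and Z: "Z \<in> Ob V" and Q: "Q \<in> Ob StrL" and S: "sat X s t Q"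
  shows "sat X s t P"
  unfolding sat_def
proof (intro allI impI)
  fix W k assume k: "phom W (F X) P k"
  note W = phomD(1)[OF k]
  have P: "P \<in> Ob StrL" and \<pi>: "\<pi> \<in> Hom V Z (SHom P Q)" using pw unfolding is_power_def by auto
  let ?p = "eps P Q \<cdot> (\<pi> \<odot> Idt V (fst P))"
  have p: "phom Z P Q ?p" by (rule phom_param[OF eps_phom[OF P Q] \<pi>])
  note A = Str_ob[OF F_ob[OF X]] and B = Str_ob[OF F_ob[OF Y]] and iZ = idt_hom[OF Z] and kh = phomD(4)[OF k] and ph = phomD(4)[OF p]
  note Zk = ten_hom[OF iZ kh] and aX = asc_hom[OF Z W A] and aY = asc_hom[OF Z W B]
  have n: "?p \<cdot> ((Idt V Z \<odot> (k \<cdot> (Idt V W \<odot> r))) \<cdot> asc V Z W (fst (F Y))) =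
      ?p \<cdot> ((Idt V Z \<odot> k) \<cdot> asc V Z W (fst (F X))) \<cdot> (Idt V (Z \<otimes> W) \<odot> r)" if r: "r \<in> Hom V (fst (F Y)) (fst (F X))" for r
  proof -
    note Wr = ten_hom[OF idt_hom[OF W] r]
    note ZWr = ten_hom[OF iZ Wr] and ZW = ten_hom[OF idt_hom[OF ten_ob[OF Z W]] r]
    have "asc V Z W (fst (F X)) \<cdot> (Idt V (Z \<otimes> W) \<odot> r) = (Idt V Z \<odot> (Idt V W \<odot> r)) \<cdot> asc V Z W (fst (F Y))"
      using asc_nat[OF iZ idt_hom[OF W] r] ten_idt[OF Z W] by simp
    then show ?thesis
      by (simp only: ten_cmp_right[OF Wr kh Z] cmp_assoc[OF aY ZWr Zk] cmp_assoc[OF ZW cmp_hom[OF aX Zk] ph] cmp_assoc[OF ZW aX Zk])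
  qed
  show "k \<cdot> (Idt V W \<odot> s) = k \<cdot> (Idt V W \<odot> t)"
  proof (rule power_inject[OF pw Q Z phom_pre[OF k s] phom_pre[OF k t]])
    show "?p \<cdot> ((Idt V Z \<odot> (k \<cdot> (Idt V W \<odot> s))) \<cdot> asc V Z W (fst (F Y))) =
        ?p \<cdot> ((Idt V Z \<odot> (k \<cdot> (Idt V W \<odot> t))) \<cdot> asc V Z W (fst (F Y)))"
      using S phom_comp[OF p k] unfolding sat_def by (simp only: n[OF Str_homD(3)[OF s]] n[OF Str_homD(3)[OF t]])
  qed
qed

end

lemma birkhoff_Mod:
  assumes E: "ext_theory V L E" shows "birkhoff \<kappa> V L (Mod V L E)"
proof -
  have eq: "X \<in> Ob V" "Y \<in> Ob V" "s \<in> Hom StrL (F Y) (F X)" "t \<in> Hom StrL (F Y) (F X)" if "(X, Y, s, t) \<in> E" for X Y s t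
    using E that unfolding ext_theory_def by auto
  note M = Mod_iff[OF E]
  have sub: "A \<in> Mod V L E" if m: "m \<in> Hom StrL A B" "monomorphism V (fst A) (fst B) m" and B: "B \<in> Mod V L E" for A B m
    using B Str_homD(1)[OF m(1)] sat_sub[OF eq m] unfolding M by blast
  show ?thesis
    unfolding birkhoff_def
  proof (intro conjI allI impI)
    show "Mod V L E \<subseteq> Ob StrL" unfolding Mod_def by blast
  next
    \<comment> \<open>Repleteness is a case of closure under substructures: the inverse embeds
      \<open>B\<close> into \<open>A\<close>.\<close>
    fix A B h assume *: "A \<in> Mod V L E \<and> iso StrL A B h"
    then obtain g where g: "g \<in> Hom StrL B A" "h \<in> Hom StrL A B" "h \<cdot> g = Idt V (fst B)"
      unfolding iso_def is_inverse_def Str_cmp Str_idt by blast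
    note g' = Str_homD(3)[OF g(1)] Str_homD(3)[OF g(2)]
    have "f = f'" if f: "f \<in> Hom V N (fst B)" "f' \<in> Hom V N (fst B)" and e: "g \<cdot> f = g \<cdot> f'" for N f f'
    proof -
      have "h \<cdot> g \<cdot> f = h \<cdot> g \<cdot> f'" by (simp only: cmp_assoc[OF f(1) g'] cmp_assoc[OF f(2) g'] e)
      then show ?thesis by (simp only: g(3) idt_left[OF f(1)] idt_left[OF f(2)])
    qed
    then have "monomorphism V (fst B) (fst A) g" unfolding monomorphism_def using g'(1) by blast
    then show "B \<in> Mod V L E" using sub[OF g(1)] * by blast
  next
    fix I :: "'u set" and D P p assume *: "small \<kappa> I \<and> (\<forall>i\<in>I. D i \<in> Mod V L E) \<and> is_product StrL I D P p"
    have "P \<in> Ob StrL" using * unfolding is_product_def by blast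
    moreover have "sat X s t P" if "(X, Y, s, t) \<in> E" for X Y s t
      by (rule sat_product[OF eq[OF that], of I D P p]) (use * that M in auto)
    ultimately show "P \<in> Mod V L E" unfolding M by blast
  next
    fix Z Q P \<pi> assume *: "Z \<in> Ob V \<and> Q \<in> Mod V L E \<and> is_power V L Z Q P \<pi>"
    have "P \<in> Ob StrL" using * unfolding is_power_def by blast
    moreover have "sat X s t P" if "(X, Y, s, t) \<in> E" for X Y s t
      by (rule sat_power[OF eq[OF that], of Z Q P \<pi>]) (use * that M in auto)
    ultimately show "P \<in> Mod V L E" unfolding M by blast
  next
    fix A B m assume *: "monomorphism StrL A B m \<and> B \<in> Mod V L E"
    then have "m \<in> Hom StrL A B" unfolding monomorphism_def by blast
    then show "A \<in> Mod V L E" using sub[OF _ Str_mono_V] * by blast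
  next
    fix A B e assume *: "epimorphism StrL A B e \<and> split_epi V (fst A) (fst B) e \<and> A \<in> Mod V L E"
    then have e: "e \<in> Hom StrL A B" unfolding epimorphism_def by blast
    have "sat X s t B" if "(X, Y, s, t) \<in> E" for X Y s t
      by (rule sat_split_quotient[OF eq[OF that] e]) (use * that M in auto)
    then show "B \<in> Mod V L E" unfolding M using Str_homD(2)[OF e] by blast
  qed
qed


section \<open>Images and reflections\<close>

text \<open>Preservation of an operation applied to a generalized element, the form in which the
  \<open>closed\<close> premise of \<open>Str_sub\<close> is verified.\<close>

lemma unc_op_cmp:
  assumes h: "h \<in> Hom StrL A B" and p: "p \<in> Hom V Z (fst A)" and f: "f \<in> Sym L"
  shows "h \<cdot> unc (Out L f) (fst A) (snd A f \<cdot> post V (In L f) Z (fst A) p) =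
    unc (Out L f) (fst B) (snd B f \<cdot> post V (In L f) Z (fst B) (h \<cdot> p))"
proof -
  note h' = Str_homD[OF h] and X = arity_ob(1)[OF f] and Y = arity_ob(2)[OF f]
  note a = Str_op[OF h'(1) f] and b = Str_op[OF h'(2) f]
  note pX = post_hom[OF p X] and hX = post_hom[OF h'(3) X] and hY = post_hom[OF h'(3) Y]
  show ?thesis
    by (simp only: unc_post[OF h'(3) cmp_hom[OF pX a] Y, symmetric] cmp_assoc[OF pX a hY, symmetric] h'(4)[OF f]
      cmp_assoc[OF pX hX b] post_cmp[OF p h'(3) X])
qed

text \<open>
  \<open>\<M>\<close> is a possibly large family of pairs of a homomorphism \<open>v : A \<rightarrow> B\<close> and a substructure \<open>m : M \<rightarrow> B\<close>;
  the intersection of all preimages of the substructures exists whatever the size of the family.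
\<close>

lemma intersection:
  assumes A: "A \<in> Ob StrL"
    and fam: "\<And>B M v m. (B, M, v, m) \<in> \<M> \<Longrightarrow> v \<in> Hom StrL A B \<and> m \<in> Hom StrL M B \<and> monomorphism V (fst M) (fst B) m"
  obtains N q where "q \<in> Hom StrL N A" "monomorphism V (fst N) (fst A) q"
    "\<And>B M v m. (B, M, v, m) \<in> \<M> \<Longrightarrow> \<exists>w. w \<in> Hom V (fst N) (fst M) \<and> v \<cdot> q = m \<cdot> w"
    "\<And>Z p. \<lbrakk>p \<in> Hom V Z (fst A); \<forall>(B, M, v, m) \<in> \<M>. \<exists>w. w \<in> Hom V Z (fst M) \<and> v \<cdot> p = m \<cdot> w\<rbrakk> \<Longrightarrow>
      \<exists>u. u \<in> Hom V Z (fst N) \<and> q \<cdot> u = p"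
proof -
  let ?c = "\<lambda>Z p. \<forall>(B, M, v, m) \<in> \<M>. \<exists>w. w \<in> Hom V Z (fst M) \<and> v \<cdot> p = m \<cdot> w"
  obtain N q where *: "q \<in> Hom StrL N A" "?c (fst N) q" "monomorphism V (fst N) (fst A) q"
    "\<And>Z p. \<lbrakk>p \<in> Hom V Z (fst A); ?c Z p\<rbrakk> \<Longrightarrow> \<exists>u. u \<in> Hom V Z (fst N) \<and> q \<cdot> u = p"
  proof (rule Str_sub[OF A, of ?c])
    fix Z Z' p f assume f: "f \<in> Hom V Z' Z" and p: "p \<in> Hom V Z (fst A)" and c: "?c Z p"
    show "?c Z' (p \<cdot> f)"
    proof clarify
      fix B P b M n v m assume i: "((B, b), (M, n), v, m) \<in> \<M>"
      obtain w where w: "w \<in> Hom V Z M" "v \<cdot> p = m \<cdot> w" using c i by fastforce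
      have v: "v \<in> Hom V (fst A) B" "m \<in> Hom V M B" using fam[OF i] Str_homD(3) by fastforce+
      have "v \<cdot> (p \<cdot> f) = m \<cdot> (w \<cdot> f)"
        by (simp only: cmp_assoc[OF f p v(1), symmetric] w(2) cmp_assoc[OF f w(1) v(2)])
      then show "\<exists>w. w \<in> Hom V Z' (fst (M, n)) \<and> v \<cdot> (p \<cdot> f) = m \<cdot> w" using cmp_hom[OF f w(1)] by auto
    qed
  next
    fix Z p K assume K: "effective_sink V K Z" and p: "p \<in> Hom V Z (fst A)" and c: "\<And>A f. (A, f) \<in> K \<Longrightarrow> ?c A (p \<cdot> f)"
    show "?c Z p"
    proof clarify
      fix B b M n v m assume i: "((B, b), (M, n), v, m) \<in> \<M>"
      have v: "v \<in> Hom V (fst A) B" "m \<in> Hom V M B" "monomorphism V M B m" using fam[OF i] Str_homD(3) by fastforce+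
      have "\<exists>g. g \<in> Hom V Z M \<and> v \<cdot> p = m \<cdot> g"
      proof (rule effective_sink_lift[OF K v(3) cmp_hom[OF p v(1)]])
        fix A' f assume Af: "(A', f) \<in> K"
        obtain w where w: "w \<in> Hom V A' M" "v \<cdot> (p \<cdot> f) = m \<cdot> w" using c[OF Af] i by fastforce
        then show "\<exists>g. g \<in> Hom V A' M \<and> v \<cdot> p \<cdot> f = m \<cdot> g"
          using cmp_assoc[OF effective_sink_hom[OF K Af] p v(1)] by auto
      qed
      then show "\<exists>w. w \<in> Hom V Z (fst (M, n)) \<and> v \<cdot> p = m \<cdot> w" by simp
    qed
  next
    fix Z p f assume p: "p \<in> Hom V Z (fst A)" and c: "?c Z p" and f: "f \<in> Sym L"
    note X = arity_ob(1)[OF f] and Y = arity_ob(2)[OF f]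
    have "\<exists>w. w \<in> Hom V (ihom V (In L f) Z \<otimes> Out L f) (fst M) \<and>
        v \<cdot> unc (Out L f) (fst A) (snd A f \<cdot> post V (In L f) Z (fst A) p) = m \<cdot> w"
      if i: "(B, M, v, m) \<in> \<M>" for B M v m
    proof -
      have v: "v \<in> Hom StrL A B" "m \<in> Hom StrL M B" using fam[OF i] by blast+
      note M = Str_homD(1)[OF v(2)]
      obtain w where w: "w \<in> Hom V Z (fst M)" "v \<cdot> p = m \<cdot> w" using c i by blast
      have "v \<cdot> unc (Out L f) (fst A) (snd A f \<cdot> post V (In L f) Z (fst A) p) =
          m \<cdot> unc (Out L f) (fst M) (snd M f \<cdot> post V (In L f) Z (fst M) w)"
        by (simp only: unc_op_cmp[OF v(1) p f] unc_op_cmp[OF v(2) w(1) f] w(2))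
      moreover have "unc (Out L f) (fst M) (snd M f \<cdot> post V (In L f) Z (fst M) w) \<in> Hom V (ihom V (In L f) Z \<otimes> Out L f) (fst M)"
        by (rule unc_hom[OF cmp_hom[OF post_hom[OF w(1) X] Str_op[OF M f]] Y Str_ob[OF M]])
      ultimately show ?thesis by blast
    qed
    then show "?c (ihom V (In L f) Z \<otimes> Out L f) (unc (Out L f) (fst A) (snd A f \<cdot> post V (In L f) Z (fst A) p))" by blast
  qed (rule that; assumption)
  show ?thesis by (rule that[OF *(1,3)]) (use *(2,4) in blast)+
qed

lemma equalizer:
  assumes f: "f \<in> Hom StrL A B" and g: "g \<in> Hom StrL A B"
  obtains N q where "q \<in> Hom StrL N A" "monomorphism V (fst N) (fst A) q" "f \<cdot> q = g \<cdot> q"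
    "\<And>Z p. \<lbrakk>p \<in> Hom V Z (fst A); f \<cdot> p = g \<cdot> p\<rbrakk> \<Longrightarrow> \<exists>u. u \<in> Hom V Z (fst N) \<and> q \<cdot> u = p"
proof -
  note f' = Str_homD[OF f] and g' = Str_homD[OF g]
  show ?thesis
  proof (rule Str_sub[OF f'(1), of "\<lambda>Z p. f \<cdot> p = g \<cdot> p"])
    fix Z Z' p h assume h: "h \<in> Hom V Z' Z" and p: "p \<in> Hom V Z (fst A)" and c: "f \<cdot> p = g \<cdot> p"
    show "f \<cdot> (p \<cdot> h) = g \<cdot> (p \<cdot> h)"
      by (simp only: cmp_assoc[OF h p f'(3), symmetric] cmp_assoc[OF h p g'(3), symmetric] c)
  next
    fix Z p K assume K: "effective_sink V K Z" and p: "p \<in> Hom V Z (fst A)" and c: "\<And>A h. (A, h) \<in> K \<Longrightarrow> f \<cdot> (p \<cdot> h) = g \<cdot> (p \<cdot> h)"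
    show "f \<cdot> p = g \<cdot> p"
    proof (rule effective_sink_epi[OF K cmp_hom[OF p f'(3)] cmp_hom[OF p g'(3)]])
      fix A' h assume Ah: "(A', h) \<in> K"
      note h = effective_sink_hom[OF K Ah]
      show "f \<cdot> p \<cdot> h = g \<cdot> p \<cdot> h" by (simp only: cmp_assoc[OF h p f'(3)] cmp_assoc[OF h p g'(3)] c[OF Ah])
    qed
  next
    fix Z p h assume "p \<in> Hom V Z (fst A)" "f \<cdot> p = g \<cdot> p" "h \<in> Sym L"
    then show "f \<cdot> unc (Out L h) (fst A) (snd A h \<cdot> post V (In L h) Z (fst A) p) =
        g \<cdot> unc (Out L h) (fst A) (snd A h \<cdot> post V (In L h) Z (fst A) p)"
      by (simp only: unc_op_cmp[OF f] unc_op_cmp[OF g])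
  qed (rule that; assumption)
qed

lemma V_mono_Str: "\<lbrakk>m \<in> Hom StrL A B; monomorphism V (fst A) (fst B) m\<rbrakk> \<Longrightarrow> monomorphism StrL A B m"
  unfolding monomorphism_def Str_cmp using Str_homD(3) by blast

text \<open>The image of \<open>f\<close> is the intersection of all substructures of \<open>P\<close> through which \<open>f\<close> factors.\<close>

lemma image_factorization:
  assumes f: "f \<in> Hom StrL A P"
  obtains N q r where "q \<in> Hom StrL N P" "monomorphism V (fst N) (fst P) q" "q \<cdot> r = f" "strong_epi StrL A N r"
proof -
  note f' = Str_homD[OF f]
  \<comment> \<open>All preimages are taken along the identity of \<open>P\<close>, so this is a
    plain intersection.\<close>
  let ?M = "{(P, M, Idt V (fst P), m) | M m. m \<in> Hom StrL M P \<and> monomorphism V (fst M) (fst P) m \<and>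
      (\<exists>h\<in>Hom V (fst A) (fst M). m \<cdot> h = f)}"
  note iP = idt_hom[OF Str_ob[OF f'(2)]]
  have iPS: "Idt V (fst P) \<in> Hom StrL P P" using category.idt_hom[OF category_Str f'(2)] by simp
  obtain N q where q: "q \<in> Hom StrL N P" "monomorphism V (fst N) (fst P) q"
    and qM: "\<And>B M v m. (B, M, v, m) \<in> ?M \<Longrightarrow> \<exists>w. w \<in> Hom V (fst N) (fst M) \<and> v \<cdot> q = m \<cdot> w"
    and qu: "\<And>Z p. \<lbrakk>p \<in> Hom V Z (fst P); \<forall>(B, M, v, m) \<in> ?M. \<exists>w. w \<in> Hom V Z (fst M) \<and> v \<cdot> p = m \<cdot> w\<rbrakk> \<Longrightarrow>
      \<exists>u. u \<in> Hom V Z (fst N) \<and> q \<cdot> u = p"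
    by (rule intersection[OF f'(2), of ?M]) (use iPS in blast, (rule that; assumption))
  note q' = Str_homD[OF q(1)]
  have least: "\<exists>w. w \<in> Hom V (fst N) (fst M) \<and> q = m \<cdot> w"
    if "m \<in> Hom StrL M P" "monomorphism V (fst M) (fst P) m" "h \<in> Hom V (fst A) (fst M)" "m \<cdot> h = f" for M m h
  proof -
    have "\<exists>w. w \<in> Hom V (fst N) (fst M) \<and> Idt V (fst P) \<cdot> q = m \<cdot> w" by (rule qM[of P]) (use that in blast)
    then show ?thesis by (simp only: idt_left[OF q'(3)])
  qed
  have "\<exists>r. r \<in> Hom V (fst A) (fst N) \<and> q \<cdot> r = f"
  proof (rule qu[OF f'(3)])
    have "\<exists>w. w \<in> Hom V (fst A) (fst M) \<and> v \<cdot> f = m \<cdot> w" if "(B, M, v, m) \<in> ?M" for B M v m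
      using that idt_left[OF f'(3)] by auto
    then show "\<forall>(B, M, v, m) \<in> ?M. \<exists>w. w \<in> Hom V (fst A) (fst M) \<and> v \<cdot> f = m \<cdot> w" by blast
  qed
  then obtain r where r: "r \<in> Hom V (fst A) (fst N)" "q \<cdot> r = f" by blast
  have rS: "r \<in> Hom StrL A N" by (rule hom_lift[OF q f r])
  \<comment> \<open>Minimality of the image in usable form: a substructure of \<open>N\<close>
    through which \<open>r\<close> factors is all of \<open>N\<close>. It is applied to an equalizer
    to show that \<open>r\<close> is epic, and to a preimage to obtain diagonals.\<close>
  have retract: "\<exists>g. g \<in> Hom V (fst N) (fst M) \<and> n \<cdot> g = Idt V (fst N)"
    if n: "n \<in> Hom StrL M N" "monomorphism V (fst M) (fst N) n" and h: "h \<in> Hom V (fst A) (fst M)" "n \<cdot> h = r" for M n h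
  proof -
    note n' = Str_homD(3)[OF n(1)]
    have "q \<cdot> n \<cdot> h = f" by (simp only: cmp_assoc[OF h(1) n' q'(3)] h(2) r(2))
    then obtain w where w: "w \<in> Hom V (fst N) (fst M)" "q = q \<cdot> n \<cdot> w"
      using least[OF Str_comp[OF n(1) q(1)] mono_cmp[OF n(2) q(2)] h(1)] by blast
    have "q \<cdot> (n \<cdot> w) = q \<cdot> Idt V (fst N)" using w(2) by (simp only: cmp_assoc[OF w(1) n' q'(3)] idt_right[OF q'(3)])
    then have "n \<cdot> w = Idt V (fst N)" by (rule monoD[OF q(2) _ cmp_hom[OF w(1) n'] idt_hom[OF Str_ob[OF q'(1)]]])
    then show ?thesis using w(1) by blast
  qed
  have epi: "epimorphism StrL A N r"
    unfolding epimorphism_def Str_cmp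
  proof (intro conjI rS allI ballI impI)
    fix B g g' assume g: "g \<in> Hom StrL N B" "g' \<in> Hom StrL N B" and e: "g \<cdot> r = g' \<cdot> r"
    obtain M n where n: "n \<in> Hom StrL M N" "monomorphism V (fst M) (fst N) n" "g \<cdot> n = g' \<cdot> n"
      and nu: "\<And>Z p. \<lbrakk>p \<in> Hom V Z (fst N); g \<cdot> p = g' \<cdot> p\<rbrakk> \<Longrightarrow> \<exists>u. u \<in> Hom V Z (fst M) \<and> n \<cdot> u = p"
      by (rule equalizer[OF g]) (rule that; assumption)
    obtain h where "h \<in> Hom V (fst A) (fst M)" "n \<cdot> h = r" using nu[OF r(1) e] by blast
    then obtain w where w: "w \<in> Hom V (fst N) (fst M)" "n \<cdot> w = Idt V (fst N)" using retract[OF n(1,2)] by blast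
    note n' = Str_homD(3)[OF n(1)] and g' = Str_homD(3)[OF g(1)] Str_homD(3)[OF g(2)]
    have "g = g \<cdot> n \<cdot> w" by (simp only: cmp_assoc[OF w(1) n' g'(1)] w(2) idt_right[OF g'(1)])
    also have "\<dots> = g'" by (simp only: n(3) cmp_assoc[OF w(1) n' g'(2)] w(2) idt_right[OF g'(2)])
    finally show "g = g'" .
  qed
  have "strong_epi StrL A N r"
    unfolding strong_epi_def Str_cmp
  proof (intro conjI epi allI impI)
    fix B C m u v assume *: "monomorphism StrL B C m \<and> u \<in> Hom StrL A B \<and> v \<in> Hom StrL N C \<and> v \<cdot> r = m \<cdot> u"
    have m: "m \<in> Hom StrL B C" "monomorphism V (fst B) (fst C) m" using * Str_mono_V unfolding monomorphism_def[of StrL] by blast+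
    note m' = Str_homD[OF m(1)] and u = conjunct1[OF conjunct2[OF *]] and v = conjunct1[OF conjunct2[OF conjunct2[OF *]]]
    note u' = Str_homD[OF u] and v' = Str_homD[OF v]
    have vr: "v \<cdot> r = m \<cdot> u" using * by blast
    \<comment> \<open>The preimage of \<open>m\<close> along \<open>v\<close>, as an intersection
      with one member. Since \<open>r\<close> factors through it, the inclusion \<open>n\<close> has
      a section \<open>g\<close>, and composing with the projection \<open>w\<close> gives the
      diagonal.\<close>
    obtain M n where n: "n \<in> Hom StrL M N" "monomorphism V (fst M) (fst N) n"
      and nw: "\<And>B' M' v' m'. (B', M', v', m') \<in> {(C, B, v, m)} \<Longrightarrow> \<exists>w. w \<in> Hom V (fst M) (fst M') \<and> v' \<cdot> n = m' \<cdot> w"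
      and nu: "\<And>Z p. \<lbrakk>p \<in> Hom V Z (fst N); \<forall>(B', M', v', m') \<in> {(C, B, v, m)}. \<exists>w. w \<in> Hom V Z (fst M') \<and> v' \<cdot> p = m' \<cdot> w\<rbrakk> \<Longrightarrow>
        \<exists>u. u \<in> Hom V Z (fst M) \<and> n \<cdot> u = p"
      by (rule intersection[OF q'(1), of "{(C, B, v, m)}"]) (use m v in blast, (rule that; assumption))
    obtain w where w: "w \<in> Hom V (fst M) (fst B)" "v \<cdot> n = m \<cdot> w" using nw by blast
    obtain h where "h \<in> Hom V (fst A) (fst M)" "n \<cdot> h = r" using nu[OF r(1)] u'(3) vr by blast
    then obtain g where g: "g \<in> Hom V (fst N) (fst M)" "n \<cdot> g = Idt V (fst N)" using retract[OF n] by blast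
    note n' = Str_homD(3)[OF n(1)]
    let ?d = "w \<cdot> g"
    note d = cmp_hom[OF g(1) w(1)]
    have md: "m \<cdot> ?d = v"
      by (simp only: cmp_assoc[OF g(1) w(1) m'(3), symmetric] w(2)[symmetric] cmp_assoc[OF g(1) n' v'(3)] g(2) idt_right[OF v'(3)])
    have dS: "?d \<in> Hom StrL N B" by (rule hom_lift[OF m v d md])
    have "m \<cdot> (?d \<cdot> r) = m \<cdot> u" by (simp only: cmp_assoc[OF r(1) d m'(3), symmetric] md vr)
    then have "?d \<cdot> r = u" by (rule monoD[OF m(2) _ cmp_hom[OF r(1) d] u'(3)])
    then show "\<exists>d\<in>Hom StrL N B. d \<cdot> r = u \<and> m \<cdot> d = v" using dS md by blast
  qed
  then show ?thesis using that q r(2) by blast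
qed

lemma birkhoff_product:
  assumes S: "birkhoff \<kappa> V L S" and "small \<kappa> (I :: 'u set)" "\<And>i. i \<in> I \<Longrightarrow> D i \<in> S" "is_product StrL I D P p"
  shows "P \<in> S"
proof -
  have "\<forall>(I :: 'u set) D P p. small \<kappa> I \<and> (\<forall>i \<in> I. D i \<in> S) \<and> is_product StrL I D P p \<longrightarrow> P \<in> S"
    using S unfolding birkhoff_def by (elim conjE)
  then show ?thesis using assms(2-4) by (metis (full_types))
qed

text \<open>
  There is only a small set of kernels \<open>{(a, b). f a = f b}\<close> of homomorphisms \<open>f\<close> out of \<open>A\<close>, with \<open>a\<close>, \<open>b\<close>
  ranging over arrows from generators, and regular epimorphisms are determined by their kernels; so the
  image of \<open>A\<close> in a small product of members of \<open>S\<close> is the reflection.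
\<close>

lemma reflection:
  assumes S: "birkhoff \<kappa> V L S" and A: "A \<in> Ob StrL"
    and reg: "\<And>A B e. strong_epi StrL A B e \<Longrightarrow> regular_epi StrL A B e"
  obtains R r where "R \<in> S" "regular_epi StrL A R r"
    "\<And>B f. \<lbrakk>B \<in> S; f \<in> Hom StrL A B\<rbrakk> \<Longrightarrow> \<exists>g. g \<in> Hom StrL R B \<and> g \<cdot> r = f"
proof -
  define ker where "ker f = {(G, a, b). G \<in> Gen \<and> a \<in> Hom V G (fst A) \<and> b \<in> Hom V G (fst A) \<and> f \<cdot> a = f \<cdot> b}" for f
  define K where "K = {ker f | f B. B \<in> S \<and> f \<in> Hom StrL A B}"
  let ?U = "Sigma Gen (\<lambda>G. Hom V G (fst A) \<times> Hom V G (fst A))"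
  have "small \<kappa> (Pow ?U)" by (intro small_Pow small_Sigma Gen small_hom)
  then have sK: "small \<kappa> K" by (rule small_subset[rotated]) (auto simp: K_def ker_def)
  obtain \<iota> :: "('o \<times> 'm \<times> 'm) set \<Rightarrow> 'u" where \<iota>: "inj_on \<iota> K" using small_embed[OF sK] .
  have "\<exists>B f. B \<in> S \<and> f \<in> Hom StrL A B \<and> \<iota> (ker f) = i" if "i \<in> \<iota> ` K" for i using that unfolding K_def by blast
  then obtain B f where Bf: "\<And>i. i \<in> \<iota> ` K \<Longrightarrow> B i \<in> S" "\<And>i. i \<in> \<iota> ` K \<Longrightarrow> f i \<in> Hom StrL A (B i)"
    "\<And>i. i \<in> \<iota> ` K \<Longrightarrow> \<iota> (ker (f i)) = i" by metis
  obtain P p where p: "is_product StrL (\<iota> ` K) B P p"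
    by (rule Str_product[OF small_image[OF sK], of \<iota> B]) (use Bf(2) Str_homD(2) in blast, rule that)
  have PS: "P \<in> S" by (rule birkhoff_product[OF S small_image[OF sK] Bf(1) p])
  have ph: "\<And>i. i \<in> \<iota> ` K \<Longrightarrow> p i \<in> Hom StrL P (B i)" using p unfolding is_product_def by blast
  obtain \<phi> where \<phi>: "\<phi> \<in> Hom StrL A P" "\<And>i. i \<in> \<iota> ` K \<Longrightarrow> p i \<cdot> \<phi> = f i"
    using is_product_universal[OF p A Bf(2)] by blast
  obtain R q r where q: "q \<in> Hom StrL R P" "monomorphism V (fst R) (fst P) q" "q \<cdot> r = \<phi>" and r: "strong_epi StrL A R r"
    by (rule image_factorization[OF \<phi>(1)])
  have RS: "R \<in> S" using S V_mono_Str[OF q(1,2)] PS unfolding birkhoff_def by blast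
  obtain Z u v where co: "coequalizer StrL Z A R u v r" using reg[OF r] unfolding regular_epi_def by blast
  have u: "u \<in> Hom StrL Z A" "v \<in> Hom StrL Z A" and rS: "r \<in> Hom StrL A R" and ruv: "r \<cdot> u = r \<cdot> v"
    and univ: "\<And>B g. \<lbrakk>g \<in> Hom StrL A B; g \<cdot> u = g \<cdot> v\<rbrakk> \<Longrightarrow> \<exists>!h. h \<in> Hom StrL R B \<and> h \<cdot> r = g"
    using co unfolding coequalizer_def Str_cmp by blast+
  note u' = Str_homD(3)[OF u(1)] Str_homD(3)[OF u(2)] and r' = Str_homD(3)[OF rS] and q' = Str_homD(3)[OF q(1)]
  show ?thesis
  proof (rule that[OF RS reg[OF r]])
    fix B' g assume B': "B' \<in> S" and g: "g \<in> Hom StrL A B'"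
    note g' = Str_homD(3)[OF g]
    have kK: "ker g \<in> K" using B' g unfolding K_def by blast
    let ?i = "\<iota> (ker g)"
    have i: "?i \<in> \<iota> ` K" using kK by blast
    have "ker (f ?i) \<in> K" using Bf(1,2)[OF i] unfolding K_def by blast
    then have kf: "ker (f ?i) = ker g" using \<iota> Bf(3)[OF i] kK unfolding inj_on_def by blast
    note p' = Str_homD(3)[OF ph[OF i]]
    have fr: "f ?i = p ?i \<cdot> q \<cdot> r" by (simp only: cmp_assoc[OF r' q' p'] q(3) \<phi>(2)[OF i])
    have fuv: "f ?i \<cdot> u = f ?i \<cdot> v"
      unfolding fr by (simp only: cmp_assoc[OF u'(1) r' cmp_hom[OF q' p']] cmp_assoc[OF u'(2) r' cmp_hom[OF q' p']] ruv)
    note f' = Str_homD(3)[OF Bf(2)[OF i]]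
    \<comment> \<open>\<open>g\<close> need not be among the chosen homomorphisms. But
      \<open>f ?i\<close> factors through \<open>r\<close> and so identifies \<open>u\<close> and
      \<open>v\<close>; on arrows from generators this is recorded in the kernel, which
      \<open>g\<close> shares.\<close>
    have "g \<cdot> u = g \<cdot> v"
    proof (rule Gen_epi[OF cmp_hom[OF u'(1) g'] cmp_hom[OF u'(2) g']])
      fix G a assume G: "G \<in> Gen" and a: "a \<in> Hom V G (fst Z)"
      note ua = cmp_hom[OF a u'(1)] cmp_hom[OF a u'(2)]
      have "f ?i \<cdot> (u \<cdot> a) = f ?i \<cdot> (v \<cdot> a)"
        by (simp only: cmp_assoc[OF a u'(1) f', symmetric] cmp_assoc[OF a u'(2) f', symmetric] fuv)
      then have "(G, u \<cdot> a, v \<cdot> a) \<in> ker (f ?i)" using G ua unfolding ker_def by blast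
      then have "g \<cdot> (u \<cdot> a) = g \<cdot> (v \<cdot> a)" unfolding kf unfolding ker_def by blast
      then show "g \<cdot> u \<cdot> a = g \<cdot> v \<cdot> a" by (simp only: cmp_assoc[OF a u'(1) g'] cmp_assoc[OF a u'(2) g'])
    qed
    then show "\<exists>h. h \<in> Hom StrL R B' \<and> h \<cdot> r = g" using univ[OF g] by blast
  qed
qed


section \<open>Birkhoff subcategories are equational\<close>

definition equations :: "('o, 'm, 'f) struct set \<Rightarrow> ('o \<times> 'o \<times> 'm \<times> 'm) set" where
  "equations S = {(X, Y, s, t). X \<in> Ob V \<and> Y \<in> Ob V \<and> s \<in> Hom StrL (F Y) (F X) \<and> t \<in> Hom StrL (F Y) (F X) \<and>
     (\<forall>Q\<in>S. sat X s t Q)}"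

lemma ext_theory_equations: "ext_theory V L (equations S)"
  unfolding ext_theory_def equations_def by auto

lemma birkhoff_eq_Mod:
  assumes S: "birkhoff \<kappa> V L S" and reg: "\<And>A B e. strong_epi StrL A B e \<Longrightarrow> regular_epi StrL A B e"
  shows "S = Mod V L (equations S)"
proof
  have SO: "S \<subseteq> Ob StrL" using S unfolding birkhoff_def by blast
  have M: "Q \<in> Mod V L (equations S) \<longleftrightarrow> Q \<in> Ob StrL \<and> (\<forall>(X, Y, s, t) \<in> equations S. sat X s t Q)" for Q
    by (rule Mod_iff[OF ext_theory_equations])
  show "S \<subseteq> Mod V L (equations S)"
  proof
    fix Q assume Q: "Q \<in> S"
    have "sat X s t Q" if "(X, Y, s, t) \<in> equations S" for X Y s t using that Q unfolding equations_def by simp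
    then show "Q \<in> Mod V L (equations S)" unfolding M using SO Q by auto
  qed
  show "Mod V L (equations S) \<subseteq> S"
  proof
    fix A assume A: "A \<in> Mod V L (equations S)"
    then have AO: "A \<in> Ob StrL" unfolding M by blast
    let ?X = "fst A"
    note X = Str_ob[OF AO]
    note FX = F_ob[OF X] and nX = \<eta>_hom[OF X]
    obtain c where c: "c \<in> Hom StrL (F ?X) A" "c \<cdot> \<eta> ?X = Idt V ?X" by (rule free_hom_extend[OF X AO idt_hom[OF X]])
    obtain R r where RS: "R \<in> S" and rr: "regular_epi StrL (F ?X) R r"
      and univ: "\<And>B f. \<lbrakk>B \<in> S; f \<in> Hom StrL (F ?X) B\<rbrakk> \<Longrightarrow> \<exists>g. g \<in> Hom StrL R B \<and> g \<cdot> r = f"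
      by (rule reflection[OF S FX reg]) (assumption | (rule that; assumption))+
    obtain Z u v where co: "coequalizer StrL Z (F ?X) R u v r" using rr unfolding regular_epi_def by blast
    have u: "u \<in> Hom StrL Z (F ?X)" and v: "v \<in> Hom StrL Z (F ?X)" and rS: "r \<in> Hom StrL (F ?X) R" and ruv: "r \<cdot> u = r \<cdot> v"
      and couniv: "\<And>B g. \<lbrakk>g \<in> Hom StrL (F ?X) B; g \<cdot> u = g \<cdot> v\<rbrakk> \<Longrightarrow> \<exists>!h. h \<in> Hom StrL R B \<and> h \<cdot> r = g"
      using co unfolding coequalizer_def Str_cmp by blast+
    let ?Y = "fst Z"
    have ZO: "Z \<in> Ob StrL" by (rule Str_homD(1)[OF u])
    note Y = Str_ob[OF ZO]
    \<comment> \<open>A term must start in a free structure, so \<open>u\<close> and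
      \<open>v\<close> are precomposed with the counit at \<open>Z\<close>.\<close>
    obtain d where d: "d \<in> Hom StrL (F ?Y) Z" "d \<cdot> \<eta> ?Y = Idt V ?Y" by (rule free_hom_extend[OF Y ZO idt_hom[OF Y]])
    note h = Str_homD(3)[OF u] Str_homD(3)[OF v] Str_homD(3)[OF rS] Str_homD(3)[OF c(1)] Str_homD(3)[OF d(1)]
    note ud = Str_comp[OF d(1) u] and vd = Str_comp[OF d(1) v]
    note ud' = cmp_hom[OF h(5,1)] and vd' = cmp_hom[OF h(5,2)]
    have "sat ?X (u \<cdot> d) (v \<cdot> d) Q" if QS: "Q \<in> S" for Q
      unfolding sat_def
    proof (intro allI impI)
      fix W k assume k: "phom W (F ?X) Q k"
      have W: "W \<in> Ob V" and Q: "Q \<in> Ob StrL" using phomD[OF k] by blast+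
      \<comment> \<open>The family \<open>k\<close> becomes an ordinary homomorphism into this
        power, which lies in \<open>S\<close>, so the reflection applies to it.\<close>
      obtain P \<pi> where pw: "is_power V L W Q P \<pi>"
        and P: "\<And>A k. phom W A Q k \<Longrightarrow> \<exists>h. h \<in> Hom StrL A P \<and> evs W (fst Q) \<cdot> (Idt V W \<odot> h) = k"
        and fP: "phom W P Q (evs W (fst Q))" "fst P = ihom V W (fst Q)"
        by (rule power_exists[OF W Q]) (rule that; assumption)
      have PS: "P \<in> S" using S W QS pw unfolding birkhoff_def by blast
      obtain g where g: "g \<in> Hom StrL (F ?X) P" "evs W (fst Q) \<cdot> (Idt V W \<odot> g) = k" using P[OF k] by blast
      obtain g' where g': "g' \<in> Hom StrL R P" "g' \<cdot> r = g" using univ[OF PS g(1)] by blast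
      note gh = Str_homD(3)[OF g(1)] and gh' = Str_homD(3)[OF g'(1)] and E = phomD(4)[OF fP(1)] and iW = idt_hom[OF W]
      have "g \<cdot> u = g \<cdot> v" unfolding g'(2)[symmetric] by (simp only: cmp_assoc[OF h(1,3) gh'] cmp_assoc[OF h(2,3) gh'] ruv)
      then have gud: "g \<cdot> (u \<cdot> d) = g \<cdot> (v \<cdot> d)"
        by (simp only: cmp_assoc[OF h(5,1) gh, symmetric] cmp_assoc[OF h(5,2) gh, symmetric])
      show "k \<cdot> (Idt V W \<odot> (u \<cdot> d)) = k \<cdot> (Idt V W \<odot> (v \<cdot> d))"
        unfolding g(2)[symmetric]
        by (simp only: cmp_assoc[OF ten_hom[OF iW ud'] ten_hom[OF iW gh] E] cmp_assoc[OF ten_hom[OF iW vd'] ten_hom[OF iW gh] E]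
          ten_cmp_right[OF ud' gh W, symmetric] ten_cmp_right[OF vd' gh W, symmetric] gud)
    qed
    then have "(?X, ?Y, u \<cdot> d, v \<cdot> d) \<in> equations S" unfolding equations_def using X Y ud vd by blast
    then have "sat ?X (u \<cdot> d) (v \<cdot> d) A" using A unfolding M by blast
    \<comment> \<open>Validity in \<open>A\<close> is used for one family only, the counit
      \<open>c\<close> indexed by the unit.\<close>
    then have "c \<cdot> lun V (fst (F ?X)) \<cdot> (Idt V (unit V) \<odot> (u \<cdot> d)) = c \<cdot> lun V (fst (F ?X)) \<cdot> (Idt V (unit V) \<odot> (v \<cdot> d))"
      using phom_unit[OF c(1)] unfolding sat_def by blast
    then have "c \<cdot> (u \<cdot> d) \<cdot> lun V (fst (F ?Y)) = c \<cdot> (v \<cdot> d) \<cdot> lun V (fst (F ?Y))"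
      using lun_hom[OF Str_ob[OF FX]] lun_hom[OF Str_ob[OF F_ob[OF Y]]] idt_hom[OF unit_ob]
      by (simp only: cmp_assoc[OF ten_hom[OF idt_hom[OF unit_ob] ud'] lun_hom[OF Str_ob[OF FX]] h(4)]
        cmp_assoc[OF ten_hom[OF idt_hom[OF unit_ob] vd'] lun_hom[OF Str_ob[OF FX]] h(4)] lun_nat[OF ud'] lun_nat[OF vd']
        cmp_assoc[OF lun_hom[OF Str_ob[OF F_ob[OF Y]]] ud' h(4)] cmp_assoc[OF lun_hom[OF Str_ob[OF F_ob[OF Y]]] vd' h(4)])
    then have cud: "c \<cdot> (u \<cdot> d) = c \<cdot> (v \<cdot> d)"
      by (rule iso_epi[OF lun_iso[OF Str_ob[OF F_ob[OF Y]]] cmp_hom[OF ud' h(4)] cmp_hom[OF vd' h(4)]])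
    \<comment> \<open>The counit \<open>d\<close> is split in the base category by the free unit, so
      it can be cancelled even if that section is not a homomorphism.\<close>
    have split: "c \<cdot> w = c \<cdot> (w \<cdot> d) \<cdot> \<eta> ?Y" if w: "w \<in> Hom V ?Y (fst (F ?X))" for w
      by (simp only: cmp_assoc[OF \<eta>_hom[OF Y] cmp_hom[OF h(5) w] h(4)] cmp_assoc[OF \<eta>_hom[OF Y] h(5) w] d(2) idt_right[OF w])
    have "c \<cdot> u = c \<cdot> v" by (simp only: split[OF h(1)] split[OF h(2)] cud)
    then obtain e where e: "e \<in> Hom StrL R A" "e \<cdot> r = c" using couniv[OF c(1)] by blast
    note e' = Str_homD(3)[OF e(1)] and rn = cmp_hom[OF nX h(3)]
    have sec: "e \<cdot> (r \<cdot> \<eta> ?X) = Idt V ?X" by (simp only: cmp_assoc[OF nX h(3) e', symmetric] e(2) c(2))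
    then have "split_epi V (fst R) (fst A) e" unfolding split_epi_def using e' rn by blast
    \<comment> \<open>Homomorphisms are arrows of the base category, so the section found there
      suffices for cancellation.\<close>
    moreover have "epimorphism StrL R A e"
      unfolding epimorphism_def Str_cmp
    proof (intro conjI e(1) allI ballI impI)
      fix B f g assume f: "f \<in> Hom StrL A B" and g: "g \<in> Hom StrL A B" and fg: "f \<cdot> e = g \<cdot> e"
      note f' = Str_homD(3)[OF f] and g' = Str_homD(3)[OF g]
      have "f = f \<cdot> e \<cdot> (r \<cdot> \<eta> ?X)" by (simp only: cmp_assoc[OF rn e' f'] sec idt_right[OF f'])
      also have "\<dots> = g" by (simp only: fg cmp_assoc[OF rn e' g'] sec idt_right[OF g'])
      finally show "f = g" .
    qed
    ultimately show "A \<in> S" using S RS unfolding birkhoff_def by blast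
  qed
qed

end

theorem theorem6p5:
  fixes \<kappa> :: "'u rel" and l :: "'l rel"
    and V :: "('o, 'm) smc" and L :: "('f, 'o) language"
  assumes "inaccessible \<kappa>"
    and "regular_cardinal l" and "l <o \<kappa>"
    and "symmetric_monoidal_closed V"
    and "locally_presentable_closed \<kappa> l V"
    and "ary_language \<kappa> l V L"
    and "\<And>A B e. strong_epi (Str V L) A B e \<Longrightarrow> regular_epi (Str V L) A B e"
  shows "{S. birkhoff \<kappa> V L S} = {Mod V L E | E. ext_theory V L E}"
proof -
  interpret symmetric_monoidal_closed V by fact
  interpret structures V \<kappa> l L
    by unfold_locales (use assms in \<open>auto simp: locally_presentable_closed_def\<close>)
  show ?thesis
    using birkhoff_Mod birkhoff_eq_Mod[OF _ assms(7)] ext_theory_equations by blast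
qed

end
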